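(* For each $n$, let $A_1(n),\dots,A_k(n)$ and $B_1(n),\dots,B_k(n)$ be deterministic matrices in $M_n(\mathbb C)$ and let $U=U(n)$ be an $n\times n$ Haar unitary random matrix, such that (1) $A_1(n),\dots,A_k(n)$ are Hermitian; (2) $((A_1(n),\dots,A_k(n)),\mathrm{Tr}_n)$ converges in compact distribution, as $n\to\infty$, to a $k$-tuple of selfadjoint compact operators $((a_1,\dots,a_k),\mathrm{Tr}_H)$ on a separable Hilbert space $H$; (3) $((B_1(n),\dots,B_k(n)),\mathrm{tr}_n)$ converges in distribution, as $n\to\infty$, to a $k$-tuple of elements in a non-commutative probability space; (4) $\sup_{n}\|B_i(n)\|<\infty$ for every $i=1,\dots,k$ (operator norm). Let $\beta_i=\lim_{n\to\infty}\mathrm{tr}_n(B_i)$, $\beta_{ij}=\lim_{n\to\infty}\mathrm{tr}_n(B_i^*B_j)$ and $B=(\beta_{ij})_{i,j=1}^k\in M_k(\mathbb C)$. Then: (i) $\displaystyle\lim_{n\to\infty}\mathrm{EV}\Big(\sum_{i=1}^k UB_iU^*A_i(UB_iU^* )^*\Big)=\mathrm{EV}\big(\sqrt B\,\mathrm{diag}(a_1,\dots,a_k)\sqrt B\big)$ almost surely, where $\sqrt B\,\mathrm{diag}(a_1,\dots,a_k)\sqrt B$ is viewed as a compact operator on $\mathbb C^k\otimes H$. (ii) If $B_1,\dots,B_k$ are Hermitian, then $\displaystyle\lim_{n\to\infty}\mathrm{EV}\Big(\sum_{i=1}^kA_iUB_iU^*A_i\Big)=\mathrm{EV}\Big(\sum_{i=1}^k\beta_ia_i^2\Big)$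 almost surely. (iii) If $k=1$ and $B_1$ is Hermitian, then with $p=\sqrt{\beta_{11}}+\beta_1$ and $q=-(\sqrt{\beta_{11}}-\beta_1)$, $\displaystyle\lim_{n\to\infty}\mathrm{EV}(A_1UB_1U^*+UB_1U^*A_1)=(p\,\mathrm{EV}(a_1))\sqcup(q\,\mathrm{EV}(a_1))$ almost surely. (iv) If $k=1$ and $B_1$ is Hermitian, then with $r=\sqrt{\beta_{11}-\beta_1^2}$, $\displaystyle\lim_{n\to\infty}\mathrm{EV}(\mathrm i[A_1,UB_1U^*])=(r\,\mathrm{EV}(a_1))\sqcup(-r\,\mathrm{EV}(a_1))$ almost surely.
   Context: $\mathrm{Tr}_n$ is the non-normalized trace on $M_n(\mathbb C)$, $\mathrm{tr}_n=\frac1n\mathrm{Tr}_n$, $\mathrm{Tr}_H$ the trace on $H$; $[X,Y]=XY-YX$, $\mathrm i=\sqrt{-1}$. The $U(n)$ are defined on a common probability space and are distributed according to normalized Haar measure on the unitary group. $C_{0,\mathrm b}(\mathbb R)$ is the set of real-valued bounded continuous functions on $\mathbb R$ that vanish in a neighborhood of $0$. For selfadjoint compact operators $a_i(n)$ on separable Hilbert spaces $H_n$ and $a_i$ on $H$ ($i=1,\dots,k$), $(a_1(n),\dots,a_k(n))$ converges in compact distribution to $(a_1,\dots,a_k)$ with respect to $\mathrm{Tr}_{H_n},\mathrm{Tr}_H$ if for all $f_1,\dots,f_k\in C_{0,\mathrm b}(\mathbb R)$, $p\ge1$ and $(i_1,\dots,i_p)\in\{1,\dots,k\}^p$, $\lim_{n\to\infty}\mathrm{Tr}_{H_n}(f_{i_1}(a_{i_1}(n))\cdots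 f_{i_p}(a_{i_p}(n)))=\mathrm{Tr}_H(f_{i_1}(a_{i_1})\cdots f_{i_p}(a_{i_p}))$. (Here $H_n=\mathbb C^n$.) A non-commutative probability space is a unital $*$-algebra with a tracial positive $*$-preserving linear functional $\tau$ with $\tau(1)=1$. Convergence in distribution of $((B_j(n))_j,\mathrm{tr}_n)$ to $((b_j)_j,\tau)$ means convergence of all $*$-moments $\mathrm{tr}_n(B_{j_1}(n)^{\varepsilon_1}\cdots B_{j_p}(n)^{\varepsilon_p})\to\tau(b_{j_1}^{\varepsilon_1}\cdots b_{j_p}^{\varepsilon_p})$, $p\ge1$, $\varepsilon_i\in\{1,*\}$. $\mathrm{EV}(a)$ is the multiset of eigenvalues (with multiplicity) of a selfadjoint compact operator $a$; $\sqcup$ is disjoint union of multisets (adding multiplicities); $c\,\mathrm{EV}(a)$ multiplies every element by $c$. For a real multiset accumulating only at $0$, let $\lambda_1^+\ge\lambda_2^+\ge\cdots\ge0$ be its nonnegative elements in nonincreasing order and $\lambda_1^-\le\lambda_2^-\le\cdots\le0$ its nonpositive elements in nondecreasing order, finite lists padded with infinitely many zeros. $\lim_n\mathrm{EV}(a_n)=\Lambda$ means that $\lambda_i^{\pm}(a_n)\to\lambda_i^\pm(\Lambda)$ for every $i\ge1$ and each sign; in particular the multiplicity of $0$ is disregarded. *)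

theory Defs
  imports
    "HOL-Probability.Probability"
    "Jordan_Normal_Form.Schur_Decomposition"
begin

no_notation Matrix.vec_index (infixl "$" 100)

section \<open>Complex Hilbert spaces\<close>

text \<open>
  A complex Hilbert space is a complete real inner product space together with a complex
  structure and a sesquilinear form (linear in the second argument) whose real part is the real
  inner product.  Hence \<open>cinner x x = (norm x)\<^sup>2\<close>, and norm, topology, closures and
  compactness are those of the library.
\<close>

class complex_hilbert = real_inner + complete_space +
  fixes scaleC :: "complex \<Rightarrow> 'a \<Rightarrow> 'a" (infixr "*\<^sub>C" 75)
    and cinner :: "'a \<Rightarrow> 'a \<Rightarrow> complex"
  assumes scaleC_add_right: "c *\<^sub>C (x + y) = c *\<^sub>C x + c *\<^sub>C y"
    and scaleC_add_left: "(c + d) *\<^sub>C x = c *\<^sub>C x + d *\<^sub>C x"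
    and scaleC_scaleC: "c *\<^sub>C d *\<^sub>C x = (c * d) *\<^sub>C x"
    and scaleR_scaleC: "t *\<^sub>R x = complex_of_real t *\<^sub>C x"
    and cinner_commute: "cinner x y = cnj (cinner y x)"
    and cinner_add_right: "cinner x (y + z) = cinner x y + cinner x z"
    and cinner_scaleC_right: "cinner x (c *\<^sub>C y) = c * cinner x y"
    and inner_eq_Re_cinner: "inner x y = Re (cinner x y)"

global_interpretation cvec: vector_space "scaleC :: complex \<Rightarrow> 'a \<Rightarrow> 'a::complex_hilbert"
proof
  fix x :: 'a
  have "1 *\<^sub>C x = 1 *\<^sub>R x" by (simp only: scaleR_scaleC of_real_1)
  then show "1 *\<^sub>C x = x" by simp
qed (simp_all add: scaleC_add_right scaleC_add_left scaleC_scaleC)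

instantiation complex :: complex_hilbert
begin
definition scaleC_complex :: "complex \<Rightarrow> complex \<Rightarrow> complex"
  where "scaleC_complex c x = c * x"
definition cinner_complex :: "complex \<Rightarrow> complex \<Rightarrow> complex"
  where "cinner_complex x y = cnj x * y"
instance
  by standard
    (simp_all add: scaleC_complex_def cinner_complex_def algebra_simps scaleR_conv_of_real
      inner_complex_def)
end

text \<open>\<open>'h ^ 'k\<close> is the Hilbert space \<open>\<complex>\<^sup>k \<otimes> H\<close>,
  that is, the orthogonal sum of \<open>k\<close> copies of \<open>H\<close>.\<close>

instantiation Finite_Cartesian_Product.vec :: (complex_hilbert, finite) complex_hilbert
begin
definition scaleC_vec :: "complex \<Rightarrow> 'a ^ 'b \<Rightarrow> 'a ^ 'b"
  where "scaleC_vec c x = (\<chi> i. c *\<^sub>C (x $ i))"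
definition cinner_vec :: "'a ^ 'b \<Rightarrow> 'a ^ 'b \<Rightarrow> complex"
  where "cinner_vec x y = (\<Sum>i\<in>UNIV. cinner (x $ i) (y $ i))"
instance
proof
  fix x y :: "'a ^ 'b"
  show "cinner x y = cnj (cinner y x)"
    unfolding cinner_vec_def cnj_sum by (rule sum.cong[OF refl]) (rule cinner_commute)
qed (simp_all add: scaleC_vec_def cinner_vec_def Finite_Cartesian_Product.vec_eq_iff scaleC_add_right scaleC_add_left
      scaleC_scaleC scaleR_scaleC cinner_add_right cinner_scaleC_right sum.distrib
      sum_distrib_left inner_vec_def inner_eq_Re_cinner)
end


section \<open>Compact selfadjoint operators\<close>

definition compact_operator :: "('h::complex_hilbert \<Rightarrow> 'h) \<Rightarrow> bool" where
  "compact_operator a \<longleftrightarrow>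
     Vector_Spaces.linear scaleC scaleC a \<and> compact (closure (a ` cball 0 1))"

definition selfadjoint :: "('h::complex_hilbert \<Rightarrow> 'h) \<Rightarrow> bool" where
  "selfadjoint a \<longleftrightarrow> (\<forall>x y. cinner (a x) y = cinner x (a y))"

definition eigenspace :: "('h::complex_hilbert \<Rightarrow> 'h) \<Rightarrow> real \<Rightarrow> 'h set" where
  "eigenspace a l = {x. a x = complex_of_real l *\<^sub>C x}"

definition orth_proj :: "'h::complex_hilbert set \<Rightarrow> 'h \<Rightarrow> 'h" where
  "orth_proj S x = (THE y. y \<in> S \<and> (\<forall>z\<in>S. cinner z (x - y) = 0))"

text \<open>Functional calculus \<open>f(a) = \<Sum>\<^sub>l f(l) P\<^sub>l\<close> over the eigenvalues
  \<open>l\<close> of \<open>a\<close>.  If \<open>a\<close> is selfadjoint and compact and \<open>f\<close> vanishes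
  near \<open>0\<close>, only finitely many terms are nonzero.\<close>

definition op_fun :: "(real \<Rightarrow> real) \<Rightarrow> ('h::complex_hilbert \<Rightarrow> 'h) \<Rightarrow> 'h \<Rightarrow> 'h" where
  "op_fun f a x =
     (\<Sum>l\<in>{l. eigenspace a l \<noteq> {0} \<and> f l \<noteq> 0}.
        complex_of_real (f l) *\<^sub>C orth_proj (eigenspace a l) x)"

definition orthonormal_basis :: "'h::complex_hilbert set \<Rightarrow> bool" where
  "orthonormal_basis E \<longleftrightarrow>
     (\<forall>e\<in>E. \<forall>e'\<in>E. cinner e e' = (if e = e' then 1 else 0)) \<and> closure (cvec.span E) = UNIV"

text \<open>The trace of a trace class operator does not depend on the orthonormal basis.\<close>

definition op_trace :: "('h::complex_hilbert \<Rightarrow> 'h) \<Rightarrow> complex" where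
  "op_trace T = (\<Sum>\<^sub>\<infinity>e\<in>(SOME E. orthonormal_basis E). cinner e (T e))"


section \<open>Complex matrices\<close>

definition hermitian :: "nat \<Rightarrow> complex mat \<Rightarrow> bool" where
  "hermitian n X \<longleftrightarrow> X \<in> carrier_mat n n \<and> mat_adjoint X = X"

definition unitary_group :: "nat \<Rightarrow> complex mat set" where
  "unitary_group n =
     {V \<in> carrier_mat n n. V * mat_adjoint V = 1\<^sub>m n \<and> mat_adjoint V * V = 1\<^sub>m n}"

definition mat_Tr :: "complex mat \<Rightarrow> complex" where
  "mat_Tr X = (\<Sum>i<dim_row X. X $$ (i, i))"

definition mat_tr :: "complex mat \<Rightarrow> complex" where
  "mat_tr X = mat_Tr X / of_nat (dim_row X)"

definition mat_sum :: "nat \<Rightarrow> ('k::finite \<Rightarrow> complex mat) \<Rightarrow> complex mat" where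
  "mat_sum n F = Matrix.mat n n (\<lambda>rc. \<Sum>i\<in>UNIV. F i $$ rc)"

definition l2_norm :: "complex Matrix.vec \<Rightarrow> real" where
  "l2_norm v = L2_set (\<lambda>i. cmod (vec_index v i)) {..<dim_vec v}"

definition mat_opnorm :: "complex mat \<Rightarrow> real" where
  "mat_opnorm X = Sup {l2_norm (X *\<^sub>v v) | v. v \<in> carrier_vec (dim_col X) \<and> l2_norm v \<le> 1}"

text \<open>Functional calculus \<open>f(V diag(d) V\<^sup>*) = V diag(f(d)) V\<^sup>*\<close> of a Hermitian
  matrix; the result does not depend on the chosen diagonalization.\<close>

definition mat_fun :: "nat \<Rightarrow> (real \<Rightarrow> real) \<Rightarrow> complex mat \<Rightarrow> complex mat" where
  "mat_fun n f X =
     (SOME Y. \<exists>V (d :: nat \<Rightarrow> real). V \<in> unitary_group n \<and>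
        X = V * mat_diag n (\<lambda>i. complex_of_real (d i)) * mat_adjoint V \<and>
        Y = V * mat_diag n (\<lambda>i. complex_of_real (f (d i))) * mat_adjoint V)"

definition mat_word :: "nat \<Rightarrow> ('j \<Rightarrow> complex mat) \<Rightarrow> 'j list \<Rightarrow> complex mat" where
  "mat_word n F w = foldr (\<lambda>j Y. F j * Y) w (1\<^sub>m n)"

definition conj_by :: "complex mat \<Rightarrow> complex mat \<Rightarrow> complex mat" where
  "conj_by V X = V * X * mat_adjoint V"


section \<open>Haar unitary random matrices\<close>

text \<open>The Borel sigma-algebra of the unitary group, as a subset of
  \<open>\<complex>\<^bsup>n \<times> n\<^esup>\<close> (the measure component is irrelevant).\<close>

definition unitary_borel :: "nat \<Rightarrow> complex mat measure" where
  "unitary_borel n =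
     vimage_algebra (unitary_group n)
       (\<lambda>V. \<lambda>rc\<in>{..<n} \<times> {..<n}. V $$ rc)
       (\<Pi>\<^sub>M rc\<in>{..<n} \<times> {..<n}. borel)"

text \<open>The normalized Haar measure: the left-invariant Borel probability measure.\<close>

definition haar_unitary_measure :: "nat \<Rightarrow> complex mat measure \<Rightarrow> bool" where
  "haar_unitary_measure n \<mu> \<longleftrightarrow>
     prob_space \<mu> \<and> sets \<mu> = sets (unitary_borel n) \<and>
     (\<forall>V\<in>unitary_group n. distr \<mu> \<mu> (\<lambda>W. V * W) = \<mu>)"

definition haar_unitary :: "'w measure \<Rightarrow> nat \<Rightarrow> ('w \<Rightarrow> complex mat) \<Rightarrow> bool" where
  "haar_unitary M n U \<longleftrightarrow>
     U \<in> measurable M (unitary_borel n) \<and>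
     haar_unitary_measure n (distr M (unitary_borel n) U)"


section \<open>Convergence in compact distribution\<close>

definition C0b :: "(real \<Rightarrow> real) set" where
  "C0b = {f. continuous_on UNIV f \<and> bounded (range f) \<and>
             (\<exists>\<epsilon>>0. \<forall>x. \<bar>x\<bar> < \<epsilon> \<longrightarrow> f x = 0)}"

definition converges_in_compact_distribution ::
  "(nat \<Rightarrow> 'k \<Rightarrow> complex mat) \<Rightarrow> ('k \<Rightarrow> 'h::complex_hilbert \<Rightarrow> 'h) \<Rightarrow> bool" where
  "converges_in_compact_distribution A a \<longleftrightarrow>
     (\<forall>f :: 'k \<Rightarrow> real \<Rightarrow> real. (\<forall>i. f i \<in> C0b) \<longrightarrow>
       (\<forall>w :: 'k list. w \<noteq> [] \<longrightarrow>
         (\<lambda>n. mat_Tr (mat_word n (\<lambda>i. mat_fun n (f i) (A n i)) w))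
           \<longlonglongrightarrow> op_trace (foldr (\<lambda>i T. op_fun (f i) (a i) \<circ> T) w id)))"


section \<open>Non-commutative probability spaces\<close>

text \<open>The underlying unital complex algebra is the ring \<open>'b\<close> with the scalar
  multiplication \<open>smult\<close>.\<close>

locale nc_prob_space =
  vector_space smult
  for smult :: "complex \<Rightarrow> 'b::ring_1 \<Rightarrow> 'b" +
  fixes star :: "'b \<Rightarrow> 'b"
    and \<tau> :: "'b \<Rightarrow> complex"
  assumes smult_mult_left: "smult c x * y = smult c (x * y)"
    and smult_mult_right: "x * smult c y = smult c (x * y)"
    and star_star: "star (star x) = x"
    and star_add: "star (x + y) = star x + star y"
    and star_smult: "star (smult c x) = smult (cnj c) (star x)"
    and star_mult: "star (x * y) = star y * star x"
    and tau_add: "\<tau> (x + y) = \<tau> x + \<tau> y"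
    and tau_smult: "\<tau> (smult c x) = c * \<tau> x"
    and tau_tracial: "\<tau> (x * y) = \<tau> (y * x)"
    and tau_star: "\<tau> (star x) = cnj (\<tau> x)"
    and tau_positive: "Im (\<tau> (star x * x)) = 0" "Re (\<tau> (star x * x)) \<ge> 0"
    and tau_one: "\<tau> 1 = 1"

text \<open>A letter \<open>(j, s)\<close> of a word stands for \<open>b\<^sub>j\<^sup>*\<close> if \<open>s\<close> holds and for
  \<open>b\<^sub>j\<close> otherwise.\<close>

definition converges_in_distribution ::
  "(nat \<Rightarrow> 'k \<Rightarrow> complex mat) \<Rightarrow> ('b::ring_1 \<Rightarrow> 'b) \<Rightarrow> ('b \<Rightarrow> complex) \<Rightarrow> ('k \<Rightarrow> 'b) \<Rightarrow> bool"
  where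
  "converges_in_distribution B star \<tau> b \<longleftrightarrow>
     (\<forall>w :: ('k \<times> bool) list. w \<noteq> [] \<longrightarrow>
       (\<lambda>n. mat_tr (mat_word n (\<lambda>(j, s). if s then mat_adjoint (B n j) else B n j) w))
         \<longlonglongrightarrow> \<tau> (prod_list (map (\<lambda>(j, s). if s then star (b j) else b j) w)))"


section \<open>Multisets of eigenvalues\<close>

text \<open>Possibly infinite real multisets are represented by their multiplicity functions
  \<open>real \<Rightarrow> enat\<close>.\<close>

definition EV_mat :: "complex mat \<Rightarrow> real \<Rightarrow> enat" where
  "EV_mat X l = enat (Polynomial.order (complex_of_real l) (char_poly X))"

definition EV_op :: "('h::complex_hilbert \<Rightarrow> 'h) \<Rightarrow> real \<Rightarrow> enat" where
  "EV_op a l =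
     (if \<exists>F. finite F \<and> eigenspace a l \<subseteq> cvec.span F then enat (cvec.dim (eigenspace a l)) else \<infinity>)"

definition mset_union :: "(real \<Rightarrow> enat) \<Rightarrow> (real \<Rightarrow> enat) \<Rightarrow> real \<Rightarrow> enat" where
  "mset_union L L' x = L x + L' x"

text \<open>The supremum over finite subsets is the (possibly infinite) sum of the multiplicities of
  all elements \<open>y\<close> with \<open>c * y = x\<close>; only for \<open>c = 0\<close> is there more than one.\<close>

definition mset_scale :: "real \<Rightarrow> (real \<Rightarrow> enat) \<Rightarrow> real \<Rightarrow> enat" where
  "mset_scale c L x = (SUP F\<in>{F. finite F \<and> F \<subseteq> {y. c * y = x}}. \<Sum>y\<in>F. L y)"

text \<open>The positive elements in nonincreasing order with multiplicities, followed by zeros if there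
  are only finitely many; indices start at \<open>0\<close>.  Such a sequence is unique, and it exists for
  multisets that accumulate only at \<open>0\<close>.  Listing the elements equal to \<open>0\<close> as well would
  give the same sequence, because of the padding.\<close>

definition lambda_plus :: "(real \<Rightarrow> enat) \<Rightarrow> nat \<Rightarrow> real" where
  "lambda_plus L =
     (THE s. (\<forall>i j. i \<le> j \<longrightarrow> s j \<le> s i) \<and> (\<forall>i. 0 \<le> s i) \<and>
             (\<forall>x>0. finite {i. s i = x} \<and> L x = enat (card {i. s i = x})))"

definition lambda_minus :: "(real \<Rightarrow> enat) \<Rightarrow> nat \<Rightarrow> real" where
  "lambda_minus L =
     (THE s. (\<forall>i j. i \<le> j \<longrightarrow> s i \<le> s j) \<and> (\<forall>i. s i \<le> 0) \<and>
             (\<forall>x<0. finite {i. s i = x} \<and> L x = enat (card {i. s i = x})))"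

definition EV_converges :: "(nat \<Rightarrow> real \<Rightarrow> enat) \<Rightarrow> (real \<Rightarrow> enat) \<Rightarrow> bool" where
  "EV_converges Ls L \<longleftrightarrow>
     (\<forall>i. (\<lambda>n. lambda_plus (Ls n) i) \<longlonglongrightarrow> lambda_plus L i) \<and>
     (\<forall>i. (\<lambda>n. lambda_minus (Ls n) i) \<longlonglongrightarrow> lambda_minus L i)"


section \<open>Operators on \<open>\<complex>\<^sup>k \<otimes> H\<close>\<close>

definition psd :: "complex ^ 'k ^ 'k::finite \<Rightarrow> bool" where
  "psd S \<longleftrightarrow> (\<forall>i j. S $ i $ j = cnj (S $ j $ i)) \<and>
     (\<forall>x. 0 \<le> Re (\<Sum>i\<in>UNIV. \<Sum>j\<in>UNIV. cnj (x i) * S $ i $ j * x j))"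

definition psd_sqrt :: "complex ^ 'k ^ 'k::finite \<Rightarrow> complex ^ 'k ^ 'k" where
  "psd_sqrt B = (THE S. psd S \<and> S ** S = B)"

text \<open>\<open>S \<otimes> 1\<close> for a scalar matrix \<open>S\<close>.\<close>

definition scalar_mat_op :: "complex ^ 'k ^ 'k \<Rightarrow> 'h::complex_hilbert ^ 'k::finite \<Rightarrow> 'h ^ 'k" where
  "scalar_mat_op S v = (\<chi> i. \<Sum>j\<in>UNIV. (S $ i $ j) *\<^sub>C (v $ j))"

definition diag_op :: "('k \<Rightarrow> 'h \<Rightarrow> 'h) \<Rightarrow> 'h::complex_hilbert ^ 'k::finite \<Rightarrow> 'h ^ 'k" where
  "diag_op a v = (\<chi> i. a i (v $ i))"

end

(* Write f(A_i), for f a soft threshold, as a sum of rank one matrices c u u^*; the number of terms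
   stays bounded in n. Replacing A_i by f(A_i) changes each of the four random matrices by little in
   the operator norm, and turns it into a finite rank matrix, the sum of x_q y_q^* over a bounded
   index set. The traces of its powers are those of the small matrix of the <y_q, x_q'>. Its
   entries involve <u, U T U^* u'>, T = B_i or B_i^* B_j, for deterministic unit vectors u, u', and
   <u, U T U^* u'> - tr(T) <u, u'> tends to 0 almost surely by a fourth moment bound of order n^-2.
   To obtain this bound from left invariance alone, average over the unitary images of a fixed
   vector in the form of all sign vectors, for which the fourth moments are elementary. Compact
   convergence then gives the limits of the traces of powers, hence the eigenvalues of the
   truncations, and Weyl's inequalities remove the truncation. *)

theory Submission
  imports Defs
begin

section \<open>Matrices as functions\<close>

text \<open>The eigenvectors of \<open>A n i\<close> need not converge, so neither do the entries
  <u, u'> of the small matrix; only words in the truncated matrices have convergent traces. The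
  limit is therefore never taken in an entry. The random factors are replaced by limits \<kappa>
  that depend on the two summands alone, and the trace of a power is expanded into words weighted by
  products of \<kappa>. The truncated limit operator has the same expansion, with eigenvectors of
  the \<open>a i\<close> in place of u. In (i), \<kappa> is B, and the square root enters only
  through its square. In (ii), \<kappa> is \<beta>_i and the words are in squares. In (iii) and
  (iv), with Y = U B_1 U^*, the products AY and YA give a two by two \<kappa> with determinant
  \<beta>_1^2 - \<beta>_11 and trace 2 \<beta>_1 or 0; its eigenvalues are p, q or r, -r. The many
  eigenvalues near 0 obstruct a comparison of all eigenvalues at once: power sums are used from
  exponent 2 on, where they stay bounded, and eigenvalues are compared by counting those above a
  positive level. The thresholds run through 1/(l + 1), so that countably many null sets are
  removed.\<close>

definition fmul :: "'q set \<Rightarrow> ('p \<Rightarrow> 'q \<Rightarrow> complex) \<Rightarrow> ('q \<Rightarrow> 'r \<Rightarrow> complex) \<Rightarrow> 'p \<Rightarrow> 'r \<Rightarrow> complex" where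
  "fmul Q X Y p r = (\<Sum>q\<in>Q. X p q * Y q r)"

text \<open>\<open>fpow Q X p\<close> is the power with exponent \<open>p + 1\<close>, so that no identity matrix is
  needed.\<close>

primrec fpow :: "'q set \<Rightarrow> ('q \<Rightarrow> 'q \<Rightarrow> complex) \<Rightarrow> nat \<Rightarrow> 'q \<Rightarrow> 'q \<Rightarrow> complex" where
  "fpow Q X 0 = X"
| "fpow Q X (Suc p) = fmul Q X (fpow Q X p)"

definition ftr :: "'q set \<Rightarrow> ('q \<Rightarrow> 'q \<Rightarrow> complex) \<Rightarrow> complex" where
  "ftr Q X = (\<Sum>q\<in>Q. X q q)"

lemma fmul_assoc: "fmul Q (fmul P X Y) Z = fmul P X (fmul Q Y Z)"
  unfolding fmul_def fun_eq_iff sum_distrib_left sum_distrib_right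
  by (subst sum.swap) (simp add: mult.assoc)

lemma ftr_fmul: "ftr P (fmul Q X Y) = ftr Q (fmul P Y X)"
  unfolding ftr_def fmul_def by (subst sum.swap) (simp add: mult.commute)

lemma fmul_cong:
  "(\<And>q. q \<in> Q \<Longrightarrow> X p q = X' p q) \<Longrightarrow> (\<And>q. q \<in> Q \<Longrightarrow> Y q r = Y' q r)
   \<Longrightarrow> fmul Q X Y p r = fmul Q X' Y' p r"
  unfolding fmul_def by (rule sum.cong) auto

lemma fpow_cong:
  assumes "\<And>x y. x \<in> Q \<Longrightarrow> y \<in> Q \<Longrightarrow> X x y = Y x y" and "x \<in> Q" "y \<in> Q"
  shows "fpow Q X p x y = fpow Q Y p x y"
  using assms(2,3) by (induction p arbitrary: x y) (auto intro!: fmul_cong simp: assms(1))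

lemma ftr_fpow_cong:
  assumes "\<And>x y. x \<in> Q \<Longrightarrow> y \<in> Q \<Longrightarrow> X x y = Y x y"
  shows "ftr Q (fpow Q X p) = ftr Q (fpow Q Y p)"
  unfolding ftr_def using fpow_cong[OF assms] by (auto intro!: sum.cong)

lemma fpow_fmul:
  "fpow P (fmul Q X Y) (Suc p) = fmul Q (fmul Q X (fpow Q (fmul P Y X) p)) Y"
  by (induction p) (simp_all add: fmul_assoc)

text \<open>XY and YX have the same nonzero eigenvalues with multiplicities, here in the form of
  traces of powers. It moves an \<open>n\<close> by \<open>n\<close> matrix of bounded rank to an
  index set that does not grow.\<close>

lemma ftr_fpow_fmul: "ftr P (fpow P (fmul Q X Y) p) = ftr Q (fpow Q (fmul P Y X) p)"
proof (cases p)
  case 0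
  show ?thesis unfolding 0 fpow.simps by (rule ftr_fmul)
next
  case (Suc k)
  have "ftr P (fpow P (fmul Q X Y) p) = ftr Q (fmul P Y (fmul Q X (fpow Q (fmul P Y X) k)))"
    unfolding Suc fpow_fmul by (rule ftr_fmul)
  then show ?thesis unfolding Suc by (simp add: fmul_assoc)
qed

lemma fpow_diag:
  assumes "finite Q" and "\<And>x y. x \<in> Q \<Longrightarrow> y \<in> Q \<Longrightarrow> X x y = (if x = y then d x else 0)"
    and "x \<in> Q" "y \<in> Q"
  shows "fpow Q X p x y = (if x = y then d x ^ Suc p else 0)"
  using assms(3,4)
proof (induction p arbitrary: x y)
  case (Suc p)
  have "fpow Q X (Suc p) x y = (\<Sum>q\<in>Q. if q = x then d x * fpow Q X p x y else 0)"
    unfolding fpow.simps fmul_def using Suc.prems assms(2) by (intro sum.cong) auto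
  then show ?case using Suc assms(1) by simp
qed (simp add: assms(2))

lemma ftr_fpow_diag:
  assumes "finite Q" and "\<And>x y. x \<in> Q \<Longrightarrow> y \<in> Q \<Longrightarrow> X x y = (if x = y then d x else 0)"
  shows "ftr Q (fpow Q X p) = (\<Sum>x\<in>Q. d x ^ Suc p)"
  unfolding ftr_def using fpow_diag[OF assms] by (auto intro!: sum.cong)

section \<open>Stability of traces of powers under vanishing perturbations\<close>

lemma Bseq_add_Bseq:
  fixes f g :: "nat \<Rightarrow> 'a::real_normed_vector"
  assumes "Bseq f" "Bseq g" shows "Bseq (\<lambda>n. f n + g n)"
proof -
  obtain K L where "\<forall>n. norm (f n) \<le> K" "\<forall>n. norm (g n) \<le> L" using assms by (auto simp: Bseq_def)
  then have "norm (f n + g n) \<le> K + L" for n by (meson add_mono norm_triangle_le)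
  then show ?thesis by (rule BseqI')
qed

text \<open>Only differences tend to 0; the reference sequences are bounded but may diverge, as do
  inner products of eigenvectors chosen separately for each \<open>n\<close>.\<close>

lemma tendsto_mult_diff_zero:
  fixes a a' b b' :: "nat \<Rightarrow> complex"
  assumes "(\<lambda>n. a n - a' n) \<longlonglongrightarrow> 0" "(\<lambda>n. b n - b' n) \<longlonglongrightarrow> 0" "Bseq a'" "Bseq b'"
  shows "(\<lambda>n. a n * b n - a' n * b' n) \<longlonglongrightarrow> 0"
proof -
  have "Bseq (\<lambda>n. b n - b' n)" using assms(2) by (intro convergent_imp_Bseq convergentI)
  from Bseq_add_Bseq[OF this assms(4)] have "Bseq b" by simp
  then obtain K where K: "\<forall>n. norm (b n) \<le> K" by (auto simp: Bseq_def)
  obtain K' where K': "\<forall>n. norm (a' n) \<le> K'" using assms(3) by (auto simp: Bseq_def)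
  have "(\<lambda>n. (a n - a' n) * b n) \<longlonglongrightarrow> 0"
    by (rule lim_null_mult_right_bounded[OF assms(1), where B = K]) (use K in auto)
  moreover have "(\<lambda>n. a' n * (b n - b' n)) \<longlonglongrightarrow> 0"
    by (rule lim_null_mult_left_bounded[OF _ assms(2), where B = K']) (use K' in auto)
  ultimately have "(\<lambda>n. (a n - a' n) * b n + a' n * (b n - b' n)) \<longlonglongrightarrow> 0 + 0" by (rule tendsto_add)
  then show ?thesis by (simp add: algebra_simps)
qed

text \<open>Boundedness of the powers of \<open>h'\<close> goes through the induction together with
  the limit, because the product estimate for the next exponent needs it.\<close>

lemma fpow_tendsto:
  fixes h h' :: "nat \<Rightarrow> 'q \<Rightarrow> 'q \<Rightarrow> complex"
  assumes "finite Q"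
    and d: "\<And>x y. x \<in> Q \<Longrightarrow> y \<in> Q \<Longrightarrow> (\<lambda>n. h n x y - h' n x y) \<longlonglongrightarrow> 0"
    and b: "\<And>x y. x \<in> Q \<Longrightarrow> y \<in> Q \<Longrightarrow> Bseq (\<lambda>n. h' n x y)"
    and "x \<in> Q" "y \<in> Q"
  shows "(\<lambda>n. fpow Q (h n) p x y - fpow Q (h' n) p x y) \<longlonglongrightarrow> 0 \<and> Bseq (\<lambda>n. fpow Q (h' n) p x y)"
  using assms(4,5)
proof (induction p arbitrary: x y)
  case (Suc p)
  have "(\<lambda>n. \<Sum>q\<in>Q. h n x q * fpow Q (h n) p q y - h' n x q * fpow Q (h' n) p q y) \<longlonglongrightarrow> (\<Sum>q\<in>Q. 0)"
    using Suc d b by (intro tendsto_sum tendsto_mult_diff_zero) auto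
  moreover have "Bseq (\<lambda>n. \<Sum>q\<in>Q'. h' n x q * fpow Q (h' n) p q y)" if "Q' \<subseteq> Q" for Q'
    using finite_subset[OF that assms(1)] that
  proof (induction Q' rule: finite_induct)
    case (insert q Q')
    then show ?case using Suc b by (auto intro!: Bseq_add_Bseq Bseq_mult)
  qed auto
  ultimately show ?case by (simp add: fmul_def sum_subtractf)
qed (use d b in auto)

lemma ftr_fpow_tendsto:
  fixes h h' :: "nat \<Rightarrow> 'q \<Rightarrow> 'q \<Rightarrow> complex"
  assumes "finite Q"
    and "\<And>x y. x \<in> Q \<Longrightarrow> y \<in> Q \<Longrightarrow> (\<lambda>n. h n x y - h' n x y) \<longlonglongrightarrow> 0"
    and "\<And>x y. x \<in> Q \<Longrightarrow> y \<in> Q \<Longrightarrow> Bseq (\<lambda>n. h' n x y)"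
    and "(\<lambda>n. ftr Q (fpow Q (h' n) p)) \<longlonglongrightarrow> L"
  shows "(\<lambda>n. ftr Q (fpow Q (h n) p)) \<longlonglongrightarrow> L"
proof -
  have "(\<lambda>n. \<Sum>x\<in>Q. fpow Q (h n) p x x - fpow Q (h' n) p x x) \<longlonglongrightarrow> (\<Sum>x\<in>Q. 0)"
    using fpow_tendsto[OF assms(1-3)] by (intro tendsto_sum) auto
  from tendsto_add[OF this assms(4)] show ?thesis by (simp add: ftr_def sum_subtractf)
qed

text \<open>Paths \<open>x \<rightarrow> z\<^sub>1 \<rightarrow> \<dots> \<rightarrow> z\<^sub>p \<rightarrow> y\<close> whose intermediate points lie over the letters of a
  given word.\<close>

primrec path_sum :: "'q set \<Rightarrow> ('q \<Rightarrow> 's) \<Rightarrow> ('q \<Rightarrow> 'q \<Rightarrow> complex) \<Rightarrow> 's list \<Rightarrow> 'q \<Rightarrow> 'q \<Rightarrow> complex" where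
  "path_sum Q \<pi> k [] x y = k x y"
| "path_sum Q \<pi> k (s # w) x y = (\<Sum>z\<in>{z\<in>Q. \<pi> z = s}. k x z * path_sum Q \<pi> k w z y)"

primrec chain_prod :: "('s \<Rightarrow> 's \<Rightarrow> complex) \<Rightarrow> 's \<Rightarrow> 's list \<Rightarrow> 's \<Rightarrow> complex" where
  "chain_prod \<kappa> s [] t = \<kappa> s t"
| "chain_prod \<kappa> s (u # w) t = \<kappa> s u * chain_prod \<kappa> u w t"

lemma sum_lists_length_Suc:
  "(\<Sum>w\<in>{w :: 's::finite list. length w = Suc p}. g w) = (\<Sum>s\<in>UNIV. \<Sum>w\<in>{w. length w = p}. g (s # w))"
proof -
  have "(\<Sum>s\<in>UNIV. \<Sum>w\<in>{w :: 's list. length w = p}. g (s # w)) =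
      (\<Sum>(s, w)\<in>UNIV \<times> {w :: 's list. length w = p}. g (s # w))"
    by (simp add: sum.cartesian_product)
  also have "\<dots> = (\<Sum>w\<in>{w :: 's list. length w = Suc p}. g w)"
    by (rule sum.reindex_bij_witness[of _ "\<lambda>w. (hd w, tl w)" "\<lambda>(s, w). s # w"])
      (auto simp: length_Suc_conv)
  finally show ?thesis ..
qed

text \<open>The weight \<open>\<kappa>\<close> sees only the letters over which the points lie.
  Grouping the intermediate points by letters therefore pulls it out, and the remaining path sums
  are what traces of words in the truncated matrices turn into.\<close>

lemma fpow_path_sum:
  fixes \<pi> :: "'q \<Rightarrow> 's::finite"
  assumes "finite Q"
  shows "fpow Q (\<lambda>x y. \<kappa> (\<pi> x) (\<pi> y) * k x y) p x y =
    (\<Sum>w\<in>{w. length w = p}. chain_prod \<kappa> (\<pi> x) w (\<pi> y) * path_sum Q \<pi> k w x y)"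
proof (induction p arbitrary: x y)
  case (Suc p)
  have "fpow Q (\<lambda>x y. \<kappa> (\<pi> x) (\<pi> y) * k x y) (Suc p) x y =
      (\<Sum>z\<in>Q. \<kappa> (\<pi> x) (\<pi> z) * k x z *
        (\<Sum>w\<in>{w. length w = p}. chain_prod \<kappa> (\<pi> z) w (\<pi> y) * path_sum Q \<pi> k w z y))"
    by (simp add: fmul_def Suc)
  also have "\<dots> = (\<Sum>s\<in>UNIV. \<Sum>z\<in>{z\<in>Q. \<pi> z = s}. \<kappa> (\<pi> x) (\<pi> z) * k x z *
        (\<Sum>w\<in>{w. length w = p}. chain_prod \<kappa> (\<pi> z) w (\<pi> y) * path_sum Q \<pi> k w z y))"
    using assms by (intro sum.group[symmetric]) auto
  also have "\<dots> = (\<Sum>s\<in>UNIV. \<Sum>w\<in>{w. length w = p}. \<Sum>z\<in>{z\<in>Q. \<pi> z = s}. \<kappa> (\<pi> x) s * k x z *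
        (chain_prod \<kappa> s w (\<pi> y) * path_sum Q \<pi> k w z y))"
    by (simp add: sum_distrib_left) (subst sum.swap, simp)
  also have "\<dots> = (\<Sum>w\<in>{w. length w = Suc p}. chain_prod \<kappa> (\<pi> x) w (\<pi> y) * path_sum Q \<pi> k w x y)"
    unfolding sum_lists_length_Suc by (simp add: sum_distrib_left mult_ac)
  finally show ?case .
qed simp

lemma ftr_fpow_path_sum:
  fixes \<pi> :: "'q \<Rightarrow> 's::finite"
  assumes "finite Q"
  shows "ftr Q (fpow Q (\<lambda>x y. \<kappa> (\<pi> x) (\<pi> y) * k x y) p) =
    (\<Sum>s\<in>UNIV. \<Sum>w\<in>{w. length w = p}. chain_prod \<kappa> s w s * (\<Sum>z\<in>{z\<in>Q. \<pi> z = s}. path_sum Q \<pi> k w z z))"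
proof -
  have "ftr Q (fpow Q (\<lambda>x y. \<kappa> (\<pi> x) (\<pi> y) * k x y) p) =
    (\<Sum>s\<in>UNIV. \<Sum>z\<in>{z\<in>Q. \<pi> z = s}. \<Sum>w\<in>{w. length w = p}. chain_prod \<kappa> (\<pi> z) w (\<pi> z) * path_sum Q \<pi> k w z z)"
    unfolding ftr_def fpow_path_sum[OF assms] using assms by (intro sum.group[symmetric]) auto
  also have "\<dots> = (\<Sum>s\<in>UNIV. \<Sum>w\<in>{w. length w = p}. \<Sum>z\<in>{z\<in>Q. \<pi> z = s}. chain_prod \<kappa> s w s * path_sum Q \<pi> k w z z)"
    by (intro sum.cong refl) (subst sum.swap, simp)
  finally show ?thesis by (simp add: sum_distrib_left)
qed

text \<open>Gaussian elimination on the number of equations. This one dimension count serves for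
  vectors orthogonal to a given family, for the linear dependence of Krylov vectors and for the
  intersections of subspaces behind Weyl's inequalities.\<close>

lemma underdetermined_system:
  fixes g :: "'i \<Rightarrow> 'j \<Rightarrow> 'f::field"
  assumes "finite K" "finite J" "card K < card J"
  shows "\<exists>c. (\<exists>j\<in>J. c j \<noteq> 0) \<and> (\<forall>k\<in>K. (\<Sum>j\<in>J. g k j * c j) = 0)"
  using assms
proof (induction K arbitrary: J g rule: finite_induct)
  case empty
  then show ?case by (intro exI[of _ "\<lambda>_. 1"]) (auto simp: card_gt_0_iff)
next
  case (insert k K)
  show ?case
  proof (cases "\<forall>j\<in>J. g k j = 0")
    case True
    have "card K < card J" using insert by auto
    from insert.IH[OF insert.prems(1) this, of g] True show ?thesis by auto
  next
    case False
    then obtain j0 where j0: "j0 \<in> J" "g k j0 \<noteq> 0" by auto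
    let ?J = "J - {j0}"
    have "card K < card ?J" using insert j0 by (simp add: card_Diff_singleton)
    then obtain c where c: "\<exists>j\<in>?J. c j \<noteq> 0"
        "\<forall>l\<in>K. (\<Sum>j\<in>?J. (g l j - g l j0 * g k j / g k j0) * c j) = 0"
      using insert.IH[of ?J "\<lambda>l j. g l j - g l j0 * g k j / g k j0"] insert.prems by auto
    \<comment> \<open>The pivot unknown \<open>j0\<close> is chosen to satisfy equation
      \<open>k\<close>; the reduced coefficients above make this choice compatible with the other
      equations.\<close>
    define c' where "c' = c(j0 := - (\<Sum>j\<in>?J. g k j * c j) / g k j0)"
    have s: "(\<Sum>j\<in>J. g l j * c' j) = g l j0 * c' j0 + (\<Sum>j\<in>?J. g l j * c j)" for l
      using insert.prems(1) j0 by (subst sum.remove[of _ j0]) (auto simp: c'_def intro!: sum.cong)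
    have "(\<Sum>j\<in>J. g k j * c' j) = 0" unfolding s using j0 by (simp add: c'_def)
    moreover have "(\<Sum>j\<in>J. g l j * c' j) = 0" if "l \<in> K" for l
    proof -
      have "0 = (\<Sum>j\<in>?J. g l j * c j) - (\<Sum>j\<in>?J. g l j0 * g k j / g k j0 * c j)"
        using c(2) that by (simp add: left_diff_distrib sum_subtractf)
      also have "(\<Sum>j\<in>?J. g l j0 * g k j / g k j0 * c j) = g l j0 * (\<Sum>j\<in>?J. g k j * c j) / g k j0"
        by (simp add: sum_distrib_left sum_divide_distrib mult_ac)
      finally show ?thesis unfolding s by (simp add: c'_def)
    qed
    moreover have "\<exists>j\<in>J. c' j \<noteq> 0" using c(1) by (auto simp: c'_def)
    ultimately show ?thesis by auto
  qed
qed

section \<open>Ordered eigenvalues and counting functions\<close>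

definition count_ge :: "'i set \<Rightarrow> ('i \<Rightarrow> real) \<Rightarrow> real \<Rightarrow> nat" where
  "count_ge I d x = card {i\<in>I. x \<le> d i}"

text \<open>Index sets of any type are allowed, so that eigenbases, orthonormal systems and products
  with \<open>bool\<close> can all list a multiset. The multiplicity at 0 is left open, as the
  ordered eigenvalues disregard it, and the finiteness condition lets members accumulate only at
  0.\<close>

definition enumerates :: "(real \<Rightarrow> enat) \<Rightarrow> 'i set \<Rightarrow> ('i \<Rightarrow> real) \<Rightarrow> bool" where
  "enumerates L I d \<longleftrightarrow> (\<forall>y>0. finite {i\<in>I. y \<le> \<bar>d i\<bar>}) \<and> (\<forall>x. x \<noteq> 0 \<longrightarrow> L x = enat (card {i\<in>I. d i = x}))"

lemma enumerates_finite_ge: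
  assumes "enumerates L I d" "0 < x"
  shows "finite {i\<in>I. x \<le> d i}"
proof (rule finite_subset)
  show "{i\<in>I. x \<le> d i} \<subseteq> {i\<in>I. x \<le> \<bar>d i\<bar>}" by auto
  show "finite {i\<in>I. x \<le> \<bar>d i\<bar>}" using assms unfolding enumerates_def by blast
qed

lemma neg_eq_iff: "- (a :: real) = x \<longleftrightarrow> a = - x"
  by auto

lemma enumerates_uminus: "enumerates L I d \<Longrightarrow> enumerates (\<lambda>x. L (- x)) I (\<lambda>i. - d i)"
  unfolding enumerates_def neg_eq_iff by simp

text \<open>The condition inside the \<open>THE\<close> of \<open>lambda_plus\<close>, named so that
  existence and uniqueness can be proved for it.\<close>

definition ordered_listing :: "(real \<Rightarrow> enat) \<Rightarrow> (nat \<Rightarrow> real) \<Rightarrow> bool" where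
  "ordered_listing L s \<longleftrightarrow> (\<forall>i j. i \<le> j \<longrightarrow> s j \<le> s i) \<and> (\<forall>i. 0 \<le> s i) \<and>
             (\<forall>x>0. finite {i. s i = x} \<and> L x = enat (card {i. s i = x}))"

text \<open>The positions with \<open>s i\<close> at least \<open>x\<close> form an initial segment
  because \<open>s\<close> is nonincreasing. Its length is the sum of the multiplicities of the
  finitely many values in question, which is the same for \<open>s\<close> and for
  \<open>d\<close>.\<close>

lemma ordered_listing_ge_iff:
  assumes "enumerates L I d" "ordered_listing L s" "0 < x"
  shows "x \<le> s i \<longleftrightarrow> i < count_ge I d x"
proof -
  let ?J = "{j\<in>I. x \<le> d j}"
  have fin: "finite ?J" by (rule enumerates_finite_ge[OF assms(1,3)])
  have L: "enat (card {j\<in>I. d j = v}) = enat (card {i. s i = v})" "finite {i. s i = v}" if "v > 0" for v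
    using assms(1,2) that by (auto simp: enumerates_def ordered_listing_def)
  have eq: "{i. x \<le> s i} = (\<Union>v\<in>d ` ?J. {i. s i = v})"
  proof (intro equalityI subsetI)
    fix i assume "i \<in> {i. x \<le> s i}"
    then have i: "x \<le> s i" by simp
    have "card {i'. s i' = s i} \<noteq> 0" using L(2)[of "s i"] i assms(3) by auto
    then have "{j\<in>I. d j = s i} \<noteq> {}" using L(1)[of "s i"] i assms(3) by (metis card.empty enat.inject less_le_trans)
    then show "i \<in> (\<Union>v\<in>d ` ?J. {i. s i = v})" using i by force
  qed auto
  have "finite {i. x \<le> s i}" unfolding eq using fin L(2) assms(3) by (intro finite_UN_I) auto
  have "card {i. x \<le> s i} = (\<Sum>v\<in>d ` ?J. card {i. s i = v})"
    unfolding eq using fin L(2) assms(3) by (intro card_UN_disjoint) auto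
  also have "\<dots> = (\<Sum>v\<in>d ` ?J. card {j\<in>?J. d j = v})"
  proof (intro sum.cong refl)
    fix v assume v: "v \<in> d ` ?J"
    then have "{j\<in>?J. d j = v} = {j\<in>I. d j = v}" by auto
    then show "card {i. s i = v} = card {j\<in>?J. d j = v}" using L(1)[of v] v assms(3) by auto
  qed
  also have "\<dots> = (\<Sum>v\<in>d ` ?J. \<Sum>j\<in>{j\<in>?J. d j = v}. 1)" by simp
  also have "\<dots> = (\<Sum>j\<in>?J. 1)" by (rule sum.image_gen[OF fin, symmetric])
  also have "\<dots> = card ?J" by simp
  finally have card: "card {i. x \<le> s i} = count_ge I d x" by (simp add: count_ge_def)
  have down: "j \<in> {i. x \<le> s i}" if "i \<in> {i. x \<le> s i}" "j \<le> i" for i j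
    using assms(2) that by (auto simp: ordered_listing_def intro: order_trans)
  show ?thesis
  proof
    assume "x \<le> s i"
    then have "{..i} \<subseteq> {i. x \<le> s i}" using down by auto
    from card_mono[OF \<open>finite {i. x \<le> s i}\<close> this] show "i < count_ge I d x" using card by simp
  next
    assume *: "i < count_ge I d x"
    show "x \<le> s i"
    proof (rule ccontr)
      assume "\<not> x \<le> s i"
      then have "j < i" if "x \<le> s j" for j using down[of j i] that by (cases "j < i") auto
      then have "{i. x \<le> s i} \<subseteq> {..<i}" by blast
      from card_mono[OF _ this] show False using card * by simp
    qed
  qed
qed

lemma ordered_listing_exists:
  assumes en: "enumerates L I d"
  shows "\<exists>s. ordered_listing L s"
proof -
  \<comment> \<open>The generalized inverse of the counting function; the inserted 0 supplies the
    padding when at most \<open>i\<close> positive members exist.\<close>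
  define s where "s i = Sup (insert 0 {x. 0 < x \<and> i < count_ge I d x})" for i
  have bdd: "bdd_above (insert 0 {x. 0 < x \<and> i < count_ge I d x})" for i
  proof (cases "\<exists>x>0. i < count_ge I d x")
    case True
    then obtain x0 where x0: "x0 > 0" "i < count_ge I d x0" by auto
    let ?J = "{j\<in>I. x0 \<le> d j}"
    have fin: "finite ?J" by (rule enumerates_finite_ge[OF en x0(1)])
    have "x \<le> max x0 (Max (d ` ?J))" if "0 < x" "i < count_ge I d x" for x
    proof (rule ccontr)
      assume *: "\<not> ?thesis"
      have "{j\<in>I. x \<le> d j} = {}"
      proof safe
        fix j assume "j \<in> I" "x \<le> d j"
        then have "d j \<in> d ` ?J" using * by auto
        then have "d j \<le> Max (d ` ?J)" using fin by auto
        with * \<open>x \<le> d j\<close> show "j \<in> {}" by auto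
      qed
      then have "count_ge I d x = 0" by (simp only: count_ge_def card.empty)
      then show False using that by simp
    qed
    then show ?thesis using x0(1) by (intro bdd_aboveI[of _ "max x0 (Max (d ` ?J))"]) auto
  next
    case False
    then show ?thesis by (intro bdd_aboveI[of _ 0]) auto
  qed
  have s0: "0 \<le> s i" for i unfolding s_def by (intro cSup_upper bdd) auto
  have iff: "x \<le> s i \<longleftrightarrow> i < count_ge I d x" if x: "0 < x" for x i
  proof
    assume "i < count_ge I d x"
    then show "x \<le> s i" unfolding s_def using x by (intro cSup_upper bdd) auto
  next
    assume xs: "x \<le> s i"
    show "i < count_ge I d x"
    proof (rule ccontr)
      assume n: "\<not> i < count_ge I d x"
      let ?J = "{j\<in>I. x / 2 \<le> d j \<and> d j < x}"
      \<comment> \<open>No member lies strictly between \<open>y\<close> and \<open>x\<close>, so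
        the counting function is constant there and the supremum cannot reach
        \<open>x\<close>.\<close>
      define y where "y = Max (insert (x / 2) (d ` ?J))"
      have fin: "finite ?J" by (rule finite_subset[OF _ enumerates_finite_ge[OF en, of "x / 2"]]) (use x in auto)
      then have yx: "y < x" unfolding y_def using x by auto
      have y0: "x / 2 \<le> y" unfolding y_def by (rule Max_ge) (use fin in auto)
      have "s i \<le> y" unfolding s_def
      proof (intro cSup_least)
        fix z assume z: "z \<in> insert 0 {x. 0 < x \<and> i < count_ge I d x}"
        show "z \<le> y"
        proof (rule ccontr)
          assume zy: "\<not> z \<le> y"
          then have z0: "0 < z" "i < count_ge I d z" using z y0 x by auto
          have "{j\<in>I. z \<le> d j} \<subseteq> {j\<in>I. x \<le> d j}"
          proof safe
            fix j assume j: "j \<in> I" "z \<le> d j"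
            show "x \<le> d j"
            proof (rule ccontr)
              assume "\<not> x \<le> d j"
              then have "d j \<in> d ` ?J" using j zy y0 by auto
              then have "d j \<le> y" unfolding y_def using fin by auto
              then show False using j zy by auto
            qed
          qed
          from card_mono[OF enumerates_finite_ge[OF en x] this] show False using z0 n by (simp add: count_ge_def)
        qed
      qed auto
      then show False using xs yx by simp
    qed
  qed
  have "finite {i. s i = x} \<and> L x = enat (card {i. s i = x})" if x: "0 < x" for x
  proof -
    let ?J = "{j\<in>I. x < d j}"
    \<comment> \<open>The next member above \<open>x\<close>, capped at \<open>x + 1\<close>. The
      positions between the counts at \<open>y\<close> and at \<open>x\<close> are exactly those
      where \<open>s\<close> equals \<open>x\<close>.\<close>
    define y where "y = Min (insert (x + 1) (d ` ?J))"
    have fx: "finite {j\<in>I. x \<le> d j}" by (rule enumerates_finite_ge[OF en x])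
    have fin: "finite ?J" by (rule finite_subset[OF _ fx]) auto
    then have xy: "x < y" unfolding y_def by auto
    have "y \<le> d j" if "j \<in> ?J" for j unfolding y_def using fin that by auto
    then have same: "{j\<in>I. z \<le> d j} = {j\<in>I. x < d j}" if "x < z" "z \<le> y" for z
      using that xy by force
    have "{i. s i = x} = {count_ge I d y..<count_ge I d x}"
    proof (rule Set.set_eqI)
      fix i
      have "s i = x \<longleftrightarrow> x \<le> s i \<and> \<not> y \<le> s i"
      proof (intro iffI conjI)
        assume "x \<le> s i \<and> \<not> y \<le> s i"
        then have a: "x \<le> s i" "s i < y" by auto
        show "s i = x"
        proof (rule ccontr)
          assume "s i \<noteq> x"
          with a have b: "x < s i" by simp
          then have "i < count_ge I d (s i)" using iff[of "s i" i] x by simp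
          then have "i < count_ge I d y" using same[OF b] same[OF xy] a by (simp add: count_ge_def)
          then show False using iff[of y i] a xy x by simp
        qed
      qed (use xy in auto)
      then show "i \<in> {i. s i = x} \<longleftrightarrow> i \<in> {count_ge I d y..<count_ge I d x}" using iff x xy by auto
    qed
    moreover have "count_ge I d x - count_ge I d y = card {j\<in>I. d j = x}"
    proof -
      have "{j\<in>I. x \<le> d j} = {j\<in>I. d j = x} \<union> ?J" by auto
      moreover have "finite {j\<in>I. d j = x}" by (rule finite_subset[OF _ fx]) auto
      ultimately have "count_ge I d x = card {j\<in>I. d j = x} + card ?J"
        unfolding count_ge_def using fin by (simp add: card_Un_disjoint disjoint_iff)
      then show ?thesis using same[OF xy] by (simp add: count_ge_def)
    qed
    ultimately show ?thesis using en x by (auto simp: enumerates_def)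
  qed
  moreover have "s j \<le> s i" if "i \<le> j" for i j
  proof (cases "s j = 0")
    case False
    then have "j < count_ge I d (s j)" using iff[of "s j" j] s0[of j] by simp
    then show ?thesis using iff[of "s j" i] False s0[of j] that by simp
  qed (use s0 in simp)
  ultimately show ?thesis using s0 unfolding ordered_listing_def by blast
qed

lemma ordered_listing_unique:
  assumes "enumerates L I d" "ordered_listing L s" "ordered_listing L t"
  shows "s = t"
proof
  fix i
  have 0: "0 \<le> s i" "0 \<le> t i" using assms(2,3) by (auto simp: ordered_listing_def)
  have "x \<le> s i \<longleftrightarrow> x \<le> t i" if "0 < x" for x
    using ordered_listing_ge_iff[OF assms(1) _ that] assms(2,3) by blast
  from this[of "s i"] this[of "t i"] show "s i = t i" using 0 by force
qed

lemma lambda_plus_listing: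
  assumes "enumerates L I d"
  shows "ordered_listing L (lambda_plus L)"
proof -
  obtain s where s: "ordered_listing L s" using ordered_listing_exists[OF assms] by auto
  have "lambda_plus L = s"
    unfolding lambda_plus_def ordered_listing_def[symmetric]
    by (rule the_equality, rule s) (use ordered_listing_unique[OF assms] s in blast)
  with s show ?thesis by simp
qed

lemma lambda_plus_ge_iff:
  "enumerates L I d \<Longrightarrow> 0 < x \<Longrightarrow> x \<le> lambda_plus L i \<longleftrightarrow> i < count_ge I d x"
  using ordered_listing_ge_iff lambda_plus_listing by blast

lemma lambda_plus_nonneg: "enumerates L I d \<Longrightarrow> 0 \<le> lambda_plus L i"
  using lambda_plus_listing by (auto simp: ordered_listing_def)

text \<open>Negating the multiset exchanges the two ends of the spectrum, so the rest of the proof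
  treats counts above positive levels only, for \<open>d\<close> and for \<open>- d\<close>.\<close>

lemma lambda_minus_eq:
  assumes "enumerates L I d"
  shows "lambda_minus L = (\<lambda>i. - lambda_plus (\<lambda>x. L (- x)) i)"
proof -
  note en = enumerates_uminus[OF assms]
  let ?P = "\<lambda>s. (\<forall>i j. i \<le> j \<longrightarrow> s i \<le> s j) \<and> (\<forall>i. s i \<le> 0) \<and>
             (\<forall>x<0. finite {i. s i = x} \<and> L x = enat (card {i :: nat. s i = (x :: real)}))"
  have P: "?P s \<longleftrightarrow> ordered_listing (\<lambda>x. L (- x)) (\<lambda>i. - s i)" for s
  proof -
    have "(\<forall>x<0. finite {i. s i = x} \<and> L x = enat (card {i. s i = x})) \<longleftrightarrow>
        (\<forall>x>0. finite {i. - s i = x} \<and> L (- x) = enat (card {i. - s i = x}))" (is "?A = ?B")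
    proof
      assume a: ?A
      show ?B
      proof (intro allI impI)
        fix x :: real assume "x > 0"
        then show "finite {i. - s i = x} \<and> L (- x) = enat (card {i. - s i = x})"
          using a[rule_format, of "- x"] unfolding neg_eq_iff by simp
      qed
    next
      assume b: ?B
      show ?A
      proof (intro allI impI)
        fix x :: real assume "x < 0"
        then show "finite {i. s i = x} \<and> L x = enat (card {i. s i = x})"
          using b[rule_format, of "- x"] by simp
      qed
    qed
    then show ?thesis unfolding ordered_listing_def by simp
  qed
  show ?thesis unfolding lambda_minus_def P
  proof (rule the_equality)
    show "ordered_listing (\<lambda>x. L (- x)) (\<lambda>i. - (- lambda_plus (\<lambda>x. L (- x)) i))"
      using lambda_plus_listing[OF en] by simp
    fix s assume "ordered_listing (\<lambda>x. L (- x)) (\<lambda>i. - s i)"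
    from ordered_listing_unique[OF en this lambda_plus_listing[OF en]]
    show "s = (\<lambda>i. - lambda_plus (\<lambda>x. L (- x)) i)" by (metis minus_minus)
  qed
qed

text \<open>The loss \<open>\<delta>\<close> is needed because counting functions jump.\<close>

definition counts_tend :: "(nat \<Rightarrow> 'i set) \<Rightarrow> (nat \<Rightarrow> 'i \<Rightarrow> real) \<Rightarrow> 'j set \<Rightarrow> ('j \<Rightarrow> real) \<Rightarrow> bool" where
  "counts_tend I d J e \<longleftrightarrow> (\<forall>x \<delta>. 0 < \<delta> \<longrightarrow> \<delta> < x \<longrightarrow>
     (\<forall>\<^sub>F n in sequentially. count_ge (I n) (d n) x \<le> count_ge J e (x - \<delta>)) \<and>
     (\<forall>\<^sub>F n in sequentially. count_ge J e x \<le> count_ge (I n) (d n) (x - \<delta>)))"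

lemma lambda_plus_tendsto:
  assumes en: "\<forall>\<^sub>F n in sequentially. enumerates (Ls n) (I n) (d n)" and en': "enumerates L J e"
    and ct: "counts_tend I d J e"
  shows "(\<lambda>n. lambda_plus (Ls n) i) \<longlonglongrightarrow> lambda_plus L i"
proof (rule order_tendstoI)
  let ?y = "lambda_plus L i"
  have y0: "0 \<le> ?y" by (rule lambda_plus_nonneg[OF en'])
  fix a assume a: "a < ?y"
  show "\<forall>\<^sub>F n in sequentially. a < lambda_plus (Ls n) i"
  proof (cases "a < 0")
    case True
    show ?thesis using en by eventually_elim (use True lambda_plus_nonneg in \<open>fastforce intro: less_le_trans\<close>)
  next
    case False
    \<comment> \<open>With this choice \<open>?y - \<delta>\<close> is the midpoint of
      \<open>a\<close> and the limit, where the counting functions are compared.\<close>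
    define \<delta> where "\<delta> = (?y - a) / 2"
    have \<delta>: "0 < \<delta>" "\<delta> < ?y" "a < ?y - \<delta>" "0 < ?y - \<delta>" using a False by (auto simp: \<delta>_def field_simps)
    have i: "i < count_ge J e ?y" using lambda_plus_ge_iff[OF en', of ?y i] a False by simp
    have "\<forall>\<^sub>F n in sequentially. count_ge J e ?y \<le> count_ge (I n) (d n) (?y - \<delta>)"
      using ct \<delta> by (auto simp: counts_tend_def)
    then show ?thesis using en
    proof eventually_elim
      case (elim n)
      then show ?case using lambda_plus_ge_iff[OF elim(2) \<delta>(4), of i] i \<delta> by simp
    qed
  qed
next
  let ?y = "lambda_plus L i"
  have y0: "0 \<le> ?y" by (rule lambda_plus_nonneg[OF en'])
  fix a assume a: "?y < a"
  define \<delta> where "\<delta> = (a - ?y) / 2"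
  have \<delta>: "0 < \<delta>" "\<delta> < a" "?y < a - \<delta>" "0 < a - \<delta>" "0 < a" using a y0 by (auto simp: \<delta>_def field_simps)
  have i: "\<not> i < count_ge J e (a - \<delta>)" using lambda_plus_ge_iff[OF en', of "a - \<delta>" i] \<delta> by simp
  have "\<forall>\<^sub>F n in sequentially. count_ge (I n) (d n) a \<le> count_ge J e (a - \<delta>)"
    using ct \<delta> by (auto simp: counts_tend_def)
  then show "\<forall>\<^sub>F n in sequentially. lambda_plus (Ls n) i < a" using en
  proof eventually_elim
    case (elim n)
    then show ?case using lambda_plus_ge_iff[OF elim(2) \<delta>(5), of i] i by simp
  qed
qed

lemma EV_convergesI:
  assumes en: "\<forall>\<^sub>F n in sequentially. enumerates (Ls n) (I n) (d n)" and en': "enumerates L J e"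
    and ct: "counts_tend I d J e" and ct': "counts_tend I (\<lambda>n i. - d n i) J (\<lambda>j. - e j)"
  shows "EV_converges Ls L"
  unfolding EV_converges_def
proof (intro conjI allI)
  fix i show "(\<lambda>n. lambda_plus (Ls n) i) \<longlonglongrightarrow> lambda_plus L i" by (rule lambda_plus_tendsto[OF en en' ct])
  have "\<forall>\<^sub>F n in sequentially. enumerates (\<lambda>x. Ls n (- x)) (I n) (\<lambda>i. - d n i)"
    using en by eventually_elim (rule enumerates_uminus)
  from lambda_plus_tendsto[OF this enumerates_uminus[OF en'] ct']
  have "(\<lambda>n. lambda_plus (\<lambda>x. Ls n (- x)) i) \<longlonglongrightarrow> lambda_plus (\<lambda>x. L (- x)) i" .
  then have "(\<lambda>n. - lambda_plus (\<lambda>x. Ls n (- x)) i) \<longlonglongrightarrow> lambda_minus L i"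
    unfolding lambda_minus_eq[OF en'] by (rule tendsto_minus)
  moreover have "\<forall>\<^sub>F n in sequentially. - lambda_plus (\<lambda>x. Ls n (- x)) i = lambda_minus (Ls n) i"
    using en by eventually_elim (simp add: lambda_minus_eq)
  ultimately show "(\<lambda>n. lambda_minus (Ls n) i) \<longlonglongrightarrow> lambda_minus L i" by (rule Lim_transform_eventually)
qed

text \<open>The output of Weyl's inequalities for a perturbation smaller than \<open>\<eta>\<close>.
  Levels \<open>x > \<eta>\<close> are taken so that the shifted level stays positive and the counts
  finite.\<close>

definition counts_near :: "real \<Rightarrow> 'i set \<Rightarrow> ('i \<Rightarrow> real) \<Rightarrow> 'j set \<Rightarrow> ('j \<Rightarrow> real) \<Rightarrow> bool" where
  "counts_near \<eta> I d J e \<longleftrightarrow>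
     (\<forall>x>\<eta>. count_ge I d x \<le> count_ge J e (x - \<eta>) \<and> count_ge J e x \<le> count_ge I d (x - \<eta>))"

lemma counts_tend_approx:
  assumes en: "enumerates L J e" and en2: "\<forall>\<^sub>F n in sequentially. enumerates (Ls n) (I n) (d n)"
    and near: "\<And>\<eta>. 0 < \<eta> \<Longrightarrow> \<exists>I' d' J' e'. counts_tend I' d' (J' :: 'm set) e' \<and>
      (\<forall>\<^sub>F n in sequentially. counts_near \<eta> (I n) (d n) (I' n :: 'l set) (d' n)) \<and> counts_near \<eta> J e J' e'"
  shows "counts_tend I d J e"
  unfolding counts_tend_def
proof (intro allI impI)
  fix x \<delta> :: real assume \<delta>: "0 < \<delta>" "\<delta> < x"
  \<comment> \<open>One third of the loss each for passing to the truncated family, for its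
    convergence, and for passing back.\<close>
  define \<eta> where "\<eta> = \<delta> / 3"
  have \<eta>: "0 < \<eta>" "\<delta> = \<eta> + \<eta> + \<eta>" "\<eta> < x" "\<eta> < x - \<eta>" "\<eta> < x - \<eta> - \<eta>" "x - \<eta> - \<eta> - \<eta> = x - \<delta>"
    using \<delta> by (auto simp: \<eta>_def field_simps)
  obtain I' J' d' e' where ct: "counts_tend I' d' (J' :: 'm set) e'"
    and nI: "\<forall>\<^sub>F n in sequentially. counts_near \<eta> (I n) (d n) (I' n :: 'l set) (d' n)" and nJ: "counts_near \<eta> J e J' e'"
    using near[OF \<eta>(1)] by blast
  have 1: "\<forall>\<^sub>F n in sequentially. count_ge (I' n) (d' n) (x - \<eta>) \<le> count_ge J' e' (x - \<eta> - \<eta>)"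
    and 2: "\<forall>\<^sub>F n in sequentially. count_ge J' e' (x - \<eta>) \<le> count_ge (I' n) (d' n) (x - \<eta> - \<eta>)"
    using ct \<eta> unfolding counts_tend_def by blast+
  show "(\<forall>\<^sub>F n in sequentially. count_ge (I n) (d n) x \<le> count_ge J e (x - \<delta>)) \<and>
      (\<forall>\<^sub>F n in sequentially. count_ge J e x \<le> count_ge (I n) (d n) (x - \<delta>))"
  proof
    show "\<forall>\<^sub>F n in sequentially. count_ge (I n) (d n) x \<le> count_ge J e (x - \<delta>)"
      using 1 nI
    proof eventually_elim
      case (elim n)
      have "count_ge (I n) (d n) x \<le> count_ge (I' n) (d' n) (x - \<eta>)" using elim(2) \<eta> by (auto simp: counts_near_def)
      also note elim(1)
      also have "count_ge J' e' (x - \<eta> - \<eta>) \<le> count_ge J e (x - \<eta> - \<eta> - \<eta>)" using nJ \<eta> unfolding counts_near_def by blast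
      finally show ?case using \<eta> by simp
    qed
    show "\<forall>\<^sub>F n in sequentially. count_ge J e x \<le> count_ge (I n) (d n) (x - \<delta>)"
      using 2 nI
    proof eventually_elim
      case (elim n)
      have "count_ge J e x \<le> count_ge J' e' (x - \<eta>)" using nJ \<eta> by (auto simp: counts_near_def)
      also note elim(1)
      also have "count_ge (I' n) (d' n) (x - \<eta> - \<eta>) \<le> count_ge (I n) (d n) (x - \<eta> - \<eta> - \<eta>)"
        using elim(2) \<eta> unfolding counts_near_def by blast
      finally show ?case using \<eta> by simp
    qed
  qed
qed

section \<open>Power sums determine eigenvalues\<close>

text \<open>The polynomial approximation of \<open>G\<close> is uniform on an interval that contains
  all members. The number of terms grows with \<open>n\<close>, but the squared factor makes the
  total error at most the uniform error times a bounded sum of squares.\<close>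

lemma power_sums_tendsto_sum:
  fixes d :: "nat \<Rightarrow> 'i \<Rightarrow> real" and e :: "'j \<Rightarrow> real" and G :: "real \<Rightarrow> real"
  assumes fin: "\<And>n. finite (I n)" "finite J"
    and mom: "\<And>p. (\<lambda>n. \<Sum>i\<in>I n. d n i ^ (p + 2)) \<longlonglongrightarrow> (\<Sum>j\<in>J. e j ^ (p + 2))"
    and cont: "continuous_on UNIV G"
  shows "(\<lambda>n. \<Sum>i\<in>I n. (d n i)\<^sup>2 * G (d n i)) \<longlonglongrightarrow> (\<Sum>j\<in>J. (e j)\<^sup>2 * G (e j))"
proof -
  have "Bseq (\<lambda>n. \<Sum>i\<in>I n. d n i ^ (0 + 2))" using mom[of 0] by (intro convergent_imp_Bseq convergentI)
  then obtain S0 where S0: "\<And>n. \<bar>\<Sum>i\<in>I n. (d n i)\<^sup>2\<bar> \<le> S0" unfolding Bseq_def by (auto simp: numeral_2_eq_2)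
  \<comment> \<open>Bounds both sums of squares; the added 1 makes \<open>S\<close> at least 1, so
    that a square below \<open>S\<close> forces the number into \<open>{-S..S}\<close>.\<close>
  define S where "S = max S0 (\<Sum>j\<in>J. (e j)\<^sup>2) + 1"
  have S: "(\<Sum>i\<in>I n. (d n i)\<^sup>2) \<le> S" "(\<Sum>j\<in>J. (e j)\<^sup>2) \<le> S" for n
    using S0[of n] by (auto simp: S_def)
  have S1: "1 \<le> S" using S0[of 0] by (auto simp: S_def)
  have sq: "\<bar>t\<bar> \<le> S" if "t\<^sup>2 \<le> S" for t :: real
  proof -
    have "t\<^sup>2 \<le> S\<^sup>2" using that S1 by (metis le_square power2_eq_square mult_left_mono order_trans mult_1_right zero_le_one)
    then show ?thesis using S1 abs_le_square_iff[of t S] by simp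
  qed
  have dS: "d n i \<in> {-S..S}" if "i \<in> I n" for n i
  proof -
    have "(d n i)\<^sup>2 \<le> S" using member_le_sum[OF that, of "\<lambda>i. (d n i)\<^sup>2"] fin(1)[of n] S(1)[of n] by simp
    from sq[OF this] show ?thesis by auto
  qed
  have eS: "e j \<in> {-S..S}" if "j \<in> J" for j
  proof -
    have "(e j)\<^sup>2 \<le> S" using member_le_sum[OF that, of "\<lambda>j. (e j)\<^sup>2"] fin(2) S(2) by simp
    from sq[OF this] show ?thesis by auto
  qed
  show ?thesis
  proof (rule LIMSEQ_I)
    fix r :: real assume r: "0 < r"
    \<comment> \<open>Makes each of the two approximation errors at most \<open>r / 4\<close>; the
      polynomial sums contribute another \<open>r / 4\<close>.\<close>
    define \<eta> where "\<eta> = r / (4 * S)"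
    have \<eta>: "0 < \<eta>" "\<eta> * S = r / 4" using r S1 by (auto simp: \<eta>_def)
    obtain q where q: "real_polynomial_function q" "\<And>x. x \<in> {-S..S} \<Longrightarrow> \<bar>G x - q x\<bar> < \<eta>"
      using Stone_Weierstrass_real_polynomial_function[of "{-S..S}" G \<eta>] continuous_on_subset[OF cont] \<eta> by auto
    obtain a m where am: "q = (\<lambda>x. \<Sum>k\<le>m. a k * x ^ k)" using q(1) unfolding real_polynomial_function_iff_sum by blast
    have ex: "(\<Sum>i\<in>K. (f i)\<^sup>2 * q (f i)) = (\<Sum>k\<le>m. a k * (\<Sum>i\<in>K. f i ^ (k + 2)))" for K and f :: "'z \<Rightarrow> real"
      unfolding am sum_distrib_left by (subst sum.swap) (simp add: power_add power2_eq_square mult_ac)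
    have "(\<lambda>n. \<Sum>i\<in>I n. (d n i)\<^sup>2 * q (d n i)) \<longlonglongrightarrow> (\<Sum>j\<in>J. (e j)\<^sup>2 * q (e j))"
      unfolding ex by (intro tendsto_intros mom)
    then obtain N where N: "\<And>n. n \<ge> N \<Longrightarrow> \<bar>(\<Sum>i\<in>I n. (d n i)\<^sup>2 * q (d n i)) - (\<Sum>j\<in>J. (e j)\<^sup>2 * q (e j))\<bar> < r / 4"
      using LIMSEQ_D[of _ _ "r / 4"] r by fastforce
    have err: "\<bar>(\<Sum>i\<in>K. (f i)\<^sup>2 * G (f i)) - (\<Sum>i\<in>K. (f i)\<^sup>2 * q (f i))\<bar> \<le> r / 4"
      if "\<And>i. i \<in> K \<Longrightarrow> f i \<in> {-S..S}" "(\<Sum>i\<in>K. (f i)\<^sup>2) \<le> S" for K and f :: "'z \<Rightarrow> real"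
    proof -
      have "\<bar>(\<Sum>i\<in>K. (f i)\<^sup>2 * G (f i)) - (\<Sum>i\<in>K. (f i)\<^sup>2 * q (f i))\<bar> = \<bar>\<Sum>i\<in>K. (f i)\<^sup>2 * (G (f i) - q (f i))\<bar>"
        by (simp add: sum_subtractf right_diff_distrib)
      also have "\<dots> \<le> (\<Sum>i\<in>K. (f i)\<^sup>2 * \<eta>)"
        using mult_left_mono[OF less_imp_le[OF q(2)[OF that(1)]]]
        by (intro order_trans[OF sum_abs] sum_mono) (simp add: abs_mult)
      also have "\<dots> \<le> \<eta> * S" using mult_left_mono[OF that(2), of \<eta>] \<eta>
        by (simp add: sum_distrib_left mult.commute)
      finally show ?thesis using \<eta> by simp
    qed
    show "\<exists>N. \<forall>n\<ge>N. norm ((\<Sum>i\<in>I n. (d n i)\<^sup>2 * G (d n i)) - (\<Sum>j\<in>J. (e j)\<^sup>2 * G (e j))) < r"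
    proof (intro exI allI impI)
      fix n assume "n \<ge> N"
      from N[OF this] err[of "I n" "d n"] err[of J e] dS[of _ n] eS S(1)[of n] S(2) r
      show "norm ((\<Sum>i\<in>I n. (d n i)\<^sup>2 * G (d n i)) - (\<Sum>j\<in>J. (e j)\<^sup>2 * G (e j))) < r"
        by (simp add: abs_if split: if_splits)
    qed
  qed
qed

text \<open>A ramp \<open>g\<close> lies between the indicators of the levels \<open>x\<close> and
  \<open>x - \<delta>\<close>, so its sums separate the two counts. It vanishes near 0 and is
  therefore \<open>t\<close> squared times a continuous function.\<close>

lemma power_sums_counts_tend:
  fixes d :: "nat \<Rightarrow> 'i \<Rightarrow> real" and e :: "'j \<Rightarrow> real"
  assumes fin: "\<And>n. finite (I n)" "finite J"
    and mom: "\<And>p. (\<lambda>n. \<Sum>i\<in>I n. d n i ^ (p + 2)) \<longlonglongrightarrow> (\<Sum>j\<in>J. e j ^ (p + 2))"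
  shows "counts_tend I d J e"
  unfolding counts_tend_def
proof (intro allI impI)
  fix x \<delta> :: real assume \<delta>: "0 < \<delta>" "\<delta> < x"
  define g where "g t = max 0 (min 1 ((t - (x - \<delta>)) / \<delta>))" for t
  \<comment> \<open>The maximum keeps the denominator away from 0 and equals \<open>t\<close>
    wherever \<open>g t\<close> is nonzero.\<close>
  define G where "G t = g t / (max t (x - \<delta>))\<^sup>2" for t
  have "continuous_on UNIV G" unfolding G_def g_def
    using \<delta> by (intro continuous_intros) auto
  from power_sums_tendsto_sum[OF fin mom this]
  have lim: "(\<lambda>n. \<Sum>i\<in>I n. (d n i)\<^sup>2 * G (d n i)) \<longlonglongrightarrow> (\<Sum>j\<in>J. (e j)\<^sup>2 * G (e j))" .
  have "t\<^sup>2 * G t = g t" for t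
  proof (cases "t \<le> x - \<delta>")
    case True
    then have "g t = 0" using \<delta> by (auto simp: g_def divide_nonpos_pos)
    then show ?thesis by (simp add: G_def)
  qed (use \<delta> in \<open>auto simp: G_def max_def\<close>)
  with lim have lim: "(\<lambda>n. \<Sum>i\<in>I n. g (d n i)) \<longlonglongrightarrow> (\<Sum>j\<in>J. g (e j))" by simp
  have g01: "0 \<le> g t" "g t \<le> 1" for t by (auto simp: g_def)
  have up: "(\<Sum>i\<in>K. g (f i)) \<le> real (count_ge K f (x - \<delta>))" if "finite K" for K and f :: "'z \<Rightarrow> real"
  proof -
    have "(\<Sum>i\<in>K. g (f i)) \<le> (\<Sum>i\<in>K. if x - \<delta> \<le> f i then 1 else 0)"
      using g01 \<delta> by (intro sum_mono) (auto simp: g_def divide_nonpos_pos)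
    also have "\<dots> = real (count_ge K f (x - \<delta>))" using that by (simp add: count_ge_def sum.If_cases Int_def)
    finally show ?thesis .
  qed
  have lo: "real (count_ge K f x) \<le> (\<Sum>i\<in>K. g (f i))" if "finite K" for K and f :: "'z \<Rightarrow> real"
  proof -
    have "real (count_ge K f x) = (\<Sum>i\<in>K. if x \<le> f i then 1 else 0)"
      using that by (simp add: count_ge_def sum.If_cases Int_def)
    also have "\<dots> \<le> (\<Sum>i\<in>K. g (f i))" using g01 \<delta> by (intro sum_mono) (auto simp: g_def field_simps)
    finally show ?thesis .
  qed
  \<comment> \<open>A distance below 1 suffices, since the counts are integers.\<close>
  have ev: "\<forall>\<^sub>F n in sequentially. dist (\<Sum>i\<in>I n. g (d n i)) (\<Sum>j\<in>J. g (e j)) < 1"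
    using lim by (rule tendstoD) simp
  show "(\<forall>\<^sub>F n in sequentially. count_ge (I n) (d n) x \<le> count_ge J e (x - \<delta>)) \<and>
     (\<forall>\<^sub>F n in sequentially. count_ge J e x \<le> count_ge (I n) (d n) (x - \<delta>))"
  proof
    show "\<forall>\<^sub>F n in sequentially. count_ge (I n) (d n) x \<le> count_ge J e (x - \<delta>)" using ev
    proof eventually_elim
      case (elim n)
      then have "real (count_ge (I n) (d n) x) < real (count_ge J e (x - \<delta>)) + 1"
        using lo[OF fin(1)[of n], of "d n"] up[OF fin(2), of e] by (simp add: dist_real_def abs_if split: if_splits)
      then show ?case by linarith
    qed
    show "\<forall>\<^sub>F n in sequentially. count_ge J e x \<le> count_ge (I n) (d n) (x - \<delta>)" using ev
    proof eventually_elim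
      case (elim n)
      then have "real (count_ge J e x) < real (count_ge (I n) (d n) (x - \<delta>)) + 1"
        using up[OF fin(1)[of n], of "d n"] lo[OF fin(2), of e] by (simp add: dist_real_def abs_if split: if_splits)
      then show ?case by linarith
    qed
  qed
qed

section \<open>Hermitian matrices\<close>

text \<open>Vectors and matrices are total functions of which only the entries below
  \<open>n\<close> count; equalities therefore hold below \<open>n\<close> and enter through
  congruence lemmas. The form is linear in its second argument, as \<open>cinner\<close> is.\<close>

definition vip :: "nat \<Rightarrow> (nat \<Rightarrow> complex) \<Rightarrow> (nat \<Rightarrow> complex) \<Rightarrow> complex" where
  "vip n x y = (\<Sum>i<n. cnj (x i) * y i)"

definition nsq :: "nat \<Rightarrow> (nat \<Rightarrow> complex) \<Rightarrow> real" where
  "nsq n x = (\<Sum>i<n. (cmod (x i))\<^sup>2)"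

definition mvec :: "nat \<Rightarrow> (nat \<Rightarrow> nat \<Rightarrow> complex) \<Rightarrow> (nat \<Rightarrow> complex) \<Rightarrow> nat \<Rightarrow> complex" where
  "mvec n X v i = (\<Sum>j<n. X i j * v j)"

definition ent :: "complex mat \<Rightarrow> nat \<Rightarrow> nat \<Rightarrow> complex" where
  "ent X i j = X $$ (i, j)"

definition hermf :: "nat \<Rightarrow> (nat \<Rightarrow> nat \<Rightarrow> complex) \<Rightarrow> bool" where
  "hermf n X \<longleftrightarrow> (\<forall>i<n. \<forall>j<n. X i j = cnj (X j i))"

lemma vip_self: "vip n x x = of_real (nsq n x)"
  unfolding vip_def nsq_def of_real_sum
  by (intro sum.cong) (simp_all add: complex_norm_square mult.commute del: of_real_power)

lemma nsq_nonneg: "0 \<le> nsq n x"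
  unfolding nsq_def by (simp add: sum_nonneg)

lemma nsq_eq_0: "nsq n x = 0 \<longleftrightarrow> (\<forall>i<n. x i = 0)"
  unfolding nsq_def by (subst sum_nonneg_eq_0_iff) auto

lemma nsq_scale: "nsq n (\<lambda>i. c * x i) = (cmod c)\<^sup>2 * nsq n x"
  unfolding nsq_def by (simp add: norm_mult power_mult_distrib sum_distrib_left)

lemma vip_cnj: "cnj (vip n x y) = vip n y x"
  unfolding vip_def by (simp add: mult.commute)

lemma vip_add_right: "vip n x (\<lambda>i. y i + z i) = vip n x y + vip n x z"
  unfolding vip_def by (simp add: distrib_left sum.distrib)

lemma vip_add_left: "vip n (\<lambda>i. x i + y i) z = vip n x z + vip n y z"
  unfolding vip_def by (simp add: distrib_right sum.distrib)

lemma vip_diff_right: "vip n x (\<lambda>i. y i - z i) = vip n x y - vip n x z"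
  unfolding vip_def by (simp add: right_diff_distrib sum_subtractf)

lemma vip_diff_left: "vip n (\<lambda>i. x i - y i) z = vip n x z - vip n y z"
  unfolding vip_def by (simp add: left_diff_distrib sum_subtractf)

lemma vip_scale_right: "vip n x (\<lambda>i. c * y i) = c * vip n x y"
  unfolding vip_def by (simp add: sum_distrib_left mult_ac)

lemma vip_scale_left: "vip n (\<lambda>i. c * x i) y = cnj c * vip n x y"
  unfolding vip_def by (simp add: sum_distrib_left mult_ac)

lemma vip_sum_right: "vip n x (\<lambda>i. \<Sum>k\<in>K. f k i) = (\<Sum>k\<in>K. vip n x (f k))"
  unfolding vip_def sum_distrib_left by (rule sum.swap)

lemma vip_sum_left: "vip n (\<lambda>i. \<Sum>k\<in>K. f k i) y = (\<Sum>k\<in>K. vip n (f k) y)"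
  unfolding vip_def cnj_sum sum_distrib_right by (rule sum.swap)

lemma vip_cong: "(\<And>i. i < n \<Longrightarrow> x i = x' i) \<Longrightarrow> (\<And>i. i < n \<Longrightarrow> y i = y' i) \<Longrightarrow> vip n x y = vip n x' y'"
  unfolding vip_def by simp

lemma nsq_cong: "(\<And>i. i < n \<Longrightarrow> x i = y i) \<Longrightarrow> nsq n x = nsq n y"
  unfolding nsq_def by simp

lemma mvec_cong:
  "(\<And>i. i < n \<Longrightarrow> x i = y i) \<Longrightarrow> (\<And>j. j < n \<Longrightarrow> X i j = Y i j) \<Longrightarrow> mvec n X x i = mvec n Y y i"
  unfolding mvec_def by simp

lemma cmod_vip_le: "cmod (vip n x y) \<le> sqrt (nsq n x) * sqrt (nsq n y)"
proof -
  have "cmod (vip n x y) \<le> (\<Sum>i<n. \<bar>cmod (x i)\<bar> * \<bar>cmod (y i)\<bar>)"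
    unfolding vip_def by (rule order_trans[OF norm_sum]) (simp add: norm_mult)
  also have "\<dots> \<le> L2_set (\<lambda>i. cmod (x i)) {..<n} * L2_set (\<lambda>i. cmod (y i)) {..<n}"
    by (rule L2_set_mult_ineq)
  finally show ?thesis by (simp add: L2_set_def nsq_def)
qed

lemma vip_mvec_adj: "vip n x (mvec n X y) = vip n (mvec n (\<lambda>i j. cnj (X j i)) x) y"
proof -
  have "vip n x (mvec n X y) = (\<Sum>i<n. \<Sum>j<n. cnj (x i) * (X i j * y j))"
    unfolding vip_def mvec_def sum_distrib_left ..
  also have "\<dots> = (\<Sum>j<n. \<Sum>i<n. cnj (x i) * (X i j * y j))" by (rule sum.swap)
  also have "\<dots> = vip n (mvec n (\<lambda>i j. cnj (X j i)) x) y"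
    unfolding vip_def mvec_def cnj_sum sum_distrib_right by (simp add: mult_ac)
  finally show ?thesis .
qed

lemma vip_mvec_herm:
  assumes "hermf n X" shows "vip n x (mvec n X y) = vip n (mvec n X x) y"
proof -
  have "cnj (X j i) = X i j" if "i < n" "j < n" for i j using assms that unfolding hermf_def by metis
  then show ?thesis unfolding vip_mvec_adj by (intro vip_cong mvec_cong refl)
qed

lemma mvec_scale: "mvec n X (\<lambda>i. c * v i) = (\<lambda>i. c * mvec n X v i)"
  unfolding mvec_def by (simp add: sum_distrib_left mult_ac)

lemma mvec_sum: "mvec n X (\<lambda>i. \<Sum>k\<in>K. f k i) = (\<lambda>i. \<Sum>k\<in>K. mvec n X (f k) i)"
  unfolding mvec_def sum_distrib_left by (rule ext) (rule sum.swap)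

lemma mvec_fmul: "mvec n (fmul {..<n} X Y) v = mvec n X (mvec n Y v)"
  unfolding mvec_def fmul_def sum_distrib_left sum_distrib_right
  by (rule ext, subst sum.swap) (simp add: mult.assoc)

section \<open>The spectral theorem for Hermitian matrices\<close>

definition eigenbasis :: "nat \<Rightarrow> (nat \<Rightarrow> nat \<Rightarrow> complex) \<Rightarrow> nat \<Rightarrow> (nat \<Rightarrow> nat \<Rightarrow> complex) \<Rightarrow> (nat \<Rightarrow> real) \<Rightarrow> bool" where
  "eigenbasis n X m V d \<longleftrightarrow> (\<forall>k<m. \<forall>l<m. vip n (V k) (V l) = (if k = l then 1 else 0)) \<and>
     (\<forall>k<m. \<forall>i<n. mvec n X (V k) i = of_real (d k) * V k i)"

text \<open>An eigenvector in an invariant subspace, from the minimal annihilating polynomial of a vector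
  orthogonal to the eigenvectors found so far.\<close>

lemma eigenbasis_extend:
  assumes herm: "hermf n X" and eb: "eigenbasis n X m V d" and "m < n"
  shows "\<exists>V' d'. eigenbasis n X (Suc m) V' d'"
proof -
  obtain w where w: "\<exists>i<n. w i \<noteq> 0" "\<forall>k<m. vip n (V k) w = 0"
    using underdetermined_system[of "{..<m}" "{..<n}" "\<lambda>k j. cnj (V k j)"] \<open>m < n\<close> unfolding vip_def by auto
  define kr where "kr j = (mvec n X ^^ j) w" for j
  have kr_Suc: "kr (Suc j) = mvec n X (kr j)" for j by (simp add: kr_def)
  \<comment> \<open>The vector p(X) w, for polynomials of degree at most \<open>n\<close>.\<close>
  define act where "act p i = (\<Sum>j\<le>n. coeff p j * kr j i)" for p i
  \<comment> \<open>The \<open>n + 1\<close> Krylov vectors are linearly dependent in dimension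
    \<open>n\<close>, which gives a nonzero annihilating polynomial.\<close>
  obtain c where c: "\<exists>j\<in>{..n}. c j \<noteq> 0" "\<forall>i<n. (\<Sum>j\<le>n. kr j i * c j) = 0"
    using underdetermined_system[of "{..<n}" "{..n}" "\<lambda>i j. kr j i"] by auto
  define p0 where "p0 = (\<Sum>j\<le>n. monom (c j) j)"
  have cp0: "coeff p0 j = (if j \<le> n then c j else 0)" for j
    unfolding p0_def by (simp add: coeff_sum if_distrib cong: if_cong)
  let ?P = "\<lambda>p. p \<noteq> 0 \<and> degree p \<le> n \<and> (\<forall>i<n. act p i = 0)"
  have P0: "?P p0"
  proof (intro conjI)
    show "p0 \<noteq> 0" using c(1) cp0 by (metis atMost_iff coeff_0)
    show "degree p0 \<le> n" by (rule degree_le) (simp add: cp0)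
    show "\<forall>i<n. act p0 i = 0" using c(2) by (auto simp: act_def cp0 mult.commute)
  qed
  obtain p where p: "?P p" and min: "\<And>q. ?P q \<Longrightarrow> degree p \<le> degree q"
    using ex_has_least_nat[of ?P p0 degree] P0 by blast
  have "degree p \<noteq> 0"
  proof
    assume 0: "degree p = 0"
    then have cj: "coeff p j = (if j = 0 then coeff p 0 else 0)" for j by (simp add: coeff_eq_0)
    have "act p i = coeff p 0 * w i" for i
    proof -
      have "act p i = (\<Sum>j\<le>n. if j = 0 then coeff p 0 * kr 0 i else 0)"
        unfolding act_def by (intro sum.cong refl) (subst cj, simp)
      then show ?thesis by (simp add: kr_def)
    qed
    with p w(1) have "coeff p 0 = 0" by auto
    with 0 p show False by (metis leading_coeff_0_iff)
  qed
  then have "\<not> constant (poly p)" by (simp add: constant_degree)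
  then obtain z where "poly p z = 0" using fundamental_theorem_of_algebra by blast
  \<comment> \<open>For a root \<open>z\<close> of the minimal \<open>p\<close>, the vector u = q(X)
    w is nonzero by minimality, while (X - z) u = p(X) w vanishes.\<close>
  then obtain q where q: "p = [:-z, 1:] * q" by (metis dvdE poly_eq_0_iff_dvd)
  have q0: "q \<noteq> 0" using p q by auto
  have dq: "degree p = Suc (degree q)" unfolding q using q0 by (subst degree_mult_eq) auto
  define u where "u = act q"
  have "\<exists>i<n. u i \<noteq> 0" using min[of q] q0 dq p unfolding u_def by force
  have "u i = (\<Sum>j<n. coeff q j * kr j i)" for i
    unfolding u_def act_def using dq p by (simp add: lessThan_Suc_atMost[symmetric] coeff_eq_0)
  then have u2: "u = (\<lambda>i. \<Sum>j<n. coeff q j * kr j i)" by auto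
  have act_p: "act p i = mvec n X u i - z * u i" for i
  proof -
    have "coeff p j = (case j of 0 \<Rightarrow> 0 | Suc k \<Rightarrow> coeff q k) - z * coeff q j" for j
      unfolding q by (simp add: coeff_pCons split: nat.split)
    then have "act p i = (\<Sum>j\<le>n. (case j of 0 \<Rightarrow> 0 | Suc k \<Rightarrow> coeff q k) * kr j i) - z * u i"
      unfolding act_def u_def by (simp add: left_diff_distrib sum_subtractf sum_distrib_left mult.assoc)
    also have "(\<Sum>j\<le>n. (case j of 0 \<Rightarrow> 0 | Suc k \<Rightarrow> coeff q k) * kr j i) = (\<Sum>j<n. coeff q j * kr (Suc j) i)"
      by (subst sum.atMost_shift) simp
    also have "\<dots> = mvec n X u i" unfolding u2 mvec_sum mvec_scale kr_Suc ..
    finally show ?thesis .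
  qed
  have ev: "mvec n X u i = z * u i" if "i < n" for i using act_p[of i] p that by simp
  define N where "N = nsq n u"
  have N: "N > 0" using \<open>\<exists>i<n. u i \<noteq> 0\<close> nsq_nonneg[of n u] nsq_eq_0[of n u] unfolding N_def by fastforce
  have "vip n u (mvec n X u) = z * of_real N"
    unfolding N_def vip_self[symmetric] vip_scale_right[symmetric] by (rule vip_cong) (simp_all add: ev)
  moreover have "vip n (mvec n X u) u = cnj z * of_real N"
    unfolding N_def vip_self[symmetric] vip_scale_left[symmetric] by (rule vip_cong) (simp_all add: ev)
  ultimately have "z = cnj z" using vip_mvec_herm[OF herm, of u u] N by simp
  then have z: "z = of_real (Re z)" by (metis Reals_cnj_iff of_real_Re)
  \<comment> \<open>The orthogonal complement of eigenvectors of a Hermitian matrix is invariant, so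
    it contains all Krylov vectors of \<open>w\<close>, and hence \<open>u\<close>.\<close>
  have orth_kr: "vip n (V k) (kr j) = 0" if "k < m" for j k
  proof (induction j)
    case 0 then show ?case using w(2) that by (simp add: kr_def)
  next
    case (Suc j)
    have "vip n (V k) (kr (Suc j)) = vip n (mvec n X (V k)) (kr j)"
      unfolding kr_Suc by (rule vip_mvec_herm[OF herm])
    also have "\<dots> = vip n (\<lambda>i. of_real (d k) * V k i) (kr j)"
      using eb that by (intro vip_cong) (auto simp: eigenbasis_def)
    finally show ?case using Suc by (simp add: vip_scale_left)
  qed
  have orth: "vip n (V k) u = 0" if "k < m" for k
    unfolding u2 vip_sum_right vip_scale_right using orth_kr[OF that] by simp
  define v where "v i = of_real (1 / sqrt N) * u i" for i
  have v: "vip n v v = 1" "\<And>k. k < m \<Longrightarrow> vip n (V k) v = 0" "\<And>i. i < n \<Longrightarrow> mvec n X v i = of_real (Re z) * v i"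
  proof -
    have "vip n v v = of_real (1 / sqrt N) * (of_real (1 / sqrt N) * of_real N)"
      unfolding v_def vip_scale_left vip_scale_right unfolding vip_self N_def by (simp only: complex_cnj_complex_of_real)
    also have "\<dots> = of_real (1 / sqrt N * (1 / sqrt N * N))" by (simp only: of_real_mult)
    also have "1 / sqrt N * (1 / sqrt N * N) = 1" using N by (simp add: field_simps)
    finally show "vip n v v = 1" by simp
    show "vip n (V k) v = 0" if "k < m" for k unfolding v_def vip_scale_right orth[OF that] by simp
    show "mvec n X v i = of_real (Re z) * v i" if "i < n" for i
      unfolding v_def mvec_scale ev[OF that] z[symmetric] by (simp add: mult_ac)
  qed
  have v2: "vip n v (V k) = 0" if "k < m" for k using v(2)[OF that] vip_cnj[of n "V k" v] by simp
  have "eigenbasis n X (Suc m) (V(m := v)) (d(m := Re z))"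
    using eb v v2 unfolding eigenbasis_def by (auto simp: less_Suc_eq)
  then show ?thesis by blast
qed

theorem eigenbasis_exists:
  assumes "hermf n X"
  shows "\<exists>V d. eigenbasis n X n V d"
proof -
  have "\<exists>V d. eigenbasis n X m V d" if "m \<le> n" for m
    using that
  proof (induction m)
    case 0 then show ?case by (simp add: eigenbasis_def)
  next
    case (Suc m)
    then obtain V d where "eigenbasis n X m V d" by auto
    then show ?case using eigenbasis_extend[OF assms] Suc by auto
  qed
  then show ?thesis by blast
qed

text \<open>Orthonormal columns provide a left inverse, which for a square matrix is also a right
  inverse.\<close>

lemma eigenbasis_complete:
  assumes "eigenbasis n X n V d" "i < n" "j < n"
  shows "(\<Sum>k<n. V k i * cnj (V k j)) = (if i = j then 1 else 0)"
proof -
  define A where "A = Matrix.mat n n (\<lambda>(k, i). cnj (V k i))"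
  define B where "B = Matrix.mat n n (\<lambda>(i, k). V k i)"
  have "A * B = 1\<^sub>m n"
    using assms(1) by (intro eq_matI) (auto simp: A_def B_def scalar_prod_def eigenbasis_def vip_def atLeast0LessThan)
  then have "B * A = 1\<^sub>m n" by (rule mat_mult_left_right_inverse[rotated 2]) (auto simp: A_def B_def)
  then have "(B * A) $$ (i, j) = 1\<^sub>m n $$ (i, j)" by simp
  then show ?thesis using assms(2,3) by (simp add: A_def B_def scalar_prod_def atLeast0LessThan)
qed

lemma eigenbasis_expand:
  assumes "eigenbasis n X n V d" "i < n"
  shows "v i = (\<Sum>k<n. vip n (V k) v * V k i)"
proof -
  have "(\<Sum>k<n. vip n (V k) v * V k i) = (\<Sum>j<n. (\<Sum>k<n. V k i * cnj (V k j)) * v j)"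
    unfolding vip_def sum_distrib_right by (subst sum.swap) (simp add: mult_ac)
  also have "\<dots> = (\<Sum>j<n. if i = j then v j else 0)"
    using eigenbasis_complete[OF assms(1,2)] by (intro sum.cong) auto
  finally show ?thesis using assms(2) by simp
qed

lemma eigenbasis_parseval:
  assumes "eigenbasis n X n V d"
  shows "vip n x y = (\<Sum>k<n. cnj (vip n (V k) x) * vip n (V k) y)"
proof -
  have "vip n x y = vip n (\<lambda>i. \<Sum>k<n. vip n (V k) x * V k i) y"
    using eigenbasis_expand[OF assms, of _ x] by (intro vip_cong) auto
  then show ?thesis by (simp add: vip_sum_left vip_scale_left)
qed

lemma eigenbasis_nsq:
  assumes "eigenbasis n X n V d"
  shows "nsq n x = (\<Sum>k<n. (cmod (vip n (V k) x))\<^sup>2)"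
proof -
  have "of_real (nsq n x) = (of_real (\<Sum>k<n. (cmod (vip n (V k) x))\<^sup>2) :: complex)"
    unfolding vip_self[symmetric] eigenbasis_parseval[OF assms, of x x] of_real_sum
    by (intro sum.cong) (simp_all add: complex_norm_square mult.commute del: of_real_power)
  then show ?thesis by (simp only: of_real_eq_iff)
qed

text \<open>The weights \<open>d\<close> are free: with the eigenvalues of a matrix they reproduce
  the matrix, with the images of the eigenvalues under a function they give the functional
  calculus.\<close>

definition spectral_sum :: "nat \<Rightarrow> (nat \<Rightarrow> nat \<Rightarrow> complex) \<Rightarrow> (nat \<Rightarrow> real) \<Rightarrow> nat \<Rightarrow> nat \<Rightarrow> complex" where
  "spectral_sum n V d i j = (\<Sum>k<n. of_real (d k) * V k i * cnj (V k j))"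

lemma mvec_spectral_sum: "mvec n (spectral_sum n V d) v i = (\<Sum>k<n. of_real (d k) * vip n (V k) v * V k i)"
  unfolding mvec_def spectral_sum_def vip_def sum_distrib_left sum_distrib_right
  by (subst sum.swap) (simp add: mult_ac)

lemma hermf_spectral_sum: "hermf n (spectral_sum n V d)"
  unfolding hermf_def spectral_sum_def by (simp add: mult_ac)

lemma eigenbasis_spectral_sum:
  assumes "eigenbasis n X n V d" "i < n" "j < n"
  shows "X i j = spectral_sum n V d i j"
proof -
  have "(\<Sum>l<n. X i l * (\<Sum>k<n. V k l * cnj (V k j))) = (\<Sum>l<n. if l = j then X i j else 0)"
    by (intro sum.cong) (auto simp: eigenbasis_complete[OF assms(1) _ assms(3)])
  then have "X i j = (\<Sum>l<n. X i l * (\<Sum>k<n. V k l * cnj (V k j)))" using assms(3) by simp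
  also have "\<dots> = (\<Sum>k<n. mvec n X (V k) i * cnj (V k j))"
    unfolding mvec_def sum_distrib_left sum_distrib_right by (subst sum.swap) (simp add: mult_ac)
  also have "\<dots> = spectral_sum n V d i j"
    using assms unfolding spectral_sum_def by (intro sum.cong) (auto simp: eigenbasis_def)
  finally show ?thesis .
qed

lemma eigenbasis_fun:
  assumes "eigenbasis n X n V d"
  shows "eigenbasis n (spectral_sum n V e) n V e"
  unfolding eigenbasis_def mvec_spectral_sum
proof (intro conjI allI impI)
  fix k i assume "k < n" "i < n"
  have "(\<Sum>l<n. of_real (e l) * vip n (V l) (V k) * V l i) = (\<Sum>l<n. if l = k then of_real (e k) * V k i else 0)"
    using assms \<open>k < n\<close> by (intro sum.cong) (auto simp: eigenbasis_def)
  then show "(\<Sum>l<n. of_real (e l) * vip n (V l) (V k) * V l i) = of_real (e k) * V k i" using \<open>k < n\<close> by simp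
qed (use assms in \<open>auto simp: eigenbasis_def\<close>)

lemma mvec_eigenbasis:
  assumes "eigenbasis n X n V d" "i < n"
  shows "mvec n X v i = (\<Sum>k<n. of_real (d k) * vip n (V k) v * V k i)"
  unfolding mvec_spectral_sum[symmetric] by (rule mvec_cong) (use eigenbasis_spectral_sum[OF assms] in auto)

lemma vip_mvec_eigenbasis:
  assumes "eigenbasis n X n V d" "k < n"
  shows "vip n (V k) (mvec n X v) = of_real (d k) * vip n (V k) v"
proof -
  have "vip n (V k) (mvec n X v) = vip n (V k) (\<lambda>i. \<Sum>l<n. (of_real (d l) * vip n (V l) v) * V l i)"
    by (intro vip_cong mvec_eigenbasis[OF assms(1)]) auto
  also have "\<dots> = (\<Sum>l<n. if l = k then of_real (d k) * vip n (V k) v else 0)"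
    unfolding vip_sum_right vip_scale_right using assms by (intro sum.cong) (auto simp: eigenbasis_def)
  finally show ?thesis using assms by simp
qed

lemma eigenbasis_form:
  assumes "eigenbasis n X n V d"
  shows "Re (vip n v (mvec n X v)) = (\<Sum>k<n. d k * (cmod (vip n (V k) v))\<^sup>2)"
proof -
  have "vip n v (mvec n X v) = (\<Sum>k<n. of_real (d k * (cmod (vip n (V k) v))\<^sup>2))"
    unfolding eigenbasis_parseval[OF assms, of v]
    by (intro sum.cong refl) (simp add: vip_mvec_eigenbasis[OF assms] complex_norm_square mult_ac del: of_real_power)
  then show ?thesis by simp
qed

lemma eigenbasis_uminus:
  "eigenbasis n X m V d \<Longrightarrow> eigenbasis n (\<lambda>i j. - X i j) m V (\<lambda>k. - d k)"
  unfolding eigenbasis_def mvec_def by (simp add: sum_negf)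

text \<open>If too many \<open>d k\<close> were at least \<open>x\<close>, a dimension count would
  give a nonzero vector in the span of their \<open>V k\<close> that is orthogonal to every
  \<open>W k\<close> with \<open>e k \<ge> x - \<eta>'\<close>. At this vector the two forms differ
  by at least \<open>\<eta>'\<close> times its squared length, more than \<open>le\<close>
  allows.\<close>

lemma weyl_count:
  assumes X: "eigenbasis n X n V d" and Y: "eigenbasis n Y n W e"
    and le: "\<And>v. Re (vip n v (mvec n X v)) \<le> Re (vip n v (mvec n Y v)) + \<eta> * nsq n v"
    and \<eta>: "\<eta> < \<eta>'"
  shows "count_ge {..<n} d x \<le> count_ge {..<n} e (x - \<eta>')"
proof (rule ccontr)
  let ?J = "{k\<in>{..<n}. x \<le> d k}" and ?K = "{k\<in>{..<n}. x - \<eta>' \<le> e k}"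
  assume "\<not> ?thesis"
  then have "card ?K < card ?J" by (simp add: count_ge_def)
  then obtain c where c: "\<exists>j\<in>?J. c j \<noteq> 0" "\<forall>k\<in>?K. (\<Sum>j\<in>?J. vip n (W k) (V j) * c j) = 0"
    using underdetermined_system[of ?K ?J "\<lambda>k j. vip n (W k) (V j)"] by auto
  define v where "v i = (\<Sum>j\<in>?J. c j * V j i)" for i
  have W0: "vip n (W k) v = 0" if "k < n" "x - \<eta>' \<le> e k" for k
    unfolding v_def vip_sum_right vip_scale_right using c(2) that by (simp add: mult.commute)
  have Vk: "vip n (V k) v = (if k \<in> ?J then c k else 0)" if "k < n" for k
  proof -
    have "vip n (V k) v = (\<Sum>j\<in>?J. if j = k then c k else 0)"
      unfolding v_def vip_sum_right vip_scale_right using X that by (intro sum.cong) (auto simp: eigenbasis_def)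
    then show ?thesis by simp
  qed
  have "nsq n v \<noteq> 0"
  proof
    assume "nsq n v = 0"
    then have "\<forall>k<n. vip n (V k) v = 0" unfolding eigenbasis_nsq[OF X] by (subst (asm) sum_nonneg_eq_0_iff) auto
    moreover obtain j where "j \<in> ?J" "c j \<noteq> 0" using c(1) by blast
    ultimately show False using Vk[of j] by simp
  qed
  then have pos: "0 < nsq n v" using nsq_nonneg[of n v] by simp
  have "x * nsq n v \<le> Re (vip n v (mvec n X v))"
    unfolding eigenbasis_form[OF X] eigenbasis_nsq[OF X] sum_distrib_left
  proof (intro sum_mono)
    fix k assume "k \<in> {..<n}"
    then show "x * (cmod (vip n (V k) v))\<^sup>2 \<le> d k * (cmod (vip n (V k) v))\<^sup>2"
      using Vk[of k] by (auto intro: mult_right_mono)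
  qed
  also have "\<dots> \<le> Re (vip n v (mvec n Y v)) + \<eta> * nsq n v" by (rule le)
  also have "Re (vip n v (mvec n Y v)) \<le> (x - \<eta>') * nsq n v"
    unfolding eigenbasis_form[OF Y] eigenbasis_nsq[OF Y] sum_distrib_left
  proof (intro sum_mono)
    fix k assume "k \<in> {..<n}"
    then show "e k * (cmod (vip n (W k) v))\<^sup>2 \<le> (x - \<eta>') * (cmod (vip n (W k) v))\<^sup>2"
      using W0[of k] by (cases "x - \<eta>' \<le> e k") (auto intro: mult_right_mono)
  qed
  finally have "(\<eta>' - \<eta>) * nsq n v \<le> 0" by (simp add: algebra_simps)
  then show False using pos \<eta> by (simp add: mult_le_0_iff)
qed

lemma counts_near_eigenbasis:
  assumes X: "eigenbasis n X n V d" and Y: "eigenbasis n Y n W e"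
    and le: "\<And>v. \<bar>Re (vip n v (mvec n X v)) - Re (vip n v (mvec n Y v))\<bar> \<le> \<eta> * nsq n v"
    and \<eta>: "\<eta> < \<eta>'"
  shows "counts_near \<eta>' {..<n} d {..<n} e" "counts_near \<eta>' {..<n} (\<lambda>k. - d k) {..<n} (\<lambda>k. - e k)"
proof -
  have neg: "mvec n (\<lambda>i j. - Z i j) v = (\<lambda>i. (- 1) * mvec n Z v i)" for Z v
    unfolding mvec_def by (simp add: sum_negf)
  have a: "Re (vip n v (mvec n X v)) \<le> Re (vip n v (mvec n Y v)) + \<eta> * nsq n v"
    "Re (vip n v (mvec n Y v)) \<le> Re (vip n v (mvec n X v)) + \<eta> * nsq n v" for v
    using le[of v] by (auto simp: abs_if split: if_splits)
  have b: "Re (vip n v (mvec n (\<lambda>i j. - X i j) v)) \<le> Re (vip n v (mvec n (\<lambda>i j. - Y i j) v)) + \<eta> * nsq n v"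
    "Re (vip n v (mvec n (\<lambda>i j. - Y i j) v)) \<le> Re (vip n v (mvec n (\<lambda>i j. - X i j) v)) + \<eta> * nsq n v" for v
    unfolding neg vip_scale_right using a[of v] by auto
  show "counts_near \<eta>' {..<n} d {..<n} e"
    unfolding counts_near_def using weyl_count[OF X Y a(1) \<eta>] weyl_count[OF Y X a(2) \<eta>] by blast
  show "counts_near \<eta>' {..<n} (\<lambda>k. - d k) {..<n} (\<lambda>k. - e k)"
    unfolding counts_near_def
    using weyl_count[OF eigenbasis_uminus[OF X] eigenbasis_uminus[OF Y] b(1) \<eta>]
      weyl_count[OF eigenbasis_uminus[OF Y] eigenbasis_uminus[OF X] b(2) \<eta>] by blast
qed

lemma ftr_fpow_eigenbasis:
  assumes X: "eigenbasis n X n V d"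
  shows "ftr {..<n} (fpow {..<n} X p) = of_real (\<Sum>k<n. d k ^ Suc p)"
proof -
  let ?A = "\<lambda>i k. of_real (d k) * V k i" and ?B = "\<lambda>k j. cnj (V k j)"
  have "ftr {..<n} (fpow {..<n} X p) = ftr {..<n} (fpow {..<n} (fmul {..<n} ?A ?B) p)"
    by (rule ftr_fpow_cong) (use eigenbasis_spectral_sum[OF X] in \<open>auto simp: spectral_sum_def fmul_def\<close>)
  also have "\<dots> = ftr {..<n} (fpow {..<n} (fmul {..<n} ?B ?A) p)" by (rule ftr_fpow_fmul)
  also have "\<dots> = (\<Sum>k<n. of_real (d k) ^ Suc p)"
  proof (rule ftr_fpow_diag)
    fix k l assume "k \<in> {..<n}" "l \<in> {..<n}"
    then have "vip n (V k) (\<lambda>i. of_real (d l) * V l i) = (if k = l then of_real (d k) else 0)"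
      unfolding vip_scale_right using X by (auto simp: eigenbasis_def)
    then show "fmul {..<n} ?B ?A k l = (if k = l then of_real (d k) else 0)" by (simp add: vip_def fmul_def)
  qed simp
  finally show ?thesis by simp
qed

section \<open>Algebraic multiplicities of eigenvalues\<close>

lemma order_prod_linear:
  "Polynomial.order x (\<Prod>i<(n::nat). [:- c i, 1:]) = card {i\<in>{..<n}. c i = (x :: 'a::field)}"
proof (induction n)
  case (Suc n)
  have o: "Polynomial.order x [:- c n, 1:] = (if c n = x then 1 else 0)"
    using order_power_n_n[of x 1] by (auto intro: order_0I)
  have "{i\<in>{..<Suc n}. c i = x} = (if c n = x then insert n {i\<in>{..<n}. c i = x} else {i\<in>{..<n}. c i = x})"
    by (auto simp: less_Suc_eq)
  then have card: "card {i\<in>{..<Suc n}. c i = x} = card {i\<in>{..<n}. c i = x} + (if c n = x then 1 else 0)"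
    by simp
  have nz: "(\<Prod>i<n. [:- c i, 1:]) \<noteq> 0" by (subst prod_zero_iff) auto
  have "(\<Prod>i<Suc n. [:- c i, 1:]) = (\<Prod>i<n. [:- c i, 1:]) * [:- c n, 1:]" by simp
  moreover have "Polynomial.order x \<dots> = Polynomial.order x (\<Prod>i<n. [:- c i, 1:]) + Polynomial.order x [:- c n, 1:]"
    by (rule order_mult) (use nz in \<open>metis mult_eq_0_iff one_neq_zero pCons_eq_0_iff\<close>)
  ultimately show ?case using Suc card o by simp
qed simp

text \<open>The characteristic polynomial is that of the diagonal matrix of the \<open>d i\<close>,
  so the order of a root counts equal entries.\<close>

lemma EV_mat_enumerates:
  assumes X: "X \<in> carrier_mat n n" and eb: "eigenbasis n (ent X) n V d"
  shows "enumerates (EV_mat X) {..<n} d"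
proof -
  define P where "P = Matrix.mat n n (\<lambda>(i, k). V k i)"
  define Q where "Q = Matrix.mat n n (\<lambda>(k, i). cnj (V k i))"
  define D where "D = Matrix.mat n n (\<lambda>(k, l). if k = l then complex_of_real (d k) else 0)"
  have QP: "Q * P = 1\<^sub>m n"
    using eb by (intro eq_matI) (auto simp: P_def Q_def scalar_prod_def eigenbasis_def vip_def atLeast0LessThan)
  have PQ: "P * Q = 1\<^sub>m n" by (rule mat_mult_left_right_inverse[OF _ _ QP]) (auto simp: P_def Q_def)
  have PD: "P * D = Matrix.mat n n (\<lambda>(i, k). V k i * of_real (d k))"
    by (intro eq_matI) (auto simp: P_def D_def scalar_prod_def atLeast0LessThan if_distrib cong: if_cong)
  have "X = P * D * Q"
  proof (rule eq_matI)
    fix i j assume ij: "i < dim_row (P * D * Q)" "j < dim_col (P * D * Q)"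
    then have ij: "i < n" "j < n" by (auto simp: P_def Q_def)
    then have "(P * D * Q) $$ (i, j) = spectral_sum n V d i j"
      unfolding PD by (simp add: Q_def scalar_prod_def atLeast0LessThan spectral_sum_def mult_ac)
    then show "X $$ (i, j) = (P * D * Q) $$ (i, j)" using eigenbasis_spectral_sum[OF eb ij] by (simp add: ent_def)
  qed (use X in \<open>auto simp: P_def Q_def\<close>)
  then have "similar_mat X D" by (intro similar_matI[of _ _ P Q n] PQ QP) (use X in \<open>auto simp: P_def Q_def D_def\<close>)
  then have "char_poly X = char_poly D" by (rule char_poly_similar)
  also have "\<dots> = (\<Prod>a\<leftarrow>diag_mat D. [:- a, 1:])"
    by (rule char_poly_upper_triangular[of _ n]) (auto simp: D_def)
  also have "diag_mat D = map (\<lambda>k. complex_of_real (d k)) [0..<n]" by (auto simp: diag_mat_def D_def)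
  also have "(\<Prod>a\<leftarrow>map (\<lambda>k. complex_of_real (d k)) [0..<n]. [:- a, 1:]) = (\<Prod>k<n. [:- complex_of_real (d k), 1:])"
    by (simp add: comp_def prod.distinct_set_conv_list[symmetric] atLeast0LessThan)
  finally have "char_poly X = (\<Prod>k<n. [:- complex_of_real (d k), 1:])" .
  then have "EV_mat X x = enat (card {i\<in>{..<n}. d i = x})" for x
    unfolding EV_mat_def by (simp only: order_prod_linear of_real_eq_iff)
  then show ?thesis unfolding enumerates_def by simp
qed

section \<open>Fourth moments of sign polynomials\<close>

text \<open>Sign vectors are indexed by the set of their negative positions; an expectation over
  independent signs becomes a sum over a power set, up to the factor \<open>2 ^ n\<close>.\<close>

definition sgnv :: "nat set \<Rightarrow> nat \<Rightarrow> real" where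
  "sgnv A j = (if j \<in> A then - 1 else 1)"

lemma sum_Pow_lessThan_Suc:
  "(\<Sum>A\<in>Pow {..<Suc n}. F A) = (\<Sum>A\<in>Pow {..<n}. F A + F (insert n A))"
proof -
  have "(\<Sum>A\<in>Pow {..<Suc n}. F A) = (\<Sum>A\<in>Pow {..<n} \<union> insert n ` Pow {..<n}. F A)"
    by (simp only: lessThan_Suc Pow_insert)
  also have "\<dots> = (\<Sum>A\<in>Pow {..<n}. F A) + (\<Sum>A\<in>insert n ` Pow {..<n}. F A)"
    by (rule sum.union_disjoint) auto
  also have "(\<Sum>A\<in>insert n ` Pow {..<n}. F A) = (\<Sum>A\<in>Pow {..<n}. F (insert n A))"
  proof (rule sum.reindex[unfolded comp_def])
    have "n \<notin> A" if "A \<in> Pow {..<n}" for A using that by auto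
    then show "inj_on (insert n) (Pow {..<n})" by (meson inj_onI insert_ident)
  qed
  finally show ?thesis by (simp add: sum.distrib)
qed

definition lin_form :: "nat \<Rightarrow> (nat \<Rightarrow> real) \<Rightarrow> nat set \<Rightarrow> real" where
  "lin_form n c A = (\<Sum>j<n. c j * sgnv A j)"

text \<open>Each pair of indices enters once, at its larger index, so that raising \<open>n\<close>
  adds the new sign times a linear form in the earlier signs. The induction for the moments rests on
  this.\<close>

definition quad_form :: "nat \<Rightarrow> (nat \<Rightarrow> nat \<Rightarrow> real) \<Rightarrow> nat set \<Rightarrow> real" where
  "quad_form n h A = (\<Sum>k<n. sgnv A k * lin_form k (\<lambda>j. h j k) A)"

lemma lin_form_insert: "n \<le> m \<Longrightarrow> lin_form n c (insert m A) = lin_form n c A"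
  unfolding lin_form_def by (intro sum.cong) (auto simp: sgnv_def)

lemma quad_form_insert: "n \<le> m \<Longrightarrow> quad_form n c (insert m A) = quad_form n c A"
  unfolding quad_form_def by (intro sum.cong) (auto simp: sgnv_def lin_form_insert)

text \<open>Averaging over the last sign removes odd powers: (L + c)^4 + (L - c)^4 = 2 L^4 + 12 c^2
  L^2 + 2 c^4. The constant 3 is the fourth moment constant of Khintchine's inequality.\<close>

lemma lin_form_moments:
  "(\<Sum>A\<in>Pow {..<n}. (lin_form n c A)\<^sup>2) = 2 ^ n * (\<Sum>j<n. (c j)\<^sup>2)"
  "(\<Sum>A\<in>Pow {..<n}. lin_form n c A ^ 4) \<le> 2 ^ n * (3 * (\<Sum>j<n. (c j)\<^sup>2)\<^sup>2)"
proof (induction n)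
  case 0
  { case 1 then show ?case by (simp add: lin_form_def) }
  { case 2 then show ?case by (simp add: lin_form_def) }
next
  case (Suc n)
  have l: "lin_form (Suc n) c A = lin_form n c A + c n" "lin_form (Suc n) c (insert n A) = lin_form n c A - c n"
    if "A \<in> Pow {..<n}" for A
  proof -
    have "n \<notin> A" using that by auto
    then show "lin_form (Suc n) c A = lin_form n c A + c n" by (simp add: lin_form_def sgnv_def)
    have "lin_form (Suc n) c (insert n A) = lin_form n c (insert n A) - c n"
      by (simp add: lin_form_def sgnv_def)
    then show "lin_form (Suc n) c (insert n A) = lin_form n c A - c n" by (simp add: lin_form_insert)
  qed
  let ?S = "\<Sum>j<n. (c j)\<^sup>2"
  have card: "(\<Sum>A\<in>Pow {..<n}. r) = 2 ^ n * r" for r :: real by (simp add: card_Pow)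
  { case 1
    have "(\<Sum>A\<in>Pow {..<Suc n}. (lin_form (Suc n) c A)\<^sup>2) = (\<Sum>A\<in>Pow {..<n}. 2 * (lin_form n c A)\<^sup>2 + 2 * (c n)\<^sup>2)"
      unfolding sum_Pow_lessThan_Suc by (intro sum.cong refl) (simp add: l, simp add: power2_eq_square algebra_simps)
    also have "\<dots> = 2 ^ Suc n * (?S + (c n)\<^sup>2)"
      unfolding sum.distrib card sum_distrib_left[symmetric] Suc by (simp add: algebra_simps)
    finally show ?case by simp }
  { case 2
    have "(\<Sum>A\<in>Pow {..<Suc n}. lin_form (Suc n) c A ^ 4) =
        (\<Sum>A\<in>Pow {..<n}. 2 * lin_form n c A ^ 4 + 12 * (c n)\<^sup>2 * (lin_form n c A)\<^sup>2 + 2 * c n ^ 4)"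
      unfolding sum_Pow_lessThan_Suc
      by (intro sum.cong refl) (simp add: l, simp add: power2_eq_square power4_eq_xxxx algebra_simps)
    also have "\<dots> = 2 * (\<Sum>A\<in>Pow {..<n}. lin_form n c A ^ 4) + 12 * (c n)\<^sup>2 * (2 ^ n * ?S) + 2 ^ n * (2 * c n ^ 4)"
      unfolding sum.distrib sum_distrib_left[symmetric] card Suc(1) by simp
    also have "\<dots> \<le> 2 * (2 ^ n * (3 * ?S\<^sup>2)) + 12 * (c n)\<^sup>2 * (2 ^ n * ?S) + 2 ^ n * (2 * c n ^ 4)"
      using Suc(2) by simp
    also have "\<dots> = 2 ^ Suc n * (3 * ?S\<^sup>2 + 6 * (c n)\<^sup>2 * ?S + c n ^ 4)" by (simp add: algebra_simps)
    also have "\<dots> \<le> 2 ^ Suc n * (3 * (?S + (c n)\<^sup>2)\<^sup>2)"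
    proof (intro mult_left_mono)
      have "3 * (?S + (c n)\<^sup>2)\<^sup>2 = 3 * ?S\<^sup>2 + 6 * (c n)\<^sup>2 * ?S + 3 * c n ^ 4" by (simp add: power2_sum)
      then show "3 * ?S\<^sup>2 + 6 * (c n)\<^sup>2 * ?S + c n ^ 4 \<le> 3 * (?S + (c n)\<^sup>2)\<^sup>2" by simp
    qed auto
    finally show ?case by simp }
qed

text \<open>The same recursion, with a linear form in place of the coefficient of the last sign. The
  constant 81 = 3^4 is the one that hypercontractivity gives in degree 2; it leaves room for the
  mixed term.\<close>

lemma quad_form_moments:
  "(\<Sum>A\<in>Pow {..<n}. (quad_form n h A)\<^sup>2) = 2 ^ n * (\<Sum>k<n. \<Sum>j<k. (h j k)\<^sup>2)"
  "(\<Sum>A\<in>Pow {..<n}. quad_form n h A ^ 4) \<le> 2 ^ n * (81 * (\<Sum>k<n. \<Sum>j<k. (h j k)\<^sup>2)\<^sup>2)"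
proof (induction n)
  case 0
  { case 1 then show ?case by (simp add: quad_form_def) }
  { case 2 then show ?case by (simp add: quad_form_def) }
next
  case (Suc n)
  let ?q = "\<lambda>A. quad_form n h A" and ?l = "\<lambda>A. lin_form n (\<lambda>j. h j n) A"
  have l: "quad_form (Suc n) h A = ?q A + ?l A" "quad_form (Suc n) h (insert n A) = ?q A - ?l A"
    if "A \<in> Pow {..<n}" for A
  proof -
    have "n \<notin> A" using that by auto
    then show "quad_form (Suc n) h A = ?q A + ?l A" by (simp add: quad_form_def sgnv_def)
    have "quad_form (Suc n) h (insert n A) = quad_form n h (insert n A) - lin_form n (\<lambda>j. h j n) (insert n A)"
      by (simp add: quad_form_def sgnv_def)
    then show "quad_form (Suc n) h (insert n A) = ?q A - ?l A" by (simp add: lin_form_insert quad_form_insert)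
  qed
  let ?G = "\<Sum>k<n. \<Sum>j<k. (h j k)\<^sup>2" and ?S = "\<Sum>j<n. (h j n)\<^sup>2"
  have GS: "0 \<le> ?G" "0 \<le> ?S" by (simp_all add: sum_nonneg)
  note lm = lin_form_moments[of n "\<lambda>j. h j n"]
  { case 1
    have "(\<Sum>A\<in>Pow {..<Suc n}. (quad_form (Suc n) h A)\<^sup>2) = (\<Sum>A\<in>Pow {..<n}. 2 * (?q A)\<^sup>2 + 2 * (?l A)\<^sup>2)"
      unfolding sum_Pow_lessThan_Suc by (intro sum.cong refl) (simp add: l, simp add: power2_eq_square algebra_simps)
    also have "\<dots> = 2 ^ Suc n * (?G + ?S)"
      unfolding sum.distrib sum_distrib_left[symmetric] Suc lm by (simp add: algebra_simps)
    finally show ?case by simp }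
  { case 2
    \<comment> \<open>The mixed term by the Cauchy-Schwarz inequality: the square root of 81 * 3 =
      243 is less than 16, and 12 * 16 / 2 = 96 is below 2 * 81.\<close>
    have "(\<Sum>A\<in>Pow {..<n}. (?q A)\<^sup>2 * (?l A)\<^sup>2)\<^sup>2 \<le> (\<Sum>A\<in>Pow {..<n}. ((?q A)\<^sup>2)\<^sup>2) * (\<Sum>A\<in>Pow {..<n}. ((?l A)\<^sup>2)\<^sup>2)"
      by (rule Cauchy_Schwarz_ineq_sum)
    also have "\<dots> = (\<Sum>A\<in>Pow {..<n}. ?q A ^ 4) * (\<Sum>A\<in>Pow {..<n}. ?l A ^ 4)" by simp
    also have "\<dots> \<le> (2 ^ n * (81 * ?G\<^sup>2)) * (2 ^ n * (3 * ?S\<^sup>2))"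
      by (intro mult_mono Suc(2) lm(2) sum_nonneg) auto
    also have "\<dots> = 243 * (2 ^ n * ?G * ?S)\<^sup>2" by (simp add: power2_eq_square)
    also have "\<dots> \<le> (16 * (2 ^ n * ?G * ?S))\<^sup>2" by (simp add: power_mult_distrib)
    finally have cs: "(\<Sum>A\<in>Pow {..<n}. (?q A)\<^sup>2 * (?l A)\<^sup>2) \<le> 16 * (2 ^ n * ?G * ?S)"
      by (rule power2_le_imp_le) (use GS in simp)
    have "(\<Sum>A\<in>Pow {..<Suc n}. quad_form (Suc n) h A ^ 4) =
        (\<Sum>A\<in>Pow {..<n}. 2 * ?q A ^ 4 + 12 * ((?q A)\<^sup>2 * (?l A)\<^sup>2) + 2 * ?l A ^ 4)"
      unfolding sum_Pow_lessThan_Suc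
      by (intro sum.cong refl) (simp add: l, simp add: power2_eq_square power4_eq_xxxx algebra_simps)
    also have "\<dots> = 2 * (\<Sum>A\<in>Pow {..<n}. ?q A ^ 4) + 12 * (\<Sum>A\<in>Pow {..<n}. (?q A)\<^sup>2 * (?l A)\<^sup>2) + 2 * (\<Sum>A\<in>Pow {..<n}. ?l A ^ 4)"
      unfolding sum.distrib sum_distrib_left[symmetric] ..
    also have "\<dots> \<le> 2 * (2 ^ n * (81 * ?G\<^sup>2)) + 12 * (16 * (2 ^ n * ?G * ?S)) + 2 * (2 ^ n * (3 * ?S\<^sup>2))"
      by (intro add_mono mult_left_mono Suc(2) cs lm(2)) auto
    also have "\<dots> = 2 ^ Suc n * (81 * ?G\<^sup>2 + 96 * (?G * ?S) + 3 * ?S\<^sup>2)" by (simp add: algebra_simps)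
    also have "\<dots> \<le> 2 ^ Suc n * (81 * (?G + ?S)\<^sup>2)"
    proof (intro mult_left_mono)
      have "0 \<le> 78 * ?S\<^sup>2 + 66 * (?S * ?G)" using GS by (intro add_nonneg_nonneg mult_nonneg_nonneg) auto
      then show "81 * ?G\<^sup>2 + 96 * (?G * ?S) + 3 * ?S\<^sup>2 \<le> 81 * (?G + ?S)\<^sup>2" by (simp add: power2_sum)
    qed auto
    finally show ?case by simp }
qed

lemma double_sum_split:
  fixes f :: "nat \<Rightarrow> nat \<Rightarrow> 'a::comm_monoid_add"
  shows "(\<Sum>j<n. \<Sum>k<n. f j k) = (\<Sum>j<n. f j j) + (\<Sum>k<n. \<Sum>j<k. f j k + f k j)"
  by (induction n) (simp_all add: sum.distrib ac_simps)

text \<open>Squared signs are 1, so the diagonal contributes the trace, which vanishes, and the rest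
  is a quadratic form in the symmetrized coefficients. Symmetrizing costs a factor 2 in the sum of
  squares, hence 324 = 4 * 81.\<close>

lemma sign_form_fourth_moment:
  fixes g :: "nat \<Rightarrow> nat \<Rightarrow> real"
  assumes "(\<Sum>j<n. g j j) = 0"
  shows "(\<Sum>A\<in>Pow {..<n}. (\<Sum>j<n. \<Sum>k<n. sgnv A j * sgnv A k * g j k) ^ 4) \<le> 2 ^ n * (324 * (\<Sum>j<n. \<Sum>k<n. (g j k)\<^sup>2)\<^sup>2)"
proof -
  let ?h = "\<lambda>j k. g j k + g k j"
  have sq: "sgnv A j * sgnv A j = 1" for A j by (simp add: sgnv_def)
  have q: "(\<Sum>j<n. \<Sum>k<n. sgnv A j * sgnv A k * g j k) = quad_form n ?h A" for A
    unfolding double_sum_split quad_form_def lin_form_def sum_distrib_left sq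
    using assms by (simp add: algebra_simps)
  have "(\<Sum>k<n. \<Sum>j<k. (?h j k)\<^sup>2) \<le> (\<Sum>k<n. \<Sum>j<k. 2 * ((g j k)\<^sup>2 + (g k j)\<^sup>2))"
    by (intro sum_mono) (simp add: power2_sum, smt (verit) sum_squares_bound)
  also have "\<dots> = 2 * (\<Sum>k<n. \<Sum>j<k. (g j k)\<^sup>2 + (g k j)\<^sup>2)" by (simp add: sum_distrib_left)
  also have "\<dots> \<le> 2 * (\<Sum>j<n. \<Sum>k<n. (g j k)\<^sup>2)" unfolding double_sum_split by (simp add: sum_nonneg)
  finally have le: "(\<Sum>k<n. \<Sum>j<k. (?h j k)\<^sup>2) \<le> 2 * (\<Sum>j<n. \<Sum>k<n. (g j k)\<^sup>2)" .
  have "(\<Sum>k<n. \<Sum>j<k. (?h j k)\<^sup>2)\<^sup>2 \<le> (2 * (\<Sum>j<n. \<Sum>k<n. (g j k)\<^sup>2))\<^sup>2"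
    by (rule power_mono[OF le]) (simp add: sum_nonneg)
  then have "2 ^ n * (81 * (\<Sum>k<n. \<Sum>j<k. (?h j k)\<^sup>2)\<^sup>2) \<le> 2 ^ n * (324 * (\<Sum>j<n. \<Sum>k<n. (g j k)\<^sup>2)\<^sup>2)"
    by (simp add: power_mult_distrib)
  with quad_form_moments(2)[of n ?h] show ?thesis unfolding q by (rule order_trans)
qed

text \<open>Real and imaginary parts are estimated separately; the factor 2 in 648 = 2 * 324 comes
  from squaring a sum of two squares.\<close>

lemma sign_vector_fourth_moment:
  fixes Y :: "nat \<Rightarrow> nat \<Rightarrow> complex"
  assumes "(\<Sum>j<n. Y j j) = 0"
  shows "(\<Sum>A\<in>Pow {..<n}. cmod (vip n (\<lambda>j. of_real (sgnv A j)) (mvec n Y (\<lambda>j. of_real (sgnv A j)))) ^ 4)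
    \<le> 2 ^ n * (648 * (\<Sum>j<n. \<Sum>k<n. (cmod (Y j k))\<^sup>2)\<^sup>2)"
proof -
  let ?R = "\<lambda>A. \<Sum>j<n. \<Sum>k<n. sgnv A j * sgnv A k * Re (Y j k)"
  let ?I = "\<lambda>A. \<Sum>j<n. \<Sum>k<n. sgnv A j * sgnv A k * Im (Y j k)"
  let ?H = "\<Sum>j<n. \<Sum>k<n. (cmod (Y j k))\<^sup>2"
  have v: "cmod (vip n (\<lambda>j. of_real (sgnv A j)) (mvec n Y (\<lambda>j. of_real (sgnv A j)))) ^ 4 = ((?R A)\<^sup>2 + (?I A)\<^sup>2)\<^sup>2" for A
  proof -
    let ?v = "vip n (\<lambda>j. of_real (sgnv A j)) (mvec n Y (\<lambda>j. of_real (sgnv A j)))"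
    have "Re ?v = ?R A" "Im ?v = ?I A"
      unfolding vip_def mvec_def by (simp_all add: sum_distrib_left mult_ac)
    moreover have "cmod ?v ^ 4 = ((Re ?v)\<^sup>2 + (Im ?v)\<^sup>2)\<^sup>2"
      unfolding cmod_power2[symmetric] by simp
    ultimately show ?thesis by simp
  qed
  have "(\<Sum>j<n. Re (Y j j)) = 0" "(\<Sum>j<n. Im (Y j j)) = 0" using assms by (metis Re_sum Im_sum zero_complex.sel)+
  note m = sign_form_fourth_moment[of "\<lambda>j k. Re (Y j k)", OF this(1)] sign_form_fourth_moment[of "\<lambda>j k. Im (Y j k)", OF this(2)]
  have "(\<Sum>A\<in>Pow {..<n}. ((?R A)\<^sup>2 + (?I A)\<^sup>2)\<^sup>2) \<le> (\<Sum>A\<in>Pow {..<n}. 2 * ?R A ^ 4 + 2 * ?I A ^ 4)"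
  proof (intro sum_mono)
    fix A
    have "0 \<le> ((?R A)\<^sup>2 - (?I A)\<^sup>2)\<^sup>2" by simp
    then show "((?R A)\<^sup>2 + (?I A)\<^sup>2)\<^sup>2 \<le> 2 * ?R A ^ 4 + 2 * ?I A ^ 4" by (simp add: power2_sum power2_diff)
  qed
  also have "\<dots> \<le> 2 * (2 ^ n * (324 * (\<Sum>j<n. \<Sum>k<n. (Re (Y j k))\<^sup>2)\<^sup>2)) + 2 * (2 ^ n * (324 * (\<Sum>j<n. \<Sum>k<n. (Im (Y j k))\<^sup>2)\<^sup>2))"
    unfolding sum.distrib sum_distrib_left[symmetric] by (intro add_mono mult_left_mono m) auto
  also have "\<dots> = 2 ^ n * (648 * ((\<Sum>j<n. \<Sum>k<n. (Re (Y j k))\<^sup>2)\<^sup>2 + (\<Sum>j<n. \<Sum>k<n. (Im (Y j k))\<^sup>2)\<^sup>2))"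
    by (simp add: algebra_simps)
  also have "\<dots> \<le> 2 ^ n * (648 * ?H\<^sup>2)"
  proof (intro mult_left_mono)
    have "?H = (\<Sum>j<n. \<Sum>k<n. (Re (Y j k))\<^sup>2) + (\<Sum>j<n. \<Sum>k<n. (Im (Y j k))\<^sup>2)"
      by (simp add: cmod_power2 sum.distrib)
    moreover have "0 \<le> (\<Sum>j<n. \<Sum>k<n. (Re (Y j k))\<^sup>2)" "0 \<le> (\<Sum>j<n. \<Sum>k<n. (Im (Y j k))\<^sup>2)" by (simp_all add: sum_nonneg)
    ultimately show "(\<Sum>j<n. \<Sum>k<n. (Re (Y j k))\<^sup>2)\<^sup>2 + (\<Sum>j<n. \<Sum>k<n. (Im (Y j k))\<^sup>2)\<^sup>2 \<le> ?H\<^sup>2"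
      by (simp add: power2_sum)
  qed auto
  finally show ?thesis unfolding v .
qed

section \<open>Unitary matrices\<close>

lemma mat_adjoint_carrier: "X \<in> carrier_mat m n \<Longrightarrow> mat_adjoint X \<in> carrier_mat n m"
  unfolding mat_adjoint_def by auto

lemma mat_adjoint_index:
  fixes X :: "complex mat"
  assumes "X \<in> carrier_mat m n" "i < n" "j < m" shows "mat_adjoint X $$ (i, j) = cnj (X $$ (j, i))"
  using assms unfolding mat_adjoint_def by (simp add: mat_of_rows_def conjugate_vec_def)

lemma mat_times_index:
  assumes "X \<in> carrier_mat m n" "Y \<in> carrier_mat n p" "i < m" "j < p"
  shows "(X * Y) $$ (i, j) = (\<Sum>k<n. X $$ (i, k) * Y $$ (k, j))"
  using assms by (simp add: scalar_prod_def atLeast0LessThan)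

lemma mat_adjoint_mult:
  fixes X Y :: "complex mat"
  assumes X: "X \<in> carrier_mat m n" and Y: "Y \<in> carrier_mat n p"
  shows "mat_adjoint (X * Y) = mat_adjoint Y * mat_adjoint X"
proof (rule eq_matI)
  note c = mat_adjoint_carrier[OF X] mat_adjoint_carrier[OF Y] mat_adjoint_carrier[OF mult_carrier_mat[OF X Y]]
  fix i j assume "i < dim_row (mat_adjoint Y * mat_adjoint X)" "j < dim_col (mat_adjoint Y * mat_adjoint X)"
  then have ij: "i < p" "j < m" using c by auto
  then show "mat_adjoint (X * Y) $$ (i, j) = (mat_adjoint Y * mat_adjoint X) $$ (i, j)"
    unfolding mat_adjoint_index[OF mult_carrier_mat[OF X Y] ij] mat_times_index[OF X Y ij(2,1)]
      mat_times_index[OF c(2,1) ij] using X Y by (simp add: mat_adjoint_index mult.commute)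
qed (use mat_adjoint_carrier[OF X] mat_adjoint_carrier[OF Y] mat_adjoint_carrier[OF mult_carrier_mat[OF X Y]] in auto)

lemma mat_adjoint_adjoint:
  fixes X :: "complex mat" assumes X: "X \<in> carrier_mat m n" shows "mat_adjoint (mat_adjoint X) = X"
  using X mat_adjoint_carrier[OF X] mat_adjoint_carrier[OF mat_adjoint_carrier[OF X]]
  by (intro eq_matI) (auto simp: mat_adjoint_index[of _ n m] mat_adjoint_index[of _ m n])

lemma unitary_group_mult:
  assumes "V \<in> unitary_group n" "W \<in> unitary_group n" shows "V * W \<in> unitary_group n"
proof -
  have c: "V \<in> carrier_mat n n" "W \<in> carrier_mat n n" using assms by (auto simp: unitary_group_def)
  note a = mat_adjoint_carrier[OF c(1)] mat_adjoint_carrier[OF c(2)]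
  have "V * W * (mat_adjoint W * mat_adjoint V) = V * (W * mat_adjoint W) * mat_adjoint V"
    using c a by (simp add: assoc_mult_mat[of _ n n _ n _ n])
  also have "\<dots> = 1\<^sub>m n" using assms c a by (simp add: unitary_group_def)
  finally have 1: "V * W * mat_adjoint (V * W) = 1\<^sub>m n" using mat_adjoint_mult[OF c] by simp
  have "mat_adjoint W * mat_adjoint V * (V * W) = mat_adjoint W * (mat_adjoint V * V) * W"
    using c a by (simp add: assoc_mult_mat[of _ n n _ n _ n])
  also have "\<dots> = 1\<^sub>m n" using assms c a by (simp add: unitary_group_def)
  finally show ?thesis using 1 c mat_adjoint_mult[OF c] by (simp add: unitary_group_def)
qed

lemma ent_mult:
  assumes "X \<in> carrier_mat n n" "Y \<in> carrier_mat n n" "i < n" "j < n"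
  shows "ent (X * Y) i j = fmul {..<n} (ent X) (ent Y) i j"
  unfolding ent_def fmul_def by (rule mat_times_index[OF assms])

lemma mvec_ent_mult:
  assumes "X \<in> carrier_mat n n" "Y \<in> carrier_mat n n" "i < n"
  shows "mvec n (ent (X * Y)) v i = mvec n (ent X) (mvec n (ent Y) v) i"
  unfolding mvec_fmul[symmetric] by (intro mvec_cong refl ent_mult[OF assms])

lemma vip_mat_adjoint:
  assumes "X \<in> carrier_mat n n"
  shows "vip n x (mvec n (ent X) y) = vip n (mvec n (ent (mat_adjoint X)) x) y"
  unfolding vip_mvec_adj
  by (intro vip_cong mvec_cong refl) (use assms in \<open>simp add: ent_def mat_adjoint_index\<close>)

lemma vip_mat_adjoint':
  assumes "X \<in> carrier_mat n n"
  shows "vip n x (mvec n (ent (mat_adjoint X)) y) = vip n (mvec n (ent X) x) y"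
  using vip_mat_adjoint[OF mat_adjoint_carrier[OF assms]] mat_adjoint_adjoint[OF assms] by simp

text \<open>A reflection exchanges two vectors of equal length, once a phase makes their inner product
  real.\<close>

lemma unitary_transitive:
  assumes "nsq n x = nsq n y"
  shows "\<exists>V c. V \<in> unitary_group n \<and> cmod c = 1 \<and> (\<forall>i<n. mvec n (ent (mat_adjoint V)) x i = c * y i)"
proof -
  \<comment> \<open>The phase that makes the inner product real and nonnegative; any phase serves if
    it is 0.\<close>
  define c where "c = (if vip n x y = 0 then 1 else cnj (vip n x y) / of_real (cmod (vip n x y)))"
  have c1: "cmod c = 1" by (simp add: c_def norm_divide)
  have cr: "c * vip n x y = of_real (cmod (vip n x y))"
    by (auto simp: c_def complex_norm_square power2_eq_square mult.commute field_simps)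
      (metis complex_norm_square mult.commute power2_eq_square of_real_mult)
  define y' where "y' i = c * y i" for i
  have xy: "vip n x y' = of_real (cmod (vip n x y))" unfolding y'_def vip_scale_right cr ..
  have yx: "vip n y' x = of_real (cmod (vip n x y))" using vip_cnj[of n x y'] xy by simp
  have ny: "nsq n y' = nsq n x" unfolding y'_def nsq_scale using assms c1 by simp
  define v where "v i = x i - y' i" for i
  define N where "N = nsq n v"
  have N: "N = 2 * (nsq n x - cmod (vip n x y))"
  proof -
    have "of_real N = vip n v v" by (simp add: N_def vip_self)
    also have "\<dots> = of_real (2 * (nsq n x - cmod (vip n x y)))"
      unfolding v_def vip_diff_left vip_diff_right xy yx unfolding vip_self ny by simp
    finally show ?thesis by (simp only: of_real_eq_iff)
  qed
  have vx: "vip n v x = of_real (N / 2)" unfolding v_def vip_diff_left yx unfolding vip_self N by simp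
  \<comment> \<open>The factor of the Householder reflection in the direction of \<open>v\<close>.
    If \<open>N = 0\<close>, division by 0 gives \<open>t = 0\<close> and the reflection is the
    identity.\<close>
  define t :: complex where "t = of_real (2 / N)"
  define R where "R i j = (if i = j then 1 else 0) - t * v i * cnj (v j)" for i j
  define V where "V = Matrix.mat n n (\<lambda>(i, j). R i j)"
  have tN: "t * (of_real N * z) = (if N = 0 then 0 else 2 * z)" for z by (simp add: t_def)
  have Rv: "mvec n R w i = w i - t * vip n v w * v i" if "i < n" for w i
  proof -
    have "R i j * w j = (if i = j then w j else 0) - t * v i * (cnj (v j) * w j)" for j
      by (simp add: R_def algebra_simps)
    then have "mvec n R w i = (\<Sum>j<n. (if i = j then w j else 0)) - t * v i * vip n v w"
      unfolding mvec_def vip_def by (simp only: sum_subtractf sum_distrib_left)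
    then show ?thesis using that by (simp add: mult_ac)
  qed
  have V: "V \<in> carrier_mat n n" by (simp add: V_def)
  have cR: "cnj (R j i) = R i j" for i j by (auto simp: R_def t_def)
  have adj: "mat_adjoint V = V"
    using mat_adjoint_carrier[OF V] V by (intro eq_matI) (auto simp: mat_adjoint_index[OF V], simp add: V_def cR)
  have "V * V = 1\<^sub>m n"
  proof (rule eq_matI)
    fix i j assume "i < dim_row (1\<^sub>m n :: complex mat)" "j < dim_col (1\<^sub>m n :: complex mat)"
    then have ij: "i < n" "j < n" by auto
    have "(V * V) $$ (i, j) = mvec n R (\<lambda>k. R k j) i"
      unfolding mat_times_index[OF V V ij] mvec_def using ij by (simp add: V_def)
    also have "\<dots> = R i j - t * vip n v (\<lambda>k. R k j) * v i" by (rule Rv[OF ij(1)])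
    also have "vip n v (\<lambda>k. R k j) = (\<Sum>k<n. if k = j then cnj (v k) else 0) - t * cnj (v j) * vip n v v"
    proof -
      have "cnj (v k) * R k j = (if k = j then cnj (v k) else 0) - t * cnj (v j) * (cnj (v k) * v k)" for k
        by (simp add: R_def algebra_simps)
      then show ?thesis unfolding vip_def by (simp only: sum_subtractf sum_distrib_left)
    qed
    also have "\<dots> = cnj (v j) - t * (of_real N * cnj (v j))" using ij by (simp add: vip_self N_def mult_ac)
    finally have *: "(V * V) $$ (i, j) = R i j - t * (cnj (v j) - t * (of_real N * cnj (v j))) * v i" .
    show "(V * V) $$ (i, j) = 1\<^sub>m n $$ (i, j)"
    proof (cases "N = 0")
      case True
      then have "v i = 0" using ij nsq_eq_0[of n v] by (simp add: N_def)
      then show ?thesis unfolding * using ij by (simp add: R_def)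
    next
      case False
      then show ?thesis unfolding * tN R_def using ij by (simp add: mult_ac)
    qed
  qed (simp_all add: V_def)
  then have "V \<in> unitary_group n" using V by (simp add: unitary_group_def adj)
  moreover have "mvec n (ent (mat_adjoint V)) x i = c * y i" if "i < n" for i
  proof -
    have "mvec n (ent (mat_adjoint V)) x i = mvec n R x i"
      unfolding adj by (rule mvec_cong) (use that in \<open>auto simp: ent_def V_def\<close>)
    also have "\<dots> = x i - t * vip n v x * v i" by (rule Rv[OF that])
    also have "\<dots> = c * y i"
    proof (cases "N = 0")
      case True
      then have "v i = 0" using that nsq_eq_0[of n v] by (simp add: N_def)
      then show ?thesis by (simp add: v_def y'_def)
    next
      case False
      then have "t * vip n v x = 1" by (simp add: t_def vx)
      then show ?thesis by (simp add: v_def y'_def)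
    qed
    finally show ?thesis .
  qed
  ultimately show ?thesis using c1 by blast
qed

section \<open>Haar unitary conjugation\<close>

lemma space_unitary_borel: "space (unitary_borel n) = unitary_group n"
  by (simp add: unitary_borel_def)

lemma measurable_unitary_entry:
  assumes "i < n" "j < n"
  shows "(\<lambda>W. W $$ (i, j)) \<in> borel_measurable (unitary_borel n)"
proof -
  have m: "(\<lambda>V. \<lambda>rc\<in>{..<n} \<times> {..<n}. V $$ rc) \<in> measurable (unitary_borel n) (\<Pi>\<^sub>M rc\<in>{..<n} \<times> {..<n}. borel :: complex measure)"
    unfolding unitary_borel_def by (rule measurable_vimage_algebra1) (auto simp: space_PiM)
  have "(\<lambda>f. f (i, j)) \<in> measurable (\<Pi>\<^sub>M rc\<in>{..<n} \<times> {..<n}. borel :: complex measure) borel"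
    by (rule measurable_component_singleton) (use assms in auto)
  from measurable_compose[OF m this] show ?thesis using assms by simp
qed

lemma ent_conj_by:
  assumes W: "W \<in> carrier_mat n n" and B: "B \<in> carrier_mat n n" and ij: "i < n" "j < n"
  shows "ent (conj_by W B) i j = (\<Sum>l<n. (\<Sum>k<n. W $$ (i, k) * B $$ (k, l)) * cnj (W $$ (j, l)))"
  unfolding ent_def conj_by_def mat_times_index[OF mult_carrier_mat[OF W B] mat_adjoint_carrier[OF W] ij]
  using ij by (intro sum.cong refl) (simp add: mat_times_index[OF W B] mat_adjoint_index[OF W] del: index_mult_mat)

lemma measurable_conj_form:
  assumes B: "B \<in> carrier_mat n n"
  shows "(\<lambda>W. vip n x (mvec n (ent (conj_by W B)) y)) \<in> borel_measurable (unitary_borel n)"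
proof -
  have "(\<lambda>W. \<Sum>i<n. cnj (x i) * (\<Sum>j<n. (\<Sum>l<n. (\<Sum>k<n. W $$ (i, k) * B $$ (k, l)) * cnj (W $$ (j, l))) * y j))
      \<in> borel_measurable (unitary_borel n)"
    using borel_measurable_continuous_onI[OF continuous_on_cnj[OF continuous_on_id]]
    by (intro borel_measurable_sum borel_measurable_times borel_measurable_const measurable_unitary_entry
          measurable_compose[OF measurable_unitary_entry]) auto
  then show ?thesis
    by (rule measurable_cong[THEN iffD1, rotated])
      (auto simp: vip_def mvec_def space_unitary_borel unitary_group_def ent_conj_by[OF _ B] intro!: sum.cong)
qed

lemma measurable_unitary_mult:
  assumes V: "V \<in> unitary_group n"
  shows "(\<lambda>W. V * W) \<in> measurable (unitary_borel n) (unitary_borel n)"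
proof -
  have "(\<lambda>W. \<lambda>rc\<in>{..<n} \<times> {..<n}. (V * W) $$ rc) \<in> measurable (unitary_borel n) (\<Pi>\<^sub>M rc\<in>{..<n} \<times> {..<n}. borel :: complex measure)"
  proof (rule measurable_restrict)
    fix rc assume "rc \<in> {..<n} \<times> {..<n}"
    then obtain i j where rc: "rc = (i, j)" "i < n" "j < n" by auto
    have "(\<lambda>W. \<Sum>k<n. V $$ (i, k) * W $$ (k, j)) \<in> borel_measurable (unitary_borel n)"
      using rc by (intro borel_measurable_sum borel_measurable_times borel_measurable_const measurable_unitary_entry) auto
    then show "(\<lambda>W. (V * W) $$ rc) \<in> borel_measurable (unitary_borel n)"
      by (rule measurable_cong[THEN iffD1, rotated])
        (use V rc in \<open>auto simp: space_unitary_borel unitary_group_def mat_times_index[of _ n n _ n] simp del: index_mult_mat\<close>)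
  qed
  then show ?thesis
    unfolding unitary_borel_def[of n]
    by (intro measurable_vimage_algebra2)
      (auto simp: space_unitary_borel[unfolded unitary_borel_def] intro: unitary_group_mult[OF V])
qed

text \<open>The squared Hilbert-Schmidt norm. Like the trace it is invariant under unitary
  conjugation, so the sign average is bounded uniformly in the unitary.\<close>

definition hs2 :: "nat \<Rightarrow> (nat \<Rightarrow> nat \<Rightarrow> complex) \<Rightarrow> real" where
  "hs2 n X = (\<Sum>i<n. \<Sum>j<n. (cmod (X i j))\<^sup>2)"

lemma hs2_eq_sum_nsq: "hs2 n X = (\<Sum>j<n. nsq n (\<lambda>i. X i j))" "hs2 n X = (\<Sum>i<n. nsq n (X i))"
  unfolding hs2_def nsq_def by (rule sum.swap, rule refl)

lemma nsq_mvec_unitary: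
  assumes "W \<in> unitary_group n"
  shows "nsq n (mvec n (ent W) v) = nsq n v" "nsq n (mvec n (ent (mat_adjoint W)) v) = nsq n v"
proof -
  have W: "W \<in> carrier_mat n n" and WW: "W * mat_adjoint W = 1\<^sub>m n" "mat_adjoint W * W = 1\<^sub>m n"
    using assms by (auto simp: unitary_group_def)
  note Wa = mat_adjoint_carrier[OF W]
  have one: "mvec n (ent (1\<^sub>m n)) v i = v i" if "i < n" for i
  proof -
    have "mvec n (ent (1\<^sub>m n)) v i = (\<Sum>j<n. if i = j then v j else 0)"
      unfolding mvec_def ent_def using that by (intro sum.cong) auto
    then show ?thesis using that by simp
  qed
  have "complex_of_real (nsq n (mvec n (ent W) v)) = vip n v (mvec n (ent (mat_adjoint W)) (mvec n (ent W) v))"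
    unfolding vip_self[symmetric] vip_mat_adjoint'[OF W] ..
  also have "\<dots> = vip n v v"
    by (rule vip_cong) (use mvec_ent_mult[OF Wa W, of _ v] one in \<open>simp_all add: WW\<close>)
  finally show "nsq n (mvec n (ent W) v) = nsq n v" by (simp only: vip_self of_real_eq_iff)
  have "complex_of_real (nsq n (mvec n (ent (mat_adjoint W)) v)) = vip n v (mvec n (ent W) (mvec n (ent (mat_adjoint W)) v))"
    unfolding vip_self[symmetric] vip_mat_adjoint[OF W] ..
  also have "\<dots> = vip n v v"
    by (rule vip_cong) (use mvec_ent_mult[OF W Wa, of _ v] one in \<open>simp_all add: WW\<close>)
  finally show "nsq n (mvec n (ent (mat_adjoint W)) v) = nsq n v" by (simp only: vip_self of_real_eq_iff)
qed

lemma hs2_unitary: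
  assumes W: "W \<in> unitary_group n" and X: "X \<in> carrier_mat n n"
  shows "hs2 n (ent (W * X)) = hs2 n (ent X)" "hs2 n (ent (X * mat_adjoint W)) = hs2 n (ent X)"
proof -
  have Wc: "W \<in> carrier_mat n n" using W by (auto simp: unitary_group_def)
  have "nsq n (\<lambda>i. ent (W * X) i j) = nsq n (\<lambda>i. ent X i j)" if "j < n" for j
  proof -
    have "nsq n (\<lambda>i. ent (W * X) i j) = nsq n (mvec n (ent W) (\<lambda>i. ent X i j))"
      by (rule nsq_cong) (use that ent_mult[OF Wc X] in \<open>simp add: mvec_def fmul_def\<close>)
    then show ?thesis using nsq_mvec_unitary(1)[OF W] by simp
  qed
  then show "hs2 n (ent (W * X)) = hs2 n (ent X)" unfolding hs2_eq_sum_nsq(1) by simp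
  have "nsq n (ent (X * mat_adjoint W) i) = nsq n (ent X i)" if "i < n" for i
  proof -
    have "nsq n (ent (X * mat_adjoint W) i) = nsq n (\<lambda>j. cnj (mvec n (ent W) (\<lambda>k. cnj (ent X i k)) j))"
      by (rule nsq_cong) (use that ent_mult[OF X mat_adjoint_carrier[OF Wc]] in
        \<open>simp add: mvec_def fmul_def ent_def mat_adjoint_index[OF Wc] mult.commute del: index_mult_mat\<close>)
    also have "\<dots> = nsq n (mvec n (ent W) (\<lambda>k. cnj (ent X i k)))" by (simp add: nsq_def)
    also have "\<dots> = nsq n (ent X i)" unfolding nsq_mvec_unitary(1)[OF W] by (simp add: nsq_def)
    finally show ?thesis .
  qed
  then show "hs2 n (ent (X * mat_adjoint W)) = hs2 n (ent X)" unfolding hs2_eq_sum_nsq(2) by simp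
qed

lemma hs2_conj_by:
  assumes W: "W \<in> unitary_group n" and X: "X \<in> carrier_mat n n"
  shows "hs2 n (ent (conj_by W X)) = hs2 n (ent X)"
proof -
  have "W \<in> carrier_mat n n" using W by (auto simp: unitary_group_def)
  then show ?thesis unfolding conj_by_def using hs2_unitary[OF W] X by (simp add: mult_carrier_mat[of _ n n _ n])
qed

lemma mat_Tr_ftr: "X \<in> carrier_mat n n \<Longrightarrow> mat_Tr X = ftr {..<n} (ent X)"
  by (simp add: mat_Tr_def ftr_def ent_def)

lemma mat_Tr_comm:
  assumes "X \<in> carrier_mat n n" "Y \<in> carrier_mat n n" shows "mat_Tr (X * Y) = mat_Tr (Y * X)"
proof -
  have *: "mat_Tr (X * Y) = ftr {..<n} (fmul {..<n} (ent X) (ent Y))" if "X \<in> carrier_mat n n" "Y \<in> carrier_mat n n" for X Y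
    unfolding mat_Tr_ftr[OF mult_carrier_mat[OF that]] ftr_def by (intro sum.cong refl ent_mult[OF that]) auto
  show ?thesis unfolding *[OF assms] *[OF assms(2,1)] by (rule ftr_fmul)
qed

lemma mat_Tr_conj_by:
  assumes W: "W \<in> unitary_group n" and X: "X \<in> carrier_mat n n"
  shows "mat_Tr (conj_by W X) = mat_Tr X"
proof -
  have Wc: "W \<in> carrier_mat n n" and WW: "mat_adjoint W * W = 1\<^sub>m n" using W by (auto simp: unitary_group_def)
  note Wa = mat_adjoint_carrier[OF Wc]
  have "mat_Tr (conj_by W X) = mat_Tr (mat_adjoint W * (W * X))"
    unfolding conj_by_def by (rule mat_Tr_comm) (use Wc X Wa in auto)
  also have "mat_adjoint W * (W * X) = X"
    using Wc X Wa by (simp add: assoc_mult_mat[OF Wa Wc X, symmetric] WW)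
  finally show ?thesis .
qed

lemma conj_by_mult_left:
  assumes V: "V \<in> carrier_mat n n" and W: "W \<in> carrier_mat n n" and X: "X \<in> carrier_mat n n"
  shows "conj_by (V * W) X = V * conj_by W X * mat_adjoint V"
  unfolding conj_by_def mat_adjoint_mult[OF V W]
  using V W X mat_adjoint_carrier[OF V] mat_adjoint_carrier[OF W] by (simp add: assoc_mult_mat[of _ n n _ n _ n])

lemma conj_by_carrier: "W \<in> carrier_mat n n \<Longrightarrow> X \<in> carrier_mat n n \<Longrightarrow> conj_by W X \<in> carrier_mat n n"
  unfolding conj_by_def using mat_adjoint_carrier[of W n n] by auto

lemma vip_conj:
  assumes V: "V \<in> carrier_mat n n" and Y: "Y \<in> carrier_mat n n"
  shows "vip n x (mvec n (ent (V * Y * mat_adjoint V)) y) =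
    vip n (mvec n (ent (mat_adjoint V)) x) (mvec n (ent Y) (mvec n (ent (mat_adjoint V)) y))"
proof -
  have "vip n x (mvec n (ent (V * Y * mat_adjoint V)) y) = vip n x (mvec n (ent V) (mvec n (ent Y) (mvec n (ent (mat_adjoint V)) y)))"
  proof (intro vip_cong refl)
    fix i assume i: "i < n"
    have "mvec n (ent (V * Y * mat_adjoint V)) y i = mvec n (ent (V * Y)) (mvec n (ent (mat_adjoint V)) y) i"
      by (rule mvec_ent_mult) (use V Y i mat_adjoint_carrier[OF V] in auto)
    then show "mvec n (ent (V * Y * mat_adjoint V)) y i = mvec n (ent V) (mvec n (ent Y) (mvec n (ent (mat_adjoint V)) y)) i"
      using mvec_ent_mult[OF V Y i] by simp
  qed
  then show ?thesis unfolding vip_mat_adjoint[OF V] .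
qed

definition haar_moment :: "nat \<Rightarrow> complex mat measure \<Rightarrow> complex mat \<Rightarrow> (nat \<Rightarrow> complex) \<Rightarrow> ennreal" where
  "haar_moment n \<mu> B z = (\<integral>\<^sup>+W. ennreal (cmod (vip n z (mvec n (ent (conj_by W B)) z)) ^ 4) \<partial>\<mu>)"

lemma haar_moment_measurable:
  assumes "B \<in> carrier_mat n n" "haar_unitary_measure n \<mu>"
  shows "(\<lambda>W. ennreal (cmod (vip n z (mvec n (ent (conj_by W B)) z)) ^ 4)) \<in> borel_measurable \<mu>"
proof -
  have s: "sets \<mu> = sets (unitary_borel n)" using assms(2) by (simp add: haar_unitary_measure_def)
  have "(\<lambda>W. vip n z (mvec n (ent (conj_by W B)) z)) \<in> borel_measurable \<mu>"
    unfolding measurable_cong_sets[OF s refl] by (rule measurable_conj_form[OF assms(1)])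
  then show ?thesis by measurable
qed

text \<open>Some unitary \<open>V\<close> has an adjoint that takes \<open>x\<close> to a phase
  times \<open>y\<close>. Replacing \<open>W\<close> by \<open>V * W\<close> moves the adjoint of
  \<open>V\<close> onto \<open>x\<close>, and the phase drops out of the modulus.\<close>

lemma haar_moment_invariant:
  assumes B: "B \<in> carrier_mat n n" and \<mu>: "haar_unitary_measure n \<mu>" and xy: "nsq n x = nsq n y"
  shows "haar_moment n \<mu> B x = haar_moment n \<mu> B y"
proof -
  have s: "sets \<mu> = sets (unitary_borel n)" using \<mu> by (simp add: haar_unitary_measure_def)
  have sp: "space \<mu> = unitary_group n" using sets_eq_imp_space_eq[OF s] by (simp add: space_unitary_borel)
  obtain V c where V: "V \<in> unitary_group n" "cmod c = 1" "\<And>i. i < n \<Longrightarrow> mvec n (ent (mat_adjoint V)) x i = c * y i"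
    using unitary_transitive[OF xy] by auto
  have Vc: "V \<in> carrier_mat n n" using V by (auto simp: unitary_group_def)
  have m: "(\<lambda>W. V * W) \<in> measurable \<mu> \<mu>"
    unfolding measurable_cong_sets[OF s s] by (rule measurable_unitary_mult[OF V(1)])
  have "haar_moment n \<mu> B x = (\<integral>\<^sup>+W. ennreal (cmod (vip n x (mvec n (ent (conj_by W B)) x)) ^ 4) \<partial>(distr \<mu> \<mu> (\<lambda>W. V * W)))"
    using \<mu> V(1) by (simp add: haar_moment_def haar_unitary_measure_def)
  also have "\<dots> = (\<integral>\<^sup>+W. ennreal (cmod (vip n x (mvec n (ent (conj_by (V * W) B)) x)) ^ 4) \<partial>\<mu>)"
    by (rule nn_integral_distr[OF m haar_moment_measurable[OF B]]) (use \<mu> V(1) in \<open>simp add: haar_unitary_measure_def\<close>)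
  also have "\<dots> = haar_moment n \<mu> B y"
    unfolding haar_moment_def
  proof (rule nn_integral_cong)
    fix W assume "W \<in> space \<mu>"
    then have W: "W \<in> carrier_mat n n" by (simp add: sp unitary_group_def)
    have "vip n x (mvec n (ent (conj_by (V * W) B)) x) = vip n (\<lambda>i. c * y i) (mvec n (ent (conj_by W B)) (\<lambda>i. c * y i))"
      unfolding conj_by_mult_left[OF Vc W B] vip_conj[OF Vc conj_by_carrier[OF W B]]
      by (intro vip_cong mvec_cong V(3) refl)
    also have "\<dots> = cnj c * c * vip n y (mvec n (ent (conj_by W B)) y)"
      unfolding mvec_scale vip_scale_left vip_scale_right by simp
    finally show "ennreal (cmod (vip n x (mvec n (ent (conj_by (V * W) B)) x)) ^ 4) = ennreal (cmod (vip n y (mvec n (ent (conj_by W B)) y)) ^ 4)"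
      by (simp add: norm_mult V(2))
  qed
  finally show ?thesis .
qed

text \<open>By invariance the moment at a fixed vector of squared length \<open>n\<close> is its average over all sign
  vectors.\<close>

lemma haar_moment_bound:
  assumes n: "n \<ge> 1" and B: "B \<in> carrier_mat n n" and \<mu>: "haar_unitary_measure n \<mu>" and tr: "mat_Tr B = 0"
  shows "haar_moment n \<mu> B z \<le> ennreal (648 * (hs2 n (ent B))\<^sup>2 * (nsq n z / n) ^ 4)"
proof -
  have s: "sets \<mu> = sets (unitary_borel n)" and ps: "prob_space \<mu>" using \<mu> by (simp_all add: haar_unitary_measure_def)
  interpret prob_space \<mu> by (rule ps)
  have sp: "space \<mu> = unitary_group n" using sets_eq_imp_space_eq[OF s] by (simp add: space_unitary_borel)
  let ?K = "648 * (hs2 n (ent B))\<^sup>2"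
  let ?v = "\<lambda>A j. complex_of_real (sgnv A j)"
  have "(cmod (?v A j))\<^sup>2 = 1" for A j by (simp add: sgnv_def)
  then have nv: "nsq n (?v A) = n" for A by (simp add: nsq_def)
  have main: "haar_moment n \<mu> B x \<le> ennreal ?K" if x: "nsq n x = n" for x
  proof -
    have "2 ^ n * haar_moment n \<mu> B x = (\<Sum>A\<in>Pow {..<n}. haar_moment n \<mu> B x)"
      by (simp add: card_Pow)
    also have "\<dots> = (\<Sum>A\<in>Pow {..<n}. haar_moment n \<mu> B (?v A))"
      by (intro sum.cong refl haar_moment_invariant[OF B \<mu>]) (simp only: x nv)
    also have "\<dots> = (\<integral>\<^sup>+W. (\<Sum>A\<in>Pow {..<n}. ennreal (cmod (vip n (?v A) (mvec n (ent (conj_by W B)) (?v A))) ^ 4)) \<partial>\<mu>)"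
      unfolding haar_moment_def by (rule nn_integral_sum[symmetric]) (rule haar_moment_measurable[OF B \<mu>])
    \<comment> \<open>For each fixed \<open>W\<close> the sum over signs is estimated for the
      conjugated matrix, which has trace 0 and the Hilbert-Schmidt norm of \<open>B\<close>.\<close>
    also have "\<dots> \<le> (\<integral>\<^sup>+W. ennreal (2 ^ n * ?K) \<partial>\<mu>)"
    proof (rule nn_integral_mono)
      fix W assume "W \<in> space \<mu>"
      then have W: "W \<in> unitary_group n" and Wc: "W \<in> carrier_mat n n" by (auto simp: sp unitary_group_def)
      have "ftr {..<n} (ent (conj_by W B)) = 0"
        using mat_Tr_conj_by[OF W B] tr mat_Tr_ftr[OF conj_by_carrier[OF Wc B]] by simp
      then have "(\<Sum>j<n. ent (conj_by W B) j j) = 0" by (simp add: ftr_def)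
      from sign_vector_fourth_moment[where Y = "ent (conj_by W B)", OF this] have
        "(\<Sum>A\<in>Pow {..<n}. cmod (vip n (?v A) (mvec n (ent (conj_by W B)) (?v A))) ^ 4) \<le> 2 ^ n * ?K"
        unfolding hs2_def[symmetric] hs2_conj_by[OF W B] .
      then show "(\<Sum>A\<in>Pow {..<n}. ennreal (cmod (vip n (?v A) (mvec n (ent (conj_by W B)) (?v A))) ^ 4)) \<le> ennreal (2 ^ n * ?K)"
        by (subst sum_ennreal) (auto intro: ennreal_leI)
    qed
    also have "\<dots> = ennreal (2 ^ n * ?K)" by (simp add: emeasure_space_1)
    also have "\<dots> = 2 ^ n * ennreal ?K" by (simp add: ennreal_mult ennreal_power[symmetric])
    finally show ?thesis by (subst (asm) ennreal_mult_le_mult_iff) (simp_all add: power_eq_top_ennreal)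
  qed
  show ?thesis
  proof (cases "nsq n z = 0")
    case True
    then have "vip n z y = 0" for y using nsq_eq_0[of n z] by (simp add: vip_def)
    then show ?thesis by (simp add: haar_moment_def)
  next
    case False
    then have p: "0 < nsq n z" using nsq_nonneg[of n z] by simp
    \<comment> \<open>Rescales \<open>z\<close> to squared length \<open>n\<close>, the common
      squared length of the sign vectors; the fourth power of the form scales by
      \<open>r ^ 8\<close>.\<close>
    define r where "r = sqrt (nsq n z / n)"
    have r: "0 < r" "r\<^sup>2 = nsq n z / n" using p n by (auto simp: r_def)
    define x where "x i = of_real (1 / r) * z i" for i
    have "(cmod (of_real (1 / r)))\<^sup>2 = 1 / r\<^sup>2" by (simp only: norm_of_real power2_abs) (simp add: power_divide)
    then have "nsq n x = nsq n z / r\<^sup>2" unfolding x_def nsq_scale by simp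
    also have "\<dots> = n" unfolding r(2) using p n by simp
    finally have x: "nsq n x = n" .
    have z: "z = (\<lambda>i. of_real r * x i)" using r by (auto simp: x_def)
    have "haar_moment n \<mu> B z = (\<integral>\<^sup>+W. ennreal (r ^ 8) * ennreal (cmod (vip n x (mvec n (ent (conj_by W B)) x)) ^ 4) \<partial>\<mu>)"
      unfolding haar_moment_def z mvec_scale vip_scale_left vip_scale_right using r
      by (intro nn_integral_cong) (simp add: norm_mult ennreal_mult[symmetric] power_mult_distrib mult.assoc[symmetric] power_add[symmetric])
    also have "\<dots> = ennreal (r ^ 8) * haar_moment n \<mu> B x"
      unfolding haar_moment_def by (rule nn_integral_cmult[OF haar_moment_measurable[OF B \<mu>]])
    also have "\<dots> \<le> ennreal (r ^ 8) * ennreal ?K" by (intro mult_left_mono main[OF x]) auto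
    also have "\<dots> = ennreal (?K * (r\<^sup>2) ^ 4)"
      using r(1) by (subst ennreal_mult[symmetric]) (simp_all add: power_mult[symmetric] mult.commute)
    finally show ?thesis unfolding r(2) .
  qed
qed

text \<open>Here the squared Hilbert-Schmidt norm is at most of order \<open>n\<close> and
  \<open>z n\<close> is bounded, so the fourth moments are of order n^-2 and summable. The sum of
  the fourth powers is then almost surely finite, whatever the joint law of the
  \<open>U n\<close>.\<close>

lemma haar_quadratic_AE:
  fixes B :: "nat \<Rightarrow> complex mat" and K :: real
  assumes M: "prob_space M" and U: "\<And>n. n \<ge> 1 \<Longrightarrow> haar_unitary M n (U n)"
    and B: "\<And>n. n \<ge> 1 \<Longrightarrow> B n \<in> carrier_mat n n" and tr: "\<And>n. n \<ge> 1 \<Longrightarrow> mat_Tr (B n) = 0"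
    and hs: "\<And>n. n \<ge> 1 \<Longrightarrow> hs2 n (ent (B n)) \<le> K * n" and z: "\<And>n. nsq n (z n) \<le> L"
  shows "AE \<omega> in M. (\<lambda>n. vip n (z n) (mvec n (ent (conj_by (U n \<omega>) (B n))) (z n))) \<longlonglongrightarrow> 0"
proof -
  interpret prob_space M by (rule M)
  define Z where "Z n \<omega> = cmod (vip n (z n) (mvec n (ent (conj_by (U n \<omega>) (B n))) (z n))) ^ 4" for n \<omega>
  have Um: "U n \<in> measurable M (unitary_borel n)" if "n \<ge> 1" for n using U[OF that] by (simp add: haar_unitary_def)
  have Zm: "(\<lambda>\<omega>. ennreal (Z n \<omega>)) \<in> borel_measurable M" if n: "n \<ge> 1" for n
    unfolding Z_def using measurable_compose[OF Um[OF n] measurable_conj_form[OF B[OF n], of "z n" "z n"]] by measurable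
  have le: "(\<integral>\<^sup>+\<omega>. ennreal (Z n \<omega>) \<partial>M) \<le> ennreal (648 * K\<^sup>2 * L ^ 4 * (inverse (real n ^ 2)))" if n: "n \<ge> 1" for n
  proof -
    let ?\<mu> = "distr M (unitary_borel n) (U n)"
    have \<mu>: "haar_unitary_measure n ?\<mu>" using U[OF n] by (simp add: haar_unitary_def)
    have "(\<integral>\<^sup>+\<omega>. ennreal (Z n \<omega>) \<partial>M) = haar_moment n ?\<mu> (B n) (z n)"
      unfolding Z_def haar_moment_def
      by (rule nn_integral_distr[symmetric, OF Um[OF n]]) (rule haar_moment_measurable[OF B[OF n] \<mu>])
    also have "\<dots> \<le> ennreal (648 * (hs2 n (ent (B n)))\<^sup>2 * (nsq n (z n) / n) ^ 4)"
      by (rule haar_moment_bound[OF n B[OF n] \<mu> tr[OF n]])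
    also have "\<dots> \<le> ennreal (648 * (K * n)\<^sup>2 * (L / n) ^ 4)"
      using hs[OF n] z[of n] n by (intro ennreal_leI mult_mono power_mono divide_right_mono) (auto simp: hs2_def sum_nonneg nsq_nonneg)
    also have "648 * (K * n)\<^sup>2 * (L / n) ^ 4 = 648 * K\<^sup>2 * L ^ 4 * (inverse (real n ^ 2))"
      using n by (simp add: field_simps power2_eq_square power4_eq_xxxx)
    finally show ?thesis .
  qed
  have "(\<integral>\<^sup>+\<omega>. (\<Sum>n. ennreal (Z (Suc n) \<omega>)) \<partial>M) = (\<Sum>n. \<integral>\<^sup>+\<omega>. ennreal (Z (Suc n) \<omega>) \<partial>M)"
    by (rule nn_integral_suminf) (rule Zm, simp)
  also have "\<dots> \<le> (\<Sum>n. ennreal (648 * K\<^sup>2 * L ^ 4 * inverse (real (Suc n) ^ 2)))"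
    by (intro suminf_le le) auto
  also have "\<dots> < \<infinity>"
  proof -
    have "summable (\<lambda>n. 648 * K\<^sup>2 * L ^ 4 * inverse (real (Suc n) ^ 2))"
      using inverse_power_summable[of 2, where 'a = real] by (intro summable_mult) (subst summable_Suc_iff, simp)
    then show ?thesis by (subst suminf_ennreal2) auto
  qed
  finally have "AE \<omega> in M. (\<Sum>n. ennreal (Z (Suc n) \<omega>)) \<noteq> \<infinity>"
    by (intro nn_integral_noteq_infinite borel_measurable_suminf_order Zm) auto
  then show ?thesis
  proof eventually_elim
    case (elim \<omega>)
    then have "summable (\<lambda>n. Z (Suc n) \<omega>)" by (intro summable_suminf_not_top) (auto simp: Z_def)
    then have "(\<lambda>n. Z (Suc n) \<omega>) \<longlonglongrightarrow> 0" by (rule summable_LIMSEQ_zero)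
    then have "(\<lambda>n. Z n \<omega>) \<longlonglongrightarrow> 0" by (rule LIMSEQ_imp_Suc)
    then have "(\<lambda>n. root 4 (Z n \<omega>)) \<longlonglongrightarrow> root 4 0" by (rule tendsto_real_root)
    then have "(\<lambda>n. cmod (vip n (z n) (mvec n (ent (conj_by (U n \<omega>) (B n))) (z n)))) \<longlonglongrightarrow> 0"
      by (simp add: Z_def real_root_power_cancel)
    then show ?case by (simp only: tendsto_norm_zero_iff)
  qed
qed

lemma vip_polarization:
  fixes Y :: "nat \<Rightarrow> nat \<Rightarrow> complex" and n :: nat and x y :: "nat \<Rightarrow> complex"
  defines "Q \<equiv> \<lambda>z. vip n z (mvec n Y z)"
  shows "4 * vip n x (mvec n Y y) = Q (\<lambda>i. x i + y i) - Q (\<lambda>i. x i + (- 1) * y i)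
    - \<i> * Q (\<lambda>i. x i + \<i> * y i) + \<i> * Q (\<lambda>i. x i + (- \<i>) * y i)"
proof -
  have a: "mvec n Y (\<lambda>i. x i + c * y i) = (\<lambda>i. mvec n Y x i + c * mvec n Y y i)" for c
    unfolding mvec_def by (simp add: algebra_simps sum.distrib sum_distrib_left)
  have Q: "Q (\<lambda>i. x i + c * y i) = Q x + c * vip n x (mvec n Y y) + cnj c * vip n y (mvec n Y x) + cnj c * c * Q y" for c
    unfolding Q_def a vip_add_left vip_add_right vip_scale_left vip_scale_right by (simp add: algebra_simps)
  show ?thesis using Q[of 1] unfolding Q[of "- 1"] Q[of "\<i>"] Q[of "- \<i>"] by (simp add: algebra_simps)
qed

lemma nsq_add_le: "nsq n (\<lambda>i. x i + y i) \<le> 2 * nsq n x + 2 * nsq n y"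
proof -
  have "(cmod (a + b))\<^sup>2 \<le> 2 * (cmod a)\<^sup>2 + 2 * (cmod b)\<^sup>2" for a b :: complex
  proof -
    have "(cmod (a + b))\<^sup>2 \<le> (cmod a + cmod b)\<^sup>2" by (intro power_mono norm_triangle_ineq) auto
    then show ?thesis using sum_squares_bound[of "cmod a" "cmod b"] by (simp add: power2_sum)
  qed
  then show ?thesis unfolding nsq_def sum_distrib_left sum.distrib[symmetric] by (rule sum_mono)
qed

text \<open>Polarization reduces the claim to quadratic forms at x + c y for four phases c. The
  trace is removed beforehand: conjugation fixes scalar multiples of the identity, and these produce
  the term \<beta> <x, y>.\<close>

theorem haar_bilinear_AE:
  fixes B :: "nat \<Rightarrow> complex mat" and K :: real
  assumes M: "prob_space M" and U: "\<And>n. n \<ge> 1 \<Longrightarrow> haar_unitary M n (U n)"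
    and B: "\<And>n. n \<ge> 1 \<Longrightarrow> B n \<in> carrier_mat n n" and tr: "(\<lambda>n. mat_tr (B n)) \<longlonglongrightarrow> \<beta>"
    and hs: "\<And>n. n \<ge> 1 \<Longrightarrow> hs2 n (ent (B n)) \<le> K * n"
    and x: "\<And>n. nsq n (x n) \<le> 1" and y: "\<And>n. nsq n (y n) \<le> 1"
  shows "AE \<omega> in M. (\<lambda>n. vip n (x n) (mvec n (ent (conj_by (U n \<omega>) (B n))) (y n)) - \<beta> * vip n (x n) (y n)) \<longlonglongrightarrow> 0"
proof -
  interpret prob_space M by (rule M)
  define B0 where "B0 n = B n - mat_tr (B n) \<cdot>\<^sub>m 1\<^sub>m n" for n
  have B0: "B0 n \<in> carrier_mat n n" for n unfolding B0_def by (rule minus_carrier_mat) simp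
  have e0: "ent (B0 n) i j = ent (B n) i j + - (if i = j then mat_tr (B n) else 0)" if "n \<ge> 1" "i < n" "j < n" for n i j
    using B[OF that(1)] that by (simp add: B0_def ent_def)
  have tr0: "mat_Tr (B0 n) = 0" if n: "n \<ge> 1" for n
  proof -
    have "mat_Tr (B0 n) = ftr {..<n} (ent (B n)) - of_nat n * mat_tr (B n)"
      unfolding mat_Tr_ftr[OF B0] ftr_def using e0[OF n] by (simp add: sum_subtractf)
    then show ?thesis using B[OF n] n by (simp add: mat_tr_def mat_Tr_ftr[OF B[OF n]])
  qed
  have "Bseq (\<lambda>n. mat_tr (B n))" using tr by (intro convergent_imp_Bseq convergentI)
  then obtain T where T: "\<And>n. cmod (mat_tr (B n)) \<le> T" by (auto simp: Bseq_def)
  \<comment> \<open>Subtracting the scalar part at most doubles the squared norm and adds 2 T^2 per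
    row, so the bound stays linear in \<open>n\<close>.\<close>
  have hs0: "hs2 n (ent (B0 n)) \<le> (2 * K + 2 * T\<^sup>2) * n" if n: "n \<ge> 1" for n
  proof -
    have "hs2 n (ent (B0 n)) \<le> (\<Sum>i<n. 2 * nsq n (ent (B n) i) + 2 * T\<^sup>2)"
      unfolding hs2_eq_sum_nsq(2)
    proof (rule sum_mono)
      fix i assume i: "i \<in> {..<n}"
      have "nsq n (ent (B0 n) i) = nsq n (\<lambda>j. ent (B n) i j + - (if i = j then mat_tr (B n) else 0))"
        using i e0[OF n] by (intro nsq_cong) auto
      also have "\<dots> \<le> 2 * nsq n (ent (B n) i) + 2 * nsq n (\<lambda>j. - (if i = j then mat_tr (B n) else 0))" by (rule nsq_add_le)
      also have "nsq n (\<lambda>j. - (if i = j then mat_tr (B n) else 0)) = (\<Sum>j<n. if i = j then (cmod (mat_tr (B n)))\<^sup>2 else 0)"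
        unfolding nsq_def by (intro sum.cong) auto
      also have "\<dots> \<le> T\<^sup>2" using i T[of n] by (simp add: power_mono)
      finally show "nsq n (ent (B0 n) i) \<le> 2 * nsq n (ent (B n) i) + 2 * T\<^sup>2" by simp
    qed
    also have "\<dots> = 2 * hs2 n (ent (B n)) + 2 * T\<^sup>2 * n" by (simp add: sum.distrib hs2_eq_sum_nsq(2) sum_distrib_left)
    also have "\<dots> \<le> (2 * K + 2 * T\<^sup>2) * n" using hs[OF n] by (simp add: algebra_simps)
    finally show ?thesis .
  qed
  have z: "nsq n (\<lambda>i. x n i + c * y n i) \<le> 4" if "cmod c = 1" for c n
    using nsq_add_le[of n "x n" "\<lambda>i. c * y n i"] x[of n] y[of n] that by (simp add: nsq_scale)
  define Q where "Q \<omega> n z = vip n z (mvec n (ent (conj_by (U n \<omega>) (B0 n))) z)" for \<omega> n z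
  have Q: "AE \<omega> in M. (\<lambda>n. Q \<omega> n (\<lambda>i. x n i + c * y n i)) \<longlonglongrightarrow> 0" if "cmod c = 1" for c
    unfolding Q_def by (rule haar_quadratic_AE[OF M U B0 tr0 hs0 z[OF that]])
  have "AE \<omega> in M. \<forall>n. n \<ge> 1 \<longrightarrow> U n \<omega> \<in> unitary_group n"
  proof (subst AE_all_countable, intro allI)
    fix n
    show "AE \<omega> in M. n \<ge> 1 \<longrightarrow> U n \<omega> \<in> unitary_group n"
    proof (rule AE_I2, rule impI)
      fix \<omega> assume \<omega>: "\<omega> \<in> space M" and n: "n \<ge> 1"
      have "U n \<in> measurable M (unitary_borel n)" using U[OF n] by (simp add: haar_unitary_def)
      from measurable_space[OF this \<omega>] show "U n \<omega> \<in> unitary_group n" by (simp add: space_unitary_borel)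
    qed
  qed
  then show ?thesis using Q[of 1, simplified] Q[of "- 1", simplified] Q[of "\<i>", simplified] Q[of "- \<i>", simplified]
  proof eventually_elim
    case (elim \<omega>)
    have dec: "vip n (x n) (mvec n (ent (conj_by (U n \<omega>) (B n))) (y n)) - mat_tr (B n) * vip n (x n) (y n) =
        vip n (x n) (mvec n (ent (conj_by (U n \<omega>) (B0 n))) (y n))" if n: "n \<ge> 1" for n
    proof -
      have W: "U n \<omega> \<in> unitary_group n" and Wc: "U n \<omega> \<in> carrier_mat n n" using elim(1) n by (auto simp: unitary_group_def)
      have conj: "ent (conj_by (U n \<omega>) (B0 n)) i j = ent (conj_by (U n \<omega>) (B n)) i j - (if i = j then mat_tr (B n) else 0)"
        if ij: "i < n" "j < n" for i j
      proof -
        have "(\<Sum>k<n. U n \<omega> $$ (i, k) * B0 n $$ (k, l)) = (\<Sum>k<n. U n \<omega> $$ (i, k) * B n $$ (k, l)) - mat_tr (B n) * U n \<omega> $$ (i, l)"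
          if l: "l < n" for l
        proof -
          have "(\<Sum>k<n. U n \<omega> $$ (i, k) * B0 n $$ (k, l)) =
              (\<Sum>k<n. U n \<omega> $$ (i, k) * B n $$ (k, l) - (if k = l then U n \<omega> $$ (i, k) * mat_tr (B n) else 0))"
          proof (intro sum.cong refl)
            fix k assume "k \<in> {..<n}"
            then have h: "B0 n $$ (k, l) = B n $$ (k, l) - (if k = l then mat_tr (B n) else 0)"
              using e0[OF n _ l, of k] by (simp add: ent_def)
            show "U n \<omega> $$ (i, k) * B0 n $$ (k, l) = U n \<omega> $$ (i, k) * B n $$ (k, l) - (if k = l then U n \<omega> $$ (i, k) * mat_tr (B n) else 0)"
              unfolding h by (simp add: right_diff_distrib)
          qed
          then show ?thesis using l by (simp add: sum_subtractf mult.commute)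
        qed
        then have "ent (conj_by (U n \<omega>) (B0 n)) i j = ent (conj_by (U n \<omega>) (B n)) i j
            - mat_tr (B n) * (\<Sum>l<n. U n \<omega> $$ (i, l) * cnj (U n \<omega> $$ (j, l)))"
          unfolding ent_conj_by[OF Wc B0 ij] ent_conj_by[OF Wc B[OF n] ij]
          by (simp add: left_diff_distrib sum_subtractf sum_distrib_left mult.assoc)
        also have "(\<Sum>l<n. U n \<omega> $$ (i, l) * cnj (U n \<omega> $$ (j, l))) = (U n \<omega> * mat_adjoint (U n \<omega>)) $$ (i, j)"
          unfolding mat_times_index[OF Wc mat_adjoint_carrier[OF Wc] ij] using ij by (simp add: mat_adjoint_index[OF Wc])
        also have "\<dots> = (if i = j then 1 else 0)" using W ij by (simp add: unitary_group_def)
        finally show ?thesis by simp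
      qed
      have "mvec n (ent (conj_by (U n \<omega>) (B0 n))) (y n) i = mvec n (ent (conj_by (U n \<omega>) (B n))) (y n) i - mat_tr (B n) * y n i"
        if i: "i < n" for i
      proof -
        have "mvec n (ent (conj_by (U n \<omega>) (B0 n))) (y n) i =
            (\<Sum>j<n. ent (conj_by (U n \<omega>) (B n)) i j * y n j - (if i = j then mat_tr (B n) * y n j else 0))"
          unfolding mvec_def
        proof (intro sum.cong refl)
          fix j assume "j \<in> {..<n}"
          then have h: "ent (conj_by (U n \<omega>) (B0 n)) i j = ent (conj_by (U n \<omega>) (B n)) i j - (if i = j then mat_tr (B n) else 0)"
            using conj[OF i] by simp
          show "ent (conj_by (U n \<omega>) (B0 n)) i j * y n j =
              ent (conj_by (U n \<omega>) (B n)) i j * y n j - (if i = j then mat_tr (B n) * y n j else 0)"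
            unfolding h by (simp add: left_diff_distrib)
        qed
        then show ?thesis using i by (simp add: sum_subtractf mvec_def)
      qed
      then have "vip n (x n) (mvec n (ent (conj_by (U n \<omega>) (B0 n))) (y n)) =
          vip n (x n) (\<lambda>i. mvec n (ent (conj_by (U n \<omega>) (B n))) (y n) i - mat_tr (B n) * y n i)"
        by (intro vip_cong refl)
      then show ?thesis by (simp add: vip_diff_right vip_scale_right)
    qed
    have "(\<lambda>n. Q \<omega> n (\<lambda>i. x n i + y n i) - Q \<omega> n (\<lambda>i. x n i + (- 1) * y n i)
        - \<i> * Q \<omega> n (\<lambda>i. x n i + \<i> * y n i) + \<i> * Q \<omega> n (\<lambda>i. x n i + (- \<i>) * y n i)) \<longlonglongrightarrow> 0 - 0 - \<i> * 0 + \<i> * 0"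
      using elim(2-5) by (intro tendsto_intros) simp_all
    then have "(\<lambda>n. 4 * vip n (x n) (mvec n (ent (conj_by (U n \<omega>) (B0 n))) (y n))) \<longlonglongrightarrow> 0"
      unfolding vip_polarization Q_def by simp
    from tendsto_mult_left[OF this, of "1 / 4"]
    have l1: "(\<lambda>n. vip n (x n) (mvec n (ent (conj_by (U n \<omega>) (B0 n))) (y n))) \<longlonglongrightarrow> 0" by simp
    have l2: "(\<lambda>n. (mat_tr (B n) - \<beta>) * vip n (x n) (y n)) \<longlonglongrightarrow> 0"
    proof (rule lim_null_mult_right_bounded[where B = 1])
      show "(\<lambda>n. mat_tr (B n) - \<beta>) \<longlonglongrightarrow> 0" using tr by (simp add: LIM_zero)
      have "cmod (vip n (x n) (y n)) \<le> 1" for n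
      proof -
        have "sqrt (nsq n (x n)) * sqrt (nsq n (y n)) \<le> 1 * 1" using x[of n] y[of n] nsq_nonneg by (intro mult_mono) auto
        then show ?thesis using cmod_vip_le[of n "x n" "y n"] by simp
      qed
      then show "\<forall>\<^sub>F n in sequentially. cmod (vip n (x n) (y n)) \<le> 1" by simp
    qed
    have "\<forall>\<^sub>F n in sequentially. vip n (x n) (mvec n (ent (conj_by (U n \<omega>) (B0 n))) (y n)) + (mat_tr (B n) - \<beta>) * vip n (x n) (y n) =
        vip n (x n) (mvec n (ent (conj_by (U n \<omega>) (B n))) (y n)) - \<beta> * vip n (x n) (y n)"
      using eventually_ge_at_top[of 1] by eventually_elim (simp add: dec[symmetric] algebra_simps)
    from Lim_transform_eventually[OF tendsto_add[OF l1 l2] this] show ?case by simp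
  qed
qed

section \<open>Compact selfadjoint operators\<close>

lemma cinner_add_left: "cinner (x + y) z = cinner x z + cinner y (z :: 'h::complex_hilbert)"
  by (metis cinner_add_right cinner_commute complex_cnj_add)

lemma cinner_scaleC_left: "cinner (c *\<^sub>C x) y = cnj c * cinner x (y :: 'h::complex_hilbert)"
  by (metis cinner_scaleC_right cinner_commute complex_cnj_mult)

lemma cinner_zero_right [simp]: "cinner x (0 :: 'h::complex_hilbert) = 0"
  using cinner_add_right[of x 0 0] by simp

lemma cinner_zero_left [simp]: "cinner (0 :: 'h::complex_hilbert) x = 0"
  using cinner_add_left[of 0 0 x] by simp

lemma cinner_minus_right: "cinner x (- y) = - cinner x (y :: 'h::complex_hilbert)"
  using cinner_add_right[of x "- y" y] by (simp add: eq_neg_iff_add_eq_0)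

lemma cinner_minus_left: "cinner (- x) y = - cinner x (y :: 'h::complex_hilbert)"
  using cinner_add_left[of "- x" x y] by (simp add: eq_neg_iff_add_eq_0)

lemma cinner_diff_right: "cinner x (y - z) = cinner x y - cinner x (z :: 'h::complex_hilbert)"
  using cinner_add_right[of x y "- z"] by (simp add: cinner_minus_right)

lemma cinner_diff_left: "cinner (x - y) z = cinner x z - cinner y (z :: 'h::complex_hilbert)"
  using cinner_add_left[of x "- y" z] by (simp add: cinner_minus_left)

lemma cinner_sum_right: "cinner x (\<Sum>i\<in>I. f i) = (\<Sum>i\<in>I. cinner x (f i :: 'h::complex_hilbert))"
  by (induction I rule: infinite_finite_induct) (simp_all add: cinner_add_right)

lemma cinner_sum_left: "cinner (\<Sum>i\<in>I. f i) x = (\<Sum>i\<in>I. cinner (f i :: 'h::complex_hilbert) x)"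
  by (induction I rule: infinite_finite_induct) (simp_all add: cinner_add_left)

lemma cinner_self: "cinner x x = of_real ((norm (x :: 'h::complex_hilbert))\<^sup>2)"
proof (rule complex_eqI)
  show "Re (cinner x x) = Re (of_real ((norm x)\<^sup>2))"
    using inner_eq_Re_cinner[of x x] by (simp add: power2_norm_eq_inner)
  have "Im (cinner x x) = - Im (cinner x x)" using arg_cong[OF cinner_commute[of x x], of Im] by simp
  then show "Im (cinner x x) = Im (of_real ((norm x)\<^sup>2))" by simp
qed

lemma norm_scaleC: "norm (c *\<^sub>C x) = cmod c * norm (x :: 'h::complex_hilbert)"
proof -
  have "complex_of_real ((norm (c *\<^sub>C x))\<^sup>2) = cnj c * c * of_real ((norm x)\<^sup>2)"
    unfolding cinner_self[symmetric] cinner_scaleC_left cinner_scaleC_right by simp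
  also have "\<dots> = of_real ((cmod c)\<^sup>2) * of_real ((norm x)\<^sup>2)"
    by (simp only: complex_norm_square mult.commute[of "cnj c"])
  also have "\<dots> = of_real ((cmod c * norm x)\<^sup>2)" by (simp add: power_mult_distrib)
  finally have "(norm (c *\<^sub>C x))\<^sup>2 = (cmod c * norm x)\<^sup>2" by (simp only: of_real_eq_iff)
  then show ?thesis by (simp add: power2_eq_iff_nonneg)
qed

lemma cmod_cinner_le: "cmod (cinner x y) \<le> norm x * norm (y :: 'h::complex_hilbert)"
proof (cases "cinner x y = 0")
  case False
  define c where "c = cnj (cinner x y) / of_real (cmod (cinner x y))"
  have "cinner x (c *\<^sub>C y) = of_real (cmod (cinner x y))"
    using False by (simp add: c_def cinner_scaleC_right complex_norm_square[symmetric] mult.commute power2_eq_square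
      nonzero_divide_eq_eq flip: of_real_mult)
  then have "cmod (cinner x y) = inner x (c *\<^sub>C y)" by (simp add: inner_eq_Re_cinner)
  also have "\<dots> \<le> norm x * norm (c *\<^sub>C y)" by (rule norm_cauchy_schwarz)
  also have "norm (c *\<^sub>C y) = norm y" using False by (simp add: norm_scaleC c_def norm_divide)
  finally show ?thesis .
qed simp

lemma cinner_eq_0_self: "cinner x x = 0 \<longleftrightarrow> x = (0 :: 'h::complex_hilbert)"
  by (simp add: cinner_self)

lemma tendsto_cinner:
  fixes f g :: "'a \<Rightarrow> 'h::complex_hilbert"
  assumes "(f \<longlongrightarrow> x) F" shows "((\<lambda>n. cinner e (f n)) \<longlongrightarrow> cinner e x) F"
proof (rule Lim_null[THEN iffD2], rule Lim_null_comparison)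
  show "\<forall>\<^sub>F n in F. norm (cinner e (f n) - cinner e x) \<le> norm e * norm (f n - x)"
    using cmod_cinner_le[of e] by (simp add: cinner_diff_right[symmetric])
  have "((\<lambda>n. norm (f n - x)) \<longlongrightarrow> 0) F" using assms by (simp add: LIM_zero tendsto_norm_zero)
  from tendsto_mult_left[OF this] show "((\<lambda>n. norm e * norm (f n - x)) \<longlongrightarrow> 0) F" by simp
qed

section \<open>Bounded and compact linear maps\<close>

definition clinear :: "('a::complex_hilbert \<Rightarrow> 'b::complex_hilbert) \<Rightarrow> bool" where
  "clinear f \<longleftrightarrow> (\<forall>x y. f (x + y) = f x + f y) \<and> (\<forall>c x. f (c *\<^sub>C x) = c *\<^sub>C f x)"

lemma clinear_simps:
  assumes "clinear f"
  shows "f (x + y) = f x + f y" "f (c *\<^sub>C x) = c *\<^sub>C f x" "f 0 = 0" "f (- x) = - f x" "f (x - y) = f x - f y"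
proof -
  show a: "f (x + y) = f x + f y" and s: "f (c *\<^sub>C x) = c *\<^sub>C f x" for x y c
    using assms by (auto simp: clinear_def)
  show 0: "f 0 = 0" using a[of 0 0] by simp
  show m: "f (- x) = - f x" for x using a[of x "- x"] 0 by (simp add: eq_neg_iff_add_eq_0 add.commute)
  show "f (x - y) = f x - f y" using a[of x "- y"] m by simp
qed

lemma clinear_sum: "clinear f \<Longrightarrow> f (\<Sum>i\<in>I. g i) = (\<Sum>i\<in>I. f (g i))"
  by (induction I rule: infinite_finite_induct) (simp_all add: clinear_simps)

definition bop :: "('a::complex_hilbert \<Rightarrow> 'b::complex_hilbert) \<Rightarrow> bool" where
  "bop f \<longleftrightarrow> clinear f \<and> (\<exists>K>0. \<forall>x. norm (f x) \<le> K * norm x)"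

lemma bop_tendsto:
  assumes "bop f" "(g \<longlongrightarrow> x) F" shows "((\<lambda>n. f (g n)) \<longlongrightarrow> f x) F"
proof -
  obtain K where K: "\<And>x. norm (f x) \<le> K * norm x" and lin: "clinear f" using assms(1) by (auto simp: bop_def)
  have "((\<lambda>n. norm (g n - x)) \<longlongrightarrow> 0) F" using assms(2) by (simp add: LIM_zero tendsto_norm_zero)
  from tendsto_mult_left[OF this, of K] have lim: "((\<lambda>n. K * norm (g n - x)) \<longlongrightarrow> 0) F" by simp
  have "\<forall>\<^sub>F n in F. norm (f (g n) - f x) \<le> K * norm (g n - x)"
    using K by (simp add: clinear_simps(5)[OF lin, symmetric])
  then show ?thesis by (rule Lim_null[THEN iffD2, OF Lim_null_comparison[OF _ lim]])
qed

text \<open>Compactness by subsequences passes directly to sums and to compositions with bounded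
  maps, such as the components and embeddings of an orthogonal sum.\<close>

definition seq_compact_op :: "('a::complex_hilbert \<Rightarrow> 'b::complex_hilbert) \<Rightarrow> bool" where
  "seq_compact_op T \<longleftrightarrow> clinear T \<and>
     (\<forall>v. (\<forall>n. norm (v n) \<le> 1) \<longrightarrow> (\<exists>r l. strict_mono r \<and> (\<lambda>n. T (v (r n :: nat))) \<longlonglongrightarrow> l))"

lemma compact_operator_seq_compact:
  assumes "compact_operator T" shows "seq_compact_op T"
  unfolding seq_compact_op_def
proof (intro conjI allI impI)
  have "Vector_Spaces.linear scaleC scaleC T" using assms by (simp add: compact_operator_def)
  then interpret l: Vector_Spaces.linear scaleC scaleC T .
  show "clinear T" unfolding clinear_def using l.add l.scale by blast
  fix v :: "nat \<Rightarrow> 'a" assume "\<forall>n. norm (v n) \<le> 1"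
  then have "T (v n) \<in> closure (T ` cball 0 1)" for n by (intro closure_subset[THEN subsetD]) auto
  moreover have "compact (closure (T ` cball 0 1))" using assms by (simp add: compact_operator_def)
  ultimately obtain l r where "strict_mono (r :: nat \<Rightarrow> nat)" "((\<lambda>n. T (v n)) \<circ> r) \<longlonglongrightarrow> l"
    unfolding compact_def by (metis (no_types, lifting))
  then show "\<exists>r l. strict_mono r \<and> (\<lambda>n. T (v (r n :: nat))) \<longlonglongrightarrow> l" by (auto simp: comp_def)
qed

text \<open>An unbounded map would send some vectors of norm at most 1 to vectors of norm at least
  k, for every k, and no subsequence of these converges.\<close>

lemma seq_compact_op_bop:
  assumes "seq_compact_op T" shows "bop T"
proof -
  have lin: "clinear T" using assms by (simp add: seq_compact_op_def)
  have "\<exists>K>0. \<forall>x. norm (T x) \<le> K * norm x"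
  proof (rule ccontr)
    assume n: "\<not> ?thesis"
    have "\<exists>x. norm x \<le> 1 \<and> real k \<le> norm (T x)" for k
    proof -
      have "\<not> (\<forall>x. norm (T x) \<le> (real k + 1) * norm x)" using n by (auto simp: not_le add_pos_nonneg)
      then obtain x where x: "(real k + 1) * norm x < norm (T x)" by (auto simp: not_le)
      then have "x \<noteq> 0" using clinear_simps(3)[OF lin] by auto
      have "norm (T (of_real (1 / norm x) *\<^sub>C x)) = norm (T x) / norm x"
        unfolding clinear_simps(2)[OF lin] norm_scaleC using \<open>x \<noteq> 0\<close> by (simp add: norm_divide)
      also have "\<dots> \<ge> real k + 1" using x \<open>x \<noteq> 0\<close> by (simp add: field_simps)
      finally have "real k \<le> norm (T (of_real (1 / norm x) *\<^sub>C x))" by simp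
      moreover have "norm (of_real (1 / norm x) *\<^sub>C x) \<le> 1" using \<open>x \<noteq> 0\<close> by (simp add: norm_scaleC norm_divide)
      ultimately show ?thesis by blast
    qed
    then obtain v where v: "\<And>k. norm (v k) \<le> 1" "\<And>k. real k \<le> norm (T (v k))" by metis
    then obtain r l where r: "strict_mono (r :: nat \<Rightarrow> nat)" "(\<lambda>n. T (v (r n))) \<longlonglongrightarrow> l"
      using assms unfolding seq_compact_op_def by blast
    then have "Bseq (\<lambda>n. T (v (r n)))" by (intro convergent_imp_Bseq convergentI)
    then obtain K where K: "\<And>n. norm (T (v (r n))) \<le> K" by (auto simp: Bseq_def)
    obtain N where "K < real N" using reals_Archimedean2 by blast
    also have "real N \<le> real (r N)" using seq_suble[OF r(1)] by simp
    also have "\<dots> \<le> K" using v(2) K order_trans by blast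
    finally show False by simp
  qed
  with lin show ?thesis by (simp add: bop_def)
qed

lemma bop_compose: "bop f \<Longrightarrow> bop g \<Longrightarrow> bop (\<lambda>x. f (g x))"
proof -
  assume f: "bop f" and g: "bop g"
  then obtain K L where K: "K > 0" "\<And>x. norm (f x) \<le> K * norm x" and L: "L > 0" "\<And>x. norm (g x) \<le> L * norm x"
    by (auto simp: bop_def)
  have "norm (f (g x)) \<le> K * L * norm x" for x
    using order_trans[OF K(2)[of "g x"] mult_left_mono[OF L(2)[of x], of K]] K(1) by (simp add: mult.assoc)
  moreover have "clinear (\<lambda>x. f (g x))" using f g by (simp add: bop_def clinear_def)
  ultimately show ?thesis using K(1) L(1) unfolding bop_def by (metis mult_pos_pos)
qed

lemma seq_compact_op_compose:
  fixes T :: "'a::complex_hilbert \<Rightarrow> 'b::complex_hilbert" and L :: "'b \<Rightarrow> 'c::complex_hilbert"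
    and R :: "'d::complex_hilbert \<Rightarrow> 'a"
  assumes T: "seq_compact_op T" and L: "bop L" and R: "bop R"
  shows "seq_compact_op (\<lambda>x. L (T (R x)))"
  unfolding seq_compact_op_def
proof (intro conjI allI impI)
  show "clinear (\<lambda>x. L (T (R x)))" using bop_compose[OF L bop_compose[OF seq_compact_op_bop[OF T] R]] by (simp add: bop_def)
  fix v :: "nat \<Rightarrow> 'd" assume v: "\<forall>n. norm (v n) \<le> 1"
  obtain K where K: "K > 0" "\<And>x. norm (R x) \<le> K * norm x" using R unfolding bop_def by blast
  have T': "clinear T" using T by (simp add: seq_compact_op_def)
  have "norm (of_real (1 / K) *\<^sub>C R (v n)) \<le> 1" for n
  proof -
    have "norm (R (v n)) \<le> K * 1" using K(2)[of "v n"] v K(1) by (meson mult_left_mono order_trans less_imp_le)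
    then show ?thesis using K(1) by (simp add: norm_scaleC norm_divide)
  qed
  then have "\<exists>r l. strict_mono (r :: nat \<Rightarrow> nat) \<and> (\<lambda>n. T (of_real (1 / K) *\<^sub>C R (v (r n)))) \<longlonglongrightarrow> l"
    using T[unfolded seq_compact_op_def, THEN conjunct2, rule_format, of "\<lambda>n. of_real (1 / K) *\<^sub>C R (v n)"] by simp
  then obtain r l where r: "strict_mono (r :: nat \<Rightarrow> nat)" "(\<lambda>n. T (of_real (1 / K) *\<^sub>C R (v (r n)))) \<longlonglongrightarrow> l"
    by blast
  have "(\<lambda>n. K *\<^sub>R T (of_real (1 / K) *\<^sub>C R (v (r n)))) \<longlonglongrightarrow> K *\<^sub>R l" by (intro tendsto_intros r)
  moreover have "K *\<^sub>R T (of_real (1 / K) *\<^sub>C x) = T x" for x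
  proof -
    have "K *\<^sub>R T (of_real (1 / K) *\<^sub>C x) = (of_real (K * (1 / K))) *\<^sub>C T x"
      by (simp only: clinear_simps(2)[OF T'] scaleR_scaleC scaleC_scaleC of_real_mult)
    then show ?thesis using K(1) by simp
  qed
  ultimately have "(\<lambda>n. L (T (R (v (r n))))) \<longlonglongrightarrow> L (K *\<^sub>R l)" by (intro bop_tendsto[OF L]) simp
  then show "\<exists>r l. strict_mono r \<and> (\<lambda>n. L (T (R (v (r n :: nat))))) \<longlonglongrightarrow> l" using r(1) by blast
qed

lemma seq_compact_op_add:
  assumes S: "seq_compact_op S" and T: "seq_compact_op T"
  shows "seq_compact_op (\<lambda>x. S x + T x)"
  unfolding seq_compact_op_def
proof (intro conjI allI impI)
  show "clinear (\<lambda>x. S x + T x)"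
    using S T by (simp add: seq_compact_op_def clinear_def scaleC_add_right add_ac)
  fix v :: "nat \<Rightarrow> 'a" assume v: "\<forall>n. norm (v n) \<le> 1"
  then obtain r l where r: "strict_mono (r :: nat \<Rightarrow> nat)" "(\<lambda>n. S (v (r n))) \<longlonglongrightarrow> l"
    using S unfolding seq_compact_op_def by blast
  have "\<forall>n. norm (v (r n)) \<le> 1" using v by simp
  then obtain q m where q: "strict_mono (q :: nat \<Rightarrow> nat)" "(\<lambda>n. T (v (r (q n)))) \<longlonglongrightarrow> m"
    using T[unfolded seq_compact_op_def, THEN conjunct2, rule_format, of "\<lambda>n. v (r n)"] by blast
  have "(\<lambda>n. S (v (r (q n)))) \<longlonglongrightarrow> l" using LIMSEQ_subseq_LIMSEQ[OF r(2) q(1)] by (simp add: comp_def)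
  from tendsto_add[OF this q(2)] show "\<exists>r l. strict_mono r \<and> (\<lambda>n. S (v (r n :: nat)) + T (v (r n))) \<longlonglongrightarrow> l"
    using strict_mono_o[OF r(1) q(1)] by (auto simp: comp_def)
qed

lemma seq_compact_op_sum:
  "finite I \<Longrightarrow> (\<And>i. i \<in> I \<Longrightarrow> seq_compact_op (T i)) \<Longrightarrow> seq_compact_op (\<lambda>x. \<Sum>i\<in>I. T i x)"
proof (induction I rule: finite_induct)
  case empty
  have "strict_mono (\<lambda>n::nat. n)" by (simp add: strict_mono_def)
  then show ?case by (auto simp: seq_compact_op_def clinear_def intro!: exI[of _ "\<lambda>n. n"])
qed (simp add: seq_compact_op_add)

lemma seq_compact_op_uminus:
  assumes "seq_compact_op T" shows "seq_compact_op (\<lambda>x. - T x)"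
proof -
  have "bop (\<lambda>x :: 'b. - x)" unfolding bop_def clinear_def by (auto intro: exI[of _ 1])
  moreover have "bop (\<lambda>x :: 'a. x)" unfolding bop_def clinear_def by (auto intro: exI[of _ 1])
  ultimately show ?thesis using seq_compact_op_compose[OF assms] by blast
qed

section \<open>Eigensystems and the variational principle\<close>

definition evalue :: "('h::complex_hilbert \<Rightarrow> 'h) \<Rightarrow> 'h \<Rightarrow> real" where
  "evalue T e = Re (cinner e (T e))"

definition orthonormal :: "'h::complex_hilbert set \<Rightarrow> bool" where
  "orthonormal E \<longleftrightarrow> (\<forall>e\<in>E. \<forall>e'\<in>E. cinner e e' = (if e = e' then 1 else 0))"

definition eigensystem :: "('h::complex_hilbert \<Rightarrow> 'h) \<Rightarrow> 'h set \<Rightarrow> bool" where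
  "eigensystem T E \<longleftrightarrow> orthonormal E \<and> (\<forall>e\<in>E. T e = of_real (evalue T e) *\<^sub>C e \<and> evalue T e \<noteq> 0)"

text \<open>Only nonzero eigenvalues are listed and the kernel is left out. Completeness is
  maximality, which Zorn's lemma provides at once; that nothing but the kernel remains is derived
  from it below.\<close>

definition complete_eigensystem :: "('h::complex_hilbert \<Rightarrow> 'h) \<Rightarrow> 'h set \<Rightarrow> bool" where
  "complete_eigensystem T E \<longleftrightarrow> eigensystem T E \<and> (\<forall>F. eigensystem T F \<longrightarrow> E \<subseteq> F \<longrightarrow> F = E)"

lemma complete_eigensystem_exists: "\<exists>E. complete_eigensystem T E"
proof -
  have "\<exists>E\<in>{E. eigensystem T E}. \<forall>F\<in>{E. eigensystem T E}. E \<subseteq> F \<longrightarrow> F = E"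
  proof (rule subset_Zorn')
    fix C assume C: "subset.chain {E. eigensystem T E} C"
    have "orthonormal (\<Union>C)" unfolding orthonormal_def
    proof (intro ballI)
      fix e e' assume "e \<in> \<Union>C" "e' \<in> \<Union>C"
      then obtain X Y where XY: "X \<in> C" "e \<in> X" "Y \<in> C" "e' \<in> Y" by auto
      then have "X \<subseteq> Y \<or> Y \<subseteq> X" using C by (auto simp: subset.chain_def)
      then obtain Z where "Z \<in> C" "e \<in> Z" "e' \<in> Z" using XY by blast
      moreover have "eigensystem T Z" using \<open>Z \<in> C\<close> C by (auto simp: subset.chain_def)
      ultimately show "cinner e e' = (if e = e' then 1 else 0)" by (simp add: eigensystem_def orthonormal_def)
    qed
    moreover have "\<forall>e\<in>\<Union>C. T e = of_real (evalue T e) *\<^sub>C e \<and> evalue T e \<noteq> 0"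
      using C unfolding subset.chain_def eigensystem_def by blast
    ultimately show "\<Union>C \<in> {E. eigensystem T E}" by (simp add: eigensystem_def)
  qed
  then show ?thesis by (auto simp: complete_eigensystem_def)
qed

text \<open>The supremum of the quadratic form on an invariant subspace is attained: a maximizing sequence
  \<open>v\<close> satisfies \<open>s v - T v \<rightarrow> 0\<close> by the Cauchy-Schwarz inequality for the form of \<open>s - T\<close>.\<close>

lemma form_maximum_attained:
  assumes T: "seq_compact_op T" and sa: "selfadjoint T"
    and W: "\<And>w. w \<in> W \<Longrightarrow> \<exists>c. T w = c *\<^sub>C w"
    and v0: "\<forall>w\<in>W. cinner w v0 = 0" "y * (norm v0)\<^sup>2 < Re (cinner v0 (T v0))" and y: "0 < y"
  shows "\<exists>u s. (\<forall>w\<in>W. cinner w u = 0) \<and> norm u = 1 \<and> y < s \<and> T u = of_real s *\<^sub>C u"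
proof -
  define V where "V = {v. \<forall>w\<in>W. cinner w v = 0}"
  obtain K where K: "K > 0" "\<And>x. norm (T x) \<le> K * norm x" and lin: "clinear T"
    using seq_compact_op_bop[OF T] by (auto simp: bop_def)
  have saD: "cinner (T x) z = cinner x (T z)" for x z using sa by (simp add: selfadjoint_def)
  have TV: "T v \<in> V" if "v \<in> V" for v
  proof -
    have "cinner w (T v) = 0" if w: "w \<in> W" for w
    proof -
      obtain c where c: "T w = c *\<^sub>C w" using W[OF w] by auto
      have "cinner w (T v) = cinner (T w) v" by (simp add: saD)
      then show ?thesis using \<open>v \<in> V\<close> w by (simp add: c cinner_scaleC_left V_def)
    qed
    then show ?thesis by (simp add: V_def)
  qed
  have Vs: "c *\<^sub>C v + c' *\<^sub>C v' \<in> V" if "v \<in> V" "v' \<in> V" for c c' v v'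
    using that by (simp add: V_def cinner_add_right cinner_scaleC_right)
  define q where "q v = Re (cinner v (T v))" for v
  have qs: "q (of_real t *\<^sub>C v) = t\<^sup>2 * q v" for t v
    by (simp add: q_def clinear_simps(2)[OF lin] cinner_scaleC_left cinner_scaleC_right power2_eq_square)
  have qK: "\<bar>q v\<bar> \<le> K * (norm v)\<^sup>2" for v
  proof -
    have "\<bar>q v\<bar> \<le> norm v * norm (T v)" unfolding q_def using abs_Re_le_cmod cmod_cinner_le order_trans by blast
    also have "\<dots> \<le> norm v * (K * norm v)" by (intro mult_left_mono K(2)) auto
    finally show ?thesis by (simp add: power2_eq_square mult_ac)
  qed
  define S where "S = q ` {v\<in>V. norm v = 1}"
  define s where "s = Sup S"
  have "v0 \<noteq> 0" using v0(2) clinear_simps(3)[OF lin] by auto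
  define v1 where "v1 = of_real (1 / norm v0) *\<^sub>C v0"
  have v1: "v1 \<in> V" "norm v1 = 1" "y < q v1"
  proof -
    show "v1 \<in> V" using Vs[of v0 v0 _ 0] v0(1) by (simp add: V_def v1_def cinner_scaleC_right)
    show "norm v1 = 1" using \<open>v0 \<noteq> 0\<close> by (simp add: v1_def norm_scaleC norm_divide)
    show "y < q v1" unfolding v1_def qs using v0(2) \<open>v0 \<noteq> 0\<close> by (simp add: q_def power_divide field_simps)
  qed
  have bdd: "bdd_above S"
  proof (rule bdd_aboveI[of _ K])
    fix z assume "z \<in> S"
    then obtain v where "norm v = 1" "z = q v" by (auto simp: S_def)
    then show "z \<le> K" using qK[of v] by simp
  qed
  have "q v1 \<le> s" unfolding s_def by (rule cSup_upper[OF _ bdd]) (use v1 in \<open>auto simp: S_def\<close>)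
  with v1 y have s: "y < s" "0 < s" by auto
  define p where "p v = s * (norm v)\<^sup>2 - q v" for v
  have p0: "0 \<le> p v" if v: "v \<in> V" for v
  proof (cases "v = 0")
    case False
    define u where "u = of_real (1 / norm v) *\<^sub>C v"
    have "u \<in> V" using v by (simp add: V_def u_def cinner_scaleC_right)
    moreover have "norm u = 1" using False by (simp add: u_def norm_scaleC norm_divide)
    ultimately have "q u \<le> s" unfolding s_def by (intro cSup_upper[OF _ bdd]) (auto simp: S_def)
    then show ?thesis using False unfolding u_def qs p_def by (simp add: power_divide field_simps)
  qed (simp add: p_def q_def)
  define A where "A v = of_real s *\<^sub>C v - T v" for v
  have pA: "p v = Re (cinner v (A v))" for v
    by (simp add: p_def q_def A_def cinner_diff_right cinner_scaleC_right cinner_self)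
  have AV: "A v \<in> V" if "v \<in> V" for v
    using that TV[OF that] by (simp add: A_def V_def cinner_diff_right cinner_scaleC_right)
  have Asa: "cinner (A x) z = cinner x (A z)" for x z
    by (simp add: A_def cinner_diff_right cinner_diff_left cinner_scaleC_left cinner_scaleC_right saD)
  have key: "(norm (A v))\<^sup>2 \<le> (s + K) * p v" if v: "v \<in> V" for v
  proof -
    \<comment> \<open>The form of \<open>A\<close> is nonnegative at v - t A v; this
      \<open>t\<close> balances the linear against the quadratic term and yields the bound of
      Cauchy-Schwarz type.\<close>
    define t where "t = 1 / (s + K)"
    have t: "0 < t" "t * (s + K) = 1" using s K by (auto simp: t_def)
    define w where "w = A v"
    have Alin: "A (v - of_real t *\<^sub>C w) = A v - of_real t *\<^sub>C A w"
      by (simp add: A_def clinear_simps[OF lin] cvec.scale_right_diff_distrib cvec.scale_left_commute)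
    have "v - of_real t *\<^sub>C w \<in> V" using v AV[OF v] by (simp add: w_def V_def cinner_diff_right cinner_scaleC_right)
    then have "0 \<le> p (v - of_real t *\<^sub>C w)" by (rule p0)
    also have "\<dots> = p v - 2 * t * (norm w)\<^sup>2 + t\<^sup>2 * p w"
    proof -
      have "cinner v (A w) = cinner w w" "cinner w (A v) = cinner w w" using Asa[of v w] by (simp_all add: w_def)
      then show ?thesis unfolding pA Alin
        by (simp add: cinner_diff_left cinner_diff_right cinner_scaleC_left cinner_scaleC_right cinner_self power2_eq_square algebra_simps)
    qed
    also have "p w \<le> (s + K) * (norm w)\<^sup>2" using qK[of w] by (simp add: p_def algebra_simps abs_le_iff)
    finally have "0 \<le> p v - 2 * t * (norm w)\<^sup>2 + t\<^sup>2 * ((s + K) * (norm w)\<^sup>2)"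
      using t(1) by (simp add: mult_left_mono)
    also have "t\<^sup>2 * ((s + K) * (norm w)\<^sup>2) = t * (norm w)\<^sup>2" using t(2) by (simp add: power2_eq_square mult.assoc[symmetric])
    finally have "t * (norm w)\<^sup>2 \<le> p v" by simp
    then show ?thesis using t s K unfolding w_def t_def by (simp add: field_simps)
  qed
  have "\<exists>v. v \<in> V \<and> norm v = 1 \<and> s - 1 / real (Suc k) < q v" for k
  proof -
    have "s - 1 / real (Suc k) < Sup S" by (simp add: s_def)
    then obtain z where "z \<in> S" "s - 1 / real (Suc k) < z"
      using less_cSup_iff[OF _ bdd] v1 by (auto simp: S_def)
    then show ?thesis by (auto simp: S_def)
  qed
  then obtain v where v: "\<And>k. v k \<in> V" "\<And>k. norm (v k) = 1" "\<And>k. s - 1 / real (Suc k) < q (v k)" by metis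
  have A0: "(\<lambda>k. A (v k)) \<longlonglongrightarrow> 0"
  proof -
    have "(norm (A (v k)))\<^sup>2 \<le> (s + K) * (1 / real (Suc k))" for k
      using key[OF v(1)[of k]] mult_left_mono[of "p (v k)" "1 / real (Suc k)" "s + K"] v(2,3)[of k] s K by (simp add: p_def)
    moreover have "(\<lambda>k. (s + K) * (1 / real (Suc k))) \<longlonglongrightarrow> 0"
      using tendsto_mult_left[OF LIMSEQ_inverse_real_of_nat, of "s + K"] by (simp add: inverse_eq_divide)
    ultimately have "(\<lambda>k. (norm (A (v k)))\<^sup>2) \<longlonglongrightarrow> 0"
      by (intro Lim_null_comparison[of "\<lambda>k. (norm (A (v k)))\<^sup>2"]) auto
    then have "(\<lambda>k. sqrt ((norm (A (v k)))\<^sup>2)) \<longlonglongrightarrow> sqrt 0" by (rule tendsto_real_sqrt)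
    then show ?thesis by (simp add: tendsto_norm_zero_iff)
  qed
  \<comment> \<open>Along a subsequence T v converges, and s v - T v tends to 0 with
    \<open>s > 0\<close>, so v itself converges.\<close>
  obtain r l where r: "strict_mono (r :: nat \<Rightarrow> nat)" "(\<lambda>n. T (v (r n))) \<longlonglongrightarrow> l"
    using T v(2) unfolding seq_compact_op_def by (metis order_refl)
  have "(\<lambda>n. A (v (r n))) \<longlonglongrightarrow> 0" using LIMSEQ_subseq_LIMSEQ[OF A0 r(1)] by (simp add: comp_def)
  from tendsto_add[OF this r(2)] have "(\<lambda>n. s *\<^sub>R v (r n)) \<longlonglongrightarrow> l" by (simp add: A_def scaleR_scaleC)
  from tendsto_scaleR[OF tendsto_const this, of "1 / s"]
  have vu: "(\<lambda>n. v (r n)) \<longlonglongrightarrow> (1 / s) *\<^sub>R l" using s by simp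
  define u where "u = (1 / s) *\<^sub>R l"
  have vu: "(\<lambda>n. v (r n)) \<longlonglongrightarrow> u" using vu by (simp add: u_def)
  have "norm u = 1" using tendsto_norm[OF vu] v(2) by (simp add: LIMSEQ_const_iff)
  moreover have "cinner w u = 0" if "w \<in> W" for w
    using tendsto_cinner[OF vu, of w] v(1) that by (simp add: V_def LIMSEQ_const_iff)
  moreover have "T u = of_real s *\<^sub>C u"
  proof -
    have "T u = l" using bop_tendsto[OF seq_compact_op_bop[OF T] vu] r(2) LIMSEQ_unique by blast
    then show ?thesis using s by (simp add: u_def scaleR_scaleC[symmetric])
  qed
  ultimately show ?thesis using s(1) by blast
qed

lemma evalue_eq: "T e = of_real x *\<^sub>C e \<Longrightarrow> norm e = 1 \<Longrightarrow> evalue T e = x"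
  by (simp add: evalue_def cinner_scaleC_right cinner_self)

lemma eigenvectors_orthogonal:
  assumes "selfadjoint T" "T u = of_real x *\<^sub>C u" "T v = of_real y *\<^sub>C v" "x \<noteq> y"
  shows "cinner u v = 0"
proof -
  have "cinner (T u) v = cinner u (T v)" using assms(1) by (simp add: selfadjoint_def)
  then show ?thesis using assms by (simp add: cinner_scaleC_left cinner_scaleC_right)
qed

lemma eigensystem_norm: "eigensystem T E \<Longrightarrow> e \<in> E \<Longrightarrow> norm e = 1"
proof -
  assume "eigensystem T E" "e \<in> E"
  then have "cinner e e = 1" by (simp add: eigensystem_def orthonormal_def)
  then have "(norm e)\<^sup>2 = 1" unfolding cinner_self by (metis of_real_eq_1_iff)
  then have "norm e = 1 \<or> norm e = - 1" by (simp add: power2_eq_1_iff)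
  then show "norm e = 1" using norm_ge_zero[of e] by linarith
qed

text \<open>Eigenvectors for different eigenvalues are orthogonal, so \<open>u\<close> is orthogonal
  to all of \<open>E\<close>; a nonzero \<open>u\<close> could be normalized and adjoined, against
  maximality.\<close>

lemma complete_eigensystem_no_more:
  assumes sa: "selfadjoint T" and E: "complete_eigensystem T E" and lin: "clinear T"
    and u: "T u = of_real x *\<^sub>C u" "x \<noteq> 0" "\<And>e. e \<in> E \<Longrightarrow> evalue T e = x \<Longrightarrow> cinner e u = 0"
  shows "u = 0"
proof (rule ccontr)
  assume "u \<noteq> 0"
  have es: "eigensystem T E" using E by (simp add: complete_eigensystem_def)
  define v where "v = of_real (1 / norm u) *\<^sub>C u"
  have nv: "norm v = 1" using \<open>u \<noteq> 0\<close> by (simp add: v_def norm_scaleC norm_divide)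
  have Tv: "T v = of_real x *\<^sub>C v"
    unfolding v_def clinear_simps(2)[OF lin] u(1) by (rule cvec.scale_left_commute)
  have ev: "evalue T v = x" by (rule evalue_eq[where T = T and x = x, OF Tv nv])
  have orth: "cinner e v = 0" if e: "e \<in> E" for e
  proof (cases "evalue T e = x")
    case True then show ?thesis using u(3)[OF e] by (simp add: v_def cinner_scaleC_right)
  next
    case False
    have "T e = of_real (evalue T e) *\<^sub>C e" using es e by (simp add: eigensystem_def)
    from eigenvectors_orthogonal[OF sa this Tv False] show ?thesis .
  qed
  then have orth': "cinner v e = 0" if "e \<in> E" for e using that cinner_commute[of v e] by simp
  have vE: "v \<notin> E" using orth[of v] nv by (auto simp: cinner_self)
  have "cinner v v = 1" using nv by (simp add: cinner_self)
  then have "orthonormal (insert v E)"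
    using es orth orth' vE unfolding eigensystem_def orthonormal_def by (metis insert_iff)
  then have "eigensystem T (insert v E)"
    using es Tv ev u(2) by (simp add: eigensystem_def)
  then show False using E vE by (auto simp: complete_eigensystem_def)
qed

text \<open>A larger value of the form would produce an eigenvector with eigenvalue above
  \<open>y\<close> that is orthogonal to all members with eigenvalue at least \<open>y\<close>,
  which maximality excludes. This is the half of the variational principle that Weyl's inequality
  needs.\<close>

lemma complete_eigensystem_form_le:
  assumes T: "seq_compact_op T" and sa: "selfadjoint T" and E: "complete_eigensystem T E"
    and v: "\<And>e. e \<in> E \<Longrightarrow> y \<le> evalue T e \<Longrightarrow> cinner e v = 0" and y: "0 < y"
  shows "Re (cinner v (T v)) \<le> y * (norm v)\<^sup>2"
proof (rule ccontr)
  assume n: "\<not> ?thesis"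
  have es: "eigensystem T E" using E by (simp add: complete_eigensystem_def)
  let ?W = "{e\<in>E. y \<le> evalue T e}"
  have "\<exists>c. T w = c *\<^sub>C w" if "w \<in> ?W" for w using es that by (auto simp: eigensystem_def)
  then obtain u s where u: "\<forall>w\<in>?W. cinner w u = 0" "norm u = 1" "y < s" "T u = of_real s *\<^sub>C u"
    using form_maximum_attained[OF T sa, of ?W v y] v n y by auto
  have "u = 0"
    by (rule complete_eigensystem_no_more[OF sa E _ u(4)]) (use T u y in \<open>auto simp: seq_compact_op_def\<close>)
  with u(2) show False by simp
qed

lemma evalue_uminus: "evalue (\<lambda>x. - T x) e = - evalue T e"
  by (simp add: evalue_def cinner_minus_right)

lemma selfadjoint_uminus: "selfadjoint T \<Longrightarrow> selfadjoint (\<lambda>x. - T x)"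
  by (simp add: selfadjoint_def cinner_minus_left cinner_minus_right)

lemma complete_eigensystem_uminus:
  assumes "complete_eigensystem T E" shows "complete_eigensystem (\<lambda>x. - T x) E"
proof -
  have "eigensystem (\<lambda>x. - T x) F \<longleftrightarrow> eigensystem T F" for F
    unfolding eigensystem_def evalue_uminus by simp
  then show ?thesis using assms by (simp add: complete_eigensystem_def)
qed

text \<open>Testing T e - T e' against e gives the eigenvalue of e, so the images of different
  members are at distance at least \<open>y\<close>, and an infinite family has no convergent
  subsequence of images.\<close>

lemma eigensystem_finite:
  assumes T: "seq_compact_op T" and es: "eigensystem T E" and y: "0 < y"
  shows "finite {e\<in>E. y \<le> \<bar>evalue T e\<bar>}"
proof (rule ccontr)
  let ?F = "{e\<in>E. y \<le> \<bar>evalue T e\<bar>}"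
  assume "infinite ?F"
  then obtain e :: "nat \<Rightarrow> 'a" where e: "inj e" "range e \<subseteq> ?F" using infinite_countable_subset by blast
  have eE: "e n \<in> E" "y \<le> \<bar>evalue T (e n)\<bar>" for n using e(2) by auto
  have n1: "norm (e n) = 1" for n by (rule eigensystem_norm[OF es eE(1)])
  obtain r l where r: "strict_mono (r :: nat \<Rightarrow> nat)" "(\<lambda>n. T (e (r n))) \<longlonglongrightarrow> l"
    using T n1 unfolding seq_compact_op_def by (metis order_refl)
  have "Cauchy (\<lambda>n. T (e (r n)))" using r(2) by (rule LIMSEQ_imp_Cauchy)
  then obtain N where N: "\<And>m n. m \<ge> N \<Longrightarrow> n \<ge> N \<Longrightarrow> norm (T (e (r m)) - T (e (r n))) < y"
    using y unfolding Cauchy_iff by blast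
  let ?a = "e (r N)" and ?b = "e (r (Suc N))"
  have "r N \<noteq> r (Suc N)" using r(1) by (metis strict_mono_eq n_not_Suc_n)
  then have "?a \<noteq> ?b" using e(1) by (auto dest: injD)
  then have ab: "cinner ?a ?b = 0" using es eE by (simp add: eigensystem_def orthonormal_def)
  have aa: "cinner ?a ?a = 1" using n1 by (simp add: cinner_self)
  have Tab: "T ?a = of_real (evalue T ?a) *\<^sub>C ?a" "T ?b = of_real (evalue T ?b) *\<^sub>C ?b"
    using es eE by (simp_all add: eigensystem_def)
  have "cinner ?a (T ?a - T ?b) = of_real (evalue T ?a)"
    unfolding Tab cinner_diff_right cinner_scaleC_right aa ab by simp
  then have "\<bar>evalue T ?a\<bar> \<le> norm (T ?a - T ?b)" using cmod_cinner_le[of ?a "T ?a - T ?b"] n1 by simp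
  with N[of N "Suc N"] eE(2)[of "r N"] show False by simp
qed

lemma orthonormal_independent:
  assumes "orthonormal F" shows "cvec.independent F"
  unfolding cvec.independent_explicit_finite_subsets
proof (intro allI impI ballI)
  fix S u v assume S: "S \<subseteq> F" "finite S" "(\<Sum>v\<in>S. u v *\<^sub>C v) = 0" "v \<in> S"
  have "0 = cinner v (\<Sum>w\<in>S. u w *\<^sub>C w)" using S(3) by simp
  also have "\<dots> = (\<Sum>w\<in>S. if w = v then u v else 0)"
    unfolding cinner_sum_right cinner_scaleC_right using assms S by (intro sum.cong) (auto simp: orthonormal_def subset_iff)
  finally show "u v = 0" using S by simp
qed

text \<open>The part of an eigenvector not captured by the members with its eigenvalue lies in the
  same eigenspace and is orthogonal to them, hence 0.\<close>

lemma complete_eigensystem_eigenspace: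
  assumes T: "seq_compact_op T" and sa: "selfadjoint T" and E: "complete_eigensystem T E" and x: "x \<noteq> 0"
  shows "finite {e\<in>E. evalue T e = x}" "v \<in> eigenspace T x \<Longrightarrow> v = (\<Sum>e\<in>{e\<in>E. evalue T e = x}. cinner e v *\<^sub>C e)"
    "(\<Sum>e\<in>{e\<in>E. evalue T e = x}. c e *\<^sub>C e) \<in> eigenspace T x"
proof -
  have es: "eigensystem T E" using E by (simp add: complete_eigensystem_def)
  have lin: "clinear T" using T by (simp add: seq_compact_op_def)
  let ?F = "{e\<in>E. evalue T e = x}"
  show fin: "finite ?F"
    by (rule finite_subset[OF _ eigensystem_finite[OF T es, of "\<bar>x\<bar>"]]) (use x in auto)
  have Te: "T e = of_real x *\<^sub>C e" if "e \<in> ?F" for e using es that by (auto simp: eigensystem_def)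
  have sum: "T (\<Sum>e\<in>?F. c e *\<^sub>C e) = of_real x *\<^sub>C (\<Sum>e\<in>?F. c e *\<^sub>C e)" for c
    unfolding clinear_sum[OF lin] cvec.scale_sum_right
    by (intro sum.cong refl) (simp add: clinear_simps(2)[OF lin] Te cvec.scale_left_commute)
  then show "(\<Sum>e\<in>?F. c e *\<^sub>C e) \<in> eigenspace T x" by (simp add: eigenspace_def)
  assume v: "v \<in> eigenspace T x"
  define u where "u = v - (\<Sum>e\<in>?F. cinner e v *\<^sub>C e)"
  have "u = 0"
  proof (rule complete_eigensystem_no_more[OF sa E lin _ x])
    show "T u = of_real x *\<^sub>C u"
      unfolding u_def clinear_simps(5)[OF lin] sum using v by (simp add: eigenspace_def cvec.scale_right_diff_distrib)
    fix e assume e: "e \<in> E" "evalue T e = x"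
    have "cinner e (\<Sum>e'\<in>?F. cinner e' v *\<^sub>C e') = (\<Sum>e'\<in>?F. if e' = e then cinner e v else 0)"
      unfolding cinner_sum_right cinner_scaleC_right using es e by (intro sum.cong) (auto simp: eigensystem_def orthonormal_def)
    then show "cinner e u = 0" using e fin by (simp add: u_def cinner_diff_right)
  qed
  then show "v = (\<Sum>e\<in>?F. cinner e v *\<^sub>C e)" by (simp add: u_def)
qed

lemma EV_op_enumerates:
  assumes T: "seq_compact_op T" and sa: "selfadjoint T" and E: "complete_eigensystem T E"
  shows "enumerates (EV_op T) E (evalue T)"
  unfolding enumerates_def
proof (intro conjI allI impI)
  have es: "eigensystem T E" using E by (simp add: complete_eigensystem_def)
  show "finite {e\<in>E. y \<le> \<bar>evalue T e\<bar>}" if "0 < y" for y by (rule eigensystem_finite[OF T es that])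
  fix x :: real assume x: "x \<noteq> 0"
  let ?F = "{e\<in>E. evalue T e = x}"
  note F = complete_eigensystem_eigenspace[OF T sa E x]
  have sub: "eigenspace T x \<subseteq> cvec.span ?F"
  proof
    fix v assume "v \<in> eigenspace T x"
    then have v: "v = (\<Sum>e\<in>?F. cinner e v *\<^sub>C e)" by (rule F(2))
    show "v \<in> cvec.span ?F" by (subst v) (intro cvec.span_sum cvec.span_scale cvec.span_base)
  qed
  have "cvec.dim (eigenspace T x) = card ?F"
  proof (rule cvec.dim_unique[OF _ sub _ refl])
    show "?F \<subseteq> eigenspace T x" using es by (auto simp: eigensystem_def eigenspace_def)
    show "cvec.independent ?F" by (rule orthonormal_independent) (use es in \<open>auto simp: eigensystem_def orthonormal_def\<close>)
  qed
  with sub F(1) show "EV_op T x = enat (card ?F)" unfolding EV_op_def by auto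
qed

lemma orthonormal_expansion:
  assumes "orthonormal F" "finite F" and v: "v = (\<Sum>e\<in>F. c e *\<^sub>C e)"
  shows "e \<in> F \<Longrightarrow> cinner e v = c e" "(norm v)\<^sup>2 = (\<Sum>e\<in>F. (cmod (c e))\<^sup>2)"
proof -
  show 1: "cinner e v = c e" if "e \<in> F" for e
  proof -
    have "cinner e v = (\<Sum>e'\<in>F. if e' = e then c e else 0)"
      unfolding v cinner_sum_right cinner_scaleC_right using assms(1) that by (intro sum.cong) (auto simp: orthonormal_def)
    then show ?thesis using that assms(2) by simp
  qed
  have "of_real ((norm v)\<^sup>2) = (\<Sum>e\<in>F. cnj (c e) * cinner e v)"
    unfolding cinner_self[symmetric] by (subst (1) v) (simp add: cinner_sum_left cinner_scaleC_left)
  also have "\<dots> = of_real (\<Sum>e\<in>F. (cmod (c e))\<^sup>2)"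
    using 1 by (simp add: complex_norm_square mult.commute del: of_real_power)
  finally show "(norm v)\<^sup>2 = (\<Sum>e\<in>F. (cmod (c e))\<^sup>2)" by (simp only: of_real_eq_iff)
qed

text \<open>The dimension count used for matrices. Only the finitely many eigenvalues above positive
  levels enter: one form is computed on a finite combination of eigenvectors, the other is bounded
  by the variational principle.\<close>

lemma weyl_count_op:
  assumes T: "seq_compact_op T" "selfadjoint T" "complete_eigensystem T E"
    and S: "seq_compact_op S" "selfadjoint S" "complete_eigensystem S F"
    and le: "\<And>v. Re (cinner v (T v)) \<le> Re (cinner v (S v)) + \<eta> * (norm v)\<^sup>2"
    and \<eta>: "\<eta> < \<eta>'" "0 \<le> \<eta>'" "\<eta>' < x"
  shows "count_ge E (evalue T) x \<le> count_ge F (evalue S) (x - \<eta>')"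
proof (rule ccontr)
  let ?J = "{e\<in>E. x \<le> evalue T e}" and ?K = "{e\<in>F. x - \<eta>' \<le> evalue S e}"
  have es: "eigensystem T E" using T(3) by (simp add: complete_eigensystem_def)
  have lin: "clinear T" using T(1) by (simp add: seq_compact_op_def)
  have fin: "finite ?J" "finite ?K"
    using enumerates_finite_ge[OF EV_op_enumerates[OF T]] enumerates_finite_ge[OF EV_op_enumerates[OF S]] \<eta> by auto
  assume "\<not> ?thesis"
  then have "card ?K < card ?J" by (simp add: count_ge_def)
  then obtain c where c: "\<exists>j\<in>?J. c j \<noteq> 0" "\<forall>k\<in>?K. (\<Sum>j\<in>?J. cinner k j * c j) = 0"
    using underdetermined_system[of ?K ?J cinner] fin by blast
  define v where "v = (\<Sum>e\<in>?J. c e *\<^sub>C e)"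
  have on: "orthonormal ?J" using es by (auto simp: eigensystem_def orthonormal_def)
  note ex = orthonormal_expansion[OF on fin(1) v_def]
  have Tv: "T v = (\<Sum>e\<in>?J. (of_real (evalue T e) * c e) *\<^sub>C e)"
    unfolding v_def clinear_sum[OF lin]
  proof (intro sum.cong refl)
    fix e assume "e \<in> ?J"
    then have "T e = of_real (evalue T e) *\<^sub>C e" using es by (simp add: eigensystem_def)
    then show "T (c e *\<^sub>C e) = (of_real (evalue T e) * c e) *\<^sub>C e"
      by (simp add: clinear_simps(2)[OF lin] mult.commute)
  qed
  have q: "Re (cinner v (T v)) = (\<Sum>e\<in>?J. evalue T e * (cmod (c e))\<^sup>2)"
  proof -
    have "cinner v e = cnj (c e)" if "e \<in> ?J" for e using ex(1)[OF that] cinner_commute[of v e] by simp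
    then have "cinner v (T v) = (\<Sum>e\<in>?J. of_real (evalue T e * (cmod (c e))\<^sup>2))"
      unfolding Tv cinner_sum_right cinner_scaleC_right
      by (intro sum.cong refl) (simp add: complex_norm_square del: of_real_power)
    then show ?thesis by simp
  qed
  have pos: "0 < (norm v)\<^sup>2"
  proof -
    obtain j where "j \<in> ?J" "c j \<noteq> 0" using c(1) by blast
    then show ?thesis unfolding ex(2) by (intro sum_pos2[OF fin(1), of j]) auto
  qed
  have "x * (norm v)\<^sup>2 \<le> Re (cinner v (T v))"
    unfolding q ex(2) sum_distrib_left by (intro sum_mono mult_right_mono) auto
  also have "\<dots> \<le> Re (cinner v (S v)) + \<eta> * (norm v)\<^sup>2" by (rule le)
  also have "Re (cinner v (S v)) \<le> (x - \<eta>') * (norm v)\<^sup>2"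
  proof (rule complete_eigensystem_form_le[OF S])
    fix e assume "e \<in> F" "x - \<eta>' \<le> evalue S e"
    then show "cinner e v = 0" using c(2) by (simp add: v_def cinner_sum_right cinner_scaleC_right mult.commute)
  qed (use \<eta> in simp)
  finally have "(\<eta>' - \<eta>) * (norm v)\<^sup>2 \<le> 0" by (simp add: algebra_simps)
  then show False using pos \<eta> by (simp add: mult_le_0_iff)
qed

lemma counts_near_op:
  assumes T: "seq_compact_op T" "selfadjoint T" "complete_eigensystem T E"
    and S: "seq_compact_op S" "selfadjoint S" "complete_eigensystem S F"
    and le: "\<And>v. \<bar>Re (cinner v (T v)) - Re (cinner v (S v))\<bar> \<le> \<eta> * (norm v)\<^sup>2"
    and \<eta>: "\<eta> < \<eta>'" "0 \<le> \<eta>'"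
  shows "counts_near \<eta>' E (evalue T) F (evalue S)" "counts_near \<eta>' E (\<lambda>e. - evalue T e) F (\<lambda>e. - evalue S e)"
proof -
  have a: "Re (cinner v (T v)) \<le> Re (cinner v (S v)) + \<eta> * (norm v)\<^sup>2"
    "Re (cinner v (S v)) \<le> Re (cinner v (T v)) + \<eta> * (norm v)\<^sup>2" for v
    using le[of v] by (auto simp: abs_if split: if_splits)
  have b: "Re (cinner v (- T v)) \<le> Re (cinner v (- S v)) + \<eta> * (norm v)\<^sup>2"
    "Re (cinner v (- S v)) \<le> Re (cinner v (- T v)) + \<eta> * (norm v)\<^sup>2" for v
    unfolding cinner_minus_right using a[of v] by auto
  note T' = seq_compact_op_uminus[OF T(1)] selfadjoint_uminus[OF T(2)] complete_eigensystem_uminus[OF T(3)]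
  note S' = seq_compact_op_uminus[OF S(1)] selfadjoint_uminus[OF S(2)] complete_eigensystem_uminus[OF S(3)]
  show "counts_near \<eta>' E (evalue T) F (evalue S)"
    unfolding counts_near_def using weyl_count_op[OF T S a(1) \<eta>] weyl_count_op[OF S T a(2) \<eta>] by blast
  show "counts_near \<eta>' E (\<lambda>e. - evalue T e) F (\<lambda>e. - evalue S e)"
    unfolding counts_near_def
    using weyl_count_op[OF T' S' b(1) \<eta>] weyl_count_op[OF S' T' b(2) \<eta>] unfolding evalue_uminus by blast
qed

section \<open>Projections onto finite orthonormal sets\<close>

definition proj :: "'h::complex_hilbert set \<Rightarrow> 'h \<Rightarrow> 'h" where
  "proj F x = (\<Sum>e\<in>F. cinner e x *\<^sub>C e)"

lemma cinner_proj:
  assumes "orthonormal F" "finite F" "e \<in> F" shows "cinner e (proj F x) = cinner e x"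
  using orthonormal_expansion(1)[OF assms(1,2) proj_def assms(3)] .

lemma cinner_span_eq_0:
  assumes "\<And>e. e \<in> F \<Longrightarrow> cinner e u = 0" "v \<in> cvec.span F" shows "cinner v u = 0"
proof -
  have "v \<in> {v. cinner v u = 0}"
    by (rule cvec.span_induct[OF assms(2)])
      (use assms(1) in \<open>auto simp: cvec.subspace_def cinner_add_left cinner_scaleC_left\<close>)
  then show ?thesis by simp
qed

lemma norm_add_orth:
  fixes u v :: "'h::complex_hilbert"
  assumes "cinner u v = 0" shows "(norm (u + v))\<^sup>2 = (norm u)\<^sup>2 + (norm v)\<^sup>2"
proof -
  have "cinner v u = 0" using assms cinner_commute[of v u] by simp
  then have "cinner (u + v) (u + v) = cinner u u + cinner v v"
    using assms by (simp add: cinner_add_left cinner_add_right)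
  then have "of_real ((norm (u + v))\<^sup>2) = (of_real ((norm u)\<^sup>2 + (norm v)\<^sup>2) :: complex)"
    unfolding cinner_self of_real_add .
  then show ?thesis by (simp only: of_real_eq_iff)
qed

lemma proj_in_span: "proj F x \<in> cvec.span F"
  unfolding proj_def by (intro cvec.span_sum cvec.span_scale cvec.span_base)

lemma proj_best:
  assumes F: "orthonormal F" "finite F" and v: "v \<in> cvec.span F"
  shows "norm (x - proj F x) \<le> norm (x - v)"
proof -
  have "cinner e (x - proj F x) = 0" if "e \<in> F" for e using cinner_proj[OF F that] by (simp add: cinner_diff_right)
  then have "cinner (proj F x - v) (x - proj F x) = 0"
    by (rule cinner_span_eq_0[of F]) (auto intro!: cvec.span_diff proj_in_span v)
  then have "(norm ((proj F x - v) + (x - proj F x)))\<^sup>2 = (norm (proj F x - v))\<^sup>2 + (norm (x - proj F x))\<^sup>2"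
    by (rule norm_add_orth)
  then have "(norm (x - proj F x))\<^sup>2 \<le> (norm (x - v))\<^sup>2" by (simp add: algebra_simps)
  then show ?thesis by (rule power2_le_imp_le) simp
qed

lemma proj_span:
  assumes "orthonormal F" "finite F" "v \<in> cvec.span F" shows "proj F v = v"
  using proj_best[OF assms, of v] by simp

lemma orthonormal_extend:
  fixes F :: "'h::complex_hilbert set"
  assumes F: "orthonormal F" "finite F"
  shows "\<exists>G. orthonormal G \<and> finite G \<and> F \<subseteq> G \<and> x \<in> cvec.span G"
proof -
  define r where "r = x - proj F x"
  have o: "cinner e r = 0" if "e \<in> F" for e using cinner_proj[OF F that] by (simp add: r_def cinner_diff_right)
  show ?thesis
  proof (cases "r = 0")
    case True
    then have "x \<in> cvec.span F" using proj_in_span[of F x] by (simp add: r_def)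
    then show ?thesis using F by blast
  next
    case False
    define u where "u = of_real (1 / norm r) *\<^sub>C r"
    have nu: "norm u = 1" using False by (simp add: u_def norm_scaleC norm_divide)
    have ou: "cinner e u = 0" if "e \<in> F" for e using o[OF that] by (simp add: u_def cinner_scaleC_right)
    have ou': "cinner u e = 0" if "e \<in> F" for e using ou[OF that] cinner_commute[of u e] by simp
    have "u \<notin> F" using ou[of u] nu by (auto simp: cinner_self)
    then have "orthonormal (insert u F)"
      using F(1) ou ou' nu unfolding orthonormal_def by (auto simp: cinner_self)
    moreover have "x \<in> cvec.span (insert u F)"
    proof -
      have "r = of_real (norm r) *\<^sub>C u" using False by (simp add: u_def)
      then have "r \<in> cvec.span (insert u F)" by (metis cvec.span_base cvec.span_scale insertI1)
      moreover have "proj F x \<in> cvec.span (insert u F)" using proj_in_span cvec.span_mono[of F "insert u F"] by blast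
      ultimately have "r + proj F x \<in> cvec.span (insert u F)" by (rule cvec.span_add)
      then show ?thesis by (simp add: r_def)
    qed
    ultimately show ?thesis using F(2) by blast
  qed
qed

lemma orthonormal_extend_finite:
  fixes F :: "'h::complex_hilbert set"
  assumes "orthonormal F" "finite F" "finite X"
  shows "\<exists>G. orthonormal G \<and> finite G \<and> F \<subseteq> G \<and> X \<subseteq> cvec.span G"
  using assms(3)
proof (induction X rule: finite_induct)
  case empty then show ?case using assms by blast
next
  case (insert x X)
  then obtain G where G: "orthonormal G" "finite G" "F \<subseteq> G" "X \<subseteq> cvec.span G" by blast
  obtain H where H: "orthonormal H" "finite H" "G \<subseteq> H" "x \<in> cvec.span H" using orthonormal_extend[OF G(1,2)] by blast
  have "X \<subseteq> cvec.span H" using G(4) cvec.span_mono[OF H(3)] by blast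
  then show ?case using G(3) H by blast
qed

section \<open>Functional calculus and traces\<close>

lemma orth_proj_eigenspace:
  assumes T: "seq_compact_op T" "selfadjoint T" "complete_eigensystem T E" and x: "x \<noteq> 0"
  shows "orth_proj (eigenspace T x) v = proj {e\<in>E. evalue T e = x} v"
  unfolding orth_proj_def
proof (rule the_equality)
  let ?F = "{e\<in>E. evalue T e = x}"
  note F = complete_eigensystem_eigenspace[OF T x]
  have on: "orthonormal ?F" using T(3) by (auto simp: complete_eigensystem_def eigensystem_def orthonormal_def)
  have in1: "proj ?F v \<in> eigenspace T x" unfolding proj_def by (rule F(3))
  have orth: "cinner z (v - proj ?F v) = 0" if z: "z \<in> eigenspace T x" for z
  proof (rule cinner_span_eq_0[of ?F])
    show "cinner e (v - proj ?F v) = 0" if "e \<in> ?F" for e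
      using cinner_proj[OF on F(1) that] by (simp add: cinner_diff_right)
    show "z \<in> cvec.span ?F" using F(2)[OF z] proj_in_span[of ?F z] by (simp add: proj_def)
  qed
  show "proj ?F v \<in> eigenspace T x \<and> (\<forall>z\<in>eigenspace T x. cinner z (v - proj ?F v) = 0)" using in1 orth by blast
  fix y assume y: "y \<in> eigenspace T x \<and> (\<forall>z\<in>eigenspace T x. cinner z (v - y) = 0)"
  have "cinner z (y - proj ?F v) = 0" if "z \<in> eigenspace T x" for z
    using orth[OF that] y that by (simp add: cinner_diff_right)
  then have "cinner (y - proj ?F v) (y - proj ?F v) = 0" using y in1 by (simp add: cinner_diff_left)
  then show "y = proj ?F v" by (simp add: cinner_eq_0_self)
qed

definition vanishes_near_0 :: "(real \<Rightarrow> real) \<Rightarrow> bool" where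
  "vanishes_near_0 f \<longleftrightarrow> (\<exists>\<delta>>0. \<forall>x. \<bar>x\<bar> < \<delta> \<longrightarrow> f x = 0)"

definition support :: "(real \<Rightarrow> real) \<Rightarrow> ('h::complex_hilbert \<Rightarrow> 'h) \<Rightarrow> 'h set \<Rightarrow> 'h set" where
  "support f T E = {e\<in>E. f (evalue T e) \<noteq> 0}"

lemma finite_support:
  assumes T: "seq_compact_op T" "complete_eigensystem T E" and f: "vanishes_near_0 f"
  shows "finite (support f T E)"
proof -
  obtain \<delta> where \<delta>: "\<delta> > 0" "\<And>x. \<bar>x\<bar> < \<delta> \<Longrightarrow> f x = 0" using f by (auto simp: vanishes_near_0_def)
  have "eigensystem T E" using T(2) by (simp add: complete_eigensystem_def)
  from eigensystem_finite[OF T(1) this \<delta>(1)] show ?thesis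
    by (rule rev_finite_subset) (use \<delta>(2) in \<open>force simp: support_def\<close>)
qed

lemma orthonormal_support: "complete_eigensystem T E \<Longrightarrow> orthonormal (support f T E)"
  by (auto simp: complete_eigensystem_def eigensystem_def orthonormal_def support_def)

text \<open>Regrouping by eigenvectors instead of eigenvalues. Since \<open>f\<close> vanishes near
  0, all projections involved are onto eigenspaces for nonzero eigenvalues, which \<open>E\<close>
  spans.\<close>

lemma op_fun_eq:
  assumes T: "seq_compact_op T" "selfadjoint T" "complete_eigensystem T E" and f: "vanishes_near_0 f"
  shows "op_fun f T v = (\<Sum>e\<in>support f T E. (of_real (f (evalue T e)) * cinner e v) *\<^sub>C e)"
proof -
  have f0: "f 0 = 0" using f by (auto simp: vanishes_near_0_def)
  have es: "eigensystem T E" using T(3) by (simp add: complete_eigensystem_def)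
  have lin: "clinear T" using T(1) by (simp add: seq_compact_op_def)
  let ?W = "support f T E"
  have fin: "finite ?W" by (rule finite_support[OF T(1,3) f])
  have L: "{l. eigenspace T l \<noteq> {0} \<and> f l \<noteq> 0} = evalue T ` ?W"
  proof (intro equalityI subsetI)
    fix l assume l: "l \<in> {l. eigenspace T l \<noteq> {0} \<and> f l \<noteq> 0}"
    then have l0: "l \<noteq> 0" using f0 by auto
    have "0 \<in> eigenspace T l" by (simp add: eigenspace_def clinear_simps(3)[OF lin])
    then obtain v where v: "v \<in> eigenspace T l" "v \<noteq> 0" using l by auto
    have "{e\<in>E. evalue T e = l} \<noteq> {}"
    proof
      assume "{e\<in>E. evalue T e = l} = {}"
      with complete_eigensystem_eigenspace(2)[OF T l0 v(1)] v(2) show False by (simp only: sum.empty)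
    qed
    then show "l \<in> evalue T ` ?W" using l by (auto simp: support_def)
  next
    fix l assume "l \<in> evalue T ` ?W"
    then obtain e where e: "e \<in> E" "f l \<noteq> 0" "l = evalue T e" by (auto simp: support_def)
    then have "e \<in> eigenspace T l" using es by (simp add: eigensystem_def eigenspace_def)
    moreover have "e \<noteq> 0" using eigensystem_norm[OF es e(1)] by auto
    ultimately show "l \<in> {l. eigenspace T l \<noteq> {0} \<and> f l \<noteq> 0}" using e by auto
  qed
  have "op_fun f T v = (\<Sum>l\<in>evalue T ` ?W. \<Sum>e\<in>{e\<in>?W. evalue T e = l}. (of_real (f (evalue T e)) * cinner e v) *\<^sub>C e)"
    unfolding op_fun_def L
  proof (intro sum.cong refl)
    fix l assume "l \<in> evalue T ` ?W"
    then have l: "f l \<noteq> 0" "l \<noteq> 0" using f0 by (auto simp: support_def)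
    have W: "{e\<in>?W. evalue T e = l} = {e\<in>E. evalue T e = l}" using l by (auto simp: support_def)
    show "of_real (f l) *\<^sub>C orth_proj (eigenspace T l) v = (\<Sum>e\<in>{e\<in>?W. evalue T e = l}. (of_real (f (evalue T e)) * cinner e v) *\<^sub>C e)"
      unfolding orth_proj_eigenspace[OF T l(2)] W proj_def cvec.scale_sum_right by (intro sum.cong refl) simp
  qed
  also have "\<dots> = (\<Sum>e\<in>?W. (of_real (f (evalue T e)) * cinner e v) *\<^sub>C e)"
    by (rule sum.image_gen[OF fin, symmetric])
  finally show ?thesis .
qed

lemma selfadjoint_diff: "selfadjoint S \<Longrightarrow> selfadjoint T \<Longrightarrow> selfadjoint (\<lambda>x. S x - T x)"
  by (simp add: selfadjoint_def cinner_diff_left cinner_diff_right)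

lemma bop_rank_one: "bop (\<lambda>v. (c * cinner e v) *\<^sub>C x)"
  unfolding bop_def
proof (intro conjI exI allI)
  show "clinear (\<lambda>v. (c * cinner e v) *\<^sub>C x)"
    unfolding clinear_def by (simp add: cinner_add_right cinner_scaleC_right distrib_left scaleC_add_left mult_ac)
  show "0 < cmod c * norm e * norm x + 1" by (simp add: add_nonneg_pos)
  fix v
  have "norm ((c * cinner e v) *\<^sub>C x) = cmod (cinner e v) * (cmod c * norm x)" by (simp add: norm_scaleC norm_mult)
  also have "\<dots> \<le> (norm e * norm v) * (cmod c * norm x)" by (intro mult_right_mono cmod_cinner_le) auto
  also have "\<dots> \<le> (cmod c * norm e * norm x + 1) * norm v" by (simp add: algebra_simps)
  finally show "norm ((c * cinner e v) *\<^sub>C x) \<le> (cmod c * norm e * norm x + 1) * norm v" .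
qed

lemma bop_add: "bop f \<Longrightarrow> bop g \<Longrightarrow> bop (\<lambda>x. f x + g x)"
proof -
  assume f: "bop f" and g: "bop g"
  then obtain K L where K: "K > 0" "\<And>x. norm (f x) \<le> K * norm x" and L: "L > 0" "\<And>x. norm (g x) \<le> L * norm x"
    by (auto simp: bop_def)
  have "norm (f x + g x) \<le> (K + L) * norm x" for x
    using norm_triangle_ineq[of "f x" "g x"] K(2)[of x] L(2)[of x] by (simp add: distrib_right)
  moreover have "clinear (\<lambda>x. f x + g x)" using f g by (simp add: bop_def clinear_def scaleC_add_right add_ac)
  ultimately show ?thesis using K(1) L(1) unfolding bop_def by (metis add_pos_pos)
qed

lemma bop_zero: "bop (\<lambda>x. 0)"
  unfolding bop_def clinear_def by (auto intro: exI[of _ 1])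

lemma bop_id: "bop (\<lambda>x. x)"
  unfolding bop_def clinear_def by (auto intro: exI[of _ 1])

lemma bop_sum: "(\<And>i. i \<in> I \<Longrightarrow> bop (f i)) \<Longrightarrow> bop (\<lambda>x. \<Sum>i\<in>I. f i x)"
  by (induction I rule: infinite_finite_induct) (simp_all add: bop_zero bop_add)

lemma bop_scaleC: "bop f \<Longrightarrow> bop (\<lambda>x. c *\<^sub>C f x)"
proof -
  assume f: "bop f"
  then obtain K where K: "K > 0" "\<And>x. norm (f x) \<le> K * norm x" by (auto simp: bop_def)
  have "norm (c *\<^sub>C f x) \<le> ((cmod c + 1) * K) * norm x" for x
  proof -
    have "norm (c *\<^sub>C f x) \<le> (cmod c + 1) * norm (f x)" by (simp add: norm_scaleC mult_right_mono)
    also have "\<dots> \<le> (cmod c + 1) * (K * norm x)" by (intro mult_left_mono K(2)) auto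
    finally show ?thesis by (simp add: mult.assoc)
  qed
  moreover have "0 < (cmod c + 1) * K" using K(1) by (simp add: add_nonneg_pos)
  moreover have "clinear (\<lambda>x. c *\<^sub>C f x)" using f by (simp add: bop_def clinear_def scaleC_add_right mult.commute)
  ultimately show ?thesis unfolding bop_def by blast
qed

lemma op_fun_bop_selfadjoint:
  assumes T: "seq_compact_op T" "selfadjoint T" "complete_eigensystem T E" and f: "vanishes_near_0 f"
  shows "bop (op_fun f T)" "selfadjoint (op_fun f T)" "seq_compact_op (op_fun f T)"
proof -
  have eq: "op_fun f T = (\<lambda>v. \<Sum>e\<in>support f T E. (of_real (f (evalue T e)) * cinner e v) *\<^sub>C e)"
    using op_fun_eq[OF assms] by auto
  show b: "bop (op_fun f T)" unfolding eq by (intro bop_sum bop_rank_one)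
  show "selfadjoint (op_fun f T)"
    unfolding eq selfadjoint_def cinner_sum_left cinner_sum_right cinner_scaleC_left cinner_scaleC_right
    by (auto intro!: sum.cong simp: mult_ac cinner_commute[symmetric])
  show "seq_compact_op (op_fun f T)"
    unfolding seq_compact_op_def
  proof (intro conjI allI impI)
    show "clinear (op_fun f T)" using b by (simp add: bop_def)
    have fin: "finite (support f T E)" by (rule finite_support[OF T(1,3) f])
    have one: "seq_compact_op (\<lambda>v. (c * cinner e v) *\<^sub>C x)" for c and e x :: 'a
      unfolding seq_compact_op_def
    proof (intro conjI allI impI)
      show "clinear (\<lambda>v. (c * cinner e v) *\<^sub>C x)" using bop_rank_one[of c e x] by (simp add: bop_def)
      fix v :: "nat \<Rightarrow> 'a" assume v: "\<forall>n. norm (v n) \<le> 1"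
      have "cinner e (v n) \<in> cball 0 (norm e)" for n
        using order_trans[OF cmod_cinner_le[of e "v n"] mult_left_mono[of "norm (v n)" 1 "norm e"]] v by simp
      then obtain l r where r: "strict_mono (r :: nat \<Rightarrow> nat)" "(\<lambda>n. cinner e (v (r n))) \<longlonglongrightarrow> l"
        using compact_cball[of "0 :: complex" "norm e", unfolded compact_def, rule_format, of "\<lambda>n. cinner e (v n)"] by (auto simp: comp_def)
      have "bop (\<lambda>z :: complex. z *\<^sub>C x)"
        unfolding bop_def clinear_def
        by (intro conjI exI[of _ "norm x + 1"])
          (simp_all add: scaleC_add_left scaleC_complex_def norm_scaleC add_nonneg_pos distrib_right distrib_left mult.commute)
      from bop_tendsto[OF this tendsto_mult_left[OF r(2), of c]]
      show "\<exists>r l. strict_mono r \<and> (\<lambda>n. (c * cinner e (v (r n :: nat))) *\<^sub>C x) \<longlonglongrightarrow> l" using r(1) by blast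
    qed
    have "seq_compact_op (op_fun f T)" unfolding eq by (intro seq_compact_op_sum fin one)
    then show "\<exists>r l. strict_mono r \<and> (\<lambda>n. op_fun f T (v (r n :: nat))) \<longlonglongrightarrow> l" if "\<forall>n. norm (v n) \<le> 1" for v :: "nat \<Rightarrow> 'a"
      using that by (simp add: seq_compact_op_def)
  qed
qed

text \<open>Both forms split along the span of the support and its complement. On the span the
  eigenvalues differ by at most \<open>\<epsilon>\<close>; on the complement the second form is 0,
  and an eigenvalue at which \<open>f\<close> vanishes is at most \<open>\<epsilon>\<close> in
  modulus.\<close>

lemma op_fun_form_near:
  assumes T: "seq_compact_op T" "selfadjoint T" "complete_eigensystem T E" and f: "vanishes_near_0 f"
    and \<epsilon>: "\<And>e. e \<in> E \<Longrightarrow> \<bar>evalue T e - f (evalue T e)\<bar> \<le> \<epsilon>" "0 \<le> \<epsilon>"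
  shows "\<bar>Re (cinner v (T v)) - Re (cinner v (op_fun f T v))\<bar> \<le> \<epsilon> * (norm v)\<^sup>2"
proof -
  let ?W = "support f T E"
  have es: "eigensystem T E" using T(3) by (simp add: complete_eigensystem_def)
  have lin: "clinear T" using T(1) by (simp add: seq_compact_op_def)
  have fin: "finite ?W" by (rule finite_support[OF T(1,3) f])
  note on = orthonormal_support[OF T(3), of f]
  define w where "w = proj ?W v"
  define u where "u = v - w"
  have v: "v = w + u" by (simp add: u_def)
  have wu: "cinner e u = 0" if "e \<in> ?W" for e using cinner_proj[OF on fin that] by (simp add: u_def w_def cinner_diff_right)
  have Te: "T e = of_real (evalue T e) *\<^sub>C e" if "e \<in> ?W" for e using es that by (simp add: eigensystem_def support_def)
  have Tw: "T w = (\<Sum>e\<in>?W. (of_real (evalue T e) * cinner e v) *\<^sub>C e)"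
    unfolding w_def proj_def clinear_sum[OF lin] by (intro sum.cong refl) (simp add: clinear_simps(2)[OF lin] Te mult.commute)
  have Twu: "cinner (T w) u = 0" unfolding Tw cinner_sum_left cinner_scaleC_left using wu by simp
  have wTu: "cinner w (T u) = 0" using T(2) Twu by (simp add: selfadjoint_def)
  have uTw: "cinner u (T w) = 0" using Twu cinner_commute[of u "T w"] by simp
  have cv: "cinner v e = cnj (cinner e v)" for e by (rule cinner_commute)
  have vTw: "cinner w (T w) = of_real (\<Sum>e\<in>?W. evalue T e * (cmod (cinner e v))\<^sup>2)"
  proof -
    have "cinner w (T w) = cinner v (T w)" using uTw by (simp add: v cinner_add_left)
    also have "\<dots> = (\<Sum>e\<in>?W. of_real (evalue T e * (cmod (cinner e v))\<^sup>2))"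
      unfolding Tw cinner_sum_right cinner_scaleC_right cv
      by (intro sum.cong refl) (simp add: complex_norm_square del: of_real_power)
    finally show ?thesis by simp
  qed
  have vfv: "cinner v (op_fun f T v) = of_real (\<Sum>e\<in>?W. f (evalue T e) * (cmod (cinner e v))\<^sup>2)"
  proof -
    have "cinner v (op_fun f T v) = (\<Sum>e\<in>?W. of_real (f (evalue T e) * (cmod (cinner e v))\<^sup>2))"
      unfolding op_fun_eq[OF T f] cinner_sum_right cinner_scaleC_right cv
      by (intro sum.cong refl) (simp add: complex_norm_square del: of_real_power)
    then show ?thesis by simp
  qed
  have "\<bar>Re (cinner u (T u))\<bar> \<le> \<epsilon> * (norm u)\<^sup>2"
  proof (rule field_le_epsilon)
    fix r :: real assume r: "0 < r"
    \<comment> \<open>Slightly above \<open>\<epsilon>\<close>, hence positive, and any eigenvalue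
      of modulus at least \<open>y\<close> has \<open>f\<close> nonzero; the excess costs at most
      \<open>r\<close> in total.\<close>
    define y where "y = \<epsilon> + r / ((norm u)\<^sup>2 + 1)"
    have y: "\<epsilon> < y" "0 < y" using r \<epsilon>(2) by (simp_all add: y_def add_nonneg_pos)
    have "cinner e u = 0" if "e \<in> E" "y \<le> \<bar>evalue T e\<bar>" for e
    proof (rule wu)
      have "f (evalue T e) \<noteq> 0" using \<epsilon>(1)[OF that(1)] that(2) y by auto
      then show "e \<in> ?W" using that by (simp add: support_def)
    qed
    then have "Re (cinner u (T u)) \<le> y * (norm u)\<^sup>2" "Re (cinner u (- T u)) \<le> y * (norm u)\<^sup>2"
      by (intro complete_eigensystem_form_le[OF T _ y(2)]
          complete_eigensystem_form_le[OF seq_compact_op_uminus[OF T(1)] selfadjoint_uminus[OF T(2)] complete_eigensystem_uminus[OF T(3)] _ y(2)];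
          simp add: evalue_uminus)+
    then have "\<bar>Re (cinner u (T u))\<bar> \<le> y * (norm u)\<^sup>2" by (simp add: cinner_minus_right abs_le_iff)
    also have "\<dots> = \<epsilon> * (norm u)\<^sup>2 + r * ((norm u)\<^sup>2 / ((norm u)\<^sup>2 + 1))" by (simp add: y_def algebra_simps)
    also have "\<dots> \<le> \<epsilon> * (norm u)\<^sup>2 + r * 1"
      using r by (intro add_left_mono mult_left_mono) (simp_all add: divide_le_eq_1 add_nonneg_pos)
    finally show "\<bar>Re (cinner u (T u))\<bar> \<le> \<epsilon> * (norm u)\<^sup>2 + r" by simp
  qed
  moreover have "\<bar>(\<Sum>e\<in>?W. evalue T e * (cmod (cinner e v))\<^sup>2) - (\<Sum>e\<in>?W. f (evalue T e) * (cmod (cinner e v))\<^sup>2)\<bar> \<le> \<epsilon> * (norm w)\<^sup>2"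
  proof -
    have "(norm w)\<^sup>2 = (\<Sum>e\<in>?W. (cmod (cinner e v))\<^sup>2)" using orthonormal_expansion(2)[OF on fin w_def[unfolded proj_def]] .
    moreover have "\<bar>\<Sum>e\<in>?W. (evalue T e - f (evalue T e)) * (cmod (cinner e v))\<^sup>2\<bar> \<le> (\<Sum>e\<in>?W. \<epsilon> * (cmod (cinner e v))\<^sup>2)"
      using \<epsilon>(1) by (intro order_trans[OF sum_abs] sum_mono) (auto simp: abs_mult support_def intro: mult_right_mono)
    ultimately show ?thesis by (simp add: sum_subtractf left_diff_distrib sum_distrib_left)
  qed
  moreover have "(norm v)\<^sup>2 = (norm w)\<^sup>2 + (norm u)\<^sup>2"
  proof -
    have "w \<in> cvec.span ?W" unfolding w_def by (rule proj_in_span)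
    from cinner_span_eq_0[OF wu this] show ?thesis unfolding v by (rule norm_add_orth)
  qed
  moreover have "Re (cinner v (T v)) = Re (cinner w (T w)) + Re (cinner u (T u))"
    using uTw wTu by (simp add: v clinear_simps(1)[OF lin] cinner_add_left cinner_add_right)
  ultimately show ?thesis unfolding vfv vTw by (simp add: distrib_left)
qed

text \<open>For a selfadjoint operator the numerical radius is the norm: the form is polarized at
  \<open>v\<close> and \<open>D v\<close>, the latter rescaled to the length of \<open>v\<close>.
  The norm bound serves for the squares in (ii), where closeness of forms alone is too weak.\<close>

lemma selfadjoint_norm_le_form:
  fixes D :: "'h::complex_hilbert \<Rightarrow> 'h"
  assumes D: "clinear D" "selfadjoint D" and le: "\<And>v. \<bar>Re (cinner v (D v))\<bar> \<le> \<epsilon> * (norm v)\<^sup>2"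
  shows "norm (D v) \<le> \<epsilon> * norm v"
proof (cases "D v = 0 \<or> v = 0")
  case True
  then show ?thesis
  proof
    assume "D v = 0"
    moreover have "0 \<le> \<epsilon> * norm v"
    proof (cases "v = 0")
      case False
      have "0 \<le> \<epsilon> * (norm v)\<^sup>2" using le[of v] by linarith
      then have "0 \<le> \<epsilon>" using False by (simp add: zero_le_mult_iff)
      then show ?thesis by simp
    qed simp
    ultimately show ?thesis by simp
  qed (simp add: clinear_simps(3)[OF D(1)])
next
  case False
  define t where "t = norm v / norm (D v)"
  define u where "u = of_real t *\<^sub>C D v"
  have nu: "norm u = norm v" using False by (simp add: u_def t_def norm_scaleC norm_divide)
  have sym: "Re (cinner v (D u)) = Re (cinner u (D v))"
    using D(2) cinner_commute[of "D v" u] by (simp add: selfadjoint_def)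
  have "4 * Re (cinner u (D v)) = Re (cinner (u + v) (D (u + v))) - Re (cinner (u - v) (D (u - v)))"
    using sym by (simp add: clinear_simps[OF D(1)] cinner_add_left cinner_add_right cinner_diff_left cinner_diff_right)
  also have "\<dots> \<le> \<epsilon> * (norm (u + v))\<^sup>2 + \<epsilon> * (norm (u - v))\<^sup>2" using le[of "u + v"] le[of "u - v"] by linarith
  also have "\<dots> = \<epsilon> * (4 * (norm v)\<^sup>2)"
  proof -
    have "(norm (u + v))\<^sup>2 + (norm (u - v))\<^sup>2 = 2 * (norm u)\<^sup>2 + 2 * (norm v)\<^sup>2"
      by (simp add: power2_norm_eq_inner inner_add_left inner_add_right inner_diff_left inner_diff_right inner_commute)
    then show ?thesis unfolding nu by (simp add: distrib_left[symmetric])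
  qed
  finally have "Re (cinner u (D v)) \<le> \<epsilon> * (norm v)\<^sup>2" by simp
  moreover have "Re (cinner u (D v)) = t * (norm (D v))\<^sup>2" by (simp add: u_def cinner_scaleC_left cinner_self)
  ultimately have "norm v * norm (D v) \<le> norm v * (\<epsilon> * norm v)" using False by (simp add: t_def power2_eq_square mult_ac)
  then show ?thesis using False by simp
qed

text \<open>The form vanishes on the orthogonal complement of \<open>E\<close>, being below every
  positive level with either sign. That complement is invariant, so polarization at \<open>v\<close>
  and \<open>T v\<close> gives the squared norm of \<open>T v\<close>.\<close>

lemma complete_eigensystem_kernel:
  assumes T: "seq_compact_op T" "selfadjoint T" "complete_eigensystem T E"
    and v: "\<And>e. e \<in> E \<Longrightarrow> cinner e v = 0"
  shows "T v = 0"
proof -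
  have lin: "clinear T" using T(1) by (simp add: seq_compact_op_def)
  have es: "eigensystem T E" using T(3) by (simp add: complete_eigensystem_def)
  have q0: "Re (cinner u (T u)) = 0" if u: "\<And>e. e \<in> E \<Longrightarrow> cinner e u = 0" for u
  proof -
    have "\<bar>Re (cinner u (T u))\<bar> \<le> 0"
    proof (rule field_le_epsilon)
      fix r :: real assume r: "0 < r"
      define y where "y = r / ((norm u)\<^sup>2 + 1)"
      have y: "0 < y" using r by (simp add: y_def add_nonneg_pos)
      have "Re (cinner u (T u)) \<le> y * (norm u)\<^sup>2" by (rule complete_eigensystem_form_le[OF T u y])
      moreover have "Re (cinner u (- T u)) \<le> y * (norm u)\<^sup>2"
        by (rule complete_eigensystem_form_le[OF seq_compact_op_uminus[OF T(1)] selfadjoint_uminus[OF T(2)] complete_eigensystem_uminus[OF T(3)] u y])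
      moreover have "y * (norm u)\<^sup>2 \<le> r"
      proof -
        have "y * (norm u)\<^sup>2 = r * ((norm u)\<^sup>2 / ((norm u)\<^sup>2 + 1))" by (simp add: y_def)
        also have "\<dots> \<le> r * 1" using r by (intro mult_left_mono) (simp_all add: divide_le_eq_1 add_nonneg_pos)
        finally show ?thesis by simp
      qed
      ultimately show "\<bar>Re (cinner u (T u))\<bar> \<le> 0 + r" by (simp add: cinner_minus_right abs_le_iff)
    qed
    then show ?thesis by simp
  qed
  define u where "u = T v"
  have u: "cinner e u = 0" if e: "e \<in> E" for e
  proof -
    have "cinner e u = cinner (T e) v" using T(2) by (simp add: u_def selfadjoint_def)
    also have "T e = of_real (evalue T e) *\<^sub>C e" using es e by (simp add: eigensystem_def)
    finally show ?thesis using v[OF e] by (simp add: cinner_scaleC_left)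
  qed
  have sym: "Re (cinner v (T u)) = Re (cinner u (T v))"
    using T(2) cinner_commute[of "T v" u] by (simp add: selfadjoint_def)
  have "4 * Re (cinner u (T v)) = Re (cinner (u + v) (T (u + v))) - Re (cinner (u - v) (T (u - v)))"
    using sym by (simp add: clinear_simps[OF lin] cinner_add_left cinner_add_right cinner_diff_left cinner_diff_right)
  also have "\<dots> = 0" using u v by (subst (1 2) q0) (simp_all add: cinner_add_right cinner_diff_right)
  finally have "Re (cinner u u) = 0" by (simp add: u_def)
  then show ?thesis by (simp add: cinner_self u_def)
qed

text \<open>A finite orthonormal set that contains \<open>E\<close> and spans the \<open>x q\<close>
  turns \<open>T\<close> into a diagonal matrix, to which \<open>ftr_fpow_fmul\<close> applies. Its
  vectors outside \<open>E\<close> lie in the kernel and contribute 0, since the exponent is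
  positive.\<close>

lemma finite_rank_power_sum:
  assumes T: "seq_compact_op T" "selfadjoint T" "complete_eigensystem T E" and Q: "finite Q"
    and rep: "\<And>v. T v = (\<Sum>q\<in>Q. \<phi> q v *\<^sub>C x q)" and \<phi>: "\<And>q. q \<in> Q \<Longrightarrow> clinear (\<phi> q)"
  shows "finite E" "of_real (\<Sum>e\<in>E. evalue T e ^ Suc p) = ftr Q (fpow Q (\<lambda>q q'. \<phi> q (x q')) p)"
proof -
  have es: "eigensystem T E" using T(3) by (simp add: complete_eigensystem_def)
  have on: "orthonormal E" using es by (simp add: eigensystem_def)
  have "E \<subseteq> cvec.span (x ` Q)"
  proof
    fix e assume e: "e \<in> E"
    then have Te: "T e = of_real (evalue T e) *\<^sub>C e" and nz: "evalue T e \<noteq> 0" using es by (auto simp: eigensystem_def)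
    have "T e \<in> cvec.span (x ` Q)" unfolding rep by (intro cvec.span_sum cvec.span_scale cvec.span_base) auto
    then have "of_real (1 / evalue T e) *\<^sub>C T e \<in> cvec.span (x ` Q)" by (rule cvec.span_scale)
    then show "e \<in> cvec.span (x ` Q)" unfolding Te scaleC_scaleC of_real_mult[symmetric] using nz by simp
  qed
  then show fin: "finite E"
    using cvec.independent_span_bound[OF finite_imageI[OF Q] orthonormal_independent[OF on]] by blast
  obtain F where F: "orthonormal F" "finite F" "E \<subseteq> F" "x ` Q \<subseteq> cvec.span F"
    using orthonormal_extend_finite[OF on fin finite_imageI[OF Q]] by blast
  have Tker: "T e = 0" if e: "e \<in> F - E" for e
    by (rule complete_eigensystem_kernel[OF T]) (use F e in \<open>auto simp: orthonormal_def\<close>)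
  have TF: "T e = of_real (evalue T e) *\<^sub>C e" if "e \<in> F" for e
  proof (cases "e \<in> E")
    case True then show ?thesis using es by (simp add: eigensystem_def)
  next
    case False
    then have "T e = 0" using Tker that by blast
    then show ?thesis by (simp add: evalue_def)
  qed
  let ?X = "\<lambda>e q. cinner e (x q)" and ?Y = "\<lambda>q e. \<phi> q e"
  have "ftr Q (fpow Q (\<lambda>q q'. \<phi> q (x q')) p) = ftr Q (fpow Q (fmul F ?Y ?X) p)"
  proof (rule ftr_fpow_cong)
    fix q q' assume q: "q \<in> Q" "q' \<in> Q"
    have "x q' = proj F (x q')" using proj_span[OF F(1,2), of "x q'"] F(4) q by auto
    then have "\<phi> q (x q') = \<phi> q (proj F (x q'))" by simp
    also have "\<dots> = fmul F ?Y ?X q q'"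
      unfolding proj_def clinear_sum[OF \<phi>[OF q(1)]] fmul_def
      by (intro sum.cong refl) (simp add: clinear_simps(2)[OF \<phi>[OF q(1)]] scaleC_complex_def)
    finally show "\<phi> q (x q') = fmul F ?Y ?X q q'" .
  qed
  also have "\<dots> = ftr F (fpow F (fmul Q ?X ?Y) p)" by (rule ftr_fpow_fmul)
  also have "\<dots> = (\<Sum>e\<in>F. of_real (evalue T e) ^ Suc p)"
  proof (rule ftr_fpow_diag[OF F(2)])
    fix e e' assume e: "e \<in> F" "e' \<in> F"
    have "fmul Q ?X ?Y e e' = cinner e (T e')"
      unfolding rep cinner_sum_right cinner_scaleC_right fmul_def by (simp add: mult.commute)
    also have "\<dots> = (if e = e' then of_real (evalue T e) else 0)"
      unfolding TF[OF e(2)] cinner_scaleC_right using F(1) e by (auto simp: orthonormal_def)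
    finally show "fmul Q ?X ?Y e e' = (if e = e' then of_real (evalue T e) else 0)" .
  qed
  also have "\<dots> = of_real (\<Sum>e\<in>F. evalue T e ^ Suc p)" by simp
  also have "(\<Sum>e\<in>F. evalue T e ^ Suc p) = (\<Sum>e\<in>E. evalue T e ^ Suc p)"
    using Tker by (intro sum.mono_neutral_right F(2,3)) (auto simp: evalue_def)
  finally show "of_real (\<Sum>e\<in>E. evalue T e ^ Suc p) = ftr Q (fpow Q (\<lambda>q q'. \<phi> q (x q')) p)" by simp
qed

section \<open>Orthonormal bases and the trace\<close>

text \<open>Gram-Schmidt orthogonalization along a dense sequence; each step keeps the earlier
  vectors, so the union is orthonormal with dense span.\<close>

lemma orthonormal_basis_exists:
  assumes sep: "separable_space (euclidean :: 'h::complex_hilbert topology)"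
  shows "\<exists>E :: 'h set. orthonormal_basis E"
proof -
  obtain C :: "'h set" where C: "countable C" "closure C = UNIV"
    using sep unfolding separable_space_def by auto
  then have "C \<noteq> {}" by auto
  define ext where "ext F x = (SOME G. orthonormal G \<and> finite G \<and> F \<subseteq> G \<and> x \<in> cvec.span G)" for F and x :: 'h
  have ext: "orthonormal (ext F x) \<and> finite (ext F x) \<and> F \<subseteq> ext F x \<and> x \<in> cvec.span (ext F x)" if "orthonormal F" "finite F" for F x
    unfolding ext_def by (rule someI_ex[OF orthonormal_extend[OF that]])
  define G where "G = rec_nat {} (\<lambda>n F. ext F (from_nat_into C n))"
  have GS: "G (Suc n) = ext (G n) (from_nat_into C n)" for n by (simp add: G_def)
  have G: "orthonormal (G n) \<and> finite (G n)" for n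
  proof (induction n)
    case 0 then show ?case by (simp add: G_def orthonormal_def)
  next
    case (Suc n) then show ?case using ext unfolding GS by blast
  qed
  have mono: "G m \<subseteq> G n" if "m \<le> n" for m n
    using that by (rule lift_Suc_mono_le[rotated]) (use ext G GS in auto)
  define E where "E = (\<Union>n. G n)"
  have "cinner e e' = (if e = e' then 1 else 0)" if "e \<in> E" "e' \<in> E" for e e'
  proof -
    obtain m n where "e \<in> G m" "e' \<in> G n" using \<open>e \<in> E\<close> \<open>e' \<in> E\<close> by (auto simp: E_def)
    then have "e \<in> G (max m n)" "e' \<in> G (max m n)" using mono[of m "max m n"] mono[of n "max m n"] by auto
    then show ?thesis using G by (simp add: orthonormal_def)
  qed
  moreover have "C \<subseteq> cvec.span E"
  proof
    fix c assume "c \<in> C"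
    then obtain n where n: "c = from_nat_into C n" using from_nat_into_surj[OF C(1)] by metis
    have "c \<in> cvec.span (G (Suc n))" unfolding GS n using ext G by blast
    then show "c \<in> cvec.span E" using cvec.span_mono[of "G (Suc n)" E] by (auto simp: E_def)
  qed
  then have "closure (cvec.span E) = UNIV" using C(2) closure_mono by blast
  ultimately have "orthonormal_basis E" by (simp add: orthonormal_basis_def)
  then show ?thesis by blast
qed

text \<open>Finite partial sums are the values of \<open>\<phi>\<close> at projections of
  \<open>x\<close>, and the projection onto a larger finite set is at least as close to
  \<open>x\<close> as any fixed combination. This gives unconditional convergence.\<close>

lemma functional_expansion:
  assumes E: "orthonormal_basis E" and \<phi>: "bop (\<phi> :: 'h::complex_hilbert \<Rightarrow> complex)"
  shows "((\<lambda>e. \<phi> e * cinner e x) has_sum \<phi> x) E"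
  unfolding has_sum_def
proof (rule tendstoI)
  fix r :: real assume r: "0 < r"
  obtain K where K: "K > 0" "\<And>x. norm (\<phi> x) \<le> K * norm x" and lin: "clinear \<phi>" using \<phi> by (auto simp: bop_def)
  have on: "orthonormal E" using E by (simp add: orthonormal_basis_def orthonormal_def)
  have "x \<in> closure (cvec.span E)" using E by (simp add: orthonormal_basis_def)
  then obtain v where v: "v \<in> cvec.span E" "dist v x < r / K" using r K(1) by (meson closure_approachable divide_pos_pos)
  from v(1) obtain S u where S: "finite S" "S \<subseteq> E" "v = (\<Sum>a\<in>S. u a *\<^sub>C a)" unfolding cvec.span_explicit by blast
  have "dist (sum (\<lambda>e. \<phi> e * cinner e x) Y) (\<phi> x) < r" if Y: "finite Y" "S \<subseteq> Y" "Y \<subseteq> E" for Y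
  proof -
    have onY: "orthonormal Y" using on Y(3) by (auto simp: orthonormal_def subset_iff)
    have "sum (\<lambda>e. \<phi> e * cinner e x) Y = \<phi> (proj Y x)"
      unfolding proj_def clinear_sum[OF lin] by (intro sum.cong refl) (simp add: clinear_simps(2)[OF lin] scaleC_complex_def)
    then have "dist (sum (\<lambda>e. \<phi> e * cinner e x) Y) (\<phi> x) = norm (\<phi> (x - proj Y x))"
      by (simp add: dist_norm norm_minus_commute clinear_simps(5)[OF lin])
    also have "\<dots> \<le> K * norm (x - proj Y x)" by (rule K(2))
    also have "\<dots> \<le> K * norm (x - v)"
    proof (intro mult_left_mono proj_best[OF onY Y(1)])
      show "v \<in> cvec.span Y" unfolding S(3) using Y(2) by (intro cvec.span_sum cvec.span_scale cvec.span_base) auto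
    qed (use K(1) in simp)
    also have "\<dots> < r" using v(2) K(1) by (simp add: dist_norm norm_minus_commute field_simps)
    finally show ?thesis .
  qed
  then show "\<forall>\<^sub>F F in finite_subsets_at_top E. dist (sum (\<lambda>e. \<phi> e * cinner e x) F) (\<phi> x) < r"
    unfolding eventually_finite_subsets_at_top using S by blast
qed

text \<open>Expanding each functional in a basis gives the formula for every orthonormal basis, in
  particular for the one that \<open>op_trace\<close> selects.\<close>

lemma op_trace_finite_rank:
  fixes x :: "'q \<Rightarrow> 'h::complex_hilbert"
  assumes sep: "separable_space (euclidean :: 'h topology)" and Q: "finite Q"
    and \<phi>: "\<And>q. q \<in> Q \<Longrightarrow> bop (\<phi> q)"
  shows "op_trace (\<lambda>v. \<Sum>q\<in>Q. \<phi> q v *\<^sub>C x q) = (\<Sum>q\<in>Q. \<phi> q (x q))"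
proof -
  define E where "E = (SOME E :: 'h set. orthonormal_basis E)"
  have E: "orthonormal_basis E" unfolding E_def by (rule someI_ex[OF orthonormal_basis_exists[OF sep]])
  have "((\<lambda>e. \<Sum>q\<in>Q. \<phi> q e * cinner e (x q)) has_sum (\<Sum>q\<in>Q. \<phi> q (x q))) E"
    using Q \<phi>
  proof (induction Q rule: finite_induct)
    case (insert q Q)
    then show ?case using functional_expansion[OF E, of "\<phi> q" "x q"] by (simp add: has_sum_add)
  qed (simp add: has_sum_0)
  then show ?thesis
    unfolding op_trace_def E_def[symmetric] cinner_sum_right cinner_scaleC_right by (rule infsumI)
qed

text \<open>Each factor is a finite sum of rank one operators, so multiplying out a word produces
  chains of inner products between eigenvectors: closed paths whose points lie over the successive
  letters.\<close>

lemma op_trace_word: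
  fixes a :: "'k \<Rightarrow> 'h::complex_hilbert \<Rightarrow> 'h" and \<iota> :: "'s \<Rightarrow> 'k"
  assumes sep: "separable_space (euclidean :: 'h topology)"
    and a: "\<And>i. seq_compact_op (a i)" "\<And>i. selfadjoint (a i)" "\<And>i. complete_eigensystem (a i) (E i)"
    and f: "vanishes_near_0 f" and Q: "finite Q" "Q = (SIGMA s:UNIV. support f (a (\<iota> s)) (E (\<iota> s)))"
  defines "k \<equiv> \<lambda>(s, e) (s', e'). of_real (f (evalue (a (\<iota> s)) e)) * cinner e e'"
  shows "op_trace (foldr (\<lambda>i T. op_fun f (a i) \<circ> T) (map \<iota> (s # w)) id) = (\<Sum>z\<in>{z\<in>Q. fst z = s}. path_sum Q fst k w z z)"
proof -
  let ?F = "\<lambda>w. foldr (\<lambda>i T. op_fun f (a i) \<circ> T) (map \<iota> w) id"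
  let ?c = "\<lambda>s e. complex_of_real (f (evalue (a (\<iota> s)) e))"
  have fibre: "(\<Sum>z\<in>{z\<in>Q. fst z = s}. g z) = (\<Sum>e\<in>support f (a (\<iota> s)) (E (\<iota> s)). g (s, e))" for g :: "_ \<Rightarrow> complex" and s
    by (rule sum.reindex_bij_witness[of _ "Pair s" snd]) (auto simp: Q(2))
  have Feq: "?F (s # w) v = (\<Sum>e\<in>support f (a (\<iota> s)) (E (\<iota> s)). (?c s e * cinner e (?F w v)) *\<^sub>C e)" for s w v
    by (simp add: op_fun_eq[OF a f])
  have bopF: "bop (?F w)" for w
  proof (induction w)
    case Nil show ?case using bop_id by (simp add: id_def)
  next
    case (Cons s w)
    from bop_compose[OF op_fun_bop_selfadjoint(1)[OF a f] Cons] show ?case by (simp add: comp_def)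
  qed
  have ps: "path_sum Q fst k w (t, e) (t', e') = ?c t e * cinner e (?F w e')" for w t t' e e'
  proof (induction w arbitrary: t e)
    case Nil show ?case by (simp add: k_def)
  next
    case (Cons s w)
    have "path_sum Q fst k (s # w) (t, e) (t', e') =
        (\<Sum>u\<in>support f (a (\<iota> s)) (E (\<iota> s)). k (t, e) (s, u) * path_sum Q fst k w (s, u) (t', e'))"
      unfolding path_sum.simps by (rule fibre)
    also have "\<dots> = ?c t e * cinner e (?F (s # w) e')"
      unfolding Feq cinner_sum_right cinner_scaleC_right Cons sum_distrib_left
      by (intro sum.cong refl) (simp add: k_def mult_ac)
    finally show ?case .
  qed
  have fin: "finite (support f (a (\<iota> s)) (E (\<iota> s)))" by (rule finite_support[OF a(1,3) f])
  have bopf: "bop (\<lambda>v. c * cinner e (?F w v))" for c and e :: 'h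
  proof -
    have "bop (\<lambda>v. c * cinner e v)" using bop_rank_one[of c e "1 :: complex"] by (simp add: scaleC_complex_def)
    from bop_compose[OF this bopF] show ?thesis .
  qed
  have "op_trace (?F (s # w)) = op_trace (\<lambda>v. \<Sum>e\<in>support f (a (\<iota> s)) (E (\<iota> s)). (?c s e * cinner e (?F w v)) *\<^sub>C e)"
    by (intro arg_cong[of _ _ op_trace] ext Feq)
  also have "\<dots> = (\<Sum>e\<in>support f (a (\<iota> s)) (E (\<iota> s)). ?c s e * cinner e (?F w e))"
    by (rule op_trace_finite_rank[OF sep fin bopf])
  also have "\<dots> = (\<Sum>z\<in>{z\<in>Q. fst z = s}. path_sum Q fst k w z z)" unfolding fibre ps ..
  finally show ?thesis .
qed

section \<open>Operators on a finite orthogonal sum\<close>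

lemma cinner_axis: "cinner v (Finite_Cartesian_Product.axis i u) = cinner (v $ i) u"
proof -
  have "cinner v (Finite_Cartesian_Product.axis i u) = (\<Sum>j\<in>UNIV. if j = i then cinner (v $ i) u else 0)"
    unfolding cinner_vec_def by (intro sum.cong refl) (auto simp: Finite_Cartesian_Product.axis_def)
  then show ?thesis by simp
qed

lemma vec_eq_sum_axis: "v = (\<Sum>i\<in>UNIV. Finite_Cartesian_Product.axis i (v $ i))"
  for v :: "'h::complex_hilbert ^ 'k"
  unfolding Finite_Cartesian_Product.vec_eq_iff
proof
  fix j
  have "(\<Sum>i\<in>UNIV. Finite_Cartesian_Product.axis i (v $ i) $ j) = (\<Sum>i\<in>UNIV. if i = j then v $ j else 0)"
    by (intro sum.cong refl) (auto simp: Finite_Cartesian_Product.axis_def)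
  then show "v $ j = (\<Sum>i\<in>UNIV. Finite_Cartesian_Product.axis i (v $ i)) $ j" by simp
qed

lemma bop_clinear: "bop f \<Longrightarrow> clinear f"
  by (simp add: bop_def)

lemma bop_nth: "bop (\<lambda>v :: 'h::complex_hilbert ^ 'k. v $ i)"
  unfolding bop_def clinear_def
  by (intro conjI exI[of _ 1]) (simp_all add: scaleC_vec_def Finite_Cartesian_Product.norm_nth_le)

lemma bop_axis: "bop (Finite_Cartesian_Product.axis i :: 'h::complex_hilbert \<Rightarrow> 'h ^ 'k)"
  unfolding bop_def clinear_def
proof (intro conjI exI[of _ 1] allI)
  fix x :: 'h
  have "norm (Finite_Cartesian_Product.axis i x) \<le> (\<Sum>j\<in>UNIV. norm (Finite_Cartesian_Product.axis i x $ j))"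
    unfolding norm_vec_def by (rule L2_set_le_sum) simp
  also have "\<dots> = (\<Sum>j\<in>UNIV. if j = i then norm x else 0)"
    by (intro sum.cong refl) (auto simp: Finite_Cartesian_Product.axis_def)
  finally show "norm (Finite_Cartesian_Product.axis i x) \<le> 1 * norm x" by simp
qed (auto simp: Finite_Cartesian_Product.vec_eq_iff Finite_Cartesian_Product.axis_def scaleC_vec_def)

lemma bop_componentwise:
  fixes f :: "'a::complex_hilbert \<Rightarrow> 'h::complex_hilbert ^ 'k"
  assumes "\<And>i. bop (\<lambda>v. f v $ i)" shows "bop f"
proof -
  have "bop (\<lambda>v. \<Sum>i\<in>UNIV. Finite_Cartesian_Product.axis i (f v $ i))"
    by (rule bop_sum) (rule bop_compose[OF bop_axis assms])
  then show ?thesis unfolding vec_eq_sum_axis[symmetric] .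
qed

lemma bop_scalar_mat_op: "bop (scalar_mat_op S)"
  by (rule bop_componentwise) (simp add: scalar_mat_op_def, intro bop_sum bop_scaleC bop_nth)

lemma scalar_mat_op_mult: "scalar_mat_op (S ** S') v = scalar_mat_op S (scalar_mat_op S' v)"
  unfolding Finite_Cartesian_Product.vec_eq_iff scalar_mat_op_def matrix_matrix_mult_def
  by (simp add: cvec.scale_sum_left cvec.scale_sum_right) (subst sum.swap, simp)

lemma scalar_mat_op_axis: "scalar_mat_op S (Finite_Cartesian_Product.axis j u) $ i = (S $ i $ j) *\<^sub>C u"
proof -
  have "scalar_mat_op S (Finite_Cartesian_Product.axis j u) $ i = (\<Sum>l\<in>UNIV. (S $ i $ l) *\<^sub>C (Finite_Cartesian_Product.axis j u $ l))"
    by (simp add: scalar_mat_op_def)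
  also have "\<dots> = (\<Sum>l\<in>UNIV. if l = j then (S $ i $ j) *\<^sub>C u else 0)"
    by (intro sum.cong refl) (auto simp: Finite_Cartesian_Product.axis_def)
  finally show ?thesis by simp
qed

lemma cinner_scalar_mat_op:
  assumes "\<And>i j. S $ i $ j = cnj (S $ j $ i)"
  shows "cinner (scalar_mat_op S x) y = cinner x (scalar_mat_op S y)"
proof -
  have "cinner (scalar_mat_op S x) y = (\<Sum>i\<in>UNIV. \<Sum>j\<in>UNIV. cnj (S $ i $ j) * cinner (x $ j) (y $ i))"
    by (simp add: cinner_vec_def scalar_mat_op_def cinner_sum_left cinner_scaleC_left)
  also have "\<dots> = (\<Sum>j\<in>UNIV. \<Sum>i\<in>UNIV. cnj (S $ i $ j) * cinner (x $ j) (y $ i))" by (rule sum.swap)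
  also have "\<dots> = cinner x (scalar_mat_op S y)"
    unfolding assms[symmetric] by (simp add: cinner_vec_def scalar_mat_op_def cinner_sum_right cinner_scaleC_right)
  finally show ?thesis .
qed

lemma diag_op_eq: "diag_op a v = (\<Sum>i\<in>UNIV. Finite_Cartesian_Product.axis i (a i (v $ i)))"
  using vec_eq_sum_axis[of "diag_op a v"] by (simp add: diag_op_def)

lemma seq_compact_diag_op:
  assumes "\<And>i. seq_compact_op (a i)" shows "seq_compact_op (diag_op a)"
proof -
  have "seq_compact_op (\<lambda>v. \<Sum>i\<in>UNIV. Finite_Cartesian_Product.axis i (a i (v $ i)))"
    by (rule seq_compact_op_sum[OF _ seq_compact_op_compose[OF assms bop_axis bop_nth]]) simp
  then show ?thesis unfolding diag_op_eq[symmetric] .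
qed

lemma selfadjoint_diag_op: "(\<And>i. selfadjoint (a i)) \<Longrightarrow> selfadjoint (diag_op a)"
  by (simp add: selfadjoint_def diag_op_def cinner_vec_def)

lemma sandwich_op:
  assumes S: "\<And>i j. S $ i $ j = cnj (S $ j $ i)" and a: "\<And>i. seq_compact_op (a i)" "\<And>i. selfadjoint (a i)"
  shows "seq_compact_op (scalar_mat_op S \<circ> diag_op a \<circ> scalar_mat_op S)"
    "selfadjoint (scalar_mat_op S \<circ> diag_op a \<circ> scalar_mat_op S)"
proof -
  show "seq_compact_op (scalar_mat_op S \<circ> diag_op a \<circ> scalar_mat_op S)"
    using seq_compact_op_compose[OF seq_compact_diag_op[OF a(1)] bop_scalar_mat_op bop_scalar_mat_op] by (simp add: comp_def)
  show "selfadjoint (scalar_mat_op S \<circ> diag_op a \<circ> scalar_mat_op S)"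
    using selfadjoint_diag_op[of a, OF a(2)] by (simp add: selfadjoint_def cinner_scalar_mat_op[OF S])
qed

section \<open>The positive square root of a matrix\<close>

lemma psd_form: "(\<Sum>i\<in>UNIV. \<Sum>j\<in>UNIV. cnj (v $ i) * S $ i $ j * v $ j) = cinner v (scalar_mat_op S v)"
  for v :: "complex ^ 'k"
  by (simp add: cinner_vec_def scalar_mat_op_def cinner_complex_def scaleC_complex_def sum_distrib_left mult.assoc)

lemma psdD:
  fixes S :: "complex ^ 'k ^ 'k::finite" and v :: "complex ^ 'k"
  assumes "psd S" shows "S $ i $ j = cnj (S $ j $ i)" "0 \<le> Re (cinner v (scalar_mat_op S v))"
proof -
  show "S $ i $ j = cnj (S $ j $ i)" using assms unfolding psd_def by blast
  show "0 \<le> Re (cinner v (scalar_mat_op S v))"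
    using assms[unfolded psd_def, THEN conjunct2, THEN spec, of "\<lambda>i. v $ i"] unfolding psd_form .
qed

text \<open>A Hermitian matrix is treated as a compact operator on a finite sum of copies of the
  complex numbers, so that the eigensystems above diagonalize it.\<close>

lemma scalar_mat_op_complex:
  fixes S :: "complex ^ 'k ^ 'k::finite"
  assumes S: "\<And>i j. S $ i $ j = cnj (S $ j $ i)"
  shows "seq_compact_op (scalar_mat_op S :: complex ^ 'k \<Rightarrow> complex ^ 'k)"
    "selfadjoint (scalar_mat_op S :: complex ^ 'k \<Rightarrow> complex ^ 'k)"
    "complete_eigensystem (scalar_mat_op S :: complex ^ 'k \<Rightarrow> complex ^ 'k) E \<Longrightarrow> finite E"
proof -
  have "seq_compact_op (\<lambda>x :: complex. x)"
    unfolding seq_compact_op_def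
  proof (intro conjI allI impI)
    fix v :: "nat \<Rightarrow> complex" assume "\<forall>n. norm (v n) \<le> 1"
    then show "\<exists>r l. strict_mono r \<and> (\<lambda>n. v (r n :: nat)) \<longlonglongrightarrow> l"
      using compact_cball[of "0 :: complex" 1, unfolded compact_def, rule_format, of v] by (auto simp: comp_def)
  qed (simp add: clinear_def)
  then have "seq_compact_op (diag_op (\<lambda>_ x. x) :: complex ^ 'k \<Rightarrow> complex ^ 'k)" by (rule seq_compact_diag_op)
  from seq_compact_op_compose[OF this bop_scalar_mat_op[of S] bop_id]
  show sc: "seq_compact_op (scalar_mat_op S :: complex ^ 'k \<Rightarrow> complex ^ 'k)" by (simp add: diag_op_def)
  show sa: "selfadjoint (scalar_mat_op S :: complex ^ 'k \<Rightarrow> complex ^ 'k)"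
    unfolding selfadjoint_def using cinner_scalar_mat_op[OF S] by blast
  assume E: "complete_eigensystem (scalar_mat_op S :: complex ^ 'k \<Rightarrow> complex ^ 'k) E"
  show "finite E"
  proof (rule finite_rank_power_sum(1)[OF sc sa E])
    fix v :: "complex ^ 'k"
    have lin: "clinear (scalar_mat_op S :: complex ^ 'k \<Rightarrow> complex ^ 'k)" using sc by (simp add: seq_compact_op_def)
    have "Finite_Cartesian_Product.axis j (v $ j) = (v $ j) *\<^sub>C (Finite_Cartesian_Product.axis j 1 :: complex ^ 'k)" for j
      by (auto simp: Finite_Cartesian_Product.vec_eq_iff Finite_Cartesian_Product.axis_def scaleC_vec_def scaleC_complex_def)
    then have "v = (\<Sum>j\<in>UNIV. (v $ j) *\<^sub>C Finite_Cartesian_Product.axis j 1)" using vec_eq_sum_axis[of v] by simp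
    then have "scalar_mat_op S v = scalar_mat_op S (\<Sum>j\<in>UNIV. (v $ j) *\<^sub>C Finite_Cartesian_Product.axis j 1)" by simp
    then show "scalar_mat_op S v = (\<Sum>j\<in>UNIV. (v $ j) *\<^sub>C scalar_mat_op S (Finite_Cartesian_Product.axis j 1))"
      unfolding clinear_sum[OF lin] clinear_simps(2)[OF lin] .
    show "clinear (\<lambda>v :: complex ^ 'k. v $ j)" for j by (rule bop_clinear[OF bop_nth])
  qed simp
qed

lemma finite_eigensystem_expansion:
  assumes T: "seq_compact_op T" "selfadjoint T" "complete_eigensystem T E" and fin: "finite E"
  shows "T v = (\<Sum>e\<in>E. (of_real (evalue T e) * cinner e v) *\<^sub>C e)"
proof -
  have lin: "clinear T" using T(1) by (simp add: seq_compact_op_def)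
  have es: "eigensystem T E" using T(3) by (simp add: complete_eigensystem_def)
  have on: "orthonormal E" using es by (simp add: eigensystem_def)
  have "T (v - proj E v) = 0"
    by (rule complete_eigensystem_kernel[OF T]) (use cinner_proj[OF on fin] in \<open>simp add: cinner_diff_right\<close>)
  then have "T v = T (proj E v)" by (simp add: clinear_simps[OF lin])
  also have "\<dots> = (\<Sum>e\<in>E. (of_real (evalue T e) * cinner e v) *\<^sub>C e)"
    unfolding proj_def clinear_sum[OF lin]
  proof (intro sum.cong refl)
    fix e assume "e \<in> E"
    then have "T e = of_real (evalue T e) *\<^sub>C e" using es by (simp add: eigensystem_def)
    then show "T (cinner e v *\<^sub>C e) = (of_real (evalue T e) * cinner e v) *\<^sub>C e"
      by (simp add: clinear_simps(2)[OF lin] mult.commute)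
  qed
  finally show ?thesis .
qed

lemma scalar_mat_op_entry: "S $ i $ j = scalar_mat_op S (Finite_Cartesian_Product.axis j 1 :: complex ^ 'k::finite) $ i"
  by (simp add: scalar_mat_op_axis scaleC_complex_def)

lemma psd_sqrt_exists:
  fixes B :: "complex ^ 'k ^ 'k::finite"
  assumes B: "psd B" shows "\<exists>S. psd S \<and> S ** S = B"
proof -
  let ?T = "scalar_mat_op B :: complex ^ 'k \<Rightarrow> complex ^ 'k"
  obtain E where E: "complete_eigensystem ?T E" using complete_eigensystem_exists by blast
  note T = scalar_mat_op_complex(1,2)[OF psdD(1)[OF B]]
  have fin: "finite E" by (rule scalar_mat_op_complex(3)[OF psdD(1)[OF B] E])
  note ex = finite_eigensystem_expansion[OF T E fin]
  have on: "orthonormal E" using E by (simp add: complete_eigensystem_def eigensystem_def)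
  let ?d = "evalue ?T"
  have d0: "0 \<le> ?d e" for e unfolding evalue_def by (rule psdD(2)[OF B])
  \<comment> \<open>The spectral sum with the square roots of the eigenvalues; the kernel, which
    \<open>E\<close> omits, contributes 0.\<close>
  define S :: "complex ^ 'k ^ 'k" where "S = (\<chi> i j. \<Sum>e\<in>E. of_real (sqrt (?d e)) * e $ i * cnj (e $ j))"
  have "psd S"
    unfolding psd_def
  proof (intro conjI allI)
    fix i j show "S $ i $ j = cnj (S $ j $ i)" by (simp add: S_def mult_ac)
  next
    fix x :: "'k \<Rightarrow> complex"
    have "(\<Sum>i\<in>UNIV. \<Sum>j\<in>UNIV. cnj (x i) * S $ i $ j * x j) =
        (\<Sum>i\<in>UNIV. \<Sum>j\<in>UNIV. \<Sum>e\<in>E. of_real (sqrt (?d e)) * (cnj (x i) * e $ i) * (x j * cnj (e $ j)))"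
      by (simp add: S_def sum_distrib_left sum_distrib_right mult_ac)
    also have "\<dots> = (\<Sum>i\<in>UNIV. \<Sum>e\<in>E. \<Sum>j\<in>UNIV. of_real (sqrt (?d e)) * (cnj (x i) * e $ i) * (x j * cnj (e $ j)))"
      by (intro sum.cong refl sum.swap)
    also have "\<dots> = (\<Sum>e\<in>E. \<Sum>i\<in>UNIV. \<Sum>j\<in>UNIV. of_real (sqrt (?d e)) * (cnj (x i) * e $ i) * (x j * cnj (e $ j)))"
      by (rule sum.swap)
    also have "\<dots> = (\<Sum>e\<in>E. of_real (sqrt (?d e) * (cmod (\<Sum>j\<in>UNIV. x j * cnj (e $ j)))\<^sup>2))"
    proof (intro sum.cong refl)
      fix e
      have "(\<Sum>i\<in>UNIV. \<Sum>j\<in>UNIV. of_real (sqrt (?d e)) * (cnj (x i) * e $ i) * (x j * cnj (e $ j))) =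
          of_real (sqrt (?d e)) * ((\<Sum>j\<in>UNIV. x j * cnj (e $ j)) * cnj (\<Sum>j\<in>UNIV. x j * cnj (e $ j)))"
        by (simp add: sum_distrib_left sum_distrib_right mult_ac)
      then show "(\<Sum>i\<in>UNIV. \<Sum>j\<in>UNIV. of_real (sqrt (?d e)) * (cnj (x i) * e $ i) * (x j * cnj (e $ j))) =
          of_real (sqrt (?d e) * (cmod (\<Sum>j\<in>UNIV. x j * cnj (e $ j)))\<^sup>2)"
        by (simp only: complex_norm_square of_real_mult)
    qed
    finally show "0 \<le> Re (\<Sum>i\<in>UNIV. \<Sum>j\<in>UNIV. cnj (x i) * S $ i $ j * x j)"
      using d0 by (simp add: sum_nonneg)
  qed
  moreover have "S ** S = B"
    unfolding Finite_Cartesian_Product.vec_eq_iff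
  proof (intro allI)
    fix i j
    have "(S ** S) $ i $ j = (\<Sum>l\<in>UNIV. \<Sum>e\<in>E. \<Sum>e'\<in>E.
        of_real (sqrt (?d e)) * e $ i * of_real (sqrt (?d e')) * cnj (e' $ j) * (cnj (e $ l) * e' $ l))"
      by (simp add: matrix_matrix_mult_def S_def sum_product mult_ac)
    also have "\<dots> = (\<Sum>e\<in>E. \<Sum>l\<in>UNIV. \<Sum>e'\<in>E.
        of_real (sqrt (?d e)) * e $ i * of_real (sqrt (?d e')) * cnj (e' $ j) * (cnj (e $ l) * e' $ l))"
      by (rule sum.swap)
    also have "\<dots> = (\<Sum>e\<in>E. \<Sum>e'\<in>E. \<Sum>l\<in>UNIV.
        of_real (sqrt (?d e)) * e $ i * of_real (sqrt (?d e')) * cnj (e' $ j) * (cnj (e $ l) * e' $ l))"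
      by (intro sum.cong refl sum.swap)
    also have "\<dots> = (\<Sum>e\<in>E. \<Sum>e'\<in>E. of_real (sqrt (?d e)) * e $ i * of_real (sqrt (?d e')) * cnj (e' $ j) * cinner e e')"
      by (simp add: cinner_vec_def cinner_complex_def sum_distrib_left)
    also have "\<dots> = (\<Sum>e\<in>E. \<Sum>e'\<in>E. if e' = e then of_real (?d e) * cnj (e $ j) * e $ i else 0)"
    proof (intro sum.cong refl)
      fix e e' assume "e \<in> E" "e' \<in> E"
      then have "cinner e e' = (if e' = e then 1 else 0)" using on by (auto simp: orthonormal_def)
      moreover have "complex_of_real (sqrt (?d e)) * of_real (sqrt (?d e)) = of_real (?d e)"
        using d0[of e] by (simp only: of_real_mult[symmetric] real_sqrt_mult_self abs_of_nonneg)
      ultimately show "of_real (sqrt (?d e)) * e $ i * of_real (sqrt (?d e')) * cnj (e' $ j) * cinner e e' =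
          (if e' = e then of_real (?d e) * cnj (e $ j) * e $ i else 0)"
        by (simp add: mult_ac)
    qed
    also have "\<dots> = (\<Sum>e\<in>E. of_real (?d e) * cnj (e $ j) * e $ i)" using fin by simp
    also have "\<dots> = ?T (Finite_Cartesian_Product.axis j 1) $ i"
      by (subst ex) (simp add: cinner_axis cinner_complex_def scaleC_vec_def scaleC_complex_def)
    also have "\<dots> = B $ i $ j" by (rule scalar_mat_op_entry[symmetric])
    finally show "(S ** S) $ i $ j = B $ i $ j" .
  qed
  ultimately show ?thesis by blast
qed

text \<open>An eigenvector \<open>e\<close> of \<open>D = S - R\<close> with eigenvalue \<open>d \<noteq> 0\<close> would satisfy
  \<open>0 = \<langle>e, (S\<^sup>2 - R\<^sup>2) e\<rangle> = d (\<langle>e, S e\<rangle> + \<langle>e, R e\<rangle>)\<close>, so both forms vanish at \<open>e\<close>, and then so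
  does \<open>d\<close>.\<close>

lemma psd_sqrt_unique:
  fixes S R :: "complex ^ 'k ^ 'k::finite"
  assumes S: "psd S" and R: "psd R" and eq: "S ** S = R ** R" shows "S = R"
proof -
  define D where "D = S - R"
  have D: "D $ i $ j = cnj (D $ j $ i)" for i j using psdD(1)[OF S, of i j] psdD(1)[OF R, of i j] by (simp add: D_def)
  let ?S = "scalar_mat_op S :: complex ^ 'k \<Rightarrow> complex ^ 'k" and ?R = "scalar_mat_op R :: complex ^ 'k \<Rightarrow> complex ^ 'k"
    and ?D = "scalar_mat_op D :: complex ^ 'k \<Rightarrow> complex ^ 'k"
  have Dv: "?D v = ?S v - ?R v" for v
    by (simp add: Finite_Cartesian_Product.vec_eq_iff scalar_mat_op_def D_def cvec.scale_left_diff_distrib sum_subtractf)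
  obtain E where E: "complete_eigensystem ?D E" using complete_eigensystem_exists by blast
  note T = scalar_mat_op_complex(1,2)[OF D]
  have "E = {}"
  proof (rule ccontr)
    assume "E \<noteq> {}"
    then obtain e where e: "e \<in> E" by auto
    let ?d = "complex_of_real (evalue ?D e)"
    have es: "?D e = ?d *\<^sub>C e" "evalue ?D e \<noteq> 0" using E e by (auto simp: complete_eigensystem_def eigensystem_def)
    have linS: "clinear ?S" by (rule bop_clinear[OF bop_scalar_mat_op])
    have "?S (?S e) = ?R (?R e)" by (simp only: scalar_mat_op_mult[symmetric] eq)
    then have "?S (?D e) + ?D (?R e) = 0" by (simp add: Dv clinear_simps(5)[OF linS])
    then have "cinner e (?S (?D e)) + cinner e (?D (?R e)) = 0" by (simp add: cinner_add_right[symmetric])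
    moreover have "cinner e (?D (?R e)) = ?d * cinner e (?R e)"
      unfolding cinner_scalar_mat_op[OF D, symmetric] es(1) by (simp add: cinner_scaleC_left)
    moreover have "cinner e (?S (?D e)) = ?d * cinner e (?S e)"
      unfolding es(1) clinear_simps(2)[OF linS] cinner_scaleC_right ..
    ultimately have "cinner e (?S e) + cinner e (?R e) = 0" using es(2) by (simp add: distrib_left[symmetric])
    then have "Re (cinner e (?S e)) + Re (cinner e (?R e)) = 0" by (metis plus_complex.sel(1) zero_complex.sel(1))
    then have "Re (cinner e (?S e)) = 0" "Re (cinner e (?R e)) = 0"
      using psdD(2)[OF S, of e] psdD(2)[OF R, of e] by linarith+
    then have "evalue ?D e = 0" by (simp add: evalue_def Dv cinner_diff_right)
    then show False using es(2) by simp
  qed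
  then have "?D v = 0" for v by (intro complete_eigensystem_kernel[OF T E]) simp
  then have "D $ i $ j = 0" for i j unfolding scalar_mat_op_entry[of D i j] by simp
  then show ?thesis by (simp add: D_def Finite_Cartesian_Product.vec_eq_iff)
qed

lemma psd_sqrt:
  assumes "psd B" shows "psd (psd_sqrt B)" "psd_sqrt B ** psd_sqrt B = B"
proof -
  have "\<exists>!S. psd S \<and> S ** S = B" using psd_sqrt_exists[OF assms] psd_sqrt_unique by blast
  from theI'[OF this] show "psd (psd_sqrt B)" "psd_sqrt B ** psd_sqrt B = B" by (simp_all add: psd_sqrt_def)
qed

section \<open>Truncation of the deterministic matrices\<close>

lemma hermitian_hermf: "hermitian n X \<Longrightarrow> hermf n (ent X)"
  unfolding hermitian_def hermf_def ent_def by (metis mat_adjoint_index)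

text \<open>With its converse \<open>eigenbasis_unitary_diag\<close> it translates between the
  diagonalizations in \<open>mat_fun\<close> and eigenbases.\<close>

lemma unitary_diag_eigenbasis:
  assumes V: "V \<in> unitary_group n"
    and X: "X = V * mat_diag n (\<lambda>i. complex_of_real (d i)) * mat_adjoint V"
  shows "eigenbasis n (ent X) n (\<lambda>k i. V $$ (i, k)) d"
    "\<And>i j. i < n \<Longrightarrow> j < n \<Longrightarrow> ent X i j = spectral_sum n (\<lambda>k i. V $$ (i, k)) d i j"
proof -
  have Vc: "V \<in> carrier_mat n n" and VV: "mat_adjoint V * V = 1\<^sub>m n" using V by (auto simp: unitary_group_def)
  note Va = mat_adjoint_carrier[OF Vc]
  have Vd: "V * mat_diag n (\<lambda>i. complex_of_real (d i)) = Matrix.mat n n (\<lambda>(i, k). V $$ (i, k) * of_real (d k))"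
    using mat_diag_mult_right[OF Vc, of "\<lambda>i. complex_of_real (d i)"] by simp
  show ent: "ent X i j = spectral_sum n (\<lambda>k i. V $$ (i, k)) d i j" if ij: "i < n" "j < n" for i j
  proof -
    have "ent X i j = (\<Sum>k<n. Matrix.mat n n (\<lambda>(i, k). V $$ (i, k) * of_real (d k)) $$ (i, k) * mat_adjoint V $$ (k, j))"
      unfolding ent_def X Vd by (rule mat_times_index[OF _ Va ij]) simp
    also have "\<dots> = spectral_sum n (\<lambda>k i. V $$ (i, k)) d i j"
      unfolding spectral_sum_def using ij by (intro sum.cong refl) (simp add: mat_adjoint_index[OF Vc] mult_ac)
    finally show ?thesis .
  qed
  have on: "vip n (\<lambda>i. V $$ (i, k)) (\<lambda>i. V $$ (i, l)) = (if k = l then 1 else 0)" if kl: "k < n" "l < n" for k l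
  proof -
    have "vip n (\<lambda>i. V $$ (i, k)) (\<lambda>i. V $$ (i, l)) = (mat_adjoint V * V) $$ (k, l)"
      unfolding mat_times_index[OF Va Vc kl] vip_def using kl by (intro sum.cong refl) (simp add: mat_adjoint_index[OF Vc])
    then show ?thesis using kl by (simp add: VV)
  qed
  show "eigenbasis n (ent X) n (\<lambda>k i. V $$ (i, k)) d"
    unfolding eigenbasis_def
  proof (intro conjI allI impI on)
    fix k i assume ki: "k < n" "i < n"
    have "mvec n (ent X) (\<lambda>i. V $$ (i, k)) i = mvec n (spectral_sum n (\<lambda>k i. V $$ (i, k)) d) (\<lambda>i. V $$ (i, k)) i"
      by (rule mvec_cong) (use ent ki in auto)
    also have "\<dots> = (\<Sum>l<n. if l = k then of_real (d k) * V $$ (i, k) else 0)"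
      unfolding mvec_spectral_sum using on ki by (intro sum.cong refl) auto
    finally show "mvec n (ent X) (\<lambda>i. V $$ (i, k)) i = of_real (d k) * V $$ (i, k)" using ki by simp
  qed
qed

lemma eigenbasis_unitary_diag:
  assumes eb: "eigenbasis n (ent X) n W e" and X: "X \<in> carrier_mat n n"
  shows "\<exists>V. V \<in> unitary_group n \<and> X = V * mat_diag n (\<lambda>i. complex_of_real (e i)) * mat_adjoint V"
proof -
  define V where "V = Matrix.mat n n (\<lambda>(i, k). W k i)"
  have Vc: "V \<in> carrier_mat n n" by (simp add: V_def)
  note Va = mat_adjoint_carrier[OF Vc]
  have VV: "mat_adjoint V * V = 1\<^sub>m n"
  proof (rule eq_matI)
    fix i j assume "i < dim_row (1\<^sub>m n :: complex mat)" "j < dim_col (1\<^sub>m n :: complex mat)"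
    then have ij: "i < n" "j < n" by auto
    have "(mat_adjoint V * V) $$ (i, j) = vip n (W i) (W j)"
      unfolding mat_times_index[OF Va Vc ij] vip_def using ij
      by (intro sum.cong refl) (simp add: mat_adjoint_index[OF Vc], simp add: V_def)
    then show "(mat_adjoint V * V) $$ (i, j) = 1\<^sub>m n $$ (i, j)" using eb ij by (simp add: eigenbasis_def)
  qed (use Va Vc in auto)
  then have VV': "V * mat_adjoint V = 1\<^sub>m n" by (rule mat_mult_left_right_inverse[OF Va Vc])
  have Vd: "V * mat_diag n (\<lambda>i. complex_of_real (e i)) = Matrix.mat n n (\<lambda>(i, k). V $$ (i, k) * of_real (e k))"
    using mat_diag_mult_right[OF Vc, of "\<lambda>i. complex_of_real (e i)"] by simp
  have "X = V * mat_diag n (\<lambda>i. complex_of_real (e i)) * mat_adjoint V"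
  proof (rule eq_matI)
    fix i j assume "i < dim_row (V * mat_diag n (\<lambda>i. complex_of_real (e i)) * mat_adjoint V)"
      "j < dim_col (V * mat_diag n (\<lambda>i. complex_of_real (e i)) * mat_adjoint V)"
    then have ij: "i < n" "j < n" using Vc Va by auto
    have "(V * mat_diag n (\<lambda>i. complex_of_real (e i)) * mat_adjoint V) $$ (i, j) =
        (\<Sum>k<n. Matrix.mat n n (\<lambda>(i, k). V $$ (i, k) * of_real (e k)) $$ (i, k) * mat_adjoint V $$ (k, j))"
      unfolding Vd by (rule mat_times_index[OF _ Va ij]) simp
    also have "\<dots> = spectral_sum n W e i j"
      unfolding spectral_sum_def using ij
      by (intro sum.cong refl) (simp add: mat_adjoint_index[OF Vc], simp add: V_def mult_ac)
    finally show "X $$ (i, j) = (V * mat_diag n (\<lambda>i. complex_of_real (e i)) * mat_adjoint V) $$ (i, j)"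
      using eigenbasis_spectral_sum[OF eb ij] by (simp add: ent_def)
  qed (use X Vc Va in auto)
  then show ?thesis using Vc VV VV' by (auto simp: unitary_group_def)
qed

text \<open>Eigenvectors \<open>V k\<close> and \<open>W l\<close> with different eigenvalues are
  orthogonal, so \<open>f (d k)\<close> may be exchanged for \<open>f (e l)\<close> in front of
  their inner product. The choice inside \<open>mat_fun\<close> thus has no effect on the
  result.\<close>

lemma spectral_sum_unique:
  assumes V: "eigenbasis n X n V d" and W: "eigenbasis n X n W e" and ij: "i < n" "j < n"
  shows "spectral_sum n V (\<lambda>k. f (d k)) i j = spectral_sum n W (\<lambda>k. f (e k)) i j"
proof -
  have Wl: "mvec n (spectral_sum n V (\<lambda>k. f (d k))) (W l) i = of_real (f (e l)) * W l i" if l: "l < n" and i: "i < n" for l i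
  proof -
    have "of_real (f (d k)) * vip n (V k) (W l) = of_real (f (e l)) * vip n (V k) (W l)" if k: "k < n" for k
    proof -
      have "of_real (d k) * vip n (V k) (W l) = vip n (V k) (mvec n X (W l))" by (rule vip_mvec_eigenbasis[OF V k, symmetric])
      also have "\<dots> = vip n (V k) (\<lambda>i. of_real (e l) * W l i)" using W l by (intro vip_cong) (auto simp: eigenbasis_def)
      finally have "(complex_of_real (d k) - of_real (e l)) * vip n (V k) (W l) = 0" by (simp add: vip_scale_right left_diff_distrib)
      then have "d k = e l \<or> vip n (V k) (W l) = 0" by (simp only: mult_eq_0_iff right_minus_eq of_real_eq_iff)
      then show ?thesis by auto
    qed
    then have "mvec n (spectral_sum n V (\<lambda>k. f (d k))) (W l) i = of_real (f (e l)) * (\<Sum>k<n. vip n (V k) (W l) * V k i)"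
      unfolding mvec_spectral_sum sum_distrib_left by (intro sum.cong refl) (simp add: mult.assoc[symmetric])
    then show ?thesis using eigenbasis_expand[OF V i, of "W l"] by simp
  qed
  have "eigenbasis n (spectral_sum n V (\<lambda>k. f (d k))) n W (\<lambda>k. f (e k))"
    using W Wl by (auto simp: eigenbasis_def)
  from eigenbasis_spectral_sum[OF this ij] show ?thesis .
qed

lemma mat_fun_eq:
  assumes eb: "eigenbasis n (ent X) n V d" and X: "X \<in> carrier_mat n n"
  shows "mat_fun n f X \<in> carrier_mat n n"
    "\<And>i j. i < n \<Longrightarrow> j < n \<Longrightarrow> ent (mat_fun n f X) i j = spectral_sum n V (\<lambda>k. f (d k)) i j"
proof -
  let ?P = "\<lambda>Y. \<exists>V (d :: nat \<Rightarrow> real). V \<in> unitary_group n \<and>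
        X = V * mat_diag n (\<lambda>i. complex_of_real (d i)) * mat_adjoint V \<and>
        Y = V * mat_diag n (\<lambda>i. complex_of_real (f (d i))) * mat_adjoint V"
  have "\<exists>Y. ?P Y" using eigenbasis_unitary_diag[OF eb X] by blast
  from someI_ex[OF this] have "?P (mat_fun n f X)" unfolding mat_fun_def .
  then obtain W e where W: "W \<in> unitary_group n" "X = W * mat_diag n (\<lambda>i. complex_of_real (e i)) * mat_adjoint W"
      "mat_fun n f X = W * mat_diag n (\<lambda>i. complex_of_real (f (e i))) * mat_adjoint W" by blast
  have Wc: "W \<in> carrier_mat n n" using W(1) by (simp add: unitary_group_def)
  show "mat_fun n f X \<in> carrier_mat n n" unfolding W(3) using Wc mat_adjoint_carrier[OF Wc] by auto
  fix i j assume ij: "i < n" "j < n"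
  show "ent (mat_fun n f X) i j = spectral_sum n V (\<lambda>k. f (d k)) i j"
    unfolding unitary_diag_eigenbasis(2)[OF W(1,3) ij]
    by (rule spectral_sum_unique[OF unitary_diag_eigenbasis(1)[OF W(1,2)] eb ij])
qed

lemma mat_word_carrier: "(\<And>j. F j \<in> carrier_mat n n) \<Longrightarrow> mat_word n F w \<in> carrier_mat n n"
  by (induction w) (auto simp: mat_word_def intro: mult_carrier_mat[of _ n n _ n])

text \<open>The counterpart of \<open>op_trace_word\<close> for matrices. Both traces become sums
  over closed paths of the same shape, so that the convergence assumed for words can be read as
  convergence of path sums.\<close>

lemma mat_Tr_word_rank:
  fixes e :: "'k \<Rightarrow> nat \<Rightarrow> nat \<Rightarrow> complex" and \<iota> :: "'s \<Rightarrow> 'k"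
  assumes F: "\<And>i. F i \<in> carrier_mat n n"
    and rep: "\<And>i r s. r < n \<Longrightarrow> s < n \<Longrightarrow> ent (F i) r s = (\<Sum>m<N. c i m * e i m r * cnj (e i m s))"
  defines "k \<equiv> \<lambda>(s, m) (s', m'). c (\<iota> s) m * vip n (e (\<iota> s) m) (e (\<iota> s') m')" and "Q \<equiv> UNIV \<times> {..<N}"
  shows "mat_Tr (mat_word n F (map \<iota> (s # w))) = (\<Sum>z\<in>{z\<in>Q. fst z = s}. path_sum Q fst k w z z)"
proof -
  let ?W = "\<lambda>w. mat_word n F (map \<iota> w)"
  have Wc: "?W w \<in> carrier_mat n n" for w by (rule mat_word_carrier[OF F])
  have fibre: "(\<Sum>z\<in>{z\<in>Q. fst z = s}. g z) = (\<Sum>m<N. g (s, m))" for g :: "_ \<Rightarrow> complex" and s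
    by (rule sum.reindex_bij_witness[of _ "Pair s" snd]) (auto simp: Q_def)
  have Fv: "mvec n (ent (F i)) v r = (\<Sum>m<N. (c i m * vip n (e i m) v) * e i m r)" if "r < n" for i v r
  proof -
    have "mvec n (ent (F i)) v r = (\<Sum>s<n. \<Sum>m<N. c i m * e i m r * cnj (e i m s) * v s)"
      unfolding mvec_def using rep[OF that] by (intro sum.cong refl) (simp add: sum_distrib_right)
    also have "\<dots> = (\<Sum>m<N. \<Sum>s<n. c i m * e i m r * cnj (e i m s) * v s)" by (rule sum.swap)
    finally show ?thesis unfolding vip_def by (simp add: sum_distrib_left sum_distrib_right mult_ac)
  qed
  have Wv: "mvec n (ent (?W (s # w))) v r = (\<Sum>m<N. (c (\<iota> s) m * vip n (e (\<iota> s) m) (mvec n (ent (?W w)) v)) * e (\<iota> s) m r)"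
    if r: "r < n" for s w v r
  proof -
    have "?W (s # w) = F (\<iota> s) * ?W w" by (simp add: mat_word_def)
    then have "mvec n (ent (?W (s # w))) v r = mvec n (ent (F (\<iota> s))) (mvec n (ent (?W w)) v) r"
      using mvec_ent_mult[OF F Wc r] by simp
    then show ?thesis using Fv[OF r] by simp
  qed
  have ps: "path_sum Q fst k w (t, m) (t', m') = c (\<iota> t) m * vip n (e (\<iota> t) m) (mvec n (ent (?W w)) (e (\<iota> t') m'))" for w t t' m m'
  proof (induction w arbitrary: t m)
    case Nil
    have "mvec n (ent (?W [])) v r = v r" if "r < n" for v r
    proof -
      have "mvec n (ent (?W [])) v r = (\<Sum>j<n. if r = j then v j else 0)"
        unfolding mvec_def ent_def mat_word_def using that by (intro sum.cong refl) auto
      then show ?thesis using that by simp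
    qed
    then have "vip n x (mvec n (ent (?W [])) y) = vip n x y" for x y by (intro vip_cong refl)
    then show ?case by (simp add: k_def)
  next
    case (Cons s w)
    have "path_sum Q fst k (s # w) (t, m) (t', m') = (\<Sum>u<N. k (t, m) (s, u) * path_sum Q fst k w (s, u) (t', m'))"
      unfolding path_sum.simps by (rule fibre)
    also have "\<dots> = c (\<iota> t) m * vip n (e (\<iota> t) m) (\<lambda>r. \<Sum>u<N. (c (\<iota> s) u * vip n (e (\<iota> s) u) (mvec n (ent (?W w)) (e (\<iota> t') m'))) * e (\<iota> s) u r)"
      unfolding vip_sum_right vip_scale_right Cons sum_distrib_left by (intro sum.cong refl) (simp add: k_def mult_ac)
    also have "vip n (e (\<iota> t) m) (\<lambda>r. \<Sum>u<N. (c (\<iota> s) u * vip n (e (\<iota> s) u) (mvec n (ent (?W w)) (e (\<iota> t') m'))) * e (\<iota> s) u r) =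
        vip n (e (\<iota> t) m) (mvec n (ent (?W (s # w))) (e (\<iota> t') m'))"
      by (intro vip_cong refl) (simp only: Wv)
    finally show ?case .
  qed
  have "mat_Tr (?W (s # w)) = (\<Sum>r<n. fmul {..<n} (ent (F (\<iota> s))) (ent (?W w)) r r)"
    unfolding mat_Tr_ftr[OF Wc] ftr_def using ent_mult[OF F Wc] by (intro sum.cong refl) (simp add: mat_word_def)
  also have "\<dots> = (\<Sum>r<n. \<Sum>q<n. \<Sum>m<N. c (\<iota> s) m * e (\<iota> s) m r * cnj (e (\<iota> s) m q) * ent (?W w) q r)"
    unfolding fmul_def by (intro sum.cong refl) (simp add: rep sum_distrib_right)
  also have "\<dots> = (\<Sum>r<n. \<Sum>m<N. \<Sum>q<n. c (\<iota> s) m * e (\<iota> s) m r * cnj (e (\<iota> s) m q) * ent (?W w) q r)"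
    by (intro sum.cong refl sum.swap)
  also have "\<dots> = (\<Sum>m<N. \<Sum>r<n. \<Sum>q<n. c (\<iota> s) m * e (\<iota> s) m r * cnj (e (\<iota> s) m q) * ent (?W w) q r)" by (rule sum.swap)
  also have "\<dots> = (\<Sum>m<N. \<Sum>q<n. \<Sum>r<n. c (\<iota> s) m * e (\<iota> s) m r * cnj (e (\<iota> s) m q) * ent (?W w) q r)"
    by (intro sum.cong refl sum.swap)
  also have "\<dots> = (\<Sum>m<N. c (\<iota> s) m * vip n (e (\<iota> s) m) (mvec n (ent (?W w)) (e (\<iota> s) m)))"
    unfolding vip_def mvec_def by (simp add: sum_distrib_left mult_ac)
  finally show ?thesis unfolding fibre ps .
qed

section \<open>The soft threshold and the selected eigenvectors\<close>

text \<open>Shrinking by \<open>\<epsilon>\<close> makes the function vanish near 0 while moving no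
  point of [-R, R] by more than \<open>\<epsilon>\<close>; clipping at \<open>R\<close> makes it
  bounded and changes nothing on that interval.\<close>

definition soft_clip :: "real \<Rightarrow> real \<Rightarrow> real \<Rightarrow> real" where
  "soft_clip \<epsilon> R x = max (- R) (min R (x - max (- \<epsilon>) (min \<epsilon> x)))"

lemma soft_clip_C0b: "0 < \<epsilon> \<Longrightarrow> 0 < R \<Longrightarrow> soft_clip \<epsilon> R \<in> C0b"
proof -
  assume \<epsilon>: "0 < \<epsilon>" and R: "0 < R"
  have "continuous_on UNIV (soft_clip \<epsilon> R)" unfolding soft_clip_def by (intro continuous_intros)
  moreover have "bounded (range (soft_clip \<epsilon> R))"
    by (rule boundedI[of _ R]) (use R in \<open>auto simp: soft_clip_def\<close>)
  moreover have "soft_clip \<epsilon> R x = 0" if "\<bar>x\<bar> < \<epsilon>" for x using that R by (auto simp: soft_clip_def)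
  ultimately show ?thesis using \<epsilon> unfolding C0b_def by blast
qed

lemma soft_clip_near: "0 < \<epsilon> \<Longrightarrow> \<bar>x\<bar> \<le> R \<Longrightarrow> \<bar>x - soft_clip \<epsilon> R x\<bar> \<le> \<epsilon>"
  unfolding soft_clip_def by (auto simp: max_def min_def)

lemma soft_clip_le: "0 < \<epsilon> \<Longrightarrow> 0 < R \<Longrightarrow> \<bar>soft_clip \<epsilon> R x\<bar> \<le> \<bar>x\<bar>" "0 < R \<Longrightarrow> \<bar>soft_clip \<epsilon> R x\<bar> \<le> R"
  unfolding soft_clip_def by (auto simp: max_def min_def)

lemma soft_clip_nonzero: "soft_clip \<epsilon> R x \<noteq> 0 \<Longrightarrow> 0 < \<epsilon> \<Longrightarrow> 0 < R \<Longrightarrow> \<epsilon> < \<bar>x\<bar>"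
  unfolding soft_clip_def by (auto simp: max_def min_def split: if_splits)

lemma C0b_vanishes: "f \<in> C0b \<Longrightarrow> vanishes_near_0 f"
  by (auto simp: C0b_def vanishes_near_0_def)

text \<open>The eigenvectors of \<open>f (A)\<close> with nonzero eigenvalue, enumerated from \<open>0\<close> and padded with
  zero vectors.\<close>

definition sel_index :: "nat \<Rightarrow> (nat \<Rightarrow> real) \<Rightarrow> nat list" where
  "sel_index n d = sorted_list_of_set {j\<in>{..<n}. d j \<noteq> 0}"

definition sel_vec :: "nat \<Rightarrow> (nat \<Rightarrow> nat \<Rightarrow> complex) \<Rightarrow> (nat \<Rightarrow> real) \<Rightarrow> nat \<Rightarrow> nat \<Rightarrow> complex" where
  "sel_vec n V d m = (if m < length (sel_index n d) then V (sel_index n d ! m) else (\<lambda>_. 0))"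

definition sel_val :: "nat \<Rightarrow> (nat \<Rightarrow> real) \<Rightarrow> nat \<Rightarrow> real" where
  "sel_val n d m = (if m < length (sel_index n d) then d (sel_index n d ! m) else 0)"

lemma length_sel_index: "length (sel_index n d) = card {j\<in>{..<n}. d j \<noteq> 0}"
  by (simp add: sel_index_def)

lemma sel_index_nth: "m < length (sel_index n d) \<Longrightarrow> sel_index n d ! m < n \<and> d (sel_index n d ! m) \<noteq> 0"
proof -
  assume "m < length (sel_index n d)"
  then have "sel_index n d ! m \<in> set (sel_index n d)" by (rule nth_mem)
  then show ?thesis by (simp add: sel_index_def)
qed

text \<open>Terms with weight 0 are dropped and the rest renumbered from 0; padding up to a common
  \<open>N\<close> adds only terms of value 0. The index range then no longer depends on
  \<open>n\<close>.\<close>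

lemma spectral_sum_sel:
  assumes N: "card {j\<in>{..<n}. d j \<noteq> 0} \<le> N"
  shows "spectral_sum n V d r s = (\<Sum>m<N. of_real (sel_val n d m) * sel_vec n V d m r * cnj (sel_vec n V d m s))"
proof -
  let ?J = "{j\<in>{..<n}. d j \<noteq> 0}" and ?L = "sel_index n d"
  have dist: "distinct ?L" "set ?L = ?J" by (simp_all add: sel_index_def)
  have "spectral_sum n V d r s = (\<Sum>j\<in>?J. of_real (d j) * V j r * cnj (V j s))"
    unfolding spectral_sum_def by (rule sum.mono_neutral_right) auto
  also have "\<dots> = (\<Sum>m<length ?L. of_real (d (?L ! m)) * V (?L ! m) r * cnj (V (?L ! m) s))"
    unfolding dist(2)[symmetric] using sum.reindex_bij_betw[OF bij_betw_nth[OF dist(1) refl refl], symmetric] .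
  also have "\<dots> = (\<Sum>m<length ?L. of_real (sel_val n d m) * sel_vec n V d m r * cnj (sel_vec n V d m s))"
    by (intro sum.cong refl) (simp add: sel_val_def sel_vec_def)
  also have "\<dots> = (\<Sum>m<N. of_real (sel_val n d m) * sel_vec n V d m r * cnj (sel_vec n V d m s))"
    by (rule sum.mono_neutral_left) (use N in \<open>auto simp: length_sel_index sel_val_def\<close>)
  finally show ?thesis .
qed

lemma sel_vec_nsq: "eigenbasis n X n V e \<Longrightarrow> nsq n (sel_vec n V d m) \<le> 1"
proof -
  assume eb: "eigenbasis n X n V e"
  show ?thesis
  proof (cases "m < length (sel_index n d)")
    case True
    then have "vip n (V (sel_index n d ! m)) (V (sel_index n d ! m)) = 1"
      using sel_index_nth[OF True] eb by (simp add: eigenbasis_def)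
    then have "nsq n (V (sel_index n d ! m)) = 1" unfolding vip_self by (metis of_real_eq_1_iff)
    then show ?thesis using True by (simp add: sel_vec_def)
  qed (simp add: sel_vec_def nsq_def)
qed

lemma sel_vec_orth:
  assumes eb: "eigenbasis n X n V e" and m: "m < length (sel_index n d)" "m' < length (sel_index n d)"
  shows "vip n (sel_vec n V d m) (sel_vec n V d m') = (if m = m' then 1 else 0)"
proof -
  have "sel_index n d ! m = sel_index n d ! m' \<longleftrightarrow> m = m'" by (rule nth_eq_iff_index_eq) (use m in \<open>simp_all add: sel_index_def\<close>)
  then show ?thesis using sel_index_nth[OF m(1)] sel_index_nth[OF m(2)] eb m by (simp add: sel_vec_def eigenbasis_def)
qed

section \<open>From moments to eigenvalues\<close>

text \<open>For each \<open>l\<close> the matrices are compared with approximants whose traces of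
  powers converge to the power sums of a finite family, so that the counts for the approximants
  converge. Weyl's inequalities on one side and the assumed \<open>counts_near\<close> on the other
  remove the approximation as \<open>l\<close> grows.\<close>

lemma EV_converges_criterion:
  fixes Mn :: "nat \<Rightarrow> complex mat" and J :: "'j set" and e :: "'j \<Rightarrow> real"
  assumes M: "\<And>n. n \<ge> 1 \<Longrightarrow> Mn n \<in> carrier_mat n n" "\<And>n. n \<ge> 1 \<Longrightarrow> hermf n (ent (Mn n))"
    and en: "enumerates L J e"
    and approx: "\<And>l :: nat. \<exists>X (J' :: 'm set) e'. (\<forall>n. hermf n (X n)) \<and>
      (\<forall>\<^sub>F n in sequentially. \<forall>v. \<bar>Re (vip n v (mvec n (ent (Mn n)) v)) - Re (vip n v (mvec n (X n) v))\<bar> \<le> C / (real l + 1) * nsq n v) \<and>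
      finite J' \<and> (\<forall>p. (\<lambda>n. ftr {..<n} (fpow {..<n} (X n) p)) \<longlonglongrightarrow> of_real (\<Sum>j\<in>J'. e' j ^ Suc p)) \<and>
      (\<forall>\<eta>. C / (real l + 1) < \<eta> \<longrightarrow> 0 < \<eta> \<longrightarrow> counts_near \<eta> J e J' e' \<and> counts_near \<eta> J (\<lambda>j. - e j) J' (\<lambda>j. - e' j))"
  shows "EV_converges (\<lambda>n. EV_mat (Mn n)) L"
proof -
  have "\<exists>V d. n \<ge> 1 \<longrightarrow> eigenbasis n (ent (Mn n)) n V d" for n
    using eigenbasis_exists[OF M(2)] by blast
  then obtain V d where Vd: "\<And>n. n \<ge> 1 \<Longrightarrow> eigenbasis n (ent (Mn n)) n (V n) (d n)" by metis
  have ev1: "\<forall>\<^sub>F n in sequentially. n \<ge> (1::nat)" by (rule eventually_ge_at_top)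
  have en1: "\<forall>\<^sub>F n in sequentially. enumerates (EV_mat (Mn n)) {..<n} (d n)"
    using ev1 by eventually_elim (rule EV_mat_enumerates[OF M(1) Vd])
  have near: "\<exists>I' d' (J' :: 'm set) e'.
      (counts_tend I' d' J' e' \<and> counts_tend I' (\<lambda>n k. - d' n k) J' (\<lambda>j. - e' j)) \<and>
      (\<forall>\<^sub>F n in sequentially. counts_near \<eta> {..<n} (d n) (I' n :: nat set) (d' n) \<and>
         counts_near \<eta> {..<n} (\<lambda>k. - d n k) (I' n) (\<lambda>k. - d' n k)) \<and>
      counts_near \<eta> J e J' e' \<and> counts_near \<eta> J (\<lambda>j. - e j) J' (\<lambda>j. - e' j)" if \<eta>: "0 < \<eta>" for \<eta>
  proof -
    obtain l :: nat where "C / \<eta> < real l" using reals_Archimedean2 by blast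
    then have l: "C / (real l + 1) < \<eta>" using \<eta> by (simp add: field_simps)
    from approx[of l] obtain X and J' :: "'m set" and e' where X: "\<And>n. hermf n (X n)"
      and near: "\<forall>\<^sub>F n in sequentially. \<forall>v. \<bar>Re (vip n v (mvec n (ent (Mn n)) v)) - Re (vip n v (mvec n (X n) v))\<bar> \<le> C / (real l + 1) * nsq n v"
      and J': "finite J'" and mom: "\<And>p. (\<lambda>n. ftr {..<n} (fpow {..<n} (X n) p)) \<longlonglongrightarrow> of_real (\<Sum>j\<in>J'. e' j ^ Suc p)"
      and cn: "counts_near \<eta> J e J' e'" "counts_near \<eta> J (\<lambda>j. - e j) J' (\<lambda>j. - e' j)"
      using l \<eta> by blast
    obtain W g where Wg: "\<And>n. eigenbasis n (X n) n (W n) (g n)" using eigenbasis_exists[OF X] by metis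
    have "(\<lambda>n. complex_of_real (\<Sum>k<n. g n k ^ Suc p)) \<longlonglongrightarrow> of_real (\<Sum>j\<in>J'. e' j ^ Suc p)" for p
      using mom[of p] unfolding ftr_fpow_eigenbasis[OF Wg] .
    then have ps: "(\<lambda>n. \<Sum>k<n. g n k ^ Suc p) \<longlonglongrightarrow> (\<Sum>j\<in>J'. e' j ^ Suc p)" for p
      by (simp only: tendsto_of_real_iff)
    have ct: "counts_tend (\<lambda>n. {..<n}) g J' e'"
      by (rule power_sums_counts_tend) (use J' ps[of "Suc _"] in \<open>simp_all del: power_Suc add: add_2_eq_Suc'\<close>)
    have neg: "(\<Sum>k\<in>K. (- f k) ^ (p + 2)) = (- 1) ^ (p + 2) * (\<Sum>k\<in>K. f k ^ (p + 2))" for p K and f :: "'z \<Rightarrow> real"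
      unfolding sum_distrib_left by (simp only: power_minus[of "f _"])
    have ct': "counts_tend (\<lambda>n. {..<n}) (\<lambda>n k. - g n k) J' (\<lambda>j. - e' j)"
    proof (rule power_sums_counts_tend)
      show "(\<lambda>n. \<Sum>k<n. (- g n k) ^ (p + 2)) \<longlonglongrightarrow> (\<Sum>j\<in>J'. (- e' j) ^ (p + 2))" for p
        unfolding neg using ps[of "Suc p"] by (intro tendsto_mult_left) (simp del: power_Suc add: add_2_eq_Suc')
    qed (use J' in auto)
    have "\<forall>\<^sub>F n in sequentially. counts_near \<eta> {..<n} (d n) {..<n} (g n) \<and>
         counts_near \<eta> {..<n} (\<lambda>k. - d n k) {..<n} (\<lambda>k. - g n k)"
      using near ev1
    proof eventually_elim
      case (elim n)
      then show ?case using counts_near_eigenbasis[OF Vd[OF elim(2)] Wg _ l] by blast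
    qed
    with ct ct' cn show ?thesis by blast
  qed
  show ?thesis
  proof (rule EV_convergesI[OF en1 en])
    show "counts_tend (\<lambda>n. {..<n}) d J e"
    proof (rule counts_tend_approx[OF en en1, where ?'m = 'm and ?'l = nat])
      fix \<eta> :: real assume "0 < \<eta>"
      from near[OF this] obtain I' d' and J' :: "'m set" and e' where *:
        "counts_tend I' d' J' e'"
        "\<forall>\<^sub>F n in sequentially. counts_near \<eta> {..<n} (d n) (I' n :: nat set) (d' n) \<and>
         counts_near \<eta> {..<n} (\<lambda>k. - d n k) (I' n) (\<lambda>k. - d' n k)"
        "counts_near \<eta> J e J' e'" by blast
      from *(2) have "\<forall>\<^sub>F n in sequentially. counts_near \<eta> {..<n} (d n) (I' n) (d' n)"
        by (rule eventually_mono) simp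
      then show "\<exists>I' d' J' e'. counts_tend I' d' (J' :: 'm set) e' \<and>
          (\<forall>\<^sub>F n in sequentially. counts_near \<eta> {..<n} (d n) (I' n :: nat set) (d' n)) \<and> counts_near \<eta> J e J' e'"
        using *(1,3) by blast
    qed
    have en2: "\<forall>\<^sub>F n in sequentially. enumerates (\<lambda>x. EV_mat (Mn n) (- x)) {..<n} (\<lambda>k. - d n k)"
      using en1 by eventually_elim (rule enumerates_uminus)
    show "counts_tend (\<lambda>n. {..<n}) (\<lambda>n i. - d n i) J (\<lambda>j. - e j)"
    proof (rule counts_tend_approx[OF enumerates_uminus[OF en] en2, where ?'m = 'm and ?'l = nat])
      fix \<eta> :: real assume "0 < \<eta>"
      from near[OF this] obtain I' d' and J' :: "'m set" and e' where *:
        "counts_tend I' (\<lambda>n k. - d' n k) J' (\<lambda>j. - e' j)"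
        "\<forall>\<^sub>F n in sequentially. counts_near \<eta> {..<n} (d n) (I' n :: nat set) (d' n) \<and>
         counts_near \<eta> {..<n} (\<lambda>k. - d n k) (I' n) (\<lambda>k. - d' n k)"
        "counts_near \<eta> J (\<lambda>j. - e j) J' (\<lambda>j. - e' j)" by blast
      from *(2) have "\<forall>\<^sub>F n in sequentially. counts_near \<eta> {..<n} (\<lambda>k. - d n k) (I' n) (\<lambda>k. - d' n k)"
        by (rule eventually_mono) simp
      then show "\<exists>I' d' J' e'. counts_tend I' d' (J' :: 'm set) e' \<and>
          (\<forall>\<^sub>F n in sequentially. counts_near \<eta> {..<n} (\<lambda>k. - d n k) (I' n :: nat set) (d' n)) \<and> counts_near \<eta> J (\<lambda>j. - e j) J' e'"
        using *(1,3) by blast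
    qed
  qed
qed

section \<open>Operator bounds\<close>

text \<open>An upper bound rather than the norm itself: products, adjoints and conjugates are then
  estimated without suprema.\<close>

definition opb :: "nat \<Rightarrow> (nat \<Rightarrow> nat \<Rightarrow> complex) \<Rightarrow> real \<Rightarrow> bool" where
  "opb n X C \<longleftrightarrow> 0 \<le> C \<and> (\<forall>v. nsq n (mvec n X v) \<le> C\<^sup>2 * nsq n v)"

lemma opb_mono: "opb n X C \<Longrightarrow> C \<le> D \<Longrightarrow> opb n X D"
  unfolding opb_def by (meson mult_right_mono nsq_nonneg order_trans power_mono)

lemma opb_sqrt: "opb n X C \<Longrightarrow> sqrt (nsq n (mvec n X v)) \<le> C * sqrt (nsq n v)"
proof -
  assume "opb n X C"
  then have "0 \<le> C" "nsq n (mvec n X v) \<le> C\<^sup>2 * nsq n v" by (auto simp: opb_def)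
  then have "sqrt (nsq n (mvec n X v)) \<le> sqrt (C\<^sup>2 * nsq n v)" by simp
  also have "\<dots> = C * sqrt (nsq n v)" using \<open>0 \<le> C\<close> by (simp add: real_sqrt_mult)
  finally show ?thesis .
qed

lemma nsq_mvec_hs2: "nsq n (mvec n X v) \<le> hs2 n X * nsq n v"
proof -
  have "(cmod (mvec n X v i))\<^sup>2 \<le> nsq n (X i) * nsq n v" for i
  proof -
    have "mvec n X v i = vip n (\<lambda>j. cnj (X i j)) v" by (simp add: mvec_def vip_def)
    then have "cmod (mvec n X v i) \<le> sqrt (nsq n (\<lambda>j. cnj (X i j))) * sqrt (nsq n v)" using cmod_vip_le by simp
    then have "(cmod (mvec n X v i))\<^sup>2 \<le> (sqrt (nsq n (\<lambda>j. cnj (X i j))) * sqrt (nsq n v))\<^sup>2" by (intro power_mono) auto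
    then show ?thesis by (simp add: power_mult_distrib nsq_nonneg) (simp add: nsq_def)
  qed
  then have "nsq n (mvec n X v) \<le> (\<Sum>i<n. nsq n (X i) * nsq n v)" unfolding nsq_def[of n "mvec n X v"] by (intro sum_mono)
  then show ?thesis by (simp add: hs2_eq_sum_nsq(2) sum_distrib_right)
qed

text \<open>The Hilbert-Schmidt norm bounds the set in the definition of \<open>mat_opnorm\<close>,
  so its supremum is an upper bound; other vectors are rescaled to the unit ball.\<close>

lemma opb_mat_opnorm:
  assumes X: "X \<in> carrier_mat n n" shows "opb n (ent X) (mat_opnorm X)"
proof -
  let ?S = "{l2_norm (X *\<^sub>v v) | v. v \<in> carrier_vec (dim_col X) \<and> l2_norm v \<le> 1}"
  have l2: "l2_norm v = sqrt (nsq n (\<lambda>i. vec_index v i))" if "v \<in> carrier_vec n" for v :: "complex Matrix.vec"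
    using that by (simp add: l2_norm_def L2_set_def nsq_def)
  have Xv: "l2_norm (X *\<^sub>v v) = sqrt (nsq n (mvec n (ent X) (\<lambda>i. vec_index v i)))" if v: "v \<in> carrier_vec n" for v
  proof -
    have c: "X *\<^sub>v v \<in> carrier_vec n" using X v by auto
    have "vec_index (X *\<^sub>v v) i = mvec n (ent X) (\<lambda>i. vec_index v i) i" if "i < n" for i
      using X v that by (simp add: mvec_def ent_def scalar_prod_def atLeast0LessThan)
    then show ?thesis unfolding l2[OF c] using nsq_cong by (metis (no_types, lifting))
  qed
  have dc: "dim_col X = n" using X by auto
  have bdd: "bdd_above ?S"
  proof (rule bdd_aboveI[of _ "sqrt (hs2 n (ent X))"])
    fix z assume "z \<in> ?S"
    then obtain v where v: "v \<in> carrier_vec n" "l2_norm v \<le> 1" "z = l2_norm (X *\<^sub>v v)" using dc by auto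
    have "nsq n (\<lambda>i. vec_index v i) \<le> 1" using v(1,2) by (simp add: l2)
    then have "hs2 n (ent X) * nsq n (\<lambda>i. vec_index v i) \<le> hs2 n (ent X) * 1"
      by (intro mult_left_mono) (auto simp: hs2_def sum_nonneg)
    then show "z \<le> sqrt (hs2 n (ent X))" unfolding v(3) Xv[OF v(1)] using nsq_mvec_hs2[of n "ent X" "\<lambda>i. vec_index v i"] by simp
  qed
  have up: "sqrt (nsq n (mvec n (ent X) w)) \<le> mat_opnorm X" if w: "nsq n w \<le> 1" for w
  proof -
    let ?v = "Matrix.vec n w"
    have v: "?v \<in> carrier_vec n" by simp
    have eq: "nsq n (\<lambda>i. vec_index ?v i) = nsq n w" by (rule nsq_cong) simp
    have eq2: "nsq n (mvec n (ent X) (\<lambda>i. vec_index ?v i)) = nsq n (mvec n (ent X) w)"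
      by (intro nsq_cong mvec_cong) auto
    have "l2_norm (X *\<^sub>v ?v) \<in> ?S" using w dc by (intro CollectI exI[of _ ?v]) (simp add: l2[OF v] eq)
    from cSup_upper[OF this bdd] show ?thesis unfolding mat_opnorm_def Xv[OF v] eq2 .
  qed
  have C0: "0 \<le> mat_opnorm X" using up[of "\<lambda>_. 0"] nsq_nonneg by (simp add: nsq_def) (metis order_trans real_sqrt_ge_zero sum_nonneg zero_le_power2)
  show ?thesis unfolding opb_def
  proof (intro conjI C0 allI)
    fix v
    show "nsq n (mvec n (ent X) v) \<le> (mat_opnorm X)\<^sup>2 * nsq n v"
    proof (cases "nsq n v = 0")
      case True
      then have "v i = 0" if "i < n" for i using that nsq_eq_0[of n v] by simp
      then have "nsq n (mvec n (ent X) v) = 0" by (simp add: nsq_def mvec_def)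
      then show ?thesis using True by simp
    next
      case False
      then have p: "0 < nsq n v" using nsq_nonneg[of n v] by simp
      define w where "w i = of_real (1 / sqrt (nsq n v)) * v i" for i
      have s: "(cmod (of_real (1 / sqrt (nsq n v))))\<^sup>2 = 1 / nsq n v"
        using p by (simp only: norm_of_real power2_abs) (simp add: power_divide)
      have "nsq n w = 1" unfolding w_def nsq_scale s using p by simp
      then have "sqrt (nsq n (mvec n (ent X) w)) \<le> mat_opnorm X" by (intro up) simp
      then have "nsq n (mvec n (ent X) w) \<le> (mat_opnorm X)\<^sup>2"
        using C0 by (metis real_sqrt_le_iff real_sqrt_unique)
      moreover have "nsq n (mvec n (ent X) w) = nsq n (mvec n (ent X) v) / nsq n v"
        unfolding w_def mvec_scale nsq_scale s by simp
      ultimately show ?thesis using p by (simp add: field_simps)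
    qed
  qed
qed

text \<open>The Cauchy-Schwarz inequality applied to the squared length of X^* v, written as <v, X
  X^* v>.\<close>

lemma opb_adjoint:
  assumes X: "X \<in> carrier_mat n n" and b: "opb n (ent X) C" shows "opb n (ent (mat_adjoint X)) C"
  unfolding opb_def
proof (intro conjI allI)
  show C: "0 \<le> C" using b by (simp add: opb_def)
  fix v
  let ?w = "mvec n (ent (mat_adjoint X)) v"
  have "complex_of_real (nsq n ?w) = vip n v (mvec n (ent X) ?w)" unfolding vip_mat_adjoint[OF X] vip_self ..
  then have "\<bar>nsq n ?w\<bar> \<le> sqrt (nsq n v) * sqrt (nsq n (mvec n (ent X) ?w))" using cmod_vip_le by (metis norm_of_real)
  also have "\<dots> \<le> sqrt (nsq n v) * (C * sqrt (nsq n ?w))" by (intro mult_left_mono opb_sqrt[OF b]) (simp add: nsq_nonneg)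
  finally have *: "sqrt (nsq n ?w) * sqrt (nsq n ?w) \<le> (C * sqrt (nsq n v)) * sqrt (nsq n ?w)"
    using nsq_nonneg[of n ?w] by (simp add: mult_ac)
  have "sqrt (nsq n ?w) \<le> C * sqrt (nsq n v)"
  proof (cases "nsq n ?w = 0")
    case True
    then show ?thesis using C nsq_nonneg[of n v] by simp
  next
    case False
    then have "0 < sqrt (nsq n ?w)" using nsq_nonneg[of n ?w] by simp
    with * show ?thesis by (rule mult_right_le_imp_le)
  qed
  then have "(sqrt (nsq n ?w))\<^sup>2 \<le> (C * sqrt (nsq n v))\<^sup>2" by (intro power_mono) (auto simp: nsq_nonneg)
  then show "nsq n ?w \<le> C\<^sup>2 * nsq n v" by (simp add: power_mult_distrib nsq_nonneg)
qed

lemma opb_mult: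
  assumes X: "X \<in> carrier_mat n n" "opb n (ent X) C" and Y: "Y \<in> carrier_mat n n" "opb n (ent Y) D"
  shows "opb n (ent (X * Y)) (C * D)"
  unfolding opb_def
proof (intro conjI allI)
  show "0 \<le> C * D" using X Y by (simp add: opb_def)
  fix v
  have "nsq n (mvec n (ent (X * Y)) v) = nsq n (mvec n (ent X) (mvec n (ent Y) v))"
    by (intro nsq_cong mvec_ent_mult X Y)
  also have "\<dots> \<le> C\<^sup>2 * nsq n (mvec n (ent Y) v)" using X by (simp add: opb_def)
  also have "\<dots> \<le> C\<^sup>2 * (D\<^sup>2 * nsq n v)" using Y by (intro mult_left_mono) (auto simp: opb_def)
  finally show "nsq n (mvec n (ent (X * Y)) v) \<le> (C * D)\<^sup>2 * nsq n v" by (simp add: power_mult_distrib mult.assoc)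
qed

lemma opb_unitary: "W \<in> unitary_group n \<Longrightarrow> opb n (ent W) 1" "W \<in> unitary_group n \<Longrightarrow> opb n (ent (mat_adjoint W)) 1"
  by (simp_all add: opb_def nsq_mvec_unitary)

lemma opb_conj_by:
  assumes W: "W \<in> unitary_group n" and X: "X \<in> carrier_mat n n" "opb n (ent X) C"
  shows "opb n (ent (conj_by W X)) C"
proof -
  have Wc: "W \<in> carrier_mat n n" using W by (simp add: unitary_group_def)
  have "opb n (ent (W * X * mat_adjoint W)) (1 * C * 1)"
    by (rule opb_mult[OF mult_carrier_mat[OF Wc X(1)] opb_mult[OF Wc opb_unitary(1)[OF W] X] mat_adjoint_carrier[OF Wc] opb_unitary(2)[OF W]])
  then show ?thesis by (simp add: conj_by_def)
qed

text \<open>Each of the \<open>n\<close> columns is the image of a unit vector. Bounded operator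
  norms thus provide the linear growth of \<open>hs2\<close> that the moment bound asks for.\<close>

lemma hs2_opb:
  assumes "opb n X C" shows "hs2 n X \<le> C\<^sup>2 * n"
proof -
  have "nsq n (\<lambda>i. X i j) \<le> C\<^sup>2" if j: "j < n" for j
  proof -
    let ?e = "\<lambda>k. if k = j then 1 else 0"
    have "(cmod (?e k))\<^sup>2 = (if k = j then 1 else 0)" for k by simp
    then have n1: "nsq n ?e = 1" unfolding nsq_def using j by simp
    have "mvec n X ?e i = X i j" for i
    proof -
      have "mvec n X ?e i = (\<Sum>k<n. if k = j then X i j else 0)" unfolding mvec_def by (intro sum.cong refl) auto
      then show ?thesis using j by simp
    qed
    then have "mvec n X ?e = (\<lambda>i. X i j)" by auto
    then show ?thesis using assms n1 unfolding opb_def by (metis mult.right_neutral)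
  qed
  then have "hs2 n X \<le> (\<Sum>j<n. C\<^sup>2)" unfolding hs2_eq_sum_nsq(1) by (intro sum_mono) auto
  then show ?thesis by (simp add: mult.commute)
qed

lemma Re_vip_le: "\<bar>Re (vip n x y)\<bar> \<le> sqrt (nsq n x) * sqrt (nsq n y)"
  using abs_Re_le_cmod cmod_vip_le order_trans by blast

section \<open>The deterministic limit of moments\<close>

text \<open>Everything that involves only the deterministic \<open>A\<close> and the limit
  \<open>a\<close>; the random factors enter later through their limits
  \<open>\<kappa>\<close>.\<close>

locale compact_limit =
  fixes A :: "nat \<Rightarrow> 'k::finite \<Rightarrow> complex mat" and a :: "'k \<Rightarrow> 'h::complex_hilbert \<Rightarrow> 'h"
  assumes herm: "\<And>n i. n \<ge> 1 \<Longrightarrow> hermitian n (A n i)"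
    and sep: "separable_space (euclidean :: 'h topology)"
    and comp: "\<And>i. compact_operator (a i)"
    and sa: "\<And>i. selfadjoint (a i)"
    and conv: "converges_in_compact_distribution A a"
begin

lemma sc: "seq_compact_op (a i)" by (rule compact_operator_seq_compact[OF comp])

lemma Acarr: "n \<ge> 1 \<Longrightarrow> A n i \<in> carrier_mat n n" using herm by (simp add: hermitian_def)

definition E :: "'k \<Rightarrow> 'h set" where "E i = (SOME E. complete_eigensystem (a i) E)"

lemma E: "complete_eigensystem (a i) (E i)"
  unfolding E_def by (rule someI_ex[OF complete_eigensystem_exists])

definition eb :: "nat \<Rightarrow> 'k \<Rightarrow> (nat \<Rightarrow> nat \<Rightarrow> complex) \<times> (nat \<Rightarrow> real)" where
  "eb n i = (SOME x. eigenbasis n (ent (A n i)) n (fst x) (snd x))"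

definition V :: "nat \<Rightarrow> 'k \<Rightarrow> nat \<Rightarrow> nat \<Rightarrow> complex" where "V n i = fst (eb n i)"
definition d :: "nat \<Rightarrow> 'k \<Rightarrow> nat \<Rightarrow> real" where "d n i = snd (eb n i)"

lemma Vd: "eigenbasis n (ent (A n i)) n (V n i) (d n i)"
proof -
  have "hermf n (ent (A n i))"
  proof (cases "n \<ge> 1")
    case False then show ?thesis by (simp add: hermf_def)
  qed (rule hermitian_hermf[OF herm])
  from eigenbasis_exists[OF this] obtain W g where "eigenbasis n (ent (A n i)) n W g" by blast
  then have "\<exists>x. eigenbasis n (ent (A n i)) n (fst x) (snd x)" by (intro exI[of _ "(W, g)"]) simp
  from someI_ex[OF this] show ?thesis unfolding V_def d_def eb_def .
qed

definition fA :: "(real \<Rightarrow> real) \<Rightarrow> nat \<Rightarrow> 'k \<Rightarrow> nat \<Rightarrow> nat \<Rightarrow> complex" where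
  "fA f n i = spectral_sum n (V n i) (\<lambda>j. f (d n i j))"

lemma mat_fun_A:
  assumes "n \<ge> 1"
  shows "mat_fun n f (A n i) \<in> carrier_mat n n" "\<And>r s. r < n \<Longrightarrow> s < n \<Longrightarrow> ent (mat_fun n f (A n i)) r s = fA f n i r s"
  unfolding fA_def using mat_fun_eq[OF Vd Acarr[OF assms]] by blast+

lemma word_limit:
  assumes f: "f \<in> C0b"
  shows "(\<lambda>n. mat_Tr (mat_word n (\<lambda>i. mat_fun n f (A n i)) (i # w)))
      \<longlonglongrightarrow> op_trace (foldr (\<lambda>i T. op_fun f (a i) \<circ> T) (i # w) id)"
  using conv[unfolded converges_in_compact_distribution_def, rule_format, of "\<lambda>_. f" "i # w"] f by simp

definition u :: "(real \<Rightarrow> real) \<Rightarrow> nat \<Rightarrow> 'k \<Rightarrow> nat \<Rightarrow> nat \<Rightarrow> complex" where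
  "u f n i = sel_vec n (V n i) (\<lambda>j. f (d n i j))"
definition c :: "(real \<Rightarrow> real) \<Rightarrow> nat \<Rightarrow> 'k \<Rightarrow> nat \<Rightarrow> real" where
  "c f n i = sel_val n (\<lambda>j. f (d n i j))"

text \<open>A bound that eventually serves all \<open>n\<close> and \<open>i\<close> lets the small
  matrices share one index set.\<close>

definition rank_le :: "(real \<Rightarrow> real) \<Rightarrow> nat \<Rightarrow> bool" where
  "rank_le f N \<longleftrightarrow> (\<forall>\<^sub>F n in sequentially. \<forall>i. card {j\<in>{..<n}. f (d n i j) \<noteq> 0} \<le> N)"

lemma fA_sel:
  assumes "card {j\<in>{..<n}. f (d n i j) \<noteq> 0} \<le> N"
  shows "fA f n i r s = (\<Sum>m<N. of_real (c f n i m) * u f n i m r * cnj (u f n i m s))"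
  unfolding fA_def u_def c_def by (rule spectral_sum_sel[OF assms])

lemma mvec_fA_sel:
  assumes "card {j\<in>{..<n}. f (d n i j) \<noteq> 0} \<le> N"
  shows "mvec n (fA f n i) v r = (\<Sum>m<N. of_real (c f n i m) * vip n (u f n i m) v * u f n i m r)"
  unfolding mvec_def fA_sel[OF assms] vip_def sum_distrib_left sum_distrib_right
  by (subst sum.swap) (simp add: mult_ac)

lemma u_nsq: "nsq n (u f n i m) \<le> 1"
  unfolding u_def by (rule sel_vec_nsq[OF Vd])

text \<open>Letters \<open>s\<close> name the summands and \<open>\<iota> s\<close> the matrix
  behind each. In (i) and (ii) the letters are the indices themselves; in (iii) and (iv) two letters
  stand for the same matrix.\<close>

definition Qn :: "nat \<Rightarrow> ('s \<times> nat) set" where "Qn N = UNIV \<times> {..<N}"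
text \<open>The Gram matrix of the selected eigenvectors, with rows weighted by the truncated
  eigenvalues; \<open>kl\<close> is its analogue for the limit operators. Their points have no
  natural correspondence, so only closed path sums are compared.\<close>

definition kn :: "('s \<Rightarrow> 'k) \<Rightarrow> (real \<Rightarrow> real) \<Rightarrow> nat \<Rightarrow> 's \<times> nat \<Rightarrow> 's \<times> nat \<Rightarrow> complex" where
  "kn \<iota> f n = (\<lambda>(s, m) (s', m'). of_real (c f n (\<iota> s) m) * vip n (u f n (\<iota> s) m) (u f n (\<iota> s') m'))"
definition Ql :: "('s \<Rightarrow> 'k) \<Rightarrow> (real \<Rightarrow> real) \<Rightarrow> ('s \<times> 'h) set" where
  "Ql \<iota> f = (SIGMA s:UNIV. support f (a (\<iota> s)) (E (\<iota> s)))"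
definition kl :: "('s \<Rightarrow> 'k) \<Rightarrow> (real \<Rightarrow> real) \<Rightarrow> 's \<times> 'h \<Rightarrow> 's \<times> 'h \<Rightarrow> complex" where
  "kl \<iota> f = (\<lambda>(s, e) (s', e'). of_real (f (evalue (a (\<iota> s)) e)) * cinner e e')"

lemma finite_Qn: "finite (Qn N :: ('s::finite \<times> nat) set)" by (simp add: Qn_def)

lemma finite_Ql: "f \<in> C0b \<Longrightarrow> finite (Ql (\<iota> :: 's::finite \<Rightarrow> 'k) f)"
  unfolding Ql_def by (intro finite_SigmaI finite_support[OF sc E C0b_vanishes]) auto

text \<open>Compact convergence in the form in which it is used: both traces are rewritten as path
  sums.\<close>

lemma word_path_limit:
  assumes f: "f \<in> C0b" and N: "rank_le f N"
  shows "(\<lambda>n. \<Sum>z\<in>{z\<in>Qn N. fst z = s}. path_sum (Qn N) fst (kn \<iota> f n) w z z)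
     \<longlonglongrightarrow> (\<Sum>z\<in>{z\<in>Ql (\<iota> :: 's::finite \<Rightarrow> 'k) f. fst z = s}. path_sum (Ql \<iota> f) fst (kl \<iota> f) w z z)"
proof -
  have "op_trace (foldr (\<lambda>i T. op_fun f (a i) \<circ> T) (map \<iota> (s # w)) id) =
      (\<Sum>z\<in>{z\<in>Ql \<iota> f. fst z = s}. path_sum (Ql \<iota> f) fst (kl \<iota> f) w z z)"
    unfolding kl_def by (rule op_trace_word[OF sep sc sa E C0b_vanishes[OF f] finite_Ql[OF f] Ql_def])
  then have lim: "(\<lambda>n. mat_Tr (mat_word n (\<lambda>i. mat_fun n f (A n i)) (map \<iota> (s # w))))
      \<longlonglongrightarrow> (\<Sum>z\<in>{z\<in>Ql \<iota> f. fst z = s}. path_sum (Ql \<iota> f) fst (kl \<iota> f) w z z)"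
    using word_limit[OF f, of "\<iota> s" "map \<iota> w"] by simp
  have "\<forall>\<^sub>F n in sequentially. mat_Tr (mat_word n (\<lambda>i. mat_fun n f (A n i)) (map \<iota> (s # w))) =
      (\<Sum>z\<in>{z\<in>Qn N. fst z = s}. path_sum (Qn N) fst (kn \<iota> f n) w z z)"
    using eventually_ge_at_top[of 1] N[unfolded rank_le_def]
  proof eventually_elim
    case (elim n)
    have "ent (mat_fun n f (A n i)) r t = (\<Sum>m<N. of_real (c f n i m) * u f n i m r * cnj (u f n i m t))"
      if "r < n" "t < n" for i r t
      using mat_fun_A(2)[OF elim(1) that] fA_sel[OF elim(2)[rule_format]] by simp
    from mat_Tr_word_rank[OF mat_fun_A(1)[OF elim(1)] this, where \<iota> = \<iota> and s = s and w = w]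
    show ?case unfolding kn_def Qn_def .
  qed
  then show ?thesis using lim by (rule Lim_transform_eventually[rotated])
qed

lemma core_limit:
  fixes \<kappa> :: "'s::finite \<Rightarrow> 's \<Rightarrow> complex"
  assumes f: "f \<in> C0b" and N: "rank_le f N"
  shows "(\<lambda>n. ftr (Qn N) (fpow (Qn N) (\<lambda>x y. \<kappa> (fst x) (fst y) * kn \<iota> f n x y) p))
    \<longlonglongrightarrow> ftr (Ql \<iota> f) (fpow (Ql \<iota> f) (\<lambda>x y. \<kappa> (fst x) (fst y) * kl \<iota> f x y) p)"
  unfolding ftr_fpow_path_sum[OF finite_Qn] ftr_fpow_path_sum[OF finite_Ql[OF f]]
  by (intro tendsto_sum tendsto_mult tendsto_const word_path_limit[OF f N])

text \<open>The trace moves to the small index set, where the entries may be replaced by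
  \<open>\<kappa>\<close> times \<open>kn\<close>, which is bounded because \<open>f\<close> is.
  What remains is \<open>core_limit\<close>.\<close>

lemma moment_limit:
  fixes \<kappa> :: "'s::finite \<Rightarrow> 's \<Rightarrow> complex" and x y :: "nat \<Rightarrow> 's \<times> nat \<Rightarrow> nat \<Rightarrow> complex"
  assumes f: "f \<in> C0b" and N: "rank_le f N" and R: "\<And>t. \<bar>f t\<bar> \<le> R"
    and xy: "\<And>q q'. q \<in> Qn N \<Longrightarrow> q' \<in> Qn N \<Longrightarrow>
      (\<lambda>n. vip n (y n q) (x n q') - \<kappa> (fst q) (fst q') * kn \<iota> f n q q') \<longlonglongrightarrow> 0"
  shows "(\<lambda>n. ftr {..<n} (fpow {..<n} (\<lambda>i j. \<Sum>q\<in>Qn N. x n q i * cnj (y n q j)) p))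
    \<longlonglongrightarrow> ftr (Ql \<iota> f) (fpow (Ql \<iota> f) (\<lambda>x y. \<kappa> (fst x) (fst y) * kl \<iota> f x y) p)"
proof -
  have eq: "ftr {..<n} (fpow {..<n} (\<lambda>i j. \<Sum>q\<in>Qn N. x n q i * cnj (y n q j)) p) =
      ftr (Qn N) (fpow (Qn N) (\<lambda>q q'. vip n (y n q) (x n q')) p)" for n
    using ftr_fpow_fmul[of "{..<n}" "Qn N" "\<lambda>i q. x n q i" "\<lambda>q j. cnj (y n q j)" p]
    unfolding fmul_def[abs_def] vip_def .
  have R0: "0 \<le> R" using R[of 0] by simp
  have "Bseq (\<lambda>n. \<kappa> (fst q) (fst q') * kn \<iota> f n q q')" if "q \<in> Qn N" "q' \<in> Qn N" for q q'
  proof (rule BseqI'[of _ "cmod (\<kappa> (fst q) (fst q')) * R"])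
    fix n
    obtain s m s' m' where q: "q = (s, m)" "q' = (s', m')" by (cases q, cases q')
    have c: "\<bar>c f n (\<iota> s) m\<bar> \<le> R" using R R0 by (simp add: c_def sel_val_def)
    have "cmod (vip n (u f n (\<iota> s) m) (u f n (\<iota> s') m')) \<le> sqrt (nsq n (u f n (\<iota> s) m)) * sqrt (nsq n (u f n (\<iota> s') m'))"
      by (rule cmod_vip_le)
    also have "\<dots> \<le> 1 * 1" by (intro mult_mono) (auto simp: u_nsq nsq_nonneg)
    finally have "cmod (kn \<iota> f n q q') \<le> R * 1"
      unfolding kn_def q using c R0 by (simp add: norm_mult) (metis mult_mono mult.right_neutral norm_ge_zero)
    then show "cmod (\<kappa> (fst q) (fst q') * kn \<iota> f n q q') \<le> cmod (\<kappa> (fst q) (fst q')) * R"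
      by (simp add: norm_mult mult_left_mono)
  qed
  from ftr_fpow_tendsto[OF finite_Qn xy this core_limit[OF f N]] show ?thesis unfolding eq by blast
qed

text \<open>Words of length 1, whose traces are linear statistics of the eigenvalues. Bounds on the
  size and the number of eigenvalues follow from suitable test functions.\<close>

lemma sum_fun_limit:
  assumes f: "f \<in> C0b"
  shows "(\<lambda>n. \<Sum>j<n. f (d n i j)) \<longlonglongrightarrow> (\<Sum>e\<in>support f (a i) (E i). f (evalue (a i) e))"
proof -
  let ?Q = "Ql (\<lambda>_ :: unit. i) f" and ?k = "kl (\<lambda>_ :: unit. i) f"
  have "op_trace (foldr (\<lambda>i T. op_fun f (a i) \<circ> T) (map (\<lambda>_ :: unit. i) [()]) id) = (\<Sum>z\<in>{z\<in>?Q. fst z = ()}. path_sum ?Q fst ?k [] z z)"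
    unfolding kl_def by (rule op_trace_word[OF sep sc sa E C0b_vanishes[OF f] finite_Ql[OF f] Ql_def])
  also have "\<dots> = (\<Sum>e\<in>support f (a i) (E i). of_real (f (evalue (a i) e)))"
  proof (rule sum.reindex_bij_witness[of _ "Pair ()" snd])
    fix z assume "z \<in> {z\<in>?Q. fst z = ()}"
    then have "snd z \<in> E i" by (auto simp: Ql_def support_def)
    then have "cinner (snd z) (snd z) = 1" using E[of i] by (simp add: complete_eigensystem_def eigensystem_def orthonormal_def)
    then show "of_real (f (evalue (a i) (snd z))) = path_sum ?Q fst ?k [] z z" by (simp add: kl_def case_prod_beta)
  qed (auto simp: Ql_def)
  finally have lim: "(\<lambda>n. mat_Tr (mat_word n (\<lambda>i. mat_fun n f (A n i)) [i]))
      \<longlonglongrightarrow> (\<Sum>e\<in>support f (a i) (E i). of_real (f (evalue (a i) e)))"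
    using word_limit[OF f, of i "[]"] by simp
  have "\<forall>\<^sub>F n in sequentially. mat_Tr (mat_word n (\<lambda>i. mat_fun n f (A n i)) [i]) = of_real (\<Sum>j<n. f (d n i j))"
    using eventually_ge_at_top[of 1]
  proof eventually_elim
    case (elim n)
    have "mat_word n (\<lambda>i. mat_fun n f (A n i)) [i] = mat_fun n f (A n i)"
      using mat_fun_A(1)[OF elim, of f i] by (simp add: mat_word_def)
    then have "mat_Tr (mat_word n (\<lambda>i. mat_fun n f (A n i)) [i]) = (\<Sum>r<n. fA f n i r r)"
      by (simp add: mat_Tr_ftr[OF mat_fun_A(1)[OF elim]] ftr_def mat_fun_A(2)[OF elim])
    also have "\<dots> = ftr {..<n} (fpow {..<n} (fA f n i) 0)" by (simp add: ftr_def)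
    also have "\<dots> = of_real (\<Sum>j<n. f (d n i j))"
      unfolding fA_def using ftr_fpow_eigenbasis[OF eigenbasis_fun[OF Vd], of n i "\<lambda>j. f (d n i j)" 0] by simp
    finally show ?case .
  qed
  from Lim_transform_eventually[OF lim this]
  have "(\<lambda>n. complex_of_real (\<Sum>j<n. f (d n i j))) \<longlonglongrightarrow> of_real (\<Sum>e\<in>support f (a i) (E i). f (evalue (a i) e))" by simp
  then show ?thesis by (simp only: tendsto_of_real_iff)
qed

definition bounded_by :: "real \<Rightarrow> bool" where
  "bounded_by R \<longleftrightarrow> 0 < R \<and> (\<forall>i. \<forall>e\<in>E i. \<bar>evalue (a i) e\<bar> \<le> R) \<and> (\<forall>i v. norm (a i v) \<le> R * norm v) \<and>
     (\<forall>\<^sub>F n in sequentially. \<forall>i. \<forall>j<n. \<bar>d n i j\<bar> \<le> R)"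

lemma bounded_exists: "\<exists>R. bounded_by R"
proof -
  have "\<exists>K>0. \<forall>v. norm (a i v) \<le> K * norm v" for i using seq_compact_op_bop[OF sc[of i]] by (simp add: bop_def)
  then obtain K where K: "\<And>i. K i > 0" "\<And>i v. norm (a i v) \<le> K i * norm v" by metis
  define R where "R = Max (range K)"
  have KR: "K i \<le> R" for i unfolding R_def by (rule Max_ge) auto
  have R: "R > 0" using K(1) KR by (meson less_le_trans)
  have aR: "norm (a i v) \<le> R * norm v" for i v
    using K(2)[of i v] mult_right_mono[OF KR[of i], of "norm v"] by simp
  have eR: "\<bar>evalue (a i) e\<bar> \<le> R" if "e \<in> E i" for i e
  proof -
    have n1: "norm e = 1" using eigensystem_norm that E[of i] by (auto simp: complete_eigensystem_def)
    have "\<bar>evalue (a i) e\<bar> \<le> norm e * norm (a i e)"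
      unfolding evalue_def using abs_Re_le_cmod cmod_cinner_le order_trans by blast
    then show ?thesis using aR[of i e] n1 by simp
  qed
  \<comment> \<open>Vanishes at all limit eigenvalues and equals 1 from \<open>R + 1\<close> on; a
    sum below 1 excludes eigenvalues there.\<close>
  define g where "g x = max 0 (min 1 (\<bar>x\<bar> - R))" for x
  have g: "g \<in> C0b"
  proof -
    have "continuous_on UNIV g" unfolding g_def by (intro continuous_intros)
    moreover have "bounded (range g)" by (rule boundedI[of _ 1]) (auto simp: g_def)
    moreover have "\<forall>x. \<bar>x\<bar> < R \<longrightarrow> g x = 0" by (auto simp: g_def)
    ultimately show ?thesis unfolding C0b_def using R by blast
  qed
  have "\<forall>\<^sub>F n in sequentially. \<forall>j<n. \<bar>d n i j\<bar> \<le> R + 1" for i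
  proof -
    have "g (evalue (a i) e) = 0" if "e \<in> E i" for e using eR[OF that] by (auto simp: g_def max_def min_def)
    then have "support g (a i) (E i) = {}" by (auto simp: support_def)
    then have "(\<lambda>n. \<Sum>j<n. g (d n i j)) \<longlonglongrightarrow> 0" using sum_fun_limit[OF g, of i] by simp
    then have "\<forall>\<^sub>F n in sequentially. (\<Sum>j<n. g (d n i j)) < 1" by (rule order_tendstoD(2)) simp
    then show ?thesis
    proof eventually_elim
      case (elim n)
      show ?case
      proof (intro allI impI)
        fix j assume j: "j < n"
        have "g (d n i j) \<le> (\<Sum>j<n. g (d n i j))" by (rule member_le_sum) (use j in \<open>auto simp: g_def\<close>)
        then have "g (d n i j) < 1" using elim by simp
        then show "\<bar>d n i j\<bar> \<le> R + 1" by (auto simp: g_def max_def min_def split: if_splits)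
      qed
    qed
  qed
  then have "\<forall>\<^sub>F n in sequentially. \<forall>i. \<forall>j<n. \<bar>d n i j\<bar> \<le> R + 1" by (simp add: eventually_all_finite)
  moreover have "norm (a i v) \<le> (R + 1) * norm v" for i v using aR[of i v] by (simp add: distrib_right add_increasing2)
  ultimately have "bounded_by (R + 1)" unfolding bounded_by_def using R eR by (auto simp: add_increasing2)
  then show ?thesis by blast
qed

text \<open>A test function that is 1 at modulus \<open>\<epsilon>\<close> and above bounds the
  number of eigenvalues there by a convergent sum. The bound is uniform over all \<open>f\<close>
  with that threshold, so a function and its square can share it.\<close>

lemma rank_exists:
  assumes \<epsilon>: "0 < \<epsilon>" shows "\<exists>N. \<forall>f. (\<forall>x. f x \<noteq> 0 \<longrightarrow> \<epsilon> \<le> \<bar>x\<bar>) \<longrightarrow> rank_le f N"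
proof -
  define g where "g x = max 0 (min 1 (2 * \<bar>x\<bar> / \<epsilon> - 1))" for x
  have g: "g \<in> C0b"
  proof -
    have "continuous_on UNIV g" unfolding g_def using \<epsilon> by (intro continuous_intros) auto
    moreover have "bounded (range g)" by (rule boundedI[of _ 1]) (auto simp: g_def)
    moreover have "\<forall>x. \<bar>x\<bar> < \<epsilon> / 2 \<longrightarrow> g x = 0" using \<epsilon> by (auto simp: g_def field_simps)
    moreover have "0 < \<epsilon> / 2" using \<epsilon> by simp
    ultimately show ?thesis unfolding C0b_def mem_Collect_eq by blast
  qed
  have "\<exists>N. \<forall>\<^sub>F n in sequentially. card {j\<in>{..<n}. \<epsilon> \<le> \<bar>d n i j\<bar>} \<le> N" for i
  proof -
    let ?L = "\<Sum>e\<in>support g (a i) (E i). g (evalue (a i) e)"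
    obtain N :: nat where N: "?L + 1 < N" using reals_Archimedean2 by blast
    have "\<forall>\<^sub>F n in sequentially. (\<Sum>j<n. g (d n i j)) < ?L + 1"
      using sum_fun_limit[OF g, of i] by (rule order_tendstoD(2)) simp
    then have "\<forall>\<^sub>F n in sequentially. card {j\<in>{..<n}. \<epsilon> \<le> \<bar>d n i j\<bar>} \<le> N"
    proof eventually_elim
      case (elim n)
      have "real (card {j\<in>{..<n}. \<epsilon> \<le> \<bar>d n i j\<bar>}) = (\<Sum>j\<in>{j\<in>{..<n}. \<epsilon> \<le> \<bar>d n i j\<bar>}. 1)" by simp
      also have "\<dots> \<le> (\<Sum>j\<in>{j\<in>{..<n}. \<epsilon> \<le> \<bar>d n i j\<bar>}. g (d n i j))"
      proof (intro sum_mono)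
        fix j assume "j \<in> {j\<in>{..<n}. \<epsilon> \<le> \<bar>d n i j\<bar>}"
        then have "1 \<le> \<bar>d n i j\<bar> / \<epsilon>" using \<epsilon> by simp
        then show "1 \<le> g (d n i j)" by (simp add: g_def)
      qed
      also have "\<dots> \<le> (\<Sum>j<n. g (d n i j))" by (rule sum_mono2) (auto simp: g_def)
      finally show ?case using elim N by linarith
    qed
    then show ?thesis by blast
  qed
  then have "\<forall>i. \<exists>N. \<forall>\<^sub>F n in sequentially. card {j\<in>{..<n}. \<epsilon> \<le> \<bar>d n i j\<bar>} \<le> N" by (rule allI)
  from choice[OF this] obtain N where N: "\<And>i. \<forall>\<^sub>F n in sequentially. card {j\<in>{..<n}. \<epsilon> \<le> \<bar>d n i j\<bar>} \<le> N i"
    by blast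
  have "rank_le f (Max (range N))" if f: "\<forall>x. f x \<noteq> 0 \<longrightarrow> \<epsilon> \<le> \<bar>x\<bar>" for f
  proof -
    have "\<forall>\<^sub>F n in sequentially. \<forall>i. card {j\<in>{..<n}. \<epsilon> \<le> \<bar>d n i j\<bar>} \<le> N i"
      using N by (simp add: eventually_all_finite)
    then show ?thesis unfolding rank_le_def
    proof eventually_elim
      case (elim n)
      show ?case
      proof
        fix i
        have "card {j\<in>{..<n}. f (d n i j) \<noteq> 0} \<le> card {j\<in>{..<n}. \<epsilon> \<le> \<bar>d n i j\<bar>}"
          by (rule card_mono) (use f in auto)
        also have "\<dots> \<le> N i" using elim by blast
        also have "N i \<le> Max (range N)" by (rule Max_ge) auto
        finally show "card {j\<in>{..<n}. f (d n i j) \<noteq> 0} \<le> Max (range N)" .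
      qed
    qed
  qed
  then show ?thesis by blast
qed

text \<open>Both matrices are diagonal in the same eigenbasis. The comparison of forms is what (i)
  uses; the comparison of images serves (ii) to (iv), where the form of the random factor is
  evaluated at vectors \<open>A v\<close>.\<close>

lemma A_minus_fA:
  assumes near: "\<And>j. j < n \<Longrightarrow> \<bar>d n i j - f (d n i j)\<bar> \<le> \<epsilon>" and \<epsilon>: "0 \<le> \<epsilon>"
  shows "\<bar>Re (vip n w (mvec n (ent (A n i)) w)) - Re (vip n w (mvec n (fA f n i) w))\<bar> \<le> \<epsilon> * nsq n w"
    "nsq n (\<lambda>r. mvec n (ent (A n i)) w r - mvec n (fA f n i) w r) \<le> \<epsilon>\<^sup>2 * nsq n w"
proof -
  note ebf = eigenbasis_fun[OF Vd[of n i], of "\<lambda>j. f (d n i j)", folded fA_def]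
  let ?g = "\<lambda>j. (cmod (vip n (V n i j) w))\<^sup>2"
  have "\<bar>\<Sum>j<n. (d n i j - f (d n i j)) * ?g j\<bar> \<le> (\<Sum>j<n. \<epsilon> * ?g j)"
    using near by (intro order_trans[OF sum_abs] sum_mono) (auto simp: abs_mult intro: mult_right_mono)
  then show "\<bar>Re (vip n w (mvec n (ent (A n i)) w)) - Re (vip n w (mvec n (fA f n i) w))\<bar> \<le> \<epsilon> * nsq n w"
    unfolding eigenbasis_form[OF Vd] eigenbasis_form[OF ebf] eigenbasis_nsq[OF Vd[of n i], of w]
    by (simp add: sum_subtractf left_diff_distrib sum_distrib_left)
  have "(cmod (vip n (V n i j) (\<lambda>r. mvec n (ent (A n i)) w r - mvec n (fA f n i) w r)))\<^sup>2 \<le> \<epsilon>\<^sup>2 * ?g j" if j: "j < n" for j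
  proof -
    have "vip n (V n i j) (\<lambda>r. mvec n (ent (A n i)) w r - mvec n (fA f n i) w r) = of_real (d n i j - f (d n i j)) * vip n (V n i j) w"
      unfolding vip_diff_right vip_mvec_eigenbasis[OF Vd j] vip_mvec_eigenbasis[OF ebf j] by (simp add: left_diff_distrib)
    moreover have "\<bar>d n i j - f (d n i j)\<bar>\<^sup>2 \<le> \<epsilon>\<^sup>2" using near[OF j] by (intro power_mono) auto
    ultimately show ?thesis by (simp add: norm_mult power_mult_distrib mult_right_mono del: of_real_diff)
  qed
  then show "nsq n (\<lambda>r. mvec n (ent (A n i)) w r - mvec n (fA f n i) w r) \<le> \<epsilon>\<^sup>2 * nsq n w"
    unfolding eigenbasis_nsq[OF Vd[of n i]] sum_distrib_left by (intro sum_mono) auto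
qed

lemma opb_fA:
  assumes "\<And>j. j < n \<Longrightarrow> \<bar>f (d n i j)\<bar> \<le> R" "0 \<le> R" shows "opb n (fA f n i) R"
  unfolding opb_def
proof (intro conjI allI assms(2))
  note ebf = eigenbasis_fun[OF Vd[of n i], of "\<lambda>j. f (d n i j)", folded fA_def]
  fix v
  have "(cmod (vip n (V n i j) (mvec n (fA f n i) v)))\<^sup>2 \<le> R\<^sup>2 * (cmod (vip n (V n i j) v))\<^sup>2" if "j < n" for j
    unfolding vip_mvec_eigenbasis[OF ebf that] using power_mono[OF assms(1)[OF that], of 2]
    by (simp add: norm_mult power_mult_distrib mult_right_mono)
  then show "nsq n (mvec n (fA f n i) v) \<le> R\<^sup>2 * nsq n v"
    unfolding eigenbasis_nsq[OF Vd[of n i]] sum_distrib_left by (intro sum_mono) auto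
qed

lemma opb_A:
  assumes "\<And>j. j < n \<Longrightarrow> \<bar>d n i j\<bar> \<le> R" "0 \<le> R" shows "opb n (ent (A n i)) R"
proof -
  have "mvec n (ent (A n i)) v r = mvec n (fA (\<lambda>x. x) n i) v r" if "r < n" for v r
    unfolding fA_def by (rule mvec_cong) (use eigenbasis_spectral_sum[OF Vd that] in auto)
  then have "nsq n (mvec n (ent (A n i)) v) = nsq n (mvec n (fA (\<lambda>x. x) n i) v)" for v by (intro nsq_cong)
  then show ?thesis using opb_fA[of n "\<lambda>x. x" i R] assms by (simp add: opb_def)
qed

end

section \<open>Forms, conjugations and traces of products\<close>

lemma vip_rank: "vip n v (mvec n (\<lambda>i j. \<Sum>q\<in>Q. x q i * cnj (y q j)) w) = (\<Sum>q\<in>Q. vip n v (x q) * vip n (y q) w)"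
proof -
  have "mvec n (\<lambda>i j. \<Sum>q\<in>Q. x q i * cnj (y q j)) w = (\<lambda>i. \<Sum>q\<in>Q. vip n (y q) w * x q i)"
    unfolding mvec_def vip_def sum_distrib_right by (rule ext, subst sum.swap) (simp add: mult_ac)
  then show ?thesis by (simp only: vip_sum_right vip_scale_right) (simp only: mult.commute)
qed

lemma hermfI:
  assumes "\<And>x y. vip n x (mvec n X y) = cnj (vip n y (mvec n X x))"
  shows "hermf n X"
  unfolding hermf_def
proof (intro allI impI)
  fix i j assume ij: "i < n" "j < n"
  let ?e = "\<lambda>i k. if k = i then 1 else 0 :: complex"
  have e: "vip n (?e i) (mvec n X (?e j)) = X i j" if "i < n" "j < n" for i j
  proof -
    have "mvec n X (?e j) k = X k j" for k
    proof -
      have "mvec n X (?e j) k = (\<Sum>l<n. if l = j then X k j else 0)" unfolding mvec_def by (intro sum.cong refl) auto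
      then show ?thesis using that by simp
    qed
    then have "vip n (?e i) (mvec n X (?e j)) = (\<Sum>k<n. if k = i then X i j else 0)"
      unfolding vip_def by (intro sum.cong refl) auto
    then show ?thesis using that by simp
  qed
  show "X i j = cnj (X j i)" using assms[of "?e i" "?e j"] e[OF ij] e[OF ij(2,1)] by simp
qed

lemma mat_adjoint_conj_by:
  assumes W: "W \<in> carrier_mat n n" and X: "X \<in> carrier_mat n n"
  shows "mat_adjoint (conj_by W X) = conj_by W (mat_adjoint X)"
proof -
  note Wa = mat_adjoint_carrier[OF W] and Xa = mat_adjoint_carrier[OF X]
  have "mat_adjoint (conj_by W X) = W * (mat_adjoint X * mat_adjoint W)"
    unfolding conj_by_def mat_adjoint_mult[OF mult_carrier_mat[OF W X] Wa] mat_adjoint_mult[OF W X] mat_adjoint_adjoint[OF W] ..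
  then show ?thesis unfolding conj_by_def using assoc_mult_mat[OF W Xa Wa] by simp
qed

lemma conj_by_mult:
  assumes W: "W \<in> unitary_group n" and X: "X \<in> carrier_mat n n" and Z: "Z \<in> carrier_mat n n"
  shows "conj_by W X * conj_by W Z = conj_by W (X * Z)"
proof -
  have Wc: "W \<in> carrier_mat n n" and WW: "mat_adjoint W * W = 1\<^sub>m n" using W by (auto simp: unitary_group_def)
  note Wa = mat_adjoint_carrier[OF Wc]
  note as = assoc_mult_mat[of _ n n _ n _ n]
  have "conj_by W X * conj_by W Z = W * X * (mat_adjoint W * W) * Z * mat_adjoint W"
    unfolding conj_by_def using Wc X Z Wa by (simp add: as)
  then show ?thesis unfolding WW conj_by_def using Wc X Z Wa by (simp add: as)
qed

lemma ent_mat_sum: "i < n \<Longrightarrow> j < n \<Longrightarrow> ent (mat_sum n F) i j = (\<Sum>s\<in>UNIV. ent (F s) i j)"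
  by (simp add: ent_def mat_sum_def)

lemma vip_mat_sum: "vip n x (mvec n (ent (mat_sum n F)) y) = (\<Sum>s\<in>UNIV. vip n x (mvec n (ent (F s)) y))"
proof -
  have "mvec n (ent (mat_sum n F)) y i = (\<Sum>s\<in>UNIV. mvec n (ent (F s)) y i)" if "i < n" for i
  proof -
    have "mvec n (ent (mat_sum n F)) y i = (\<Sum>j<n. \<Sum>s\<in>UNIV. ent (F s) i j * y j)"
      unfolding mvec_def using that by (intro sum.cong refl) (simp add: ent_mat_sum sum_distrib_right)
    then show ?thesis unfolding mvec_def by (subst sum.swap)
  qed
  then have "vip n x (mvec n (ent (mat_sum n F)) y) = vip n x (\<lambda>i. \<Sum>s\<in>UNIV. mvec n (ent (F s)) y i)" by (intro vip_cong refl)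
  then show ?thesis by (simp add: vip_sum_right)
qed

lemma vip_ent_mult:
  assumes "X \<in> carrier_mat n n" "Y \<in> carrier_mat n n"
  shows "vip n x (mvec n (ent (X * Y)) y) = vip n x (mvec n (ent X) (mvec n (ent Y) y))"
  by (intro vip_cong refl mvec_ent_mult[OF assms])

lemma vip_herm:
  assumes "hermitian n X" shows "vip n x (mvec n (ent X) y) = vip n (mvec n (ent X) x) y"
  using vip_mat_adjoint[of X n x y] assms by (simp add: hermitian_def)

lemma mat_tr_adjoint_mult:
  assumes X: "X \<in> carrier_mat n n" and Y: "Y \<in> carrier_mat n n"
  shows "mat_tr (mat_adjoint X * Y) = (\<Sum>r<n. \<Sum>k<n. cnj (ent X k r) * ent Y k r) / of_nat n"
proof -
  note Xa = mat_adjoint_carrier[OF X]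
  have c: "mat_adjoint X * Y \<in> carrier_mat n n" using Xa Y by auto
  have "mat_Tr (mat_adjoint X * Y) = (\<Sum>r<n. \<Sum>k<n. cnj (ent X k r) * ent Y k r)"
    unfolding mat_Tr_ftr[OF c] ftr_def
  proof (intro sum.cong refl)
    fix r assume "r \<in> {..<n}"
    then have r: "r < n" by simp
    show "ent (mat_adjoint X * Y) r r = (\<Sum>k<n. cnj (ent X k r) * ent Y k r)"
      unfolding ent_mult[OF Xa Y r r] fmul_def
      by (intro sum.cong refl) (simp add: ent_def mat_adjoint_index[OF X] r)
  qed
  then show ?thesis using c Xa by (simp add: mat_tr_def)
qed

lemma hs2_mat_tr:
  assumes X: "X \<in> carrier_mat n n"
  shows "mat_tr (mat_adjoint X * X) = of_real (hs2 n (ent X) / n)"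
proof -
  have "(\<Sum>r<n. \<Sum>k<n. cnj (ent X k r) * ent X k r) = of_real (\<Sum>r<n. nsq n (\<lambda>k. ent X k r))"
    unfolding of_real_sum vip_self[symmetric] vip_def ..
  then show ?thesis unfolding mat_tr_adjoint_mult[OF X X] by (simp add: hs2_eq_sum_nsq(1))
qed

text \<open>The Cauchy-Schwarz inequality on the diagonal, which together with
  \<open>hs2_mat_tr\<close> gives |tr X|^2 \<le> tr (X^* X). In the limit it makes the radicand in
  (iv) nonnegative.\<close>

lemma cmod_mat_tr_le:
  assumes X: "X \<in> carrier_mat n n" and n: "n \<ge> 1"
  shows "(cmod (mat_tr X))\<^sup>2 \<le> hs2 n (ent X) / n"
proof -
  have "cmod (mat_Tr X) \<le> (\<Sum>i<n. 1 * cmod (ent X i i))"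
    unfolding mat_Tr_ftr[OF X] ftr_def by (simp add: norm_sum)
  then have "(cmod (mat_Tr X))\<^sup>2 \<le> (\<Sum>i<n. 1 * cmod (ent X i i))\<^sup>2" by (intro power_mono) auto
  also have "\<dots> \<le> (\<Sum>i<n. 1\<^sup>2) * (\<Sum>i<n. (cmod (ent X i i))\<^sup>2)" by (rule Cauchy_Schwarz_ineq_sum)
  also have "\<dots> \<le> n * hs2 n (ent X)"
  proof -
    have "(cmod (ent X i i))\<^sup>2 \<le> (\<Sum>j<n. (cmod (ent X i j))\<^sup>2)" if "i < n" for i
      using member_le_sum[of i "{..<n}" "\<lambda>j. (cmod (ent X i j))\<^sup>2"] that by simp
    then have "(\<Sum>i<n. (cmod (ent X i i))\<^sup>2) \<le> hs2 n (ent X)" unfolding hs2_def by (intro sum_mono) auto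
    then show ?thesis by (simp add: mult_left_mono)
  qed
  finally have "(cmod (mat_Tr X))\<^sup>2 \<le> n * hs2 n (ent X)" .
  moreover have "(cmod (mat_tr X))\<^sup>2 = (cmod (mat_Tr X))\<^sup>2 / (real n)\<^sup>2"
    using X by (simp add: mat_tr_def norm_divide power_divide)
  ultimately have "real n * (real n * (cmod (mat_tr X))\<^sup>2) \<le> real n * hs2 n (ent X)"
    using n by (simp add: power2_eq_square)
  then have "real n * (cmod (mat_tr X))\<^sup>2 \<le> hs2 n (ent X)" by (rule mult_left_le_imp_le) (use n in simp)
  then show ?thesis using n by (simp add: field_simps)
qed

section \<open>Random compressions\<close>

locale haar_compact = compact_limit A a
  for A :: "nat \<Rightarrow> 'k::finite \<Rightarrow> complex mat" and a :: "'k \<Rightarrow> 'h::complex_hilbert \<Rightarrow> 'h" +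
  fixes M :: "'w measure" and U :: "nat \<Rightarrow> 'w \<Rightarrow> complex mat" and B :: "nat \<Rightarrow> 'k \<Rightarrow> complex mat"
    and \<beta> :: "'k \<Rightarrow> complex" and \<beta>\<beta> :: "complex ^ 'k ^ 'k"
  assumes M: "prob_space M" and U: "\<And>n. n \<ge> 1 \<Longrightarrow> haar_unitary M n (U n)"
    and Bc: "\<And>n i. n \<ge> 1 \<Longrightarrow> B n i \<in> carrier_mat n n"
    and bdd: "\<And>i. bdd_above ((\<lambda>n. mat_opnorm (B n i)) ` {1..})"
    and trB: "\<And>i. (\<lambda>n. mat_tr (B n i)) \<longlonglongrightarrow> \<beta> i"
    and trBB: "\<And>i j. (\<lambda>n. mat_tr (mat_adjoint (B n i) * B n j)) \<longlonglongrightarrow> \<beta>\<beta> $ i $ j"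
begin

lemma opb_exists: "\<exists>C\<ge>1. \<forall>n i. n \<ge> 1 \<longrightarrow> opb n (ent (B n i)) C"
proof -
  have "\<exists>C. \<forall>n\<ge>1. mat_opnorm (B n i) \<le> C" for i
  proof -
    obtain K where "\<forall>x\<in>(\<lambda>n. mat_opnorm (B n i)) ` {1..}. x \<le> K" using bdd[of i] unfolding bdd_above_def by blast
    then show ?thesis by (intro exI[of _ K]) auto
  qed
  then have "\<forall>i. \<exists>C. \<forall>n\<ge>1. mat_opnorm (B n i) \<le> C" by blast
  from choice[OF this] obtain C where C: "\<And>i n. n \<ge> 1 \<Longrightarrow> mat_opnorm (B n i) \<le> C i" by blast
  have "opb n (ent (B n i)) (max 1 (Max (range C)))" if n: "n \<ge> 1" for n i
  proof (rule opb_mono[OF opb_mat_opnorm[OF Bc[OF n]]])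
    have "mat_opnorm (B n i) \<le> C i" by (rule C[OF n])
    also have "C i \<le> Max (range C)" by (rule Max_ge) auto
    finally show "mat_opnorm (B n i) \<le> max 1 (Max (range C))" by simp
  qed
  then show ?thesis by (intro exI[of _ "max 1 (Max (range C))"]) auto
qed

definition C :: real where "C = (SOME C. 1 \<le> C \<and> (\<forall>n i. n \<ge> 1 \<longrightarrow> opb n (ent (B n i)) C))"

lemma C: "1 \<le> C" "n \<ge> 1 \<Longrightarrow> opb n (ent (B n i)) C"
  using someI_ex[OF opb_exists] unfolding C_def[symmetric] by blast+

definition R :: real where "R = (SOME R. bounded_by R)"

lemma R: "bounded_by R"
  unfolding R_def by (rule someI_ex[OF bounded_exists])

lemma R0: "0 < R" using R by (simp add: bounded_by_def)

text \<open>A sequence of thresholds, so that the almost sure events of all of them can be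
  intersected.\<close>

definition eps :: "nat \<Rightarrow> real" where "eps l = 1 / (real l + 1)"

lemma eps: "0 < eps l" "eps l \<le> 1" by (simp_all add: eps_def)

definition f :: "nat \<Rightarrow> real \<Rightarrow> real" where "f l = soft_clip (eps l) R"

lemma f: "f l \<in> C0b" "\<bar>f l t\<bar> \<le> R" "\<bar>t\<bar> \<le> R \<Longrightarrow> \<bar>t - f l t\<bar> \<le> eps l"
  unfolding f_def using soft_clip_C0b[OF eps(1) R0] soft_clip_le(2)[OF R0] soft_clip_near[OF eps(1)] by blast+

definition N :: "nat \<Rightarrow> nat" where
  "N l = (SOME N. \<forall>f. (\<forall>x. f x \<noteq> 0 \<longrightarrow> eps l \<le> \<bar>x\<bar>) \<longrightarrow> rank_le f N)"

text \<open>A function and its square vanish at the same points, so one rank bound serves for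
  both.\<close>

lemma N: "rank_le (f l) (N l)" "rank_le (\<lambda>x. (f l x)\<^sup>2) (N l)"
proof -
  have *: "rank_le g (N l)" if "\<forall>x. g x \<noteq> 0 \<longrightarrow> eps l \<le> \<bar>x\<bar>" for g
    using someI_ex[OF rank_exists[OF eps(1)[of l]]] that unfolding N_def by blast
  have "eps l \<le> \<bar>x\<bar>" if "f l x \<noteq> 0" for x using soft_clip_nonzero[OF _ eps(1) R0] that unfolding f_def by fastforce
  then show "rank_le (f l) (N l)" "rank_le (\<lambda>x. (f l x)\<^sup>2) (N l)" by (auto intro!: *)
qed

definition good :: "nat \<Rightarrow> nat \<Rightarrow> bool" where
  "good l n \<longleftrightarrow> n \<ge> 1 \<and> (\<forall>i. \<forall>j<n. \<bar>d n i j\<bar> \<le> R) \<and> (\<forall>i. card {j\<in>{..<n}. f l (d n i j) \<noteq> 0} \<le> N l)"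

lemma ev_good: "\<forall>\<^sub>F n in sequentially. good l n"
proof -
  have "\<forall>\<^sub>F n in sequentially. \<forall>i. \<forall>j<n. \<bar>d n i j\<bar> \<le> R" using R by (simp add: bounded_by_def)
  then show ?thesis using eventually_ge_at_top[of 1] N(1)[unfolded rank_le_def, of l]
    by eventually_elim (simp add: good_def)
qed

abbreviation F :: "nat \<Rightarrow> nat \<Rightarrow> 'k \<Rightarrow> nat \<Rightarrow> nat \<Rightarrow> complex" where "F l \<equiv> fA (f l)"
abbreviation uu :: "nat \<Rightarrow> nat \<Rightarrow> 'k \<Rightarrow> nat \<Rightarrow> nat \<Rightarrow> complex" where "uu l \<equiv> u (f l)"
abbreviation cc :: "nat \<Rightarrow> nat \<Rightarrow> 'k \<Rightarrow> nat \<Rightarrow> real" where "cc l \<equiv> c (f l)"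

lemma cc_le: "\<bar>cc l n i m\<bar> \<le> R"
  using f(2) R0 by (simp add: c_def sel_val_def)

lemma good_facts:
  assumes g: "good l n"
  shows "n \<ge> 1" "\<bar>Re (vip n w (mvec n (ent (A n i)) w)) - Re (vip n w (mvec n (F l n i) w))\<bar> \<le> eps l * nsq n w"
    "sqrt (nsq n (\<lambda>r. mvec n (ent (A n i)) w r - mvec n (F l n i) w r)) \<le> eps l * sqrt (nsq n w)"
    "opb n (ent (A n i)) R" "opb n (F l n i) R"
    "\<And>v r. mvec n (F l n i) v r = (\<Sum>m<N l. of_real (cc l n i m) * vip n (uu l n i m) v * uu l n i m r)"
    "vip n x (mvec n (F l n i) y) = (\<Sum>m<N l. of_real (cc l n i m) * vip n (uu l n i m) y * vip n x (uu l n i m))"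
proof -
  show n: "n \<ge> 1" using g by (simp add: good_def)
  have near: "\<bar>d n i j - f l (d n i j)\<bar> \<le> eps l" if "j < n" for j using g f(3) that by (simp add: good_def)
  note e0 = less_imp_le[OF eps(1)[of l]]
  show "\<bar>Re (vip n w (mvec n (ent (A n i)) w)) - Re (vip n w (mvec n (F l n i) w))\<bar> \<le> eps l * nsq n w"
    by (rule A_minus_fA(1)[OF near e0])
  have "sqrt (nsq n (\<lambda>r. mvec n (ent (A n i)) w r - mvec n (F l n i) w r)) \<le> sqrt ((eps l)\<^sup>2 * nsq n w)"
    using A_minus_fA(2)[OF near e0] by simp
  then show "sqrt (nsq n (\<lambda>r. mvec n (ent (A n i)) w r - mvec n (F l n i) w r)) \<le> eps l * sqrt (nsq n w)"
    using e0 by (simp add: real_sqrt_mult)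
  show "opb n (ent (A n i)) R" by (rule opb_A) (use g R0 in \<open>auto simp: good_def\<close>)
  show "opb n (F l n i) R" by (rule opb_fA) (use f(2) R0 in auto)
  show s: "mvec n (F l n i) v r = (\<Sum>m<N l. of_real (cc l n i m) * vip n (uu l n i m) v * uu l n i m r)" for v r
    by (rule mvec_fA_sel) (use g in \<open>simp add: good_def\<close>)
  have "mvec n (F l n i) y = (\<lambda>r. \<Sum>m<N l. (of_real (cc l n i m) * vip n (uu l n i m) y) * uu l n i m r)"
    using s by auto
  then show "vip n x (mvec n (F l n i) y) = (\<Sum>m<N l. of_real (cc l n i m) * vip n (uu l n i m) y * vip n x (uu l n i m))"
    by (simp add: vip_sum_right vip_scale_right)
qed

definition unit_U :: "'w \<Rightarrow> bool" where "unit_U \<omega> \<longleftrightarrow> (\<forall>n\<ge>1. U n \<omega> \<in> unitary_group n)"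

lemma AE_unit_U: "AE \<omega> in M. unit_U \<omega>"
  unfolding unit_U_def
proof (rule AE_I2, intro allI impI)
  fix \<omega> n assume \<omega>: "\<omega> \<in> space M" and n: "n \<ge> (1 :: nat)"
  have "U n \<in> measurable M (unitary_borel n)" using U[OF n] by (simp add: haar_unitary_def)
  from measurable_space[OF this \<omega>] show "U n \<omega> \<in> unitary_group n" by (simp add: space_unitary_borel)
qed

text \<open>The randomness that the limits use, for one realization \<open>\<omega>\<close>; from
  here on the argument is deterministic.\<close>

definition pair_limit :: "(nat \<Rightarrow> complex mat) \<Rightarrow> complex \<Rightarrow> 'w \<Rightarrow> bool" where
  "pair_limit T t \<omega> \<longleftrightarrow> (\<forall>l i i'. \<forall>m<N l. \<forall>m'<N l.
    (\<lambda>n. vip n (uu l n i m) (mvec n (ent (conj_by (U n \<omega>) (T n))) (uu l n i' m')) - t * vip n (uu l n i m) (uu l n i' m')) \<longlonglongrightarrow> 0)"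

text \<open>Countably many thresholds and positions and finitely many matrices, hence countably many
  almost sure events.\<close>

lemma AE_pair_limit:
  assumes T: "\<And>n. n \<ge> 1 \<Longrightarrow> T n \<in> carrier_mat n n" "\<And>n. n \<ge> 1 \<Longrightarrow> opb n (ent (T n)) K" and t: "(\<lambda>n. mat_tr (T n)) \<longlonglongrightarrow> t"
  shows "AE \<omega> in M. pair_limit T t \<omega>"
proof -
  have hs: "hs2 n (ent (T n)) \<le> K\<^sup>2 * n" if "n \<ge> 1" for n by (rule hs2_opb[OF T(2)[OF that]])
  have *: "AE \<omega> in M. (\<lambda>n. vip n (uu l n i m) (mvec n (ent (conj_by (U n \<omega>) (T n))) (uu l n i' m')) -
      t * vip n (uu l n i m) (uu l n i' m')) \<longlonglongrightarrow> 0" for l i i' m m'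
    by (rule haar_bilinear_AE[OF M U T(1) t hs u_nsq u_nsq])
  show ?thesis
    unfolding pair_limit_def AE_all_countable[where 'i = nat] eventually_all_finite
    by (intro allI) (simp add: AE_all_countable eventually_all_finite *)
qed

lemma AE_limits:
  "AE \<omega> in M. unit_U \<omega> \<and> (\<forall>i. pair_limit (\<lambda>n. B n i) (\<beta> i) \<omega>) \<and>
     (\<forall>i j. pair_limit (\<lambda>n. mat_adjoint (B n i) * B n j) (\<beta>\<beta> $ i $ j) \<omega>)"
proof -
  have "AE \<omega> in M. pair_limit (\<lambda>n. B n i) (\<beta> i) \<omega>" for i
    by (rule AE_pair_limit[OF Bc C(2) trB])
  moreover have "AE \<omega> in M. pair_limit (\<lambda>n. mat_adjoint (B n i) * B n j) (\<beta>\<beta> $ i $ j) \<omega>" for i j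
  proof (rule AE_pair_limit[where K = "C * C"])
    fix n :: nat assume n: "n \<ge> 1"
    show "mat_adjoint (B n i) * B n j \<in> carrier_mat n n"
      by (rule mult_carrier_mat[OF mat_adjoint_carrier[OF Bc[OF n]] Bc[OF n]])
    show "opb n (ent (mat_adjoint (B n i) * B n j)) (C * C)"
      by (intro opb_mult opb_adjoint mat_adjoint_carrier Bc[OF n] C(2)[OF n])
  qed (rule trBB)
  ultimately show ?thesis using AE_unit_U by (simp add: eventually_all_finite)
qed

abbreviation Y :: "'w \<Rightarrow> nat \<Rightarrow> 'k \<Rightarrow> complex mat" where "Y \<omega> n i \<equiv> conj_by (U n \<omega>) (B n i)"

lemma Y_facts:
  assumes "unit_U \<omega>" "n \<ge> 1"
  shows "Y \<omega> n i \<in> carrier_mat n n" "mat_adjoint (Y \<omega> n i) \<in> carrier_mat n n"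
    "opb n (ent (Y \<omega> n i)) C" "opb n (ent (mat_adjoint (Y \<omega> n i))) C"
    "vip n (mvec n (ent (Y \<omega> n i)) x) (mvec n (ent (Y \<omega> n j)) y) =
       vip n x (mvec n (ent (conj_by (U n \<omega>) (mat_adjoint (B n i) * B n j))) y)"
    "hermitian n (B n i) \<Longrightarrow> hermitian n (Y \<omega> n i)"
proof -
  have W: "U n \<omega> \<in> unitary_group n" and Wc: "U n \<omega> \<in> carrier_mat n n" using assms by (auto simp: unit_U_def unitary_group_def)
  note B = Bc[OF assms(2)]
  show Yc: "Y \<omega> n i \<in> carrier_mat n n" for i by (rule conj_by_carrier[OF Wc B])
  show Ya: "mat_adjoint (Y \<omega> n i) \<in> carrier_mat n n" by (rule mat_adjoint_carrier[OF Yc])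
  show "opb n (ent (Y \<omega> n i)) C" by (rule opb_conj_by[OF W B C(2)[OF assms(2)]])
  then show "opb n (ent (mat_adjoint (Y \<omega> n i))) C" by (rule opb_adjoint[OF Yc])
  have "mat_adjoint (Y \<omega> n i) * Y \<omega> n j = conj_by (U n \<omega>) (mat_adjoint (B n i) * B n j)"
    unfolding mat_adjoint_conj_by[OF Wc B] by (rule conj_by_mult[OF W mat_adjoint_carrier[OF B] B])
  then show "vip n (mvec n (ent (Y \<omega> n i)) x) (mvec n (ent (Y \<omega> n j)) y) =
       vip n x (mvec n (ent (conj_by (U n \<omega>) (mat_adjoint (B n i) * B n j))) y)"
    using vip_ent_mult[OF Ya Yc, of x j y] vip_mat_adjoint'[OF Yc, of x i "mvec n (ent (Y \<omega> n j)) y"] by simp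
  show "hermitian n (Y \<omega> n i)" if "hermitian n (B n i)"
    using that Yc unfolding hermitian_def mat_adjoint_conj_by[OF Wc B] by simp
qed

text \<open>A limit of Gram matrices of the \<open>B n i\<close> for the normalized Hilbert-Schmidt
  inner product.\<close>

lemma psd_\<beta>\<beta>: "psd \<beta>\<beta>"
  unfolding psd_def
proof (intro conjI allI)
  fix i j
  have "\<forall>\<^sub>F n in sequentially. cnj (mat_tr (mat_adjoint (B n j) * B n i)) = mat_tr (mat_adjoint (B n i) * B n j)"
    using eventually_ge_at_top[of 1]
    by eventually_elim (simp add: mat_tr_adjoint_mult[OF Bc Bc] mult.commute)
  from Lim_transform_eventually[OF tendsto_cnj[OF trBB] this]
  show "\<beta>\<beta> $ i $ j = cnj (\<beta>\<beta> $ j $ i)" using trBB LIMSEQ_unique by blast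
next
  fix x :: "'k \<Rightarrow> complex"
  have lim: "(\<lambda>n. Re (\<Sum>i\<in>UNIV. \<Sum>j\<in>UNIV. cnj (x i) * mat_tr (mat_adjoint (B n i) * B n j) * x j)) \<longlonglongrightarrow>
      Re (\<Sum>i\<in>UNIV. \<Sum>j\<in>UNIV. cnj (x i) * \<beta>\<beta> $ i $ j * x j)"
    by (intro tendsto_intros trBB)
  have "0 \<le> Re (\<Sum>i\<in>UNIV. \<Sum>j\<in>UNIV. cnj (x i) * mat_tr (mat_adjoint (B n i) * B n j) * x j)" if n: "n \<ge> 1" for n
  proof -
    \<comment> \<open>The entries of the combination of the \<open>B n i\<close> with coefficients
      \<open>x\<close>, whose squared Hilbert-Schmidt norm is \<open>n\<close> times the
      form.\<close>
    define g where "g r k = (\<Sum>i\<in>UNIV. x i * ent (B n i) k r)" for r k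
    have "of_real (\<Sum>r<n. \<Sum>k<n. (cmod (g r k))\<^sup>2) = (\<Sum>r<n. \<Sum>k<n. \<Sum>i\<in>UNIV. \<Sum>j\<in>UNIV. cnj (x i) * (cnj (ent (B n i) k r) * ent (B n j) k r) * x j)"
    proof -
      have "of_real ((cmod (g r k))\<^sup>2) = (\<Sum>i\<in>UNIV. \<Sum>j\<in>UNIV. cnj (x i) * (cnj (ent (B n i) k r) * ent (B n j) k r) * x j)" for r k
      proof -
        have "of_real ((cmod (g r k))\<^sup>2) = (\<Sum>i\<in>UNIV. cnj (x i * ent (B n i) k r)) * (\<Sum>j\<in>UNIV. x j * ent (B n j) k r)"
          unfolding complex_norm_square mult.commute[of "g r k"] unfolding g_def cnj_sum ..
        also have "\<dots> = (\<Sum>i\<in>UNIV. \<Sum>j\<in>UNIV. cnj (x i * ent (B n i) k r) * (x j * ent (B n j) k r))" by (rule sum_product)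
        finally show ?thesis by (simp add: mult_ac)
      qed
      then show ?thesis unfolding of_real_sum by simp
    qed
    also have "\<dots> = (\<Sum>r<n. \<Sum>i\<in>UNIV. \<Sum>k<n. \<Sum>j\<in>UNIV. cnj (x i) * (cnj (ent (B n i) k r) * ent (B n j) k r) * x j)"
      by (intro sum.cong refl sum.swap)
    also have "\<dots> = (\<Sum>r<n. \<Sum>i\<in>UNIV. \<Sum>j\<in>UNIV. \<Sum>k<n. cnj (x i) * (cnj (ent (B n i) k r) * ent (B n j) k r) * x j)"
      by (intro sum.cong refl sum.swap)
    also have "\<dots> = (\<Sum>i\<in>UNIV. \<Sum>r<n. \<Sum>j\<in>UNIV. \<Sum>k<n. cnj (x i) * (cnj (ent (B n i) k r) * ent (B n j) k r) * x j)"
      by (rule sum.swap)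
    also have "\<dots> = (\<Sum>i\<in>UNIV. \<Sum>j\<in>UNIV. \<Sum>r<n. \<Sum>k<n. cnj (x i) * (cnj (ent (B n i) k r) * ent (B n j) k r) * x j)"
      by (intro sum.cong refl sum.swap)
    finally have eq: "of_real (\<Sum>r<n. \<Sum>k<n. (cmod (g r k))\<^sup>2) = (\<Sum>i\<in>UNIV. \<Sum>j\<in>UNIV. \<Sum>r<n. \<Sum>k<n. cnj (x i) * (cnj (ent (B n i) k r) * ent (B n j) k r) * x j)" .
    have "(\<Sum>i\<in>UNIV. \<Sum>j\<in>UNIV. cnj (x i) * mat_tr (mat_adjoint (B n i) * B n j) * x j) =
        (\<Sum>i\<in>UNIV. \<Sum>j\<in>UNIV. \<Sum>r<n. \<Sum>k<n. cnj (x i) * (cnj (ent (B n i) k r) * ent (B n j) k r) * x j) / of_nat n"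
      unfolding mat_tr_adjoint_mult[OF Bc[OF n] Bc[OF n]]
      by (simp add: sum_divide_distrib sum_distrib_left sum_distrib_right)
    also have "\<dots> = of_real ((\<Sum>r<n. \<Sum>k<n. (cmod (g r k))\<^sup>2) / n)" unfolding eq[symmetric] by simp
    finally show ?thesis by (simp add: sum_nonneg)
  qed
  then show "0 \<le> Re (\<Sum>i\<in>UNIV. \<Sum>j\<in>UNIV. cnj (x i) * \<beta>\<beta> $ i $ j * x j)"
    by (intro tendsto_lowerbound[OF lim]) (auto intro: eventually_mono[OF eventually_ge_at_top[of 1]])
qed

lemma \<beta>_real:
  assumes "\<And>n. n \<ge> 1 \<Longrightarrow> hermitian n (B n j)"
  shows "\<beta> j = of_real (Re (\<beta> j))"
proof -
  have "\<forall>\<^sub>F n in sequentially. cnj (mat_tr (B n j)) = mat_tr (B n j)"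
    using eventually_ge_at_top[of 1]
  proof eventually_elim
    case (elim n)
    have "cnj (ent (B n j) i i) = ent (B n j) i i" if "i < n" for i
      using hermitian_hermf[OF assms[OF elim]] that unfolding hermf_def by metis
    then show ?case using Bc[OF elim, of j] by (simp add: mat_tr_def mat_Tr_ftr[OF Bc[OF elim]] ftr_def)
  qed
  from Lim_transform_eventually[OF tendsto_cnj[OF trB] this] have "cnj (\<beta> j) = \<beta> j" using trB LIMSEQ_unique by blast
  then show ?thesis by (metis Reals_cnj_iff of_real_Re)
qed

lemma \<beta>\<beta>_diag: "\<beta>\<beta> $ j $ j = of_real (Re (\<beta>\<beta> $ j $ j))" "(cmod (\<beta> j))\<^sup>2 \<le> Re (\<beta>\<beta> $ j $ j)"
proof -
  have "\<beta>\<beta> $ j $ j = cnj (\<beta>\<beta> $ j $ j)" using psd_\<beta>\<beta> unfolding psd_def by blast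
  then show "\<beta>\<beta> $ j $ j = of_real (Re (\<beta>\<beta> $ j $ j))" by (metis Reals_cnj_iff of_real_Re)
  have "\<forall>\<^sub>F n in sequentially. (cmod (mat_tr (B n j)))\<^sup>2 \<le> Re (mat_tr (mat_adjoint (B n j) * B n j))"
    using eventually_ge_at_top[of 1]
    by eventually_elim (use cmod_mat_tr_le[OF Bc] in \<open>simp add: hs2_mat_tr[OF Bc]\<close>)
  then show "(cmod (\<beta> j))\<^sup>2 \<le> Re (\<beta>\<beta> $ j $ j)"
    by (intro tendsto_le[OF sequentially_bot tendsto_Re[OF trBB] tendsto_power[OF tendsto_norm[OF trB]]])
qed

end

section \<open>The four limits\<close>

text \<open>Eigenvectors of a single operator are orthonormal, so the limiting small matrix in (iii)
  and (iv) is the tensor product of \<open>\<kappa>\<close> with a diagonal matrix.\<close>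

lemma fpow_kronecker:
  assumes Q: "Q = UNIV \<times> W" "finite W"
    and h: "\<And>s e s' e'. e \<in> W \<Longrightarrow> e' \<in> W \<Longrightarrow> h (s, e) (s', e') = \<kappa> s s' * (if e = e' then g e else 0)"
    and e: "e \<in> W" "e' \<in> W"
  shows "fpow Q h p (s :: 's::finite, e) (s', e') = fpow UNIV \<kappa> p s s' * (if e = e' then g e ^ Suc p else 0)"
  using e
proof (induction p arbitrary: s e)
  case 0 then show ?case by (simp add: h)
next
  case (Suc p)
  have "fpow Q h (Suc p) (s, e) (s', e') = (\<Sum>t\<in>UNIV. \<Sum>e''\<in>W. h (s, e) (t, e'') * fpow Q h p (t, e'') (s', e'))"
    unfolding Q(1) by (simp add: fmul_def sum.cartesian_product)
  also have "\<dots> = (\<Sum>t\<in>UNIV. \<Sum>e''\<in>W. if e'' = e then \<kappa> s t * fpow UNIV \<kappa> p t s' * (g e * (if e = e' then g e ^ Suc p else 0)) else 0)"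
    using Suc by (intro sum.cong refl) (auto simp: h)
  also have "\<dots> = (\<Sum>t\<in>UNIV. \<kappa> s t * fpow UNIV \<kappa> p t s') * (g e * (if e = e' then g e ^ Suc p else 0))"
    using Q(2) Suc.prems(1) by (simp add: sum_distrib_right)
  finally show ?case by (simp add: fmul_def)
qed

lemma ftr_fpow_kronecker:
  assumes Q: "Q = UNIV \<times> W" "finite W"
    and h: "\<And>s e s' e'. e \<in> W \<Longrightarrow> e' \<in> W \<Longrightarrow> h (s :: 's::finite, e) (s', e') = \<kappa> s s' * (if e = e' then g e else 0)"
  shows "ftr Q (fpow Q h p) = ftr UNIV (fpow UNIV \<kappa> p) * (\<Sum>e\<in>W. g e ^ Suc p)"
proof -
  have "ftr Q (fpow Q h p) = (\<Sum>s\<in>UNIV. \<Sum>e\<in>W. fpow Q h p (s, e) (s, e))"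
    unfolding ftr_def Q(1) by (simp add: sum.cartesian_product case_prod_beta)
  also have "\<dots> = (\<Sum>s\<in>UNIV. \<Sum>e\<in>W. fpow UNIV \<kappa> p s s * g e ^ Suc p)"
    using fpow_kronecker[OF Q h] by (intro sum.cong refl) simp
  finally show ?thesis unfolding ftr_def sum_product .
qed

text \<open>The Cayley-Hamilton recursion, with two consecutive exponents carried along. It covers
  the case \<open>x = y\<close>, where \<open>\<kappa>\<close> may fail to be
  diagonalizable.\<close>

lemma ftr_fpow_two_by_two:
  fixes \<kappa> :: "bool \<Rightarrow> bool \<Rightarrow> complex"
  assumes tr: "\<kappa> False False + \<kappa> True True = x + y"
    and det: "\<kappa> False False * \<kappa> True True - \<kappa> False True * \<kappa> True False = x * y"
  shows "ftr UNIV (fpow UNIV \<kappa> p) = x ^ Suc p + y ^ Suc p"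
proof -
  have ch: "fmul UNIV \<kappa> (fmul UNIV \<kappa> Z) s t = (x + y) * fmul UNIV \<kappa> Z s t - x * y * Z s t" for Z :: "bool \<Rightarrow> bool \<Rightarrow> complex" and s t
    unfolding tr[symmetric] det[symmetric] by (cases s) (simp_all add: fmul_def UNIV_bool algebra_simps)
  have "ftr UNIV (fpow UNIV \<kappa> p) = x ^ Suc p + y ^ Suc p \<and> ftr UNIV (fpow UNIV \<kappa> (Suc p)) = x ^ Suc (Suc p) + y ^ Suc (Suc p)"
  proof (induction p)
    case 0
    have "ftr UNIV (fpow UNIV \<kappa> 0) = x + y" using tr by (simp add: ftr_def UNIV_bool add.commute)
    moreover have "ftr UNIV (fpow UNIV \<kappa> (Suc 0)) = (\<kappa> False False + \<kappa> True True)\<^sup>2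
        - 2 * (\<kappa> False False * \<kappa> True True - \<kappa> False True * \<kappa> True False)"
      by (simp add: ftr_def fmul_def UNIV_bool power2_eq_square algebra_simps)
    ultimately show ?case unfolding tr det by (simp add: power2_eq_square algebra_simps)
  next
    case (Suc p)
    have "ftr UNIV (fpow UNIV \<kappa> (Suc (Suc p))) = (x + y) * ftr UNIV (fpow UNIV \<kappa> (Suc p)) - x * y * ftr UNIV (fpow UNIV \<kappa> p)"
      by (simp add: ftr_def ch sum_subtractf sum_distrib_left)
    then show ?case using Suc by (simp add: algebra_simps)
  qed
  then show ?thesis by blast
qed

lemma mset_scale_enumerates:
  assumes en: "enumerates L I d" and x: "x \<noteq> 0"
  shows "mset_scale r L x = enat (card {i\<in>I. r * d i = x})"
proof (cases "r = 0")
  case True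
  then have "{y. r * y = x} = {}" "{i\<in>I. r * d i = x} = {}" using x by auto
  moreover have "{F. finite F \<and> F \<subseteq> ({} :: real set)} = {{}}" by auto
  ultimately show ?thesis unfolding mset_scale_def by (simp add: zero_enat_def)
next
  case False
  then have y: "{y. r * y = x} = {x / r}" by (auto simp: field_simps)
  have F: "{F. finite F \<and> F \<subseteq> {x / r}} = {{}, {x / r}}" by auto
  have "mset_scale r L x = L (x / r)" unfolding mset_scale_def y F by (simp add: sup_absorb2 flip: zero_enat_def)
  also have "\<dots> = enat (card {i\<in>I. d i = x / r})" using en x False by (simp add: enumerates_def)
  also have "{i\<in>I. d i = x / r} = {i\<in>I. r * d i = x}" using False by (auto simp: field_simps)
  finally show ?thesis .
qed

lemma finite_scaled:
  assumes en: "enumerates L I d" and y: "0 < y" shows "finite {i\<in>I. y \<le> \<bar>r * d i\<bar>}"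
proof (cases "r = 0")
  case True
  then have "{i\<in>I. y \<le> \<bar>r * d i\<bar>} \<subseteq> {}" using y by auto
  then show ?thesis by (rule finite_subset) simp
next
  case False
  have "finite {i\<in>I. y / \<bar>r\<bar> \<le> \<bar>d i\<bar>}" using en y False unfolding enumerates_def by (metis divide_pos_pos zero_less_abs_iff)
  moreover have "{i\<in>I. y \<le> \<bar>r * d i\<bar>} = {i\<in>I. y / \<bar>r\<bar> \<le> \<bar>d i\<bar>}" using False by (auto simp: abs_mult field_simps)
  ultimately show ?thesis by simp
qed

lemma card_UNIV_bool_split:
  assumes "finite {i\<in>I. P False i}" "finite {i\<in>I. P True i}"
  shows "finite {z\<in>UNIV \<times> I. P (fst z) (snd z)}"
    "card {z\<in>UNIV \<times> I. P (fst z) (snd z)} = card {i\<in>I. P False i} + card {i\<in>I. P True i}"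
proof -
  have eq: "{z\<in>UNIV \<times> I. P (fst z) (snd z)} = Pair False ` {i\<in>I. P False i} \<union> Pair True ` {i\<in>I. P True i}"
    by (auto simp: image_iff) (metis (full_types))
  show "finite {z\<in>UNIV \<times> I. P (fst z) (snd z)}" unfolding eq using assms by simp
  have "card (Pair False ` {i\<in>I. P False i} \<union> Pair True ` {i\<in>I. P True i}) =
      card (Pair False ` {i\<in>I. P False i}) + card (Pair True ` {i\<in>I. P True i})"
    by (rule card_Un_disjoint) (use assms in auto)
  then show "card {z\<in>UNIV \<times> I. P (fst z) (snd z)} = card {i\<in>I. P False i} + card {i\<in>I. P True i}"
    unfolding eq by (simp add: card_image inj_on_def)
qed

lemma enumerates_union_scale:
  fixes l :: "bool \<Rightarrow> real"
  assumes en: "enumerates L I d"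
  shows "enumerates (mset_union (mset_scale (l False) L) (mset_scale (l True) L)) (UNIV \<times> I) (\<lambda>(s, i). l s * d i)"
  unfolding enumerates_def
proof (intro conjI allI impI)
  show "finite {z\<in>UNIV \<times> I. y \<le> \<bar>case z of (s, i) \<Rightarrow> l s * d i\<bar>}" if "0 < y" for y
    using card_UNIV_bool_split(1)[of I "\<lambda>s i. y \<le> \<bar>l s * d i\<bar>"] finite_scaled[OF en that] by (simp add: case_prod_beta)
  fix x :: real assume x: "x \<noteq> 0"
  have fin: "finite {i\<in>I. r * d i = x}" for r
    by (rule finite_subset[OF _ finite_scaled[OF en, of "\<bar>x\<bar>" r]]) (use x in auto)
  show "mset_union (mset_scale (l False) L) (mset_scale (l True) L) x = enat (card {z\<in>UNIV \<times> I. (case z of (s, i) \<Rightarrow> l s * d i) = x})"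
    using card_UNIV_bool_split(2)[of I "\<lambda>s i. l s * d i = x"] fin
    by (simp add: mset_union_def mset_scale_enumerates[OF en x] case_prod_beta)
qed

text \<open>Termwise closeness takes the place of Weyl's inequalities, since the limits in (iii) and
  (iv) are given as multisets and not by one operator. Members outside \<open>J\<close> are at most
  \<open>\<eta>\<close> in modulus and never reach the levels compared.\<close>

lemma counts_near_restrict:
  assumes en: "enumerates L I d" and J: "J \<subseteq> I" "\<And>i. i \<in> I \<Longrightarrow> i \<notin> J \<Longrightarrow> e i = 0"
    and near: "\<And>i. i \<in> I \<Longrightarrow> \<bar>d i - e i\<bar> \<le> \<eta>" and fin: "finite J"
  shows "counts_near \<eta> I d J e" "counts_near \<eta> I (\<lambda>i. - d i) J (\<lambda>i. - e i)"
proof -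
  have *: "counts_near \<eta> I d J e"
    if en: "enumerates L I d" and J: "J \<subseteq> I" "\<And>i. i \<in> I \<Longrightarrow> i \<notin> J \<Longrightarrow> e i = 0"
      and near: "\<And>i. i \<in> I \<Longrightarrow> \<bar>d i - e i\<bar> \<le> \<eta>" for L d e
    unfolding counts_near_def
  proof (intro allI impI conjI)
    fix x assume x: "\<eta> < x"
    show "count_ge I d x \<le> count_ge J e (x - \<eta>)"
      unfolding count_ge_def
    proof (rule card_mono)
      show "{i\<in>I. x \<le> d i} \<subseteq> {i\<in>J. x - \<eta> \<le> e i}"
      proof safe
        fix i assume i: "i \<in> I" "x \<le> d i"
        then show "x - \<eta> \<le> e i" using near[OF i(1)] by (simp add: abs_le_iff)
        then show "i \<in> J" using J(2)[OF i(1)] x by fastforce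
      qed
    qed (use fin in simp)
    show "count_ge J e x \<le> count_ge I d (x - \<eta>)"
      unfolding count_ge_def
    proof (rule card_mono)
      show "finite {i\<in>I. x - \<eta> \<le> d i}" using enumerates_finite_ge[OF en] x by simp
      show "{i\<in>J. x \<le> e i} \<subseteq> {i\<in>I. x - \<eta> \<le> d i}" using J(1) near by (fastforce simp: abs_le_iff)
    qed
  qed
  show "counts_near \<eta> I d J e" by (rule *[OF en J near])
  show "counts_near \<eta> I (\<lambda>i. - d i) J (\<lambda>i. - e i)"
    by (rule *[OF enumerates_uminus[OF en] J(1)]) (use J(2) near in \<open>auto simp: abs_minus_commute\<close>)
qed

lemma op_fun_square:
  assumes T: "seq_compact_op T" "selfadjoint T" "complete_eigensystem T E" and f: "vanishes_near_0 f"
  shows "op_fun f T (op_fun f T v) = op_fun (\<lambda>x. (f x)\<^sup>2) T v"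
proof -
  have f2: "vanishes_near_0 (\<lambda>x. (f x)\<^sup>2)" using f by (auto simp: vanishes_near_0_def)
  have s: "support (\<lambda>x. (f x)\<^sup>2) T E = support f T E" by (auto simp: support_def)
  have "cinner e (op_fun f T v) = of_real (f (evalue T e)) * cinner e v" if "e \<in> support f T E" for e
    using orthonormal_expansion(1)[OF orthonormal_support[OF T(3)] finite_support[OF T(1,3) f] op_fun_eq[OF T f] that] .
  then show ?thesis
    unfolding op_fun_eq[OF T f2] s op_fun_eq[OF T f, of "op_fun f T v"]
    by (intro sum.cong refl) (simp add: power2_eq_square)
qed

context haar_compact
begin

lemma sum_Qn: "(\<Sum>q\<in>(Qn n :: ('s::finite \<times> nat) set). g q) = (\<Sum>s\<in>UNIV. \<Sum>m<n. g (s, m))"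
  unfolding Qn_def by (simp add: sum.cartesian_product case_prod_beta)

text \<open>With x = Y u and y = c Y u the pairings are c <u, U B_s^* B_s' U^* u'>, so
  \<open>\<kappa>\<close> is \<open>\<beta>\<beta>\<close>. In the limit operator \<open>S\<close>
  stands on both sides of each rank one term, and its pairings carry the same factor because
  \<open>S ** S = \<beta>\<beta>\<close>.\<close>

theorem EV_limit_sandwich:
  assumes uU: "unit_U \<omega>" and pl: "\<And>i j. pair_limit (\<lambda>n. mat_adjoint (B n i) * B n j) (\<beta>\<beta> $ i $ j) \<omega>"
  shows "EV_converges
      (\<lambda>n. EV_mat (mat_sum n (\<lambda>i. Y \<omega> n i * A n i * mat_adjoint (Y \<omega> n i))))
      (EV_op (scalar_mat_op (psd_sqrt \<beta>\<beta>) \<circ> diag_op a \<circ> scalar_mat_op (psd_sqrt \<beta>\<beta>)))"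
proof -
  define S where "S = psd_sqrt \<beta>\<beta>"
  have S: "S $ i $ j = cnj (S $ j $ i)" for i j unfolding S_def by (rule psdD(1)[OF psd_sqrt(1)[OF psd_\<beta>\<beta>]])
  have SS: "S ** S = \<beta>\<beta>" unfolding S_def by (rule psd_sqrt(2)[OF psd_\<beta>\<beta>])
  define T :: "'h ^ 'k \<Rightarrow> 'h ^ 'k" where "T = scalar_mat_op S \<circ> diag_op a \<circ> scalar_mat_op S"
  note T = sandwich_op[where a = a, OF S sc sa, folded T_def]
  obtain ET where ET: "complete_eigensystem T ET" using complete_eigensystem_exists by blast
  obtain K where K: "K > 0" "\<And>v :: 'h ^ 'k. norm (scalar_mat_op S v) \<le> K * norm v"
    using bop_scalar_mat_op[of S] by (auto simp: bop_def)
  let ?Mn = "\<lambda>n. mat_sum n (\<lambda>i. Y \<omega> n i * A n i * mat_adjoint (Y \<omega> n i))"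
  let ?w = "\<lambda>n s v. mvec n (ent (mat_adjoint (Y \<omega> n s))) v"
  have formM: "vip n v (mvec n (ent (?Mn n)) w) = (\<Sum>s\<in>UNIV. vip n (?w n s v) (mvec n (ent (A n s)) (?w n s w)))" if n: "n \<ge> 1" for n v w
    unfolding vip_mat_sum by (intro sum.cong refl vip_conj Y_facts(1)[OF uU n] Acarr[OF n])
  \<comment> \<open>One constant for both sides: each summand loses at most \<open>C\<^sup>2\<close>
    times the threshold, and the limit operator at most \<open>K\<^sup>2\<close> times it.\<close>
  define D where "D = real CARD('k) * C\<^sup>2 + K\<^sup>2"
  show ?thesis
    unfolding S_def[symmetric] T_def[symmetric]
  proof (rule EV_converges_criterion[where C = D and ?'m = "'h ^ 'k", OF _ _ EV_op_enumerates[OF T ET]])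
    fix n :: nat assume n: "n \<ge> 1"
    show "?Mn n \<in> carrier_mat n n" by (simp add: mat_sum_def)
    show "hermf n (ent (?Mn n))"
      by (rule hermfI) (unfold formM[OF n], simp add: vip_cnj vip_herm[OF herm[OF n]])
  next
    fix l :: nat
    define x where "x n q = mvec n (ent (Y \<omega> n (fst q))) (uu l n (fst q) (snd q))" for n q
    define y where "y n q i = of_real (cc l n (fst q) (snd q)) * x n q i" for n q i
    define X where "X n = (\<lambda>i j. \<Sum>q\<in>Qn (N l). x n q i * cnj (y n q j))" for n
    define Tf :: "'h ^ 'k \<Rightarrow> 'h ^ 'k" where "Tf = scalar_mat_op S \<circ> diag_op (\<lambda>i. op_fun (f l) (a i)) \<circ> scalar_mat_op S"
    note fv = C0b_vanishes[OF f(1)[of l]]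
    note Tf = sandwich_op[where a = "\<lambda>i. op_fun (f l) (a i)", OF S op_fun_bop_selfadjoint(3,2)[OF sc sa E fv], folded Tf_def]
    obtain EF where EF: "complete_eigensystem Tf EF" using complete_eigensystem_exists by blast
    define \<phi> where "\<phi> q v = of_real (f l (evalue (a (fst q)) (snd q))) * cinner (snd q) (scalar_mat_op S v $ fst q)" for q v
    define xx where "xx q = scalar_mat_op S (Finite_Cartesian_Product.axis (fst q) (snd q))" for q :: "'k \<times> 'h"
    have linS: "clinear (scalar_mat_op S :: 'h ^ 'k \<Rightarrow> 'h ^ 'k)" by (rule bop_clinear[OF bop_scalar_mat_op])
    have rep: "Tf v = (\<Sum>q\<in>Ql id (f l). \<phi> q v *\<^sub>C xx q)" for v
    proof -
      have "Tf v = (\<Sum>s\<in>UNIV. \<Sum>e\<in>support (f l) (a s) (E s). \<phi> (s, e) v *\<^sub>C xx (s, e))"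
        unfolding Tf_def comp_def diag_op_eq clinear_sum[OF linS]
      proof (intro sum.cong refl)
        fix s
        have "Finite_Cartesian_Product.axis s (op_fun (f l) (a s) (scalar_mat_op S v $ s)) =
            (\<Sum>e\<in>support (f l) (a s) (E s). \<phi> (s, e) v *\<^sub>C Finite_Cartesian_Product.axis s e)"
          unfolding op_fun_eq[OF sc sa E fv] clinear_sum[OF bop_clinear[OF bop_axis]] clinear_simps(2)[OF bop_clinear[OF bop_axis]]
          by (simp add: \<phi>_def)
        then show "scalar_mat_op S (Finite_Cartesian_Product.axis s (op_fun (f l) (a s) (scalar_mat_op S v $ s))) =
            (\<Sum>e\<in>support (f l) (a s) (E s). \<phi> (s, e) v *\<^sub>C xx (s, e))"
          by (simp add: clinear_sum[OF linS] clinear_simps(2)[OF linS] xx_def)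
      qed
      also have "\<dots> = (\<Sum>q\<in>Ql id (f l). \<phi> q v *\<^sub>C xx q)"
        unfolding Ql_def id_def by (subst sum.Sigma) (auto simp: finite_support[OF sc E fv] case_prod_beta)
      finally show ?thesis .
    qed
    have \<phi>lin: "clinear (\<phi> q)" for q
    proof -
      have "scalar_mat_op S (x + y) $ i = scalar_mat_op S x $ i + scalar_mat_op S y $ i"
        "scalar_mat_op S (c *\<^sub>C x) $ i = c *\<^sub>C (scalar_mat_op S x $ i)" for x y :: "'h ^ 'k" and c i
        by (simp_all only: clinear_simps[OF linS]) (simp_all add: scaleC_vec_def)
      then show ?thesis
        unfolding clinear_def \<phi>_def by (simp add: cinner_add_right cinner_scaleC_right scaleC_complex_def distrib_left mult_ac)
    qed
    have \<phi>xx: "\<phi> q (xx q') = \<beta>\<beta> $ fst q $ fst q' * kl id (f l) q q'" for q q'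
      unfolding \<phi>_def xx_def scalar_mat_op_mult[symmetric] SS scalar_mat_op_axis cinner_scaleC_right
      by (simp add: kl_def case_prod_beta mult_ac)
    note fr = finite_rank_power_sum[OF Tf EF finite_Ql[OF f(1)] rep \<phi>lin, unfolded \<phi>xx]
    have mom: "(\<lambda>n. ftr {..<n} (fpow {..<n} (X n) p)) \<longlonglongrightarrow> of_real (\<Sum>e\<in>EF. evalue Tf e ^ Suc p)" for p
      unfolding fr(2) X_def
    proof (rule moment_limit[where \<kappa> = "\<lambda>s s'. \<beta>\<beta> $ s $ s'", OF f(1) N(1) f(2)])
      fix q q' :: "'k \<times> nat" assume q: "q \<in> Qn (N l)" "q' \<in> Qn (N l)"
      obtain s m s' m' where sm: "q = (s, m)" "q' = (s', m')" by (cases q, cases q')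
      have mN: "m < N l" "m' < N l" using q by (auto simp: Qn_def sm)
      let ?D = "\<lambda>n. vip n (uu l n s m) (mvec n (ent (conj_by (U n \<omega>) (mat_adjoint (B n s) * B n s'))) (uu l n s' m'))
          - \<beta>\<beta> $ s $ s' * vip n (uu l n s m) (uu l n s' m')"
      have D0: "?D \<longlonglongrightarrow> 0" using pl[of s s'] mN unfolding pair_limit_def by blast
      have "(\<lambda>n. of_real (cc l n s m) * ?D n) \<longlonglongrightarrow> 0"
        by (rule lim_null_mult_left_bounded[OF _ D0, where B = R]) (simp add: cc_le)
      moreover have "\<forall>\<^sub>F n in sequentially. of_real (cc l n s m) * ?D n = vip n (y n q) (x n q') - \<beta>\<beta> $ fst q $ fst q' * kn id (f l) n q q'"
        using eventually_ge_at_top[of 1]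
      proof eventually_elim
        case (elim n)
        have "vip n (y n q) (x n q') = of_real (cc l n s m) * vip n (x n q) (x n q')"
          unfolding y_def[abs_def] vip_scale_left by (simp add: sm)
        then show ?case unfolding x_def using Y_facts(5)[OF uU elim] by (simp add: sm kn_def algebra_simps)
      qed
      ultimately show "(\<lambda>n. vip n (y n q) (x n q') - \<beta>\<beta> $ fst q $ fst q' * kn id (f l) n q q') \<longlonglongrightarrow> 0"
        by (rule Lim_transform_eventually)
    qed
    have hX: "hermf n (X n)" for n unfolding hermf_def X_def y_def by (simp add: mult_ac)
    have D: "real CARD('k) * C\<^sup>2 \<le> D" "K\<^sup>2 \<le> D" by (simp_all add: D_def)
    have nearX: "\<forall>\<^sub>F n in sequentially. \<forall>v. \<bar>Re (vip n v (mvec n (ent (?Mn n)) v)) - Re (vip n v (mvec n (X n) v))\<bar> \<le> D / (real l + 1) * nsq n v"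
      using ev_good[of l]
    proof eventually_elim
      case (elim n)
      note g = good_facts[OF elim]
      show ?case
      proof
        fix v
        have "vip n v (mvec n (X n) v) = (\<Sum>s\<in>UNIV. vip n (?w n s v) (mvec n (F l n s) (?w n s v)))"
          unfolding X_def vip_rank unfolding sum_Qn g(7)
        proof (intro sum.cong refl)
          fix s m
          have "vip n v (x n (s, m)) = vip n (?w n s v) (uu l n s m)"
            unfolding x_def by (simp add: vip_mat_adjoint[OF Y_facts(1)[OF uU g(1)]])
          moreover have "vip n (y n (s, m)) v = of_real (cc l n s m) * vip n (uu l n s m) (?w n s v)"
            unfolding y_def[abs_def] vip_scale_left x_def by (simp add: vip_mat_adjoint'[OF Y_facts(1)[OF uU g(1)]])
          ultimately show "vip n v (x n (s, m)) * vip n (y n (s, m)) v =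
              of_real (cc l n s m) * vip n (uu l n s m) (?w n s v) * vip n (?w n s v) (uu l n s m)" by simp
        qed
        then have "\<bar>Re (vip n v (mvec n (ent (?Mn n)) v)) - Re (vip n v (mvec n (X n) v))\<bar> =
            \<bar>\<Sum>s\<in>UNIV. Re (vip n (?w n s v) (mvec n (ent (A n s)) (?w n s v))) - Re (vip n (?w n s v) (mvec n (F l n s) (?w n s v)))\<bar>"
          by (simp add: formM[OF g(1)] sum_subtractf)
        also have "\<dots> \<le> (\<Sum>s\<in>(UNIV :: 'k set). eps l * (C\<^sup>2 * nsq n v))"
        proof (intro order_trans[OF sum_abs] sum_mono order_trans[OF g(2)] mult_left_mono)
          show "nsq n (?w n s v) \<le> C\<^sup>2 * nsq n v" for s using Y_facts(4)[OF uU g(1)] by (simp add: opb_def)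
        qed (use eps(1)[of l] in simp)
        also have "\<dots> = real CARD('k) * C\<^sup>2 / (real l + 1) * nsq n v" by (simp add: eps_def)
        also have "\<dots> \<le> D / (real l + 1) * nsq n v"
          by (intro mult_right_mono divide_right_mono D nsq_nonneg) simp
        finally show "\<bar>Re (vip n v (mvec n (ent (?Mn n)) v)) - Re (vip n v (mvec n (X n) v))\<bar> \<le> D / (real l + 1) * nsq n v" .
      qed
    qed
    have nearT: "\<bar>Re (cinner v (T v)) - Re (cinner v (Tf v))\<bar> \<le> D / (real l + 1) * (norm v)\<^sup>2" for v
    proof -
      let ?z = "scalar_mat_op S v"
      have z: "cinner v (T v) = (\<Sum>s\<in>UNIV. cinner (?z $ s) (a s (?z $ s)))"
        "cinner v (Tf v) = (\<Sum>s\<in>UNIV. cinner (?z $ s) (op_fun (f l) (a s) (?z $ s)))"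
        unfolding T_def Tf_def comp_def cinner_scalar_mat_op[OF S, symmetric] by (simp_all add: cinner_vec_def diag_op_def)
      have "\<bar>Re (cinner v (T v)) - Re (cinner v (Tf v))\<bar> \<le> (\<Sum>s\<in>UNIV. eps l * (norm (?z $ s))\<^sup>2)"
        unfolding z Re_sum sum_subtractf[symmetric]
      proof (intro order_trans[OF sum_abs] sum_mono op_fun_form_near[OF sc sa E fv])
        fix s e assume "e \<in> E s"
        then show "\<bar>evalue (a s) e - f l (evalue (a s) e)\<bar> \<le> eps l" using R by (intro f(3)) (simp add: bounded_by_def)
      qed (use eps(1)[of l] in simp)
      also have "\<dots> = eps l * (norm ?z)\<^sup>2"
        by (simp add: sum_distrib_left[symmetric] norm_vec_def L2_set_def sum_nonneg)
      also have "\<dots> \<le> eps l * (K * norm v)\<^sup>2" using eps(1)[of l] by (intro mult_left_mono power_mono K) auto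
      also have "\<dots> = K\<^sup>2 / (real l + 1) * (norm v)\<^sup>2" by (simp add: eps_def power_mult_distrib)
      also have "\<dots> \<le> D / (real l + 1) * (norm v)\<^sup>2" by (intro mult_right_mono divide_right_mono D) auto
      finally show ?thesis .
    qed
    have cn: "counts_near \<eta> ET (evalue T) EF (evalue Tf) \<and> counts_near \<eta> ET (\<lambda>j. - evalue T j) EF (\<lambda>j. - evalue Tf j)"
      if "D / (real l + 1) < \<eta>" "0 < \<eta>" for \<eta>
      using counts_near_op[OF T ET Tf EF nearT that(1)] that(2) by simp
    show "\<exists>X (J' :: ('h ^ 'k) set) e'. (\<forall>n. hermf n (X n)) \<and>
      (\<forall>\<^sub>F n in sequentially. \<forall>v. \<bar>Re (vip n v (mvec n (ent (?Mn n)) v)) - Re (vip n v (mvec n (X n) v))\<bar> \<le> D / (real l + 1) * nsq n v) \<and>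
      finite J' \<and> (\<forall>p. (\<lambda>n. ftr {..<n} (fpow {..<n} (X n) p)) \<longlonglongrightarrow> of_real (\<Sum>j\<in>J'. e' j ^ Suc p)) \<and>
      (\<forall>\<eta>. D / (real l + 1) < \<eta> \<longrightarrow> 0 < \<eta> \<longrightarrow> counts_near \<eta> ET (evalue T) J' e' \<and> counts_near \<eta> ET (\<lambda>j. - evalue T j) J' (\<lambda>j. - e' j))"
      using hX nearX fr(1) mom cn by blast
  qed
qed

end

lemma mvec_diff: "mvec n X (\<lambda>i. v i - w i) = (\<lambda>i. mvec n X v i - mvec n X w i)"
  unfolding mvec_def by (simp add: right_diff_distrib sum_subtractf)

text \<open>Changing one argument at a time makes the difference linear in
  \<open>\<delta>\<close>.\<close>

lemma opb_form_diff:
  assumes Y: "opb n Y C" and \<delta>: "sqrt (nsq n (\<lambda>i. p i - q i)) \<le> \<delta>"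
    and r: "sqrt (nsq n p) \<le> r" "sqrt (nsq n q) \<le> r"
  shows "\<bar>Re (vip n p (mvec n Y p)) - Re (vip n q (mvec n Y q))\<bar> \<le> 2 * \<delta> * C * r"
proof -
  let ?d = "\<lambda>i. p i - q i"
  have C: "0 \<le> C" using Y by (simp add: opb_def)
  have \<delta>0: "0 \<le> \<delta>" using \<delta> nsq_nonneg[of n ?d] by (meson order_trans real_sqrt_ge_zero)
  have r0: "0 \<le> r" using r(1) nsq_nonneg[of n p] by (meson order_trans real_sqrt_ge_zero)
  have "vip n p (mvec n Y p) - vip n q (mvec n Y q) = vip n ?d (mvec n Y p) + vip n q (mvec n Y ?d)"
    by (simp add: vip_diff_left mvec_diff vip_diff_right)
  then have "Re (vip n p (mvec n Y p)) - Re (vip n q (mvec n Y q)) = Re (vip n ?d (mvec n Y p)) + Re (vip n q (mvec n Y ?d))"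
    by (metis minus_complex.sel(1) plus_complex.sel(1))
  moreover have "\<bar>Re (vip n ?d (mvec n Y p))\<bar> \<le> \<delta> * (C * r)"
    using \<delta> \<delta>0 order_trans[OF opb_sqrt[OF Y] mult_left_mono[OF r(1) C]]
    by (intro order_trans[OF Re_vip_le mult_mono]) (auto simp: nsq_nonneg)
  moreover have "\<bar>Re (vip n q (mvec n Y ?d))\<bar> \<le> r * (C * \<delta>)"
    using r(2) r0 order_trans[OF opb_sqrt[OF Y] mult_left_mono[OF \<delta> C]]
    by (intro order_trans[OF Re_vip_le mult_mono]) (auto simp: nsq_nonneg)
  ultimately show ?thesis by (simp add: mult_ac)
qed

lemma real_combination_op:
  assumes S: "\<And>i :: 'i::finite. seq_compact_op (S i)" "\<And>i. selfadjoint (S i)" and \<beta>: "\<And>i. \<beta> i = complex_of_real (Re (\<beta> i))"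
  shows "seq_compact_op (\<lambda>x. \<Sum>i\<in>UNIV. \<beta> i *\<^sub>C S i x)" "selfadjoint (\<lambda>x. \<Sum>i\<in>UNIV. \<beta> i *\<^sub>C S i x)"
proof -
  have "seq_compact_op (\<lambda>x. \<beta> i *\<^sub>C S i x)" for i
    by (rule seq_compact_op_compose[OF S(1) bop_scaleC[OF bop_id] bop_id])
  then show "seq_compact_op (\<lambda>x. \<Sum>i\<in>UNIV. \<beta> i *\<^sub>C S i x)" by (intro seq_compact_op_sum) auto
  have "cnj (\<beta> i) = \<beta> i" for i by (subst (1 2) \<beta>) simp
  then show "selfadjoint (\<lambda>x. \<Sum>i\<in>UNIV. \<beta> i *\<^sub>C S i x)"
    using S(2) by (simp add: selfadjoint_def cinner_sum_left cinner_sum_right cinner_scaleC_left cinner_scaleC_right)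
qed

lemma square_op:
  assumes "seq_compact_op T" "selfadjoint T"
  shows "seq_compact_op (\<lambda>x. T (T x))" "selfadjoint (\<lambda>x. T (T x))"
  using seq_compact_op_compose[OF assms(1) seq_compact_op_bop[OF assms(1)] bop_id] assms(2) by (simp_all add: selfadjoint_def)

lemma selfadjoint_square_form: "selfadjoint T \<Longrightarrow> cinner v (T (T v)) = of_real ((norm (T v))\<^sup>2)"
  unfolding cinner_self[symmetric] by (simp add: selfadjoint_def)

text \<open>The form of a square is a squared norm, so the difference factors into a difference of
  norms, at most \<open>\<epsilon> * norm v\<close>, and a sum of norms; with
  \<open>\<epsilon> \<le> 1\<close> the sum is at most \<open>(2 * R + 1) * norm v\<close>.\<close>

lemma op_fun_square_near:
  assumes T: "seq_compact_op T" "selfadjoint T" "complete_eigensystem T E" and f: "vanishes_near_0 f"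
    and \<epsilon>: "\<And>e. e \<in> E \<Longrightarrow> \<bar>evalue T e - f (evalue T e)\<bar> \<le> \<epsilon>" "0 \<le> \<epsilon>" "\<epsilon> \<le> 1"
    and R: "norm (T v) \<le> R * norm v"
  shows "\<bar>(norm (T v))\<^sup>2 - (norm (op_fun f T v))\<^sup>2\<bar> \<le> \<epsilon> * (2 * R + 1) * (norm v)\<^sup>2"
proof -
  let ?h = "op_fun f T"
  note h = op_fun_bop_selfadjoint[OF T f]
  have lin: "clinear (\<lambda>x. T x - ?h x)"
    using bop_clinear[OF seq_compact_op_bop[OF T(1)]] bop_clinear[OF h(1)]
    by (simp add: clinear_def cvec.scale_right_diff_distrib)
  have "\<bar>Re (cinner x (T x - ?h x))\<bar> \<le> \<epsilon> * (norm x)\<^sup>2" for x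
    using op_fun_form_near[OF T f \<epsilon>(1,2), of x] by (simp add: cinner_diff_right)
  from selfadjoint_norm_le_form[OF lin selfadjoint_diff[OF T(2) h(2)] this]
  have d: "norm (T v - ?h v) \<le> \<epsilon> * norm v" .
  have hv: "norm (?h v) \<le> norm (T v) + \<epsilon> * norm v" "\<bar>norm (T v) - norm (?h v)\<bar> \<le> \<epsilon> * norm v"
    using d norm_triangle_ineq2[of "?h v" "T v"] norm_triangle_ineq3[of "T v" "?h v"] by (auto simp: norm_minus_commute)
  have "\<epsilon> * norm v \<le> norm v" using \<epsilon>(3) mult_right_mono[of \<epsilon> 1 "norm v"] by simp
  then have s: "norm (T v) + norm (?h v) \<le> (2 * R + 1) * norm v" using hv(1) R by (simp add: distrib_right)
  have "\<bar>(norm (T v))\<^sup>2 - (norm (?h v))\<^sup>2\<bar> = \<bar>norm (T v) - norm (?h v)\<bar> * (norm (T v) + norm (?h v))"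
    by (simp add: power2_eq_square square_diff_square_factored abs_mult mult.commute)
  also have "\<dots> \<le> (\<epsilon> * norm v) * ((2 * R + 1) * norm v)" using hv(2) s \<epsilon>(2) by (intro mult_mono) auto
  finally show ?thesis by (simp add: power2_eq_square mult_ac)
qed

context haar_compact
begin

text \<open>Selected eigenvectors of one matrix are orthonormal except for the padding by zero
  vectors, where the weights vanish; multiplied by the weights the relation holds for all
  indices.\<close>

lemma cc_orth:
  "of_real (cc l n i m) * of_real (cc l n i m') * vip n (uu l n i m) (uu l n i m') = (if m = m' then (of_real (cc l n i m))\<^sup>2 else 0)"
proof -
  let ?g = "\<lambda>j. f l (d n i j)"
  consider "m < length (sel_index n ?g)" "m' < length (sel_index n ?g)" | "cc l n i m = 0" | "cc l n i m' = 0"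
    unfolding c_def sel_val_def
    by (cases "m < length (sel_index n ?g)"; cases "m' < length (sel_index n ?g)"; simp)
  then show ?thesis
  proof cases
    case 1
    from sel_vec_orth[OF Vd this] show ?thesis by (simp add: u_def power2_eq_square)
  qed auto
qed

lemma u_square: "u (\<lambda>x. (f l x)\<^sup>2) n i m = uu l n i m" "c (\<lambda>x. (f l x)\<^sup>2) n i m = (cc l n i m)\<^sup>2"
  by (simp_all add: u_def c_def sel_vec_def sel_val_def sel_index_def)

lemma f_square: "(\<lambda>x. (f l x)\<^sup>2) \<in> C0b" "\<bar>(f l t)\<^sup>2\<bar> \<le> R\<^sup>2"
proof -
  show *: "\<bar>(f l t)\<^sup>2\<bar> \<le> R\<^sup>2" for t using power_mono[OF f(2)[of l t], of 2] by simp
  have "bounded (range (\<lambda>x. (f l x)\<^sup>2))" by (rule boundedI[of _ "R\<^sup>2"]) (use * in auto)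
  moreover have "continuous_on UNIV (\<lambda>x. (f l x)\<^sup>2)" using f(1)[of l] by (auto simp: C0b_def intro!: continuous_intros)
  moreover obtain \<epsilon> where "\<epsilon> > 0" "\<forall>x. \<bar>x\<bar> < \<epsilon> \<longrightarrow> f l x = 0" using f(1)[of l] by (auto simp: C0b_def)
  ultimately show "(\<lambda>x. (f l x)\<^sup>2) \<in> C0b" unfolding C0b_def by auto
qed

lemma vip_F: "vip n x (mvec n (F l n i) y) = vip n (mvec n (F l n i) x) y"
  unfolding fA_def by (rule vip_mvec_herm[OF hermf_spectral_sum])

lemma cmod_vip_u_le: "cmod (vip n (u g n i m) (u h n i' m')) \<le> 1"
proof -
  have "cmod (vip n (u g n i m) (u h n i' m')) \<le> sqrt (nsq n (u g n i m)) * sqrt (nsq n (u h n i' m'))" by (rule cmod_vip_le)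
  also have "\<dots> \<le> 1 * 1" by (intro mult_mono) (auto simp: u_nsq nsq_nonneg)
  finally show ?thesis by simp
qed

text \<open>With x = u and y = c F Y u a second copy of the truncated matrix appears in the pairing.
  Its expansion runs over all selected eigenvectors u_k, but <u, Y u_k> is close to \<beta> <u,
  u_k>, so only the term with equal indices survives and the weights become squares. Words in the
  square of \<open>f\<close> then give the limit.\<close>

theorem EV_limit_compressed:
  assumes uU: "unit_U \<omega>" and pl: "\<And>i. pair_limit (\<lambda>n. B n i) (\<beta> i) \<omega>"
    and hB: "\<And>n i. n \<ge> 1 \<Longrightarrow> hermitian n (B n i)"
  shows "EV_converges (\<lambda>n. EV_mat (mat_sum n (\<lambda>i. A n i * Y \<omega> n i * A n i))) (EV_op (\<lambda>x. \<Sum>i\<in>UNIV. \<beta> i *\<^sub>C a i (a i x)))"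
proof -
  define T where "T = (\<lambda>x. \<Sum>i\<in>UNIV. \<beta> i *\<^sub>C a i (a i x))"
  have \<beta>r: "\<beta> i = of_real (Re (\<beta> i))" for i by (rule \<beta>_real[OF hB])
  note T = real_combination_op[where \<beta> = \<beta> and S = "\<lambda>i x. a i (a i x)", OF square_op[OF sc sa] \<beta>r, folded T_def]
  obtain ET where ET: "complete_eigensystem T ET" using complete_eigensystem_exists by blast
  let ?Mn = "\<lambda>n. mat_sum n (\<lambda>i. A n i * Y \<omega> n i * A n i)"
  let ?A = "\<lambda>n s v. mvec n (ent (A n s)) v" and ?Y = "\<lambda>n s v. mvec n (ent (Y \<omega> n s)) v"
  have formM: "vip n v (mvec n (ent (?Mn n)) w) = (\<Sum>s\<in>UNIV. vip n (?A n s v) (?Y n s (?A n s w)))" if n: "n \<ge> 1" for n v w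
    unfolding vip_mat_sum
  proof (intro sum.cong refl)
    fix s
    note A = Acarr[OF n, of s] and Ys = Y_facts(1)[OF uU n, of s]
    show "vip n v (mvec n (ent (A n s * Y \<omega> n s * A n s)) w) = vip n (?A n s v) (?Y n s (?A n s w))"
      unfolding vip_ent_mult[OF mult_carrier_mat[OF A Ys] A] vip_ent_mult[OF A Ys] by (rule vip_herm[OF herm[OF n]])
  qed
  have Yh: "vip n v (?Y n s w) = vip n (?Y n s v) w" if n: "n \<ge> 1" for n s v w
    by (rule vip_herm[OF Y_facts(6)[OF uU n hB[OF n]]])
  define D1 where "D1 = real CARD('k) * (2 * C * R)"
  define D2 where "D2 = (\<Sum>i\<in>UNIV. cmod (\<beta> i)) * (2 * R + 1)"
  have D0: "0 \<le> D1" "0 \<le> D2" using C(1) R0 by (auto simp: D1_def D2_def sum_nonneg)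
  show ?thesis
    unfolding T_def[symmetric]
  proof (rule EV_converges_criterion[where C = "D1 + D2" and ?'m = 'h, OF _ _ EV_op_enumerates[OF T ET]])
    fix n :: nat assume n: "n \<ge> 1"
    show "?Mn n \<in> carrier_mat n n" by (simp add: mat_sum_def)
    show "hermf n (ent (?Mn n))"
      by (rule hermfI) (unfold formM[OF n], simp add: vip_cnj Yh[OF n])
  next
    fix l :: nat
    let ?g = "\<lambda>x. (f l x)\<^sup>2"
    let ?F = "\<lambda>n s v. mvec n (F l n s) v"
    \<comment> \<open>Zero for the finitely many exceptional \<open>n\<close>, so that
      \<open>X n\<close> is Hermitian for every \<open>n\<close>.\<close>
    define x where "x n q = (if good l n then uu l n (fst q) (snd q) else (\<lambda>_. 0))" for n q
    define y where "y n q i = of_real (cc l n (fst q) (snd q)) * ?F n (fst q) (?Y n (fst q) (uu l n (fst q) (snd q))) i" for n q i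
    define X where "X n = (\<lambda>i j. \<Sum>q\<in>Qn (N l). x n q i * cnj (y n q j))" for n
    define Tg where "Tg = (\<lambda>v. \<Sum>i\<in>UNIV. \<beta> i *\<^sub>C op_fun ?g (a i) v)"
    note fv = C0b_vanishes[OF f(1)[of l]] and gv = C0b_vanishes[OF f_square(1)[of l]]
    note Tg = real_combination_op[where \<beta> = \<beta> and S = "\<lambda>i. op_fun ?g (a i)", OF op_fun_bop_selfadjoint(3,2)[OF sc sa E gv] \<beta>r, folded Tg_def]
    obtain EF where EF: "complete_eigensystem Tg EF" using complete_eigensystem_exists by blast
    define \<phi> where "\<phi> q v = \<beta> (fst q) * (of_real (?g (evalue (a (fst q)) (snd q))) * cinner (snd q) v)" for q v
    have rep: "Tg v = (\<Sum>q\<in>Ql id ?g. \<phi> q v *\<^sub>C snd q)" for v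
    proof -
      have "Tg v = (\<Sum>s\<in>UNIV. \<Sum>e\<in>support ?g (a s) (E s). \<phi> (s, e) v *\<^sub>C e)"
        unfolding Tg_def op_fun_eq[OF sc sa E gv] by (simp add: \<phi>_def cvec.scale_sum_right)
      also have "\<dots> = (\<Sum>q\<in>Ql id ?g. \<phi> q v *\<^sub>C snd q)"
        unfolding Ql_def id_def by (subst sum.Sigma) (auto simp: finite_support[OF sc E gv] case_prod_beta)
      finally show ?thesis .
    qed
    have \<phi>lin: "clinear (\<phi> q)" for q
      unfolding clinear_def \<phi>_def by (simp add: cinner_add_right cinner_scaleC_right scaleC_complex_def algebra_simps)
    have \<phi>x: "\<phi> q (snd q') = \<beta> (fst q) * kl id ?g q q'" for q q'
      unfolding \<phi>_def by (simp add: kl_def case_prod_beta)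
    note fr = finite_rank_power_sum[OF Tg EF finite_Ql[OF f_square(1)] rep \<phi>lin, unfolded \<phi>x]
    have y_vip: "vip n (y n q) w = of_real (cc l n (fst q) (snd q)) * vip n (uu l n (fst q) (snd q)) (?Y n (fst q) (?F n (fst q) w))"
      if "n \<ge> 1" for n q w
      unfolding y_def[abs_def] vip_scale_left by (simp add: vip_F[symmetric] Yh[OF that])
    have mom: "(\<lambda>n. ftr {..<n} (fpow {..<n} (X n) p)) \<longlonglongrightarrow> of_real (\<Sum>e\<in>EF. evalue Tg e ^ Suc p)" for p
      unfolding fr(2) X_def
    proof (rule moment_limit[where \<kappa> = "\<lambda>s s'. \<beta> s", OF f_square(1) N(2) f_square(2)])
      fix q q' :: "'k \<times> nat" assume q: "q \<in> Qn (N l)" "q' \<in> Qn (N l)"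
      obtain s m s' m' where sm: "q = (s, m)" "q' = (s', m')" by (cases q, cases q')
      have mN: "m < N l" "m' < N l" using q by (auto simp: Qn_def sm)
      let ?D = "\<lambda>n k. vip n (uu l n s m) (mvec n (ent (Y \<omega> n s)) (uu l n s k)) - \<beta> s * vip n (uu l n s m) (uu l n s k)"
      let ?h = "\<lambda>n k. of_real (cc l n s m) * of_real (cc l n s k) * vip n (uu l n s k) (uu l n s' m')"
      have "(\<lambda>n. \<Sum>k<N l. ?h n k * ?D n k) \<longlonglongrightarrow> (\<Sum>k<N l. 0)"
      proof (rule tendsto_sum)
        fix k assume "k \<in> {..<N l}"
        then have D0: "(\<lambda>n. ?D n k) \<longlonglongrightarrow> 0" using pl[of s] mN unfolding pair_limit_def by blast
        have "norm (?h n k) \<le> R * R * 1" for n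
          unfolding norm_mult norm_of_real by (intro mult_mono cc_le cmod_vip_u_le) (use R0 in auto)
        then show "(\<lambda>n. ?h n k * ?D n k) \<longlonglongrightarrow> 0" by (intro lim_null_mult_left_bounded[OF _ D0, where B = "R * R * 1"]) simp
      qed
      then have "(\<lambda>n. \<Sum>k<N l. ?h n k * ?D n k) \<longlonglongrightarrow> 0" by simp
      moreover have "\<forall>\<^sub>F n in sequentially. (\<Sum>k<N l. ?h n k * ?D n k) = vip n (y n q) (x n q') - \<beta> (fst q) * kn id ?g n q q'"
        using ev_good[of l]
      proof eventually_elim
        case (elim n)
        note g = good_facts[OF elim]
        have "vip n (y n q) (x n q') = (\<Sum>k<N l. ?h n k * vip n (uu l n s m) (?Y n s (uu l n s k)))"
          unfolding y_vip[OF g(1)] Yh[OF g(1)] g(7) using elim by (simp add: sm x_def sum_distrib_left mult_ac)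
        \<comment> \<open>The weighted orthogonality \<open>cc_orth\<close> leaves the single term
          \<open>k = m\<close>, which carries the weight of \<open>kn\<close> for the square of
          \<open>f\<close>.\<close>
        moreover have "\<beta> (fst q) * kn id ?g n q q' = (\<Sum>k<N l. ?h n k * (\<beta> s * vip n (uu l n s m) (uu l n s k)))"
        proof -
          have "?h n k * (\<beta> s * vip n (uu l n s m) (uu l n s k)) =
              (if m = k then \<beta> s * ((of_real (cc l n s m))\<^sup>2 * vip n (uu l n s m) (uu l n s' m')) else 0)" for k
          proof -
            have e: "?h n k * (\<beta> s * vip n (uu l n s m) (uu l n s k)) = \<beta> s * vip n (uu l n s k) (uu l n s' m') *
              (of_real (cc l n s m) * of_real (cc l n s k) * vip n (uu l n s m) (uu l n s k))" by (simp only: mult_ac)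
            show ?thesis unfolding e cc_orth by (auto simp: mult_ac)
          qed
          then show ?thesis using mN by (simp add: sm kn_def u_square)
        qed
        ultimately show ?case by (simp only: right_diff_distrib sum_subtractf)
      qed
      ultimately show "(\<lambda>n. vip n (y n q) (x n q') - \<beta> (fst q) * kn id ?g n q q') \<longlonglongrightarrow> 0"
        by (rule Lim_transform_eventually)
    qed
    have formX: "vip n v (mvec n (X n) w) = (\<Sum>s\<in>UNIV. vip n (?F n s v) (?Y n s (?F n s w)))" if gd: "good l n" for n v w
    proof -
      note g = good_facts[OF gd]
      have "vip n v (mvec n (X n) w) = (\<Sum>s\<in>UNIV. vip n v (?F n s (?Y n s (?F n s w))))"
        unfolding X_def vip_rank unfolding sum_Qn g(7)[where x = v] y_vip[OF g(1)] using gd by (simp add: x_def mult_ac)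
      then show ?thesis by (simp only: vip_F)
    qed
    have hX: "hermf n (X n)" for n
    proof (cases "good l n")
      case True
      show ?thesis
        by (rule hermfI) (unfold formX[OF True], simp add: vip_cnj Yh[OF good_facts(1)[OF True]])
    qed (simp add: hermf_def X_def x_def)
    have nearX: "\<forall>\<^sub>F n in sequentially. \<forall>v. \<bar>Re (vip n v (mvec n (ent (?Mn n)) v)) - Re (vip n v (mvec n (X n) v))\<bar> \<le> (D1 + D2) / (real l + 1) * nsq n v"
      using ev_good[of l]
    proof eventually_elim
      case (elim n)
      note g = good_facts[OF elim]
      show ?case
      proof
        fix v
        have "\<bar>Re (vip n v (mvec n (ent (?Mn n)) v)) - Re (vip n v (mvec n (X n) v))\<bar> =
            \<bar>\<Sum>s\<in>UNIV. Re (vip n (?A n s v) (?Y n s (?A n s v))) - Re (vip n (?F n s v) (?Y n s (?F n s v)))\<bar>"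
          by (simp add: formM[OF g(1)] formX[OF elim] sum_subtractf)
        also have "\<dots> \<le> (\<Sum>s\<in>(UNIV :: 'k set). 2 * (eps l * sqrt (nsq n v)) * C * (R * sqrt (nsq n v)))"
          by (intro order_trans[OF sum_abs] sum_mono opb_form_diff[OF Y_facts(3)[OF uU g(1)]] g(3) opb_sqrt[OF g(4)] opb_sqrt[OF g(5)])
        also have "\<dots> = D1 / (real l + 1) * nsq n v"
          using nsq_nonneg[of n v] by (simp add: eps_def D1_def mult_ac)
        also have "\<dots> \<le> (D1 + D2) / (real l + 1) * nsq n v"
          using D0 by (intro mult_right_mono divide_right_mono nsq_nonneg) auto
        finally show "\<bar>Re (vip n v (mvec n (ent (?Mn n)) v)) - Re (vip n v (mvec n (X n) v))\<bar> \<le> (D1 + D2) / (real l + 1) * nsq n v" .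
      qed
    qed
    have nearT: "\<bar>Re (cinner v (T v)) - Re (cinner v (Tg v))\<bar> \<le> (D1 + D2) / (real l + 1) * (norm v)\<^sup>2" for v
    proof -
      let ?h = "\<lambda>s. op_fun (f l) (a s)"
      have hh: "op_fun ?g (a s) v = ?h s (?h s v)" for s by (rule op_fun_square[OF sc sa E fv, symmetric])
      have z: "cinner v (T v) = (\<Sum>s\<in>UNIV. \<beta> s * of_real ((norm (a s v))\<^sup>2))"
        "cinner v (Tg v) = (\<Sum>s\<in>UNIV. \<beta> s * of_real ((norm (?h s v))\<^sup>2))"
        unfolding T_def Tg_def hh cinner_sum_right cinner_scaleC_right selfadjoint_square_form[OF sa]
          selfadjoint_square_form[OF op_fun_bop_selfadjoint(2)[OF sc sa E fv]] by simp_all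
      have "\<bar>Re (cinner v (T v)) - Re (cinner v (Tg v))\<bar> = \<bar>\<Sum>s\<in>UNIV. Re (\<beta> s) * ((norm (a s v))\<^sup>2 - (norm (?h s v))\<^sup>2)\<bar>"
        unfolding z Re_sum sum_subtractf[symmetric] by (simp add: right_diff_distrib)
      also have "\<dots> \<le> (\<Sum>s\<in>UNIV. cmod (\<beta> s) * (eps l * (2 * R + 1) * (norm v)\<^sup>2))"
      proof (intro order_trans[OF sum_abs] sum_mono, unfold abs_mult, intro mult_mono abs_Re_le_cmod op_fun_square_near[OF sc sa E fv])
        fix s e assume "e \<in> E s"
        then show "\<bar>evalue (a s) e - f l (evalue (a s) e)\<bar> \<le> eps l" using R by (intro f(3)) (simp add: bounded_by_def)
      next
        fix s show "norm (a s v) \<le> R * norm v" using R by (simp add: bounded_by_def)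
      qed (use eps(1)[of l] in \<open>auto simp: eps(2)\<close>)
      also have "\<dots> = D2 / (real l + 1) * (norm v)\<^sup>2"
        unfolding sum_distrib_right[symmetric] by (simp add: eps_def D2_def)
      also have "\<dots> \<le> (D1 + D2) / (real l + 1) * (norm v)\<^sup>2" using D0 by (intro mult_right_mono divide_right_mono) auto
      finally show ?thesis .
    qed
    have cn: "counts_near \<eta> ET (evalue T) EF (evalue Tg) \<and> counts_near \<eta> ET (\<lambda>j. - evalue T j) EF (\<lambda>j. - evalue Tg j)"
      if "(D1 + D2) / (real l + 1) < \<eta>" "0 < \<eta>" for \<eta>
      using counts_near_op[OF T ET Tg EF nearT that(1)] that(2) by simp
    show "\<exists>X (J' :: 'h set) e'. (\<forall>n. hermf n (X n)) \<and>
      (\<forall>\<^sub>F n in sequentially. \<forall>v. \<bar>Re (vip n v (mvec n (ent (?Mn n)) v)) - Re (vip n v (mvec n (X n) v))\<bar> \<le> (D1 + D2) / (real l + 1) * nsq n v) \<and>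
      finite J' \<and> (\<forall>p. (\<lambda>n. ftr {..<n} (fpow {..<n} (X n) p)) \<longlonglongrightarrow> of_real (\<Sum>j\<in>J'. e' j ^ Suc p)) \<and>
      (\<forall>\<eta>. (D1 + D2) / (real l + 1) < \<eta> \<longrightarrow> 0 < \<eta> \<longrightarrow> counts_near \<eta> ET (evalue T) J' e' \<and> counts_near \<eta> ET (\<lambda>j. - evalue T j) J' (\<lambda>j. - e' j))"
      using hX nearX fr(1) mom cn by blast
  qed
qed

text \<open>The letter \<open>False\<close> stands for \<alpha> A Y and \<open>True\<close> for its
  adjoint. The limiting pairings form a two by two matrix with trace
  \<open>(\<alpha> + cnj \<alpha>) * \<beta> j\<close> and, since \<alpha> has modulus 1,
  determinant \<open>(\<beta> j)\<^sup>2 - \<beta>\<beta> $ j $ j\<close>; \<open>r\<close> lists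
  its eigenvalues. The anticommutator is the case \<alpha> = 1, the commutator the case \<alpha> =
  \<i>.\<close>

theorem EV_limit_bilinear:
  fixes r :: "bool \<Rightarrow> real"
  assumes uU: "unit_U \<omega>" and plB: "pair_limit (\<lambda>n. B n j) (\<beta> j) \<omega>"
    and plBB: "pair_limit (\<lambda>n. mat_adjoint (B n j) * B n j) (\<beta>\<beta> $ j $ j) \<omega>"
    and hB: "\<And>n. n \<ge> 1 \<Longrightarrow> hermitian n (B n j)"
    and \<alpha>: "cmod \<alpha> = 1"
    and tr: "complex_of_real (r False + r True) = (\<alpha> + cnj \<alpha>) * \<beta> j"
    and det: "complex_of_real (r False * r True) = (\<beta> j)\<^sup>2 - \<beta>\<beta> $ j $ j"
    and Mn: "\<And>n. n \<ge> 1 \<Longrightarrow> Mn n \<in> carrier_mat n n"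
      "\<And>n s t. n \<ge> 1 \<Longrightarrow> s < n \<Longrightarrow> t < n \<Longrightarrow>
        ent (Mn n) s t = \<alpha> * ent (A n j * Y \<omega> n j) s t + cnj \<alpha> * ent (Y \<omega> n j * A n j) s t"
  shows "EV_converges (\<lambda>n. EV_mat (Mn n))
    (mset_union (mset_scale (r False) (EV_op (a j))) (mset_scale (r True) (EV_op (a j))))"
proof -
  let ?A = "\<lambda>n v. mvec n (ent (A n j)) v" and ?Y = "\<lambda>n v. mvec n (ent (Y \<omega> n j)) v"
  note en = enumerates_union_scale[OF EV_op_enumerates[OF sc[of j] sa[of j] E[of j]], of r]
  have Yh: "vip n v (?Y n w) = vip n (?Y n v) w" if n: "n \<ge> 1" for n v w
    by (rule vip_herm[OF Y_facts(6)[OF uU n hB[OF n]]])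
  have formM: "vip n v (mvec n (ent (Mn n)) w) = \<alpha> * vip n (?A n v) (?Y n w) + cnj \<alpha> * vip n (?Y n v) (?A n w)" if n: "n \<ge> 1" for n v w
  proof -
    have "mvec n (ent (Mn n)) w i = \<alpha> * mvec n (ent (A n j * Y \<omega> n j)) w i + cnj \<alpha> * mvec n (ent (Y \<omega> n j * A n j)) w i" if "i < n" for i
    proof -
      have "mvec n (ent (Mn n)) w i = (\<Sum>k<n. \<alpha> * (ent (A n j * Y \<omega> n j) i k * w k) + cnj \<alpha> * (ent (Y \<omega> n j * A n j) i k * w k))"
        unfolding mvec_def by (intro sum.cong refl) (simp add: Mn(2)[OF n that] algebra_simps)
      then show ?thesis by (simp add: mvec_def sum.distrib sum_distrib_left)
    qed
    then have "vip n v (mvec n (ent (Mn n)) w) =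
        vip n v (\<lambda>i. \<alpha> * mvec n (ent (A n j * Y \<omega> n j)) w i + cnj \<alpha> * mvec n (ent (Y \<omega> n j * A n j)) w i)"
      by (intro vip_cong refl)
    also have "\<dots> = \<alpha> * vip n v (?A n (?Y n w)) + cnj \<alpha> * vip n v (?Y n (?A n w))"
      unfolding vip_add_right vip_scale_right vip_ent_mult[OF Acarr[OF n] Y_facts(1)[OF uU n]] vip_ent_mult[OF Y_facts(1)[OF uU n] Acarr[OF n]] ..
    finally show ?thesis unfolding vip_herm[OF herm[OF n]] Yh[OF n] .
  qed
  \<comment> \<open>The first part serves the random matrices, the second the scaled eigenvalues of
    the limit.\<close>
  define D where "D = 2 * C + (\<bar>r False\<bar> + \<bar>r True\<bar>)"
  show ?thesis
  proof (rule EV_converges_criterion[where C = D and ?'m = "bool \<times> 'h", OF Mn(1) _ en])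
    show "hermf n (ent (Mn n))" if n: "n \<ge> 1" for n
      by (rule hermfI) (unfold formM[OF n], simp add: vip_cnj)
  next
    fix l :: nat
    let ?F = "\<lambda>n v. mvec n (F l n j) v" and ?\<iota> = "\<lambda>_ :: bool. j"
    let ?W = "support (f l) (a j) (E j)"
    define x where "x n q = (if good l n then (if fst q then (\<lambda>i. cnj \<alpha> * ?Y n (uu l n j (snd q)) i)
      else (\<lambda>i. \<alpha> * uu l n j (snd q) i)) else (\<lambda>_. 0))" for n and q :: "bool \<times> nat"
    define y where "y n q = (\<lambda>i. of_real (cc l n j (snd q)) *
      (if fst q then uu l n j (snd q) else ?Y n (uu l n j (snd q))) i)" for n and q :: "bool \<times> nat"
    define X where "X n = (\<lambda>i k. \<Sum>q\<in>Qn (N l). x n q i * cnj (y n q k))" for n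
    \<comment> \<open>The four limits of the pairings: off the diagonal Y u meets Y u', or u meets
      u'; on the diagonal a single Y is left.\<close>
    define \<kappa> where "\<kappa> s s' = (if s then (if s' then cnj \<alpha> * \<beta> j else \<alpha>) else (if s' then cnj \<alpha> * \<beta>\<beta> $ j $ j else \<alpha> * \<beta> j))" for s s'
    define e' where "e' = (\<lambda>(s, e). r s * f l (evalue (a j) e))"
    note fv = C0b_vanishes[OF f(1)[of l]]
    have finW: "finite ?W" by (rule finite_support[OF sc E fv])
    have mom: "(\<lambda>n. ftr {..<n} (fpow {..<n} (X n) p)) \<longlonglongrightarrow> of_real (\<Sum>q\<in>UNIV \<times> ?W. e' q ^ Suc p)" for p
    proof -
      have Q: "Ql ?\<iota> (f l) = UNIV \<times> ?W" by (simp add: Ql_def)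
      have k: "\<kappa> (fst (s, e)) (fst (s', e')) * kl ?\<iota> (f l) (s, e) (s', e') = \<kappa> s s' * (if e = e' then of_real (f l (evalue (a j) e)) else 0)"
        if "e \<in> ?W" "e' \<in> ?W" for s e s' e'
        using orthonormal_support[OF E[of j], of "f l"] that by (simp add: kl_def orthonormal_def)
      have k\<alpha>: "\<alpha> * cnj \<alpha> = 1" using complex_norm_square[of \<alpha>] \<alpha> by simp
      have \<kappa>d: "\<kappa> False False * \<kappa> True True - \<kappa> False True * \<kappa> True False = complex_of_real (r False) * complex_of_real (r True)"
      proof -
        have "\<kappa> False False * \<kappa> True True - \<kappa> False True * \<kappa> True False = (\<alpha> * cnj \<alpha>) * ((\<beta> j)\<^sup>2 - \<beta>\<beta> $ j $ j)"
          by (simp add: \<kappa>_def algebra_simps power2_eq_square)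
        then show ?thesis using det k\<alpha> by simp
      qed
      have \<kappa>t: "\<kappa> False False + \<kappa> True True = complex_of_real (r False) + complex_of_real (r True)"
        using tr by (simp add: \<kappa>_def algebra_simps)
      have "ftr (Ql ?\<iota> (f l)) (fpow (Ql ?\<iota> (f l)) (\<lambda>x y. \<kappa> (fst x) (fst y) * kl ?\<iota> (f l) x y) p) =
          (of_real (r False) ^ Suc p + of_real (r True) ^ Suc p) * (\<Sum>e\<in>?W. of_real (f l (evalue (a j) e)) ^ Suc p)"
        unfolding ftr_fpow_two_by_two[OF \<kappa>t \<kappa>d, symmetric] by (rule ftr_fpow_kronecker[OF Q finW k])
      also have "\<dots> = of_real ((r False ^ Suc p + r True ^ Suc p) * (\<Sum>e\<in>?W. f l (evalue (a j) e) ^ Suc p))" by simp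
      also have "(r False ^ Suc p + r True ^ Suc p) * (\<Sum>e\<in>?W. f l (evalue (a j) e) ^ Suc p) = (\<Sum>s\<in>UNIV. \<Sum>e\<in>?W. e' (s, e) ^ Suc p)"
        unfolding e'_def case_prod_conv power_mult_distrib sum_distrib_left[symmetric] UNIV_bool
        by (simp add: distrib_right del: power_Suc)
      also have "(\<Sum>s\<in>UNIV. \<Sum>e\<in>?W. e' (s, e) ^ Suc p) = (\<Sum>q\<in>UNIV \<times> ?W. e' q ^ Suc p)"
        by (simp add: sum.cartesian_product case_prod_beta)
      finally have lim_eq: "ftr (Ql ?\<iota> (f l)) (fpow (Ql ?\<iota> (f l)) (\<lambda>x y. \<kappa> (fst x) (fst y) * kl ?\<iota> (f l) x y) p) =
        of_real (\<Sum>q\<in>UNIV \<times> ?W. e' q ^ Suc p)" .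
      show ?thesis
        unfolding lim_eq[symmetric] X_def
      proof (rule moment_limit[OF f(1) N(1) f(2)])
        fix q q' :: "bool \<times> nat" assume q: "q \<in> Qn (N l)" "q' \<in> Qn (N l)"
        obtain s m s' m' where sm: "q = (s, m)" "q' = (s', m')" by (cases q, cases q')
        have mN: "m < N l" "m' < N l" using q by (auto simp: Qn_def sm)
        let ?u = "\<lambda>n. uu l n j m" and ?u' = "\<lambda>n. uu l n j m'"
        let ?D = "\<lambda>n. vip n (?u n) (?Y n (?u' n)) - \<beta> j * vip n (?u n) (?u' n)"
        let ?DD = "\<lambda>n. vip n (?u n) (mvec n (ent (conj_by (U n \<omega>) (mat_adjoint (B n j) * B n j))) (?u' n)) - \<beta>\<beta> $ j $ j * vip n (?u n) (?u' n)"
        have D0: "?D \<longlonglongrightarrow> 0" using plB mN unfolding pair_limit_def by blast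
        have DD0: "?DD \<longlonglongrightarrow> 0" using plBB mN unfolding pair_limit_def by blast
        define h where "h n = (if s then (if s' then cnj \<alpha> * ?D n else 0) else (if s' then cnj \<alpha> * ?DD n else \<alpha> * ?D n))" for n
        have "h \<longlonglongrightarrow> 0"
          using tendsto_mult_left[OF D0, of \<alpha>] tendsto_mult_left[OF D0, of "cnj \<alpha>"] tendsto_mult_left[OF DD0, of "cnj \<alpha>"]
          unfolding h_def[abs_def] by (cases s; cases s') simp_all
        then have "(\<lambda>n. of_real (cc l n j m) * h n) \<longlonglongrightarrow> 0"
          by (intro lim_null_mult_left_bounded[where B = R]) (simp_all add: cc_le)
        moreover have "\<forall>\<^sub>F n in sequentially. of_real (cc l n j m) * h n = vip n (y n q) (x n q') - \<kappa> (fst q) (fst q') * kn ?\<iota> (f l) n q q'"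
          using ev_good[of l]
        proof eventually_elim
          case (elim n)
          note n = good_facts(1)[OF elim]
          show ?case
            using elim unfolding h_def x_def y_def \<kappa>_def sm kn_def vip_scale_left
            by (cases s; cases s') (simp_all add: vip_scale_right Yh[OF n, symmetric] Y_facts(5)[OF uU n] algebra_simps)
        qed
        ultimately show "(\<lambda>n. vip n (y n q) (x n q') - \<kappa> (fst q) (fst q') * kn ?\<iota> (f l) n q q') \<longlonglongrightarrow> 0"
          by (rule Lim_transform_eventually)
      qed
    qed
    have formX: "vip n v (mvec n (X n) w) = \<alpha> * vip n (?F n v) (?Y n w) + cnj \<alpha> * vip n (?Y n v) (?F n w)" if gd: "good l n" for n v w
    proof -
      note g = good_facts[OF gd]
      have "vip n v (mvec n (X n) w) = \<alpha> * vip n v (?F n (?Y n w)) + cnj \<alpha> * vip n (?Y n v) (?F n w)"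
        unfolding X_def vip_rank unfolding sum_Qn g(7) x_def y_def vip_scale_left
        using gd by (simp add: UNIV_bool vip_scale_right Yh[OF g(1)] sum_distrib_left mult_ac add.commute)
      then show ?thesis by (simp only: vip_F)
    qed
    have hX: "hermf n (X n)" for n
    proof (cases "good l n")
      case True
      show ?thesis by (rule hermfI) (unfold formX[OF True], simp add: vip_cnj)
    qed (simp add: hermf_def X_def x_def)
    have D: "2 * C \<le> D" "\<bar>r s\<bar> \<le> D" for s
      using C(1) by (simp_all add: D_def) (cases s; simp)
    have nearX: "\<forall>\<^sub>F n in sequentially. \<forall>v. \<bar>Re (vip n v (mvec n (ent (Mn n)) v)) - Re (vip n v (mvec n (X n) v))\<bar> \<le> D / (real l + 1) * nsq n v"
      using ev_good[of l]
    proof eventually_elim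
      case (elim n)
      note g = good_facts[OF elim]
      show ?case
      proof
        fix v
        let ?d = "\<lambda>i. ?A n v i - ?F n v i"
        let ?z = "\<alpha> * vip n ?d (?Y n v)"
        have "vip n v (mvec n (ent (Mn n)) v) - vip n v (mvec n (X n) v) = ?z + cnj ?z"
          unfolding formM[OF g(1)] formX[OF elim] by (simp add: vip_cnj vip_diff_left vip_diff_right algebra_simps)
        then have "Re (vip n v (mvec n (ent (Mn n)) v)) - Re (vip n v (mvec n (X n) v)) = Re ?z + Re (cnj ?z)"
          by (metis minus_complex.sel(1) plus_complex.sel(1))
        moreover have "\<bar>Re z + Re (cnj z)\<bar> = 2 * \<bar>Re z\<bar>" for z by simp
        ultimately have "\<bar>Re (vip n v (mvec n (ent (Mn n)) v)) - Re (vip n v (mvec n (X n) v))\<bar> = 2 * \<bar>Re ?z\<bar>" by (simp only:)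
        also have "\<dots> \<le> 2 * (cmod (vip n ?d (?Y n v)))" using abs_Re_le_cmod[of ?z] \<alpha> by (simp add: norm_mult)
        also have "\<dots> \<le> 2 * ((eps l * sqrt (nsq n v)) * (C * sqrt (nsq n v)))"
          by (intro mult_left_mono order_trans[OF cmod_vip_le] mult_mono g(3) opb_sqrt[OF Y_facts(3)[OF uU g(1)]])
            (use eps(1)[of l] in \<open>auto simp: nsq_nonneg\<close>)
        also have "\<dots> = 2 * C / (real l + 1) * nsq n v" using nsq_nonneg[of n v] by (simp add: eps_def mult_ac)
        also have "\<dots> \<le> D / (real l + 1) * nsq n v"
          by (intro mult_right_mono divide_right_mono D nsq_nonneg) simp
        finally show "\<bar>Re (vip n v (mvec n (ent (Mn n)) v)) - Re (vip n v (mvec n (X n) v))\<bar> \<le> D / (real l + 1) * nsq n v" .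
      qed
    qed
    have cn: "counts_near \<eta> (UNIV \<times> E j) (\<lambda>(s, e). r s * evalue (a j) e) (UNIV \<times> ?W) e' \<and>
        counts_near \<eta> (UNIV \<times> E j) (\<lambda>q. - (case q of (s, e) \<Rightarrow> r s * evalue (a j) e)) (UNIV \<times> ?W) (\<lambda>q. - e' q)"
      if \<eta>: "D / (real l + 1) < \<eta>" for \<eta>
    proof -
      have sub: "UNIV \<times> ?W \<subseteq> UNIV \<times> E j" by (auto simp: support_def)
      have z: "e' q = 0" if "q \<in> UNIV \<times> E j" "q \<notin> UNIV \<times> ?W" for q using that by (auto simp: e'_def support_def)
      have near: "\<bar>(case q of (s, e) \<Rightarrow> r s * evalue (a j) e) - e' q\<bar> \<le> \<eta>" if q: "q \<in> UNIV \<times> E j" for q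
      proof -
        obtain s e where se: "q = (s, e)" "e \<in> E j" using q by auto
        have "\<bar>evalue (a j) e - f l (evalue (a j) e)\<bar> \<le> eps l" using R se(2) by (intro f(3)) (simp add: bounded_by_def)
        then have "\<bar>r s\<bar> * \<bar>evalue (a j) e - f l (evalue (a j) e)\<bar> \<le> D * eps l" using D(2)[of s] by (intro mult_mono) auto
        also have "\<dots> \<le> \<eta>" using \<eta> by (simp add: eps_def)
        finally show ?thesis by (simp add: se e'_def abs_mult[symmetric] right_diff_distrib)
      qed
      show ?thesis using counts_near_restrict[OF en sub z near] finW by simp
    qed
    show "\<exists>X (J' :: (bool \<times> 'h) set) e'. (\<forall>n. hermf n (X n)) \<and>
      (\<forall>\<^sub>F n in sequentially. \<forall>v. \<bar>Re (vip n v (mvec n (ent (Mn n)) v)) - Re (vip n v (mvec n (X n) v))\<bar> \<le> D / (real l + 1) * nsq n v) \<and>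
      finite J' \<and> (\<forall>p. (\<lambda>n. ftr {..<n} (fpow {..<n} (X n) p)) \<longlonglongrightarrow> of_real (\<Sum>j\<in>J'. e' j ^ Suc p)) \<and>
      (\<forall>\<eta>. D / (real l + 1) < \<eta> \<longrightarrow> 0 < \<eta> \<longrightarrow> counts_near \<eta> (UNIV \<times> E j) (\<lambda>(s, i). r s * evalue (a j) i) J' e' \<and>
        counts_near \<eta> (UNIV \<times> E j) (\<lambda>q. - (case q of (s, i) \<Rightarrow> r s * evalue (a j) i)) J' (\<lambda>q. - e' q))"
      using hX nearX finW mom cn by (intro exI[of _ X] exI[of _ "UNIV \<times> ?W"] exI[of _ e']) simp
  qed
qed

end

theorem theorem5p1:
  fixes A B :: "nat \<Rightarrow> 'k::finite \<Rightarrow> complex mat"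
    and M :: "'w measure"
    and U :: "nat \<Rightarrow> 'w \<Rightarrow> complex mat"
    and a :: "'k \<Rightarrow> 'h::complex_hilbert \<Rightarrow> 'h"
    and smult :: "complex \<Rightarrow> 'b::ring_1 \<Rightarrow> 'b"
    and star :: "'b \<Rightarrow> 'b"
    and \<tau> :: "'b \<Rightarrow> complex"
    and b :: "'k \<Rightarrow> 'b"
    and \<beta> :: "'k \<Rightarrow> complex"
    and \<beta>\<beta> :: "complex ^ 'k ^ 'k"
  assumes "prob_space M"
    and "\<And>n. n \<ge> 1 \<Longrightarrow> haar_unitary M n (U n)"
    and "\<And>n i. n \<ge> 1 \<Longrightarrow> B n i \<in> carrier_mat n n"
    and "\<And>n i. n \<ge> 1 \<Longrightarrow> hermitian n (A n i)"
    and "separable_space (euclidean :: 'h topology)"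
    and "\<And>i. compact_operator (a i)"
    and "\<And>i. selfadjoint (a i)"
    and "converges_in_compact_distribution A a"
    and "nc_prob_space smult star \<tau>"
    and "converges_in_distribution B star \<tau> b"
    and "\<And>i. bdd_above ((\<lambda>n. mat_opnorm (B n i)) ` {1..})"
    and "\<beta> = (\<lambda>i. lim (\<lambda>n. mat_tr (B n i)))"
    and "\<beta>\<beta> = (\<chi> i j. lim (\<lambda>n. mat_tr (mat_adjoint (B n i) * B n j)))"
  shows
    "(AE \<omega> in M. EV_converges
        (\<lambda>n. EV_mat (mat_sum n (\<lambda>i.
           conj_by (U n \<omega>) (B n i) * A n i * mat_adjoint (conj_by (U n \<omega>) (B n i)))))
        (EV_op (scalar_mat_op (psd_sqrt \<beta>\<beta>) \<circ> diag_op a \<circ> scalar_mat_op (psd_sqrt \<beta>\<beta>))))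
     \<and>
     ((\<forall>n\<ge>1. \<forall>i. hermitian n (B n i)) \<longrightarrow>
      (AE \<omega> in M. EV_converges
        (\<lambda>n. EV_mat (mat_sum n (\<lambda>i. A n i * conj_by (U n \<omega>) (B n i) * A n i)))
        (EV_op (\<lambda>x. \<Sum>i\<in>UNIV. \<beta> i *\<^sub>C a i (a i x)))))
     \<and>
     (\<forall>j. CARD('k) = 1 \<and> (\<forall>n\<ge>1. hermitian n (B n j)) \<longrightarrow>
      (let p = sqrt (Re (\<beta>\<beta> $ j $ j)) + Re (\<beta> j);
           q = - (sqrt (Re (\<beta>\<beta> $ j $ j)) - Re (\<beta> j))
       in AE \<omega> in M. EV_converges
            (\<lambda>n. EV_mat (A n j * conj_by (U n \<omega>) (B n j) + conj_by (U n \<omega>) (B n j) * A n j))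
            (mset_union (mset_scale p (EV_op (a j))) (mset_scale q (EV_op (a j))))))
     \<and>
     (\<forall>j. CARD('k) = 1 \<and> (\<forall>n\<ge>1. hermitian n (B n j)) \<longrightarrow>
      (let r = sqrt (Re (\<beta>\<beta> $ j $ j) - (Re (\<beta> j))\<^sup>2)
       in AE \<omega> in M. EV_converges
            (\<lambda>n. EV_mat (\<i> \<cdot>\<^sub>m (A n j * conj_by (U n \<omega>) (B n j) - conj_by (U n \<omega>) (B n j) * A n j)))
            (mset_union (mset_scale r (EV_op (a j))) (mset_scale (- r) (EV_op (a j))))))"
proof -
  \<comment> \<open>A \<open>lim\<close> has the intended value once convergence is known; here it
    comes from words of length 1 and, for \<open>\<beta>\<beta>\<close>, of length 2.\<close>
  have trB: "(\<lambda>n. mat_tr (B n i)) \<longlonglongrightarrow> \<beta> i" for i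
  proof -
    note lim = assms(10)[unfolded converges_in_distribution_def, rule_format, of "[(i, False)]"]
    have ev: "\<forall>\<^sub>F n in sequentially. mat_tr (mat_word n (\<lambda>(j, s). if s then mat_adjoint (B n j) else B n j) [(i, False)]) = mat_tr (B n i)"
      using eventually_ge_at_top[of 1]
    proof eventually_elim
      case (elim n)
      from right_mult_one_mat[OF assms(3)[OF this, of i]] show ?case by (simp add: mat_word_def)
    qed
    have "convergent (\<lambda>n. mat_tr (B n i))" by (rule convergentI[OF Lim_transform_eventually[OF lim ev]]) simp
    then show ?thesis unfolding assms(12) by (simp add: convergent_LIMSEQ_iff)
  qed
  have trBB: "(\<lambda>n. mat_tr (mat_adjoint (B n i) * B n j)) \<longlonglongrightarrow> \<beta>\<beta> $ i $ j" for i j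
  proof -
    note lim = assms(10)[unfolded converges_in_distribution_def, rule_format, of "[(i, True), (j, False)]"]
    have ev: "\<forall>\<^sub>F n in sequentially. mat_tr (mat_word n (\<lambda>(j, s). if s then mat_adjoint (B n j) else B n j) [(i, True), (j, False)]) =
        mat_tr (mat_adjoint (B n i) * B n j)"
      using eventually_ge_at_top[of 1]
    proof eventually_elim
      case (elim n)
      from right_mult_one_mat[OF assms(3)[OF this, of j]] show ?case by (simp add: mat_word_def)
    qed
    have "convergent (\<lambda>n. mat_tr (mat_adjoint (B n i) * B n j))" by (rule convergentI[OF Lim_transform_eventually[OF lim ev]]) simp
    then show ?thesis unfolding assms(13) by (simp add: convergent_LIMSEQ_iff)
  qed
  interpret haar_compact A a M U B \<beta> \<beta>\<beta>
    by (intro haar_compact.intro compact_limit.intro haar_compact_axioms.intro)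
      (fact assms(4) assms(5) assms(6) assms(7) assms(8) assms(1) assms(2) assms(3) assms(11) trB trBB)+
  have real_id: "(\<beta> j)\<^sup>2 - \<beta>\<beta> $ j $ j = of_real ((Re (\<beta> j))\<^sup>2 - Re (\<beta>\<beta> $ j $ j))" if "\<forall>n\<ge>1. hermitian n (B n j)" for j
  proof -
    have "\<beta> j = of_real (Re (\<beta> j))" by (rule \<beta>_real) (use that in blast)
    then have "(\<beta> j)\<^sup>2 = of_real ((Re (\<beta> j))\<^sup>2)" by (metis of_real_power)
    then show ?thesis using \<beta>\<beta>_diag(1)[of j] by (metis of_real_diff)
  qed
  \<comment> \<open>Both radicands are nonnegative, so that \<open>sqrt\<close> inverts the square
    in the determinant conditions below.\<close>
  have pos: "0 \<le> Re (\<beta>\<beta> $ j $ j)" "(Re (\<beta> j))\<^sup>2 \<le> Re (\<beta>\<beta> $ j $ j)" for j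
  proof -
    have "(Re (\<beta> j))\<^sup>2 \<le> (cmod (\<beta> j))\<^sup>2" by (simp add: cmod_def)
    then show "(Re (\<beta> j))\<^sup>2 \<le> Re (\<beta>\<beta> $ j $ j)" using \<beta>\<beta>_diag(2)[of j] by linarith
    then show "0 \<le> Re (\<beta>\<beta> $ j $ j)" using zero_le_power2 order_trans by blast
  qed
  \<comment> \<open>(iii) and (iv) differ only in the phase \<open>\<alpha>\<close> and in the two
    roots, prescribed here by their sum and product.\<close>
  have bilinear: "AE \<omega> in M. EV_converges (\<lambda>n. EV_mat (Mn (A n j) (Y \<omega> n j)))
      (mset_union (mset_scale x (EV_op (a j))) (mset_scale y (EV_op (a j))))"
    if h: "\<forall>n\<ge>1. hermitian n (B n j)" and \<alpha>: "cmod \<alpha> = 1" and tr: "complex_of_real (x + y) = (\<alpha> + cnj \<alpha>) * \<beta> j"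
      and det: "x * y = (Re (\<beta> j))\<^sup>2 - Re (\<beta>\<beta> $ j $ j)"
      and Mn: "\<And>n X Z. X \<in> carrier_mat n n \<Longrightarrow> Z \<in> carrier_mat n n \<Longrightarrow> Mn X Z \<in> carrier_mat n n"
        "\<And>n X Z s t. X \<in> carrier_mat n n \<Longrightarrow> Z \<in> carrier_mat n n \<Longrightarrow> s < n \<Longrightarrow> t < n \<Longrightarrow>
          ent (Mn X Z) s t = \<alpha> * ent (X * Z) s t + cnj \<alpha> * ent (Z * X) s t"
    for j \<alpha> x y Mn
    using AE_limits
  proof eventually_elim
    case (elim \<omega>)
    have tr': "complex_of_real ((if False then y else x) + (if True then y else x)) = (\<alpha> + cnj \<alpha>) * \<beta> j" using tr by simp
    have det': "complex_of_real ((if False then y else x) * (if True then y else x)) = (\<beta> j)\<^sup>2 - \<beta>\<beta> $ j $ j"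
      unfolding real_id[OF h] det[symmetric] by simp
    have "EV_converges (\<lambda>n. EV_mat (Mn (A n j) (Y \<omega> n j)))
      (mset_union (mset_scale (if False then y else x) (EV_op (a j))) (mset_scale (if True then y else x) (EV_op (a j))))"
    proof (rule EV_limit_bilinear[where r = "\<lambda>s. if s then y else x" and \<alpha> = \<alpha> and \<omega> = \<omega>, OF _ _ _ _ \<alpha> tr' det'])
      show uU: "unit_U \<omega>" and "pair_limit (\<lambda>n. B n j) (\<beta> j) \<omega>"
        "pair_limit (\<lambda>n. mat_adjoint (B n j) * B n j) (\<beta>\<beta> $ j $ j) \<omega>"
        using elim by blast+
      show "hermitian n (B n j)" if "n \<ge> 1" for n using h that by blast
      show "Mn (A n j) (Y \<omega> n j) \<in> carrier_mat n n" if "n \<ge> 1" for n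
        by (rule Mn(1)[OF Acarr[OF that] Y_facts(1)[OF uU that]])
      show "ent (Mn (A n j) (Y \<omega> n j)) s t = \<alpha> * ent (A n j * Y \<omega> n j) s t + cnj \<alpha> * ent (Y \<omega> n j * A n j) s t"
        if "n \<ge> 1" "s < n" "t < n" for n s t
        by (rule Mn(2)[OF Acarr[OF that(1)] Y_facts(1)[OF uU that(1)] that(2,3)])
    qed
    then show ?case by simp
  qed
  show ?thesis
  proof (intro conjI impI allI)
    show "AE \<omega> in M. EV_converges (\<lambda>n. EV_mat (mat_sum n (\<lambda>i. Y \<omega> n i * A n i * mat_adjoint (Y \<omega> n i))))
        (EV_op (scalar_mat_op (psd_sqrt \<beta>\<beta>) \<circ> diag_op a \<circ> scalar_mat_op (psd_sqrt \<beta>\<beta>)))"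
      using AE_limits by eventually_elim (rule EV_limit_sandwich; blast)
  next
    assume h: "\<forall>n\<ge>1. \<forall>i. hermitian n (B n i)"
    show "AE \<omega> in M. EV_converges (\<lambda>n. EV_mat (mat_sum n (\<lambda>i. A n i * Y \<omega> n i * A n i)))
        (EV_op (\<lambda>x. \<Sum>i\<in>UNIV. \<beta> i *\<^sub>C a i (a i x)))"
      using AE_limits by eventually_elim (rule EV_limit_compressed; use h in blast)
  next
    fix j assume "CARD('k) = 1 \<and> (\<forall>n\<ge>1. hermitian n (B n j))"
    then have h: "\<forall>n\<ge>1. hermitian n (B n j)" ..
    have \<beta>j: "\<beta> j = of_real (Re (\<beta> j))" by (rule \<beta>_real) (use h in blast)
    show "let p = sqrt (Re (\<beta>\<beta> $ j $ j)) + Re (\<beta> j); q = - (sqrt (Re (\<beta>\<beta> $ j $ j)) - Re (\<beta> j))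
       in AE \<omega> in M. EV_converges (\<lambda>n. EV_mat (A n j * Y \<omega> n j + Y \<omega> n j * A n j))
            (mset_union (mset_scale p (EV_op (a j))) (mset_scale q (EV_op (a j))))"
      unfolding Let_def
    \<comment> \<open>p and q are the roots of t^2 - 2 \<beta>_1 t + \<beta>_1^2 -
      \<beta>_11.\<close>
    proof (rule bilinear[of j 1 _ _ "\<lambda>X Z. X * Z + Z * X", OF h])
      show "complex_of_real (sqrt (Re (\<beta>\<beta> $ j $ j)) + Re (\<beta> j) + - (sqrt (Re (\<beta>\<beta> $ j $ j)) - Re (\<beta> j))) = (1 + cnj 1) * \<beta> j"
        using arg_cong[OF \<beta>j, of Im] by (simp add: complex_eq_iff)
      show "(sqrt (Re (\<beta>\<beta> $ j $ j)) + Re (\<beta> j)) * - (sqrt (Re (\<beta>\<beta> $ j $ j)) - Re (\<beta> j)) = (Re (\<beta> j))\<^sup>2 - Re (\<beta>\<beta> $ j $ j)"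
        using pos(1)[of j] by (simp add: algebra_simps power2_eq_square)
    qed (auto simp: ent_def)
  next
    fix j assume "CARD('k) = 1 \<and> (\<forall>n\<ge>1. hermitian n (B n j))"
    then have h: "\<forall>n\<ge>1. hermitian n (B n j)" ..
    show "let r = sqrt (Re (\<beta>\<beta> $ j $ j) - (Re (\<beta> j))\<^sup>2)
       in AE \<omega> in M. EV_converges (\<lambda>n. EV_mat (\<i> \<cdot>\<^sub>m (A n j * Y \<omega> n j - Y \<omega> n j * A n j)))
            (mset_union (mset_scale r (EV_op (a j))) (mset_scale (- r) (EV_op (a j))))"
      unfolding Let_def
    \<comment> \<open>For this phase the trace vanishes, so the two roots are opposite.\<close>
    proof (rule bilinear[of j \<i> _ _ "\<lambda>X Z. \<i> \<cdot>\<^sub>m (X * Z - Z * X)", OF h])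
      show "sqrt (Re (\<beta>\<beta> $ j $ j) - (Re (\<beta> j))\<^sup>2) * - sqrt (Re (\<beta>\<beta> $ j $ j) - (Re (\<beta> j))\<^sup>2) = (Re (\<beta> j))\<^sup>2 - Re (\<beta>\<beta> $ j $ j)"
        using pos(2)[of j] by simp
    qed (auto simp: ent_def right_diff_distrib)
  qed
qed

end
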